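(* Let $\mathfrak{M}$ be a type II$_1$ factor, let $\tau$ be the faithful normal tracial state on $\mathfrak{M}$, and let $\mathcal{A}$ be a MASA of $\mathfrak{M}$ with corresponding normal conditional expectation $E_{\mathcal{A}}:\mathfrak{M}\to\mathcal{A}$. Let $N\in\mathfrak{M}$ be a normal operator such that $\sigma(N)=\{z_k\}_{k=1}^n\subseteq\mathbb{C}$. Then \[ A\in\overline{\mathcal{D}_{\mathcal{A}}(N)}^{\|\cdot\|} \] if and only if there exists a partition of unity $\{A_k\}_{k=1}^n$ in $\mathcal{A}$ such that $\tau(A_k)=\tau(\chi_{\{z_k\}}(N))$ for each $k$, and \[ \sum_{k=1}^n z_kA_k=A. \]
   Context: A MASA is a maximal abelian self-adjoint subalgebra. For $T\in\mathfrak{M}$, $\mathcal{D}_{\mathcal{A}}(T):=\{E_{\mathcal{A}}(U^*TU)\mid U\in\mathfrak{M}\text{ unitary}\}$, and $\overline{\,\cdot\,}^{\|\cdot\|}$ denotes norm closure. The points $z_1,\dots,z_n$ are the distinct points of the spectrum $\sigma(N)$, and $\chi_X(N)$ denotes the spectral projection of $N$ for the Borel set $X\subseteq\mathbb{C}$. A partition of unity in $\mathcal{A}$ is a finite collection $\{A_k\}_{k=1}^n\subseteq\mathcal{A}$ with $0\le A_k\le I_{\mathfrak{M}}$ for all $k$ and $\sum_{k=1}^nA_k=I_{\mathfrak{M}}$. *)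

theory Defs
  imports "HOL-Analysis.Analysis"
begin

class scaleC =
  fixes scaleC :: "complex \<Rightarrow> 'a \<Rightarrow> 'a"  (infixr \<open>*\<^sub>C\<close> 75)

text \<open>The underlying real inner product is the real part of the complex one, so that the norm and
  the topology are those of the library. The complex inner product is linear in its first argument.\<close>

class complex_hilbert_space = real_inner + complete_space + scaleC +
  fixes cinner :: "'a \<Rightarrow> 'a \<Rightarrow> complex"
  assumes scaleC_add_right: "c *\<^sub>C (x + y) = c *\<^sub>C x + c *\<^sub>C y"
    and scaleC_add_left: "(c + d) *\<^sub>C x = c *\<^sub>C x + d *\<^sub>C x"
    and scaleC_scaleC: "c *\<^sub>C d *\<^sub>C x = (c * d) *\<^sub>C x"
    and scaleC_of_real: "complex_of_real r *\<^sub>C x = r *\<^sub>R x"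
    and cinner_commute: "cinner x y = cnj (cinner y x)"
    and cinner_add_left: "cinner (x + y) w = cinner x w + cinner y w"
    and cinner_scaleC_left: "cinner (c *\<^sub>C x) y = c * cinner x y"
    and Re_cinner: "Re (cinner x y) = inner x y"
begin

subclass banach ..

end

lemma cinner_self: "cinner x x = complex_of_real ((norm x)\<^sup>2)"
proof -
  have "Im (cinner x x) = 0"
    using arg_cong[OF cinner_commute[of x x], of Im] by simp
  then show ?thesis
    by (simp add: complex_eq_iff Re_cinner power2_norm_eq_inner)
qed

lemma norm_scaleC: "norm (c *\<^sub>C x) = cmod c * norm (x :: 'h::complex_hilbert_space)"
proof -
  have "cinner (c *\<^sub>C x) (c *\<^sub>C x) = (c * cnj c) * cinner x x"
    using cinner_scaleC_left[of c x "c *\<^sub>C x"] cinner_commute[of x "c *\<^sub>C x"]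
      cinner_scaleC_left[of c x x] cinner_commute[of x x] by simp
  then have "complex_of_real ((norm (c *\<^sub>C x))\<^sup>2) = complex_of_real ((cmod c * norm x)\<^sup>2)"
    unfolding cinner_self by (simp add: complex_norm_square[symmetric] power_mult_distrib)
  then have "(norm (c *\<^sub>C x))\<^sup>2 = (cmod c * norm x)\<^sup>2"
    using of_real_eq_iff by blast
  then show ?thesis
    by (simp add: power2_eq_iff_nonneg)
qed

lemma bounded_linear_scaleC:
  "bounded_linear (\<lambda>x :: 'h::complex_hilbert_space. c *\<^sub>C x)"
proof (rule bounded_linear_intro[where K = "cmod c"])
  fix r and x :: 'h
  show "c *\<^sub>C r *\<^sub>R x = r *\<^sub>R c *\<^sub>C x"
    by (simp add: scaleC_of_real[symmetric] scaleC_scaleC mult.commute)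
qed (simp_all add: scaleC_add_right norm_scaleC)

instantiation complex :: scaleC
begin
definition scaleC_complex :: "complex \<Rightarrow> complex \<Rightarrow> complex" where
  "scaleC_complex c w = c * w"
instance ..
end

instantiation blinfun :: (complex_hilbert_space, complex_hilbert_space) scaleC
begin
definition scaleC_blinfun :: "complex \<Rightarrow> ('a \<Rightarrow>\<^sub>L 'b) \<Rightarrow> ('a \<Rightarrow>\<^sub>L 'b)" where
  "scaleC_blinfun c T = Blinfun (\<lambda>x. c *\<^sub>C blinfun_apply T x)"
instance ..
end

lemma blinfun_apply_scaleC: "blinfun_apply (c *\<^sub>C T) x = c *\<^sub>C blinfun_apply T x"
  unfolding scaleC_blinfun_def
  by (simp add: bounded_linear_Blinfun_apply
      bounded_linear_compose[OF bounded_linear_scaleC blinfun.bounded_linear_right])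

text \<open>The type \<open>'h \<Rightarrow>\<^sub>L 'h\<close> consists of the bounded real-linear maps with the operator norm;
  \<open>bounded_ops\<close> is its norm-closed subalgebra of complex-linear maps.\<close>

type_synonym 'h op = "'h \<Rightarrow>\<^sub>L 'h"

definition bounded_ops :: "'h::complex_hilbert_space op set" where
  "bounded_ops = {T. \<forall>c x. blinfun_apply T (c *\<^sub>C x) = c *\<^sub>C blinfun_apply T x}"

definition adj :: "'h::complex_hilbert_space op \<Rightarrow> 'h op" where
  "adj T = (THE S. \<forall>x y. cinner (blinfun_apply S x) y = cinner x (blinfun_apply T y))"

definition self_adjoint :: "'h::complex_hilbert_space op \<Rightarrow> bool" where
  "self_adjoint T \<longleftrightarrow> T \<in> bounded_ops \<and> adj T = T"

definition normal_operator :: "'h::complex_hilbert_space op \<Rightarrow> bool" where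
  "normal_operator T \<longleftrightarrow> T \<in> bounded_ops \<and> adj T o\<^sub>L T = T o\<^sub>L adj T"

definition unitary :: "'h::complex_hilbert_space op \<Rightarrow> bool" where
  "unitary U \<longleftrightarrow> U \<in> bounded_ops \<and> adj U o\<^sub>L U = id_blinfun \<and> U o\<^sub>L adj U = id_blinfun"

definition projection :: "'h::complex_hilbert_space op \<Rightarrow> bool" where
  "projection P \<longleftrightarrow> self_adjoint P \<and> P o\<^sub>L P = P"

definition positive_op :: "'h::complex_hilbert_space op \<Rightarrow> bool" where
  "positive_op T \<longleftrightarrow>
    T \<in> bounded_ops \<and> (\<forall>x. cinner (blinfun_apply T x) x \<in> \<real>\<^sub>\<ge>\<^sub>0)"

definition op_le :: "'h::complex_hilbert_space op \<Rightarrow> 'h op \<Rightarrow> bool"  (infix \<open>\<preceq>\<close> 50) where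
  "S \<preceq> T \<longleftrightarrow> positive_op (T - S)"

definition op_spectrum :: "'h::complex_hilbert_space op \<Rightarrow> complex set" where
  "op_spectrum T = {c. \<not> (\<exists>S\<in>bounded_ops.
    S o\<^sub>L (T - c *\<^sub>C id_blinfun) = id_blinfun \<and> (T - c *\<^sub>C id_blinfun) o\<^sub>L S = id_blinfun)}"

definition scalar_measure ::
    "(complex set \<Rightarrow> 'h::complex_hilbert_space op) \<Rightarrow> 'h \<Rightarrow> complex measure" where
  "scalar_measure P x =
    measure_of UNIV (sets borel) (\<lambda>X. ennreal (Re (cinner (blinfun_apply (P X) x) x)))"

text \<open>A countably additive projection-valued Borel measure \<open>P\<close> with \<open>N = \<integral> z dP(z)\<close> (in the weak
  sense). Only the values of \<open>P\<close> on Borel sets matter, and for normal \<open>N\<close> these are unique by the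
  spectral theorem.\<close>

definition spectral_measure ::
    "(complex set \<Rightarrow> 'h::complex_hilbert_space op) \<Rightarrow> 'h op \<Rightarrow> bool" where
  "spectral_measure P N \<longleftrightarrow>
    (\<forall>X\<in>sets borel. projection (P X)) \<and>
    P UNIV = id_blinfun \<and>
    (\<forall>X\<in>sets borel. \<forall>Y\<in>sets borel. P (X \<inter> Y) = P X o\<^sub>L P Y) \<and>
    (\<forall>F :: nat \<Rightarrow> complex set. range F \<subseteq> sets borel \<longrightarrow> disjoint_family F \<longrightarrow>
      (\<forall>x. (\<lambda>i. blinfun_apply (P (F i)) x) sums blinfun_apply (P (\<Union>i. F i)) x)) \<and>
    (\<forall>x. integrable (scalar_measure P x) (\<lambda>w. w) \<and>
      cinner (blinfun_apply N x) x = (LINT w|scalar_measure P x. w))"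

text \<open>\<open>spectral_projection N X\<close> is \<open>\<chi>\<^sub>X(N)\<close>, for normal \<open>N\<close> and Borel \<open>X\<close>.\<close>

definition spectral_projection :: "'h::complex_hilbert_space op \<Rightarrow> complex set \<Rightarrow> 'h op" where
  "spectral_projection N X = (THE Q. \<exists>P. spectral_measure P N \<and> Q = P X)"

definition star_subalgebra :: "'h::complex_hilbert_space op set \<Rightarrow> bool" where
  "star_subalgebra A \<longleftrightarrow> A \<subseteq> bounded_ops \<and> 0 \<in> A \<and>
    (\<forall>S\<in>A. \<forall>T\<in>A. S + T \<in> A \<and> S o\<^sub>L T \<in> A) \<and>
    (\<forall>c. \<forall>T\<in>A. c *\<^sub>C T \<in> A) \<and>
    (\<forall>T\<in>A. adj T \<in> A)"

definition commutant :: "'h::complex_hilbert_space op set \<Rightarrow> 'h op set" where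
  "commutant S = {T \<in> bounded_ops. \<forall>R\<in>S. T o\<^sub>L R = R o\<^sub>L T}"

definition von_neumann_algebra :: "'h::complex_hilbert_space op set \<Rightarrow> bool" where
  "von_neumann_algebra M \<longleftrightarrow> star_subalgebra M \<and> commutant (commutant M) = M"

definition factor :: "'h::complex_hilbert_space op set \<Rightarrow> bool" where
  "factor M \<longleftrightarrow> von_neumann_algebra M \<and> (id_blinfun :: 'h op) \<noteq> 0 \<and>
    M \<inter> commutant M = range (\<lambda>c. c *\<^sub>C id_blinfun)"

definition equivalent_projections ::
    "'h::complex_hilbert_space op set \<Rightarrow> 'h op \<Rightarrow> 'h op \<Rightarrow> bool" where
  "equivalent_projections M P Q \<longleftrightarrow> (\<exists>V\<in>M. adj V o\<^sub>L V = P \<and> V o\<^sub>L adj V = Q)"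

definition finite_projection :: "'h::complex_hilbert_space op set \<Rightarrow> 'h op \<Rightarrow> bool" where
  "finite_projection M P \<longleftrightarrow> P \<in> M \<and> projection P \<and>
    (\<forall>Q\<in>M. projection Q \<longrightarrow> Q \<preceq> P \<longrightarrow> equivalent_projections M P Q \<longrightarrow> Q = P)"

definition abelian_projection :: "'h::complex_hilbert_space op set \<Rightarrow> 'h op \<Rightarrow> bool" where
  "abelian_projection M P \<longleftrightarrow> P \<in> M \<and> projection P \<and>
    (\<forall>S\<in>M. \<forall>T\<in>M.
      (P o\<^sub>L S o\<^sub>L P) o\<^sub>L (P o\<^sub>L T o\<^sub>L P) = (P o\<^sub>L T o\<^sub>L P) o\<^sub>L (P o\<^sub>L S o\<^sub>L P))"

definition type_II1_factor :: "'h::complex_hilbert_space op set \<Rightarrow> bool" where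
  "type_II1_factor M \<longleftrightarrow> factor M \<and> finite_projection M id_blinfun \<and>
    (\<forall>P. abelian_projection M P \<longrightarrow> P = 0)"

definition abelian :: "'h::complex_hilbert_space op set \<Rightarrow> bool" where
  "abelian A \<longleftrightarrow> (\<forall>S\<in>A. \<forall>T\<in>A. S o\<^sub>L T = T o\<^sub>L S)"

definition masa :: "'h::complex_hilbert_space op set \<Rightarrow> 'h op set \<Rightarrow> bool" where
  "masa M A \<longleftrightarrow> star_subalgebra A \<and> abelian A \<and> A \<subseteq> M \<and>
    (\<forall>B. star_subalgebra B \<and> abelian B \<and> A \<subseteq> B \<and> B \<subseteq> M \<longrightarrow> B = A)"

definition complex_linear_on ::
    "'h::complex_hilbert_space op set \<Rightarrow> ('h op \<Rightarrow> 'b::{plus, scaleC}) \<Rightarrow> bool" where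
  "complex_linear_on M F \<longleftrightarrow>
    (\<forall>S\<in>M. \<forall>T\<in>M. F (S + T) = F S + F T) \<and> (\<forall>c. \<forall>T\<in>M. F (c *\<^sub>C T) = c *\<^sub>C F T)"

text \<open>Upward directed sets take the place of increasing nets.\<close>

definition directed_in :: "'h::complex_hilbert_space op set \<Rightarrow> 'h op set \<Rightarrow> bool" where
  "directed_in M D \<longleftrightarrow> D \<subseteq> {T \<in> M. self_adjoint T} \<and> D \<noteq> {} \<and>
    (\<forall>S\<in>D. \<forall>T\<in>D. \<exists>R\<in>D. S \<preceq> R \<and> T \<preceq> R)"

definition lub_in ::
    "'h::complex_hilbert_space op set \<Rightarrow> 'h op set \<Rightarrow> 'h op \<Rightarrow> bool" where
  "lub_in M D S \<longleftrightarrow> S \<in> M \<and> self_adjoint S \<and> (\<forall>T\<in>D. T \<preceq> S) \<and>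
    (\<forall>R\<in>M. self_adjoint R \<longrightarrow> (\<forall>T\<in>D. T \<preceq> R) \<longrightarrow> S \<preceq> R)"

text \<open>A positive functional takes real values on self-adjoint elements, and it is bounded on any set
  that has a least upper bound, so the real supremum below is a genuine one.\<close>

definition faithful_normal_tracial_state ::
    "'h::complex_hilbert_space op set \<Rightarrow> ('h op \<Rightarrow> complex) \<Rightarrow> bool" where
  "faithful_normal_tracial_state M \<tau> \<longleftrightarrow>
    complex_linear_on M \<tau> \<and>
    (\<forall>T\<in>M. positive_op T \<longrightarrow> \<tau> T \<in> \<real>\<^sub>\<ge>\<^sub>0) \<and>
    \<tau> id_blinfun = 1 \<and>
    (\<forall>S\<in>M. \<forall>T\<in>M. \<tau> (S o\<^sub>L T) = \<tau> (T o\<^sub>L S)) \<and>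
    (\<forall>T\<in>M. \<tau> (adj T o\<^sub>L T) = 0 \<longrightarrow> T = 0) \<and>
    (\<forall>D S. directed_in M D \<longrightarrow> lub_in M D S \<longrightarrow> Re (\<tau> S) = (SUP T\<in>D. Re (\<tau> T)))"

definition normal_conditional_expectation ::
    "'h::complex_hilbert_space op set \<Rightarrow> 'h op set \<Rightarrow> ('h op \<Rightarrow> 'h op) \<Rightarrow> bool" where
  "normal_conditional_expectation M A E \<longleftrightarrow>
    (\<forall>T\<in>M. E T \<in> A) \<and>
    complex_linear_on M E \<and>
    (\<forall>T\<in>M. positive_op T \<longrightarrow> positive_op (E T)) \<and>
    (\<forall>T\<in>A. E T = T) \<and>
    (\<forall>R\<in>A. \<forall>S\<in>A. \<forall>T\<in>M. E (R o\<^sub>L T o\<^sub>L S) = R o\<^sub>L E T o\<^sub>L S) \<and>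
    (\<forall>D S. directed_in M D \<longrightarrow> lub_in M D S \<longrightarrow> lub_in A (E ` D) (E S))"

text \<open>\<open>expectation_orbit M E T\<close> is \<open>\<D>\<^sub>A(T)\<close>, where \<open>E\<close> is the conditional expectation of \<open>M\<close>
  onto \<open>A\<close>.\<close>

definition expectation_orbit ::
    "'h::complex_hilbert_space op set \<Rightarrow> ('h op \<Rightarrow> 'h op) \<Rightarrow> 'h op \<Rightarrow> 'h op set" where
  "expectation_orbit M E T = {E (adj U o\<^sub>L T o\<^sub>L U) | U. U \<in> M \<and> unitary U}"

definition partition_of_unity ::
    "'h::complex_hilbert_space op set \<Rightarrow> nat \<Rightarrow> (nat \<Rightarrow> 'h op) \<Rightarrow> bool" where
  "partition_of_unity A n B \<longleftrightarrow>
    (\<forall>k\<in>{1..n}. B k \<in> A \<and> 0 \<preceq> B k \<and> B k \<preceq> id_blinfun) \<and>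
    (\<Sum>k=1..n. B k) = id_blinfun"

end

theory Submission
  imports Defs
begin

text \<open>
  Write \<open>N = \<Sum> z\<^sub>k P\<^sub>k\<close> with the spectral projections of \<open>N\<close>. A diagonal of \<open>N\<close> is then \<open>\<Sum> z\<^sub>k E(U\<^sup>* P\<^sub>k U)\<close>,
  and the \<open>E(U\<^sup>* P\<^sub>k U)\<close> form a partition of unity with the right traces. Such partitions form a convex
  set, so near-minimal elements for the trace norm form a Cauchy sequence by the parallelogram law; as
  bounded Cauchy sequences for the trace norm converge strongly and every normal state is continuous along
  them, this replaces weak compactness in passing to limits. The same minimisation shows that \<open>E\<close>
  preserves the trace and that \<open>P M Q \<noteq> 0\<close> for nonzero projections of the factor, which leads to the equivalence
  of projections of equal trace.

  Conversely, a partition of unity \<open>B\<close> is almost scalar on small projections \<open>e\<close> of the MASA. Split \<open>e\<close> into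
  \<open>d\<close> projections of equal trace, join these by matrix units, and conjugate them by the discrete Fourier
  matrix: this produces \<open>d\<close> orthogonal projections with sum \<open>e\<close> and expectation \<open>e / d\<close>, since the
  expectation kills the off-diagonal matrix units. Sums of these, after a correction of norm \<open>O(1 / d)\<close> that
  makes the traces exact, are projections \<open>Q\<^sub>k\<close> with expectations close to \<open>B\<^sub>k\<close>, and the equality of traces
  makes \<open>(Q\<^sub>k)\<close> unitarily equivalent to \<open>(P\<^sub>k)\<close>.
\<close>

section \<open>Adjoints, positivity and monotone limits\<close>

text \<open>Until \<open>E\<close> is known to preserve the trace, the state
  \<open>\<tau> o E\<close> is not known to be continuous for the trace norm, so a trace-norm limit
  alone says nothing about it. Subsequences are therefore taken so fast that the squared errors are
  dominated by a multiple of one decreasing sequence of positive elements with strong limit 0; every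
  normal state sends such a sequence to 0. This is \<open>order_conv\<close>, and it explains the
  rate \<open>(1/8) ^ n\<close> below. The converse needs closeness in the operator norm. The error
  on each small projection of the MASA is therefore measured by the quadratic form of that
  projection: such errors do not add up over orthogonal projections. The Fourier matrix is chosen
  because all its entries have the same modulus, so each rotated projection has a flat expectation.
  Traces must be matched exactly, because a unitary carrying \<open>Q k\<close> to
  \<open>P k\<close> exists only if the traces agree; this is what the final correction pays
  for.\<close>

lemma near_minimal_sequence:
  fixes C :: "nat \<Rightarrow> 'a set" and q :: "'a \<Rightarrow> real" and d :: "'a \<Rightarrow> 'a \<Rightarrow> real"
    and mid :: "'a \<Rightarrow> 'a \<Rightarrow> 'a"
  assumes dec: "\<And>m n. m \<le> n \<Longrightarrow> C n \<subseteq> C m"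
    and mid: "\<And>m a b. a \<in> C m \<Longrightarrow> b \<in> C m \<Longrightarrow> mid a b \<in> C m"
    and par: "\<And>a b. a \<in> C 0 \<Longrightarrow> b \<in> C 0 \<Longrightarrow> d a b \<le> 2 * q a + 2 * q b - 4 * q (mid a b)"
    and lower: "\<And>a. a \<in> C 0 \<Longrightarrow> L \<le> q a"
    and upper: "\<And>m. \<exists>a\<in>C m. q a \<le> K"
  obtains b where "\<And>m. b m \<in> C m" "\<And>m a. a \<in> C m \<Longrightarrow> q (b m) \<le> q a + 1 / Suc m"
    "\<And>e. e > 0 \<Longrightarrow> \<exists>N. \<forall>m\<ge>N. \<forall>n\<ge>N. d (b m) (b n) < e"
proof -
  \<comment> \<open>The sets shrink, so these infima increase, and \<open>K\<close> bounds them.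
    Once they are close to their limit, the midpoint of two later points cannot have a much smaller
    \<open>q\<close> than the points themselves, and the parallelogram inequality makes the points
    close.\<close>
  define i where "i m = Inf (q ` C m)" for m
  have ne: "C m \<noteq> {}" for m using upper[of m] by auto
  have C0: "C m \<subseteq> C 0" for m using dec by simp
  have bdd: "bdd_below (q ` C m)" for m
    using lower C0[of m] by (auto intro!: bdd_belowI[of _ L])
  have i_le: "i m \<le> q a" if "a \<in> C m" for a m
    unfolding i_def using bdd that by (auto intro: cInf_lower)
  have iK: "i m \<le> K" for m using upper[of m] i_le by (meson order_trans)
  have mono: "i m \<le> i n" if "m \<le> n" for m n
    unfolding i_def using ne[of n] bdd dec[OF that] by (intro cInf_superset_mono) auto
  have "\<exists>b\<in>C m. q b < i m + 1 / Suc m" for m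
  proof -
    have "Inf (q ` C m) < i m + 1 / Suc m" by (simp add: i_def)
    then show ?thesis using cInf_lessD[of "q ` C m"] ne[of m] by auto
  qed
  then obtain b where b: "\<And>m. b m \<in> C m" "\<And>m. q (b m) < i m + 1 / Suc m" by metis
  have "incseq i" using mono by (simp add: incseq_def)
  then obtain I where I: "i \<longlonglongrightarrow> I" "\<And>m. i m \<le> I"
    using incseq_convergent[of i K] iK by metis
  have lim: "(\<lambda>k. 4 * (I - i k) + 4 * (1 / Suc k)) \<longlonglongrightarrow> 4 * (I - I) + 4 * 0"
    using LIMSEQ_inverse_real_of_nat by (intro tendsto_intros I) (simp add: inverse_eq_divide)
  have est: "d (b m) (b n) \<le> 4 * (I - i k) + 4 * (1 / Suc k)" if "k \<le> m" "k \<le> n" for m n k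
  proof -
    have bC: "b m \<in> C k" "b n \<in> C k" using b dec that by blast+
    define r where "r j = 1 / real (Suc j)" for j
    have 1: "r m \<le> r k" "r n \<le> r k"
      using that by (simp_all add: frac_le r_def)
    have "d (b m) (b n) \<le> 2 * q (b m) + 2 * q (b n) - 4 * q (mid (b m) (b n))"
      using par bC C0 by blast
    also have "\<dots> \<le> 2 * (i m + r m) + 2 * (i n + r n) - 4 * i k"
      using b(2)[of m] b(2)[of n] i_le[OF mid[OF bC]] by (simp add: r_def)
    also have "\<dots> \<le> 4 * (I - i k) + 4 * r k"
      using I(2)[of m] I(2)[of n] 1 by simp
    finally show ?thesis by (simp add: r_def)
  qed
  have "\<exists>N. \<forall>m\<ge>N. \<forall>n\<ge>N. d (b m) (b n) < e" if "e > 0" for e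
  proof -
    have "\<forall>\<^sub>F k in sequentially. 4 * (I - i k) + 4 * (1 / Suc k) < e"
      using order_tendstoD(2)[OF lim, of e] that by simp
    then obtain k where "4 * (I - i k) + 4 * (1 / Suc k) < e"
      by (auto simp: eventually_sequentially)
    then show ?thesis using est by (meson le_less_trans)
  qed
  moreover have "q (b m) \<le> q a + 1 / Suc m" if "a \<in> C m" for m a
    using b(2)[of m] i_le[OF that] by linarith
  ultimately show thesis using that b(1) by blast
qed

section \<open>Riesz representation and real adjoints\<close>

lemma inner_eqI: "(\<And>y. inner x y = inner x' y) \<Longrightarrow> x = x'"
  by (metis vector_eq_rdot)

lemma op_eqI:
  fixes S T :: "'a::real_inner \<Rightarrow>\<^sub>L 'a"
  assumes "\<And>x y. inner (S x) y = inner (T x) y"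
  shows "S = T"
  by (rule blinfun_eqI, rule inner_eqI, rule assms)

lemma quadratic_nonneg_linear_zero:
  fixes a b :: real
  assumes "\<And>t. 0 \<le> t\<^sup>2 * a + t * b"
  shows "b = 0"
proof (rule ccontr)
  assume "b \<noteq> 0"
  \<comment> \<open>At \<open>t = - s * b\<close> the linear term \<open>- s * b\<^sup>2\<close>
    outweighs the quadratic one as soon as \<open>s * \<bar>a\<bar> < 1\<close>.\<close>
  define s where "s = 1 / (1 + \<bar>a\<bar>)"
  have s: "s > 0" "s * \<bar>a\<bar> < 1" by (auto simp: s_def field_simps)
  have "0 \<le> (- s * b)\<^sup>2 * a + (- s * b) * b" by (rule assms)
  also have "\<dots> = s * b\<^sup>2 * (s * a - 1)" by (simp add: power2_eq_square algebra_simps)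
  finally have "0 \<le> s * b\<^sup>2 * (s * a - 1)" .
  moreover have "0 < s * b\<^sup>2" using s \<open>b \<noteq> 0\<close> by simp
  ultimately have "0 \<le> s * a - 1"
    using zero_le_mult_iff[of "s * b\<^sup>2" "s * a - 1"] by linarith
  moreover have "s * a \<le> s * \<bar>a\<bar>" using s by (simp add: mult_left_mono)
  ultimately show False using s by linarith
qed

text \<open>For \<open>f x = inner x y\<close> one has
  \<open>q x = (norm (x - y))\<^sup>2 - (norm y)\<^sup>2\<close>, so the representing vector is
  sought as the minimiser of \<open>q\<close>; the vanishing of the first variation there is the
  representation.\<close>

lemma riesz:
  fixes f :: "'a::{real_inner,complete_space} \<Rightarrow> real"
  assumes "bounded_linear f"
  shows "\<exists>y. \<forall>x. f x = inner x y"
proof -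
  interpret f: bounded_linear f by fact
  define q where "q x = (norm x)\<^sup>2 - 2 * f x" for x
  obtain B where B: "\<And>x. norm (f x) \<le> norm x * B" using f.bounded by blast
  have lower: "- B\<^sup>2 \<le> q x" for x
  proof -
    have "0 \<le> (norm x - B)\<^sup>2" by simp
    then show ?thesis using B[of x] by (simp add: q_def power2_eq_square algebra_simps)
  qed
  have par: "(norm (a - b))\<^sup>2 = 2 * q a + 2 * q b - 4 * q ((1/2) *\<^sub>R (a + b))" for a b
    unfolding q_def f.scaleR f.add power2_norm_eq_inner
    by (simp add: inner_simps inner_commute algebra_simps)
  obtain b where b: "\<And>m a. q (b m) \<le> q a + 1 / Suc m"
      "\<And>e. e > 0 \<Longrightarrow> \<exists>N. \<forall>m\<ge>N. \<forall>n\<ge>N. (norm (b m - b n))\<^sup>2 < e"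
    using near_minimal_sequence[of "\<lambda>_::nat. UNIV :: 'a set" "\<lambda>a b. (1/2) *\<^sub>R (a + b)"
        "\<lambda>a b. (norm (a - b))\<^sup>2" q "- B\<^sup>2" "q 0"] lower par by auto
  have "Cauchy b"
  proof (rule CauchyI)
    fix e :: real assume "0 < e"
    then obtain N where "\<forall>m\<ge>N. \<forall>n\<ge>N. (norm (b m - b n))\<^sup>2 < e\<^sup>2"
      using b(2)[of "e\<^sup>2"] by auto
    then show "\<exists>M. \<forall>m\<ge>M. \<forall>n\<ge>M. norm (b m - b n) < e"
      using \<open>0 < e\<close> by (meson less_imp_le power_less_imp_less_base)
  qed
  then obtain y where y: "b \<longlonglongrightarrow> y" using Cauchy_convergent convergent_def by blast
  have "(\<lambda>m. q (b m)) \<longlonglongrightarrow> q y"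
    unfolding q_def using y by (intro tendsto_intros f.tendsto)
  moreover have "(\<lambda>m. q a + 1 / Suc m) \<longlonglongrightarrow> q a + 0" for a
    using LIMSEQ_inverse_real_of_nat by (intro tendsto_intros) (simp add: inverse_eq_divide)
  ultimately have min: "q y \<le> q a" for a
    using LIMSEQ_le[of "\<lambda>m. q (b m)" "q y" "\<lambda>m. q a + 1 / Suc m" "q a"] b(1) by auto
  have "f x = inner x y" for x
  proof -
    have "0 \<le> t\<^sup>2 * (norm x)\<^sup>2 + t * (2 * inner x y - 2 * f x)" for t
      using min[of "y + t *\<^sub>R x"] unfolding q_def power2_norm_eq_inner f.add f.scaleR
      by (simp add: inner_simps inner_commute algebra_simps power2_eq_square)
    from quadratic_nonneg_linear_zero[OF this] show ?thesis by simp
  qed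
  then show ?thesis by blast
qed

lemma real_adjoint_exists:
  fixes T :: "'a::{real_inner,complete_space} \<Rightarrow>\<^sub>L 'a"
  shows "\<exists>S :: 'a \<Rightarrow>\<^sub>L 'a. \<forall>x y. inner (S x) y = inner x (T y)"
proof -
  have "\<exists>z. \<forall>x. inner (T x) y = inner x z" for y
    by (rule riesz) (intro bounded_linear_intros blinfun.bounded_linear_right bounded_linear_inner_left_comp)
  then obtain S where S: "\<And>x y. inner (T x) y = inner x (S y)" by metis
  have "bounded_linear S"
  proof (rule bounded_linear_intro[where K = "norm T"])
    show "S (x + y) = S x + S y" for x y
      by (rule inner_eqI) (metis S inner_add_left inner_add_right inner_commute)
    show "S (r *\<^sub>R x) = r *\<^sub>R S x" for r x
      by (rule inner_eqI) (metis S inner_scaleR_left inner_scaleR_right inner_commute)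
    show "norm (S x) \<le> norm x * norm T" for x
    proof -
      have "norm (S x) * norm (S x) = inner (T (S x)) x" 
        by (simp add: S norm_eq_sqrt_inner)
      also have "\<dots> \<le> norm (T (S x)) * norm x" by (rule norm_cauchy_schwarz)
      also have "\<dots> \<le> norm T * norm (S x) * norm x" by (intro mult_right_mono norm_blinfun) auto
      finally have "norm (S x) * norm (S x) \<le> norm (S x) * (norm x * norm T)" by (simp add: ac_simps)
      then show ?thesis by (cases "norm (S x) = 0") (auto simp: zero_le_mult_iff)
    qed
  qed
  then have "inner (Blinfun S x) y = inner x (T y)" for x y
    by (simp add: bounded_linear_Blinfun_apply S[symmetric] inner_commute)
  then show ?thesis by blast
qed

lemmas op_simps = blinfun.add_left blinfun.diff_left blinfun.minus_left blinfun.scaleR_left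
  blinfun.add_right blinfun.diff_right blinfun.minus_right blinfun.scaleR_right
  blinfun.zero_left blinfun.zero_right blinfun.sum_left blinfun.sum_right blinfun_apply_scaleC

section \<open>Complex scalars and the adjoint\<close>

lemma scaleC_one [simp]: "1 *\<^sub>C (x :: 'h::complex_hilbert_space) = x"
  using scaleC_of_real[of 1 x] by simp

lemma scaleC_zero_left [simp]: "0 *\<^sub>C (x :: 'h::complex_hilbert_space) = 0"
  using scaleC_of_real[of 0 x] by simp

lemma scaleC_zero_right [simp]: "c *\<^sub>C (0 :: 'h::complex_hilbert_space) = 0"
  using bounded_linear.linear[OF bounded_linear_scaleC] linear_0 by blast

lemma scaleC_minus_left: "(- c) *\<^sub>C (x :: 'h::complex_hilbert_space) = - (c *\<^sub>C x)"
  using scaleC_add_left[of c "- c" x] by (simp add: add_eq_0_iff)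

lemma scaleC_minus_right: "c *\<^sub>C (- (x :: 'h::complex_hilbert_space)) = - (c *\<^sub>C x)"
  using bounded_linear.linear[OF bounded_linear_scaleC] linear_neg by blast

lemma scaleC_diff_right: "c *\<^sub>C (x - y :: 'h::complex_hilbert_space) = c *\<^sub>C x - c *\<^sub>C y"
  using bounded_linear.linear[OF bounded_linear_scaleC] linear_diff by blast

lemma scaleC_diff_left: "(c - d) *\<^sub>C (x :: 'h::complex_hilbert_space) = c *\<^sub>C x - d *\<^sub>C x"
  using scaleC_add_left[of c "- d" x] by (simp add: scaleC_minus_left)

lemma scaleC_scaleR_commute: "c *\<^sub>C r *\<^sub>R (x :: 'h::complex_hilbert_space) = r *\<^sub>R c *\<^sub>C x"
  by (simp add: scaleC_of_real[symmetric] scaleC_scaleC mult.commute)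

lemma scaleC_sum_right: "c *\<^sub>C (\<Sum>i\<in>I. f i :: 'h::complex_hilbert_space) = (\<Sum>i\<in>I. c *\<^sub>C f i)"
  using bounded_linear.linear[OF bounded_linear_scaleC] linear_sum by blast

lemma scaleC_sum_left: "(\<Sum>i\<in>I. c i) *\<^sub>C (x :: 'h::complex_hilbert_space) = (\<Sum>i\<in>I. c i *\<^sub>C x)"
  by (induction I rule: infinite_finite_induct) (auto simp: scaleC_add_left)

lemma tendsto_scaleC:
  "(f \<longlongrightarrow> (l :: 'h::complex_hilbert_space)) F \<Longrightarrow> ((\<lambda>x. c *\<^sub>C f x) \<longlongrightarrow> c *\<^sub>C l) F"
  by (rule bounded_linear.tendsto[OF bounded_linear_scaleC])

lemma cinner_scaleC_right: "cinner x (c *\<^sub>C y) = cnj c * cinner (x :: 'h::complex_hilbert_space) y"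
  by (metis cinner_commute cinner_scaleC_left complex_cnj_mult)

lemma inner_scaleC_left: "inner (c *\<^sub>C x) y = inner (x :: 'h::complex_hilbert_space) (cnj c *\<^sub>C y)"
  by (simp add: Re_cinner[symmetric] cinner_scaleC_right cinner_scaleC_left)

lemma Im_cinner: "Im (cinner x y) = inner (x :: 'h::complex_hilbert_space) (\<i> *\<^sub>C y)"
  by (simp add: Re_cinner[symmetric] cinner_scaleC_right)

lemma bounded_opsD: "T \<in> bounded_ops \<Longrightarrow> blinfun_apply T (c *\<^sub>C x) = c *\<^sub>C blinfun_apply T x"
  by (simp add: bounded_ops_def)

text \<open>The real adjoint of a complex-linear map satisfies the complex identity as well, since
  the imaginary part of \<open>cinner x y\<close> is \<open>inner x (\<i> *\<^sub>C y)\<close>. It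
  therefore meets the description in \<open>adj_def\<close>, and afterwards real inner products
  suffice.\<close>

lemma adj_bounded_ops: "adj T \<in> bounded_ops" (is ?A)
  and inner_adj_left: "inner (adj T x) y = inner x (T y)" (is ?B)
  if T: "T \<in> bounded_ops"
proof -
  obtain S where S: "\<And>x y. inner (blinfun_apply S x) y = inner x (T y)"
    using real_adjoint_exists by blast
  have bS: "S \<in> bounded_ops"
    unfolding bounded_ops_def
    by (intro CollectI allI, rule inner_eqI) (simp add: S inner_scaleC_left bounded_opsD[OF T])
  have c: "cinner (S x) y = cinner x (T y)" for x y
    by (rule complex_eqI)
      (simp_all add: Re_cinner Im_cinner S bounded_opsD[OF T, symmetric])
  have "adj T = S"
    unfolding adj_def
  proof (rule the_equality)
    show "\<forall>x y. cinner (S x) y = cinner x (T y)" using c by blast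
    fix R assume R: "\<forall>x y. cinner (blinfun_apply R x) y = cinner x (T y)"
    show "R = S"
      by (rule op_eqI) (metis R c Re_cinner)
  qed
  then show ?A ?B using S bS by auto
qed

lemma inner_adj_right: "T \<in> bounded_ops \<Longrightarrow> inner x (adj T y) = inner (T x) y"
  by (metis inner_adj_left inner_commute)

lemma adj_eqI:
  assumes "T \<in> bounded_ops" "\<And>x y. inner (blinfun_apply S x) y = inner x (T y)"
  shows "adj T = S"
  by (rule op_eqI) (simp add: assms inner_adj_left)

lemma bounded_ops_intros [simp]:
  "0 \<in> bounded_ops" "id_blinfun \<in> bounded_ops"
  "S \<in> bounded_ops \<Longrightarrow> T \<in> bounded_ops \<Longrightarrow> S + T \<in> bounded_ops"
  "S \<in> bounded_ops \<Longrightarrow> T \<in> bounded_ops \<Longrightarrow> S - T \<in> bounded_ops"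
  "S \<in> bounded_ops \<Longrightarrow> T \<in> bounded_ops \<Longrightarrow> S o\<^sub>L T \<in> bounded_ops"
  "T \<in> bounded_ops \<Longrightarrow> c *\<^sub>C T \<in> bounded_ops"
  "T \<in> bounded_ops \<Longrightarrow> r *\<^sub>R T \<in> bounded_ops"
  "T \<in> bounded_ops \<Longrightarrow> - T \<in> bounded_ops"
  "T \<in> bounded_ops \<Longrightarrow> adj T \<in> bounded_ops"
  using adj_bounded_ops
  by (simp_all add: bounded_ops_def op_simps scaleC_add_right scaleC_diff_right scaleC_scaleC
      mult.commute[of c] scaleC_scaleR_commute scaleC_minus_right)

lemma adj_simps [simp]:
  "adj id_blinfun = (id_blinfun :: 'h::complex_hilbert_space op)"
  "adj (0 :: 'h op) = 0"
  "S \<in> bounded_ops \<Longrightarrow> T \<in> bounded_ops \<Longrightarrow> adj (S + T) = adj S + adj (T :: 'h op)"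
  "S \<in> bounded_ops \<Longrightarrow> T \<in> bounded_ops \<Longrightarrow> adj (S - T) = adj S - adj (T :: 'h op)"
  "S \<in> bounded_ops \<Longrightarrow> T \<in> bounded_ops \<Longrightarrow> adj (S o\<^sub>L T) = adj T o\<^sub>L adj (S :: 'h op)"
  "T \<in> bounded_ops \<Longrightarrow> adj (c *\<^sub>C T) = cnj c *\<^sub>C adj (T :: 'h op)"
  "T \<in> bounded_ops \<Longrightarrow> adj (r *\<^sub>R T) = r *\<^sub>R adj (T :: 'h op)"
  "T \<in> bounded_ops \<Longrightarrow> adj (adj T) = (T :: 'h op)"
  by (rule adj_eqI; simp add: op_simps inner_simps inner_adj_left inner_adj_right inner_scaleC_left
      bounded_opsD)+

lemma adj_sum:
  "(\<And>i. i \<in> I \<Longrightarrow> f i \<in> bounded_ops) \<Longrightarrow> adj (\<Sum>i\<in>I. f i) = (\<Sum>i\<in>I. adj (f i :: 'h::complex_hilbert_space op))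
    \<and> (\<Sum>i\<in>I. f i) \<in> bounded_ops"
  by (induction I rule: infinite_finite_induct) auto

section \<open>Self-adjoint and positive operators\<close>

lemma self_adjoint_iff:
  "self_adjoint T \<longleftrightarrow> T \<in> bounded_ops \<and> (\<forall>x y. inner (T x) y = inner x (T y))"
  unfolding self_adjoint_def by (metis adj_eqI inner_adj_left)

lemma self_adjointD:
  "self_adjoint T \<Longrightarrow> T \<in> bounded_ops" "self_adjoint T \<Longrightarrow> adj T = T"
  "self_adjoint T \<Longrightarrow> inner (T x) y = inner x (T y)"
  by (auto simp: self_adjoint_def) (metis self_adjoint_def self_adjoint_iff)

lemma self_adjoint_intros:
  "self_adjoint 0" "self_adjoint id_blinfun"
  "self_adjoint S \<Longrightarrow> self_adjoint T \<Longrightarrow> self_adjoint (S + T)"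
  "self_adjoint S \<Longrightarrow> self_adjoint T \<Longrightarrow> self_adjoint (S - T)"
  "self_adjoint T \<Longrightarrow> self_adjoint (r *\<^sub>R T)"
  "self_adjoint T \<Longrightarrow> self_adjoint (- T)"
  "T \<in> bounded_ops \<Longrightarrow> self_adjoint (adj T o\<^sub>L T)"
  "T \<in> bounded_ops \<Longrightarrow> self_adjoint S \<Longrightarrow> self_adjoint (adj T o\<^sub>L S o\<^sub>L T)"
  "self_adjoint S \<Longrightarrow> self_adjoint T \<Longrightarrow> S o\<^sub>L T = T o\<^sub>L S \<Longrightarrow> self_adjoint (S o\<^sub>L T)"
  by (auto simp: self_adjoint_iff op_simps inner_simps inner_adj_left inner_adj_right)
    (metis blinfun_apply_blinfun_compose)

lemma self_adjoint_sum: "(\<And>i. i \<in> I \<Longrightarrow> self_adjoint (f i)) \<Longrightarrow> self_adjoint (\<Sum>i\<in>I. f i)"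
  by (induction I rule: infinite_finite_induct) (auto intro: self_adjoint_intros)

text \<open>On a complex space a real quadratic form already forces self-adjointness: the imaginary
  part vanishes at \<open>x + y\<close>, and \<open>y = (- \<i>) *\<^sub>C z\<close> turns the cross
  terms into \<open>inner (T x) z - inner (T z) x\<close>. Afterwards positivity is a statement
  about the real inner product.\<close>

lemma positive_op_iff:
  "positive_op T \<longleftrightarrow> self_adjoint T \<and> (\<forall>x. 0 \<le> inner (T x) x)"
proof
  assume p: "positive_op T"
  then have T: "T \<in> bounded_ops" by (simp add: positive_op_def)
  have Im0: "inner (T x) (\<i> *\<^sub>C x) = 0" for x
    using p by (auto simp: positive_op_def Im_cinner[symmetric] complex_nonneg_Reals_iff)
  have "inner (T x) z = inner x (T z)" for x z
  proof -
    define y where "y = (- \<i>) *\<^sub>C z"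
    have z: "z = \<i> *\<^sub>C y" by (simp add: y_def scaleC_scaleC)
    have "inner (T x) (\<i> *\<^sub>C y) + inner (T y) (\<i> *\<^sub>C x) = 0"
      using Im0[of "x + y"] Im0[of x] Im0[of y]
      by (simp add: op_simps inner_simps scaleC_add_right)
    moreover have "inner (T y) (\<i> *\<^sub>C x) = - inner (T z) x"
      using inner_scaleC_left[of "- \<i>" "T y" x] by (simp add: z bounded_opsD[OF T] scaleC_minus_left)
    ultimately show ?thesis by (simp add: z inner_commute)
  qed
  moreover have "0 \<le> inner (T x) x" for x
    using p by (auto simp: positive_op_def complex_nonneg_Reals_iff Re_cinner)
  ultimately show "self_adjoint T \<and> (\<forall>x. 0 \<le> inner (T x) x)" using T by (auto simp: self_adjoint_iff)
next
  assume a: "self_adjoint T \<and> (\<forall>x. 0 \<le> inner (T x) x)"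
  have "cinner (T x) x \<in> \<real>\<^sub>\<ge>\<^sub>0" for x
  proof -
    have "inner (T x) (\<i> *\<^sub>C x) = inner x (\<i> *\<^sub>C T x)"
      using a bounded_opsD[of T \<i> x] by (metis self_adjointD(1,3))
    also have "\<dots> = - inner (T x) (\<i> *\<^sub>C x)"
      using inner_scaleC_left[of \<i> "T x" x] by (simp add: scaleC_minus_left inner_commute)
    finally have "Im (cinner (T x) x) = 0" by (simp add: Im_cinner)
    moreover have "Re (cinner (T x) x) \<ge> 0" using a by (simp add: Re_cinner)
    ultimately show ?thesis by (simp add: complex_nonneg_Reals_iff)
  qed
  then show "positive_op T" using a by (simp add: positive_op_def self_adjoint_def)
qed

lemma op_le_iff:
  "self_adjoint S \<Longrightarrow> self_adjoint T \<Longrightarrow> S \<preceq> T \<longleftrightarrow> (\<forall>x. inner (S x) x \<le> inner (T x) x)"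
  by (simp add: op_le_def positive_op_iff self_adjoint_intros op_simps inner_simps)

lemma positive_opD: "positive_op T \<Longrightarrow> self_adjoint T" "positive_op T \<Longrightarrow> 0 \<le> inner (T x) x"
  by (auto simp: positive_op_iff)

lemma positive_op_intros:
  "positive_op 0" "positive_op id_blinfun"
  "positive_op S \<Longrightarrow> positive_op T \<Longrightarrow> positive_op (S + T)"
  "0 \<le> r \<Longrightarrow> positive_op T \<Longrightarrow> positive_op (r *\<^sub>R T)"
  "S \<in> bounded_ops \<Longrightarrow> positive_op (adj S o\<^sub>L S)"
  "S \<in> bounded_ops \<Longrightarrow> positive_op T \<Longrightarrow> positive_op (adj S o\<^sub>L T o\<^sub>L S)"
  by (auto simp: positive_op_iff self_adjoint_intros op_simps inner_simps inner_adj_left)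

lemma positive_op_sandwich:
  "self_adjoint S \<Longrightarrow> positive_op T \<Longrightarrow> positive_op (S o\<^sub>L T o\<^sub>L S)"
  "self_adjoint S \<Longrightarrow> positive_op (S o\<^sub>L S)"
  using positive_op_intros(5,6)[of S] by (metis self_adjointD(1,2))+

lemma positive_op_sum: "(\<And>i. i \<in> I \<Longrightarrow> positive_op (f i)) \<Longrightarrow> positive_op (\<Sum>i\<in>I. f i)"
  by (induction I rule: infinite_finite_induct) (auto intro: positive_op_intros)

lemma op_le_refl: "T \<preceq> T"
  by (simp add: op_le_def positive_op_intros)

lemma op_le_trans: "S \<preceq> T \<Longrightarrow> T \<preceq> R \<Longrightarrow> S \<preceq> R"
  unfolding op_le_def by (drule positive_op_intros(3), assumption) simp

lemma op_le_antisym: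
  assumes "S \<preceq> T" "T \<preceq> S"
  shows "S = T"
proof -
  have q: "inner ((T - S) x) x = 0" and s: "self_adjoint (T - S)" for x
    using assms positive_opD(2)[of "T - S" x] positive_opD(2)[of "S - T" x] positive_opD(1)[of "T - S"]
    by (auto simp: op_le_def op_simps inner_simps)
  have "inner ((T - S) x) y = 0" for x y
    using q[of "x + y"] q[of x] q[of y] self_adjointD(3)[OF s, of x y]
    by (simp only: blinfun.add_right inner_add_left inner_add_right) (simp add: inner_commute)
  then have "T - S = 0" by (intro op_eqI) simp
  then show ?thesis by simp
qed

lemma self_adjoint_eq_zeroI:
  "self_adjoint T \<Longrightarrow> (\<And>x. inner (T x) x = 0) \<Longrightarrow> T = 0"
  by (rule op_le_antisym) (simp_all add: op_le_iff self_adjoint_intros op_simps)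

lemma norm_op_square: "T \<in> bounded_ops \<Longrightarrow> inner ((adj T o\<^sub>L T) x) x = (norm (T x))\<^sup>2"
  by (simp add: inner_adj_left power2_norm_eq_inner)

section \<open>Projections\<close>

lemma projection_iff: "projection P \<longleftrightarrow> self_adjoint P \<and> (\<forall>x. P (P x) = P x)"
  unfolding projection_def by (metis blinfun_apply_blinfun_compose blinfun_eqI)

lemma projectionD:
  "projection P \<Longrightarrow> self_adjoint P" "projection P \<Longrightarrow> P \<in> bounded_ops" "projection P \<Longrightarrow> adj P = P"
  "projection P \<Longrightarrow> P (P x) = P x" "projection P \<Longrightarrow> P o\<^sub>L P = P"
  unfolding self_adjoint_def projection_def by (blast, blast, blast, metis blinfun_apply_blinfun_compose, blast)

lemma projection_norm: "projection P \<Longrightarrow> inner (P x) x = (norm (P x))\<^sup>2"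
  by (metis power2_norm_eq_inner projectionD(1,4) self_adjointD(3))

lemma projection_positive: "projection P \<Longrightarrow> positive_op P"
  by (simp add: positive_op_iff projection_norm projectionD)

lemma projection_compl: "projection P \<Longrightarrow> projection (id_blinfun - P)"
  by (auto simp: projection_iff self_adjoint_intros op_simps)

lemma projection_norm_le: "projection P \<Longrightarrow> norm (P x) \<le> norm x"
proof -
  assume P: "projection P"
  have "0 \<le> inner ((id_blinfun - P) x) x"
    by (rule positive_opD(2)[OF projection_positive[OF projection_compl[OF P]]])
  then have "(norm (P x))\<^sup>2 \<le> (norm x)\<^sup>2"
    by (simp add: op_simps inner_simps projection_norm[OF P] power2_norm_eq_inner[of x])
  then show ?thesis by (rule power2_le_imp_le) simp
qed

lemma projection_le_id: "projection P \<Longrightarrow> P \<preceq> id_blinfun"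
  by (simp add: op_le_def projection_positive projection_compl)

lemma projection_trivial [simp]: "projection 0" "projection id_blinfun"
  by (auto simp: projection_iff self_adjoint_intros op_simps)

lemma projection_commute_zero:
  assumes "projection P" "projection Q" "P o\<^sub>L Q = 0"
  shows "Q o\<^sub>L P = 0"
proof -
  have "adj (P o\<^sub>L Q) = Q o\<^sub>L P" using assms(1,2) by (simp add: projectionD)
  then show ?thesis by (simp add: assms(3))
qed

lemma projection_add:
  assumes "projection P" "projection Q" "P o\<^sub>L Q = 0"
  shows "projection (P + Q)"
proof -
  have "P (Q x) = 0" "Q (P x) = 0" for x
    using assms projection_commute_zero[OF assms] 
    by (metis blinfun_apply_blinfun_compose blinfun.zero_left)+
  then show ?thesis using assms by (simp add: projection_iff self_adjoint_intros op_simps)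
qed

lemma projection_mult:
  assumes "projection P" "projection Q" "P o\<^sub>L Q = Q o\<^sub>L P"
  shows "projection (P o\<^sub>L Q)"
proof -
  have "P (Q x) = Q (P x)" for x using assms(3) by (metis blinfun_apply_blinfun_compose)
  then show ?thesis using assms by (simp add: projection_iff self_adjoint_intros)
qed

text \<open>If \<open>P \<preceq> Q\<close>, then \<open>norm (P x) \<le> norm (Q (P x))\<close>, so
  by Pythagoras \<open>Q\<close> loses nothing on the range of \<open>P\<close>.\<close>

lemma projection_le_iff:
  assumes "projection P" "projection Q"
  shows "P \<preceq> Q \<longleftrightarrow> Q o\<^sub>L P = P"
proof
  assume "P \<preceq> Q"
  then have le: "(norm (P x))\<^sup>2 \<le> (norm (Q x))\<^sup>2" for x
    using assms by (simp add: op_le_iff projectionD projection_norm)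
  have "(id_blinfun - Q) (P x) = 0" for x
  proof -
    have "(norm ((id_blinfun - Q) (P x)))\<^sup>2 = (norm (P x))\<^sup>2 - (norm (Q (P x)))\<^sup>2"
      using projection_norm[OF projection_compl[OF assms(2)], of "P x"] projection_norm[OF assms(2), of "P x"]
      by (simp add: op_simps inner_simps power2_norm_eq_inner)
    also have "\<dots> \<le> 0" using le[of "P x"] assms by (simp add: projectionD)
    finally show ?thesis by simp
  qed
  then show "Q o\<^sub>L P = P" by (intro blinfun_eqI) (simp add: op_simps)
next
  assume QP: "Q o\<^sub>L P = P"
  have "adj (Q o\<^sub>L P) = P o\<^sub>L Q" using assms by (simp add: projectionD)
  then have "P o\<^sub>L Q = P" using assms by (simp add: QP projectionD)
  then have "P (Q x) = P x" "Q (P x) = P x" for x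
    using QP by (metis blinfun_apply_blinfun_compose)+
  then have "projection (Q - P)"
    using assms unfolding projection_iff by (auto simp: self_adjoint_intros op_simps)
  then show "P \<preceq> Q" by (simp add: op_le_def projection_positive)
qed

lemma projection_diff:
  assumes "projection P" "projection Q" "Q o\<^sub>L P = P"
  shows "projection (Q - P)" "P o\<^sub>L Q = P" "P o\<^sub>L (Q - P) = 0"
proof -
  have "adj (Q o\<^sub>L P) = P o\<^sub>L Q" using assms(1,2) by (simp add: projectionD)
  then show PQ: "P o\<^sub>L Q = P" using assms by (simp add: projectionD)
  have 1: "P (Q x) = P x" "Q (P x) = P x" for x
    using PQ assms(3) by (metis blinfun_apply_blinfun_compose)+
  show "projection (Q - P)"
    using assms 1 unfolding projection_iff by (auto simp: self_adjoint_intros op_simps)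
  show "P o\<^sub>L (Q - P) = 0" 
    using assms 1 by (intro blinfun_eqI) (auto simp: op_simps projectionD)
qed

text \<open>Cauchy--Schwarz for the form of \<open>T\<close>, applied at \<open>x - K\<inverse> T x\<close>.\<close>

lemma positive_op_norm_apply:
  assumes "positive_op T" "\<And>x. inner (T x) x \<le> K * (norm x)\<^sup>2"
  shows "(norm (T x))\<^sup>2 \<le> K * inner (T x) x"
proof (cases "K > 0")
  case True
  note s = positive_opD(1)[OF assms(1)]
  have "inner (T (x - t *\<^sub>R T x)) (x - t *\<^sub>R T x)
      = inner (T x) x - 2 * t * (norm (T x))\<^sup>2 + t\<^sup>2 * inner (T (T x)) (T x)" for t
    using self_adjointD(3)[OF s, of "T x" x]
    by (simp add: op_simps inner_simps power2_norm_eq_inner power2_eq_square[of t] algebra_simps)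
  from this[of "1 / K"] positive_opD(2)[OF assms(1), of "x - (1/K) *\<^sub>R T x"]
  have "0 \<le> inner (T x) x - 2 * (1/K) * (norm (T x))\<^sup>2 + (1/K)\<^sup>2 * inner (T (T x)) (T x)" by simp
  also have "(1/K)\<^sup>2 * inner (T (T x)) (T x) \<le> (1/K)\<^sup>2 * (K * (norm (T x))\<^sup>2)"
    by (intro mult_left_mono assms) auto
  also have "(1/K)\<^sup>2 * (K * (norm (T x))\<^sup>2) = (norm (T x))\<^sup>2 / K"
    using True by (simp add: power2_eq_square)
  finally show ?thesis using True by (simp add: field_simps)
next
  case False
  have "inner (T y) y = 0" for y
    using assms(2)[of y] positive_opD(2)[OF assms(1), of y] False
    by (smt (verit) mult_nonpos_nonneg zero_le_power2)
  then have "T = 0" using self_adjoint_eq_zeroI positive_opD(1)[OF assms(1)] by blast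
  then show ?thesis by (simp add: op_simps)
qed

lemma self_adjoint_norm_apply:
  assumes s: "self_adjoint T" and c: "\<And>x. \<bar>inner (T x) x\<bar> \<le> c * (norm x)\<^sup>2"
  shows "norm (T x) \<le> c * norm x"
proof (cases "T x = 0")
  case True
  have "0 \<le> c * (norm x)\<^sup>2" using c[of x] by linarith
  then show ?thesis using True by (cases "x = 0") (auto simp: zero_le_mult_iff)
next
  case False
  \<comment> \<open>\<open>y\<close> points along \<open>T x\<close> and has the length of
    \<open>x\<close>, so \<open>inner (T x) y\<close> is the product of the two norms, while
    polarisation and the parallelogram law bound it by \<open>c * (norm x)\<^sup>2\<close>.\<close>
  define y where "y = (norm x / norm (T x)) *\<^sub>R T x"
  have y: "norm y = norm x" using False by (simp add: y_def)
  have x0: "norm x > 0" using False by (auto simp: op_simps)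
  have "4 * inner (T x) y = inner (T (x + y)) (x + y) - inner (T (x - y)) (x - y)"
    using self_adjointD(3)[OF s, of x y] by (simp add: op_simps inner_simps inner_commute)
  also have "\<dots> \<le> c * (norm (x + y))\<^sup>2 + c * (norm (x - y))\<^sup>2"
    using c[of "x + y"] c[of "x - y"] by linarith
  also have "\<dots> = 2 * c * ((norm x)\<^sup>2 + (norm y)\<^sup>2)"
    by (simp add: power2_norm_eq_inner inner_simps inner_commute algebra_simps)
  finally have "inner (T x) y \<le> c * (norm x)\<^sup>2" by (simp add: y)
  moreover have "inner (T x) y = norm x * norm (T x)"
    using False by (simp add: y_def power2_norm_eq_inner[symmetric] power2_eq_square)
  ultimately show ?thesis using x0 by (simp add: power2_eq_square)
qed

lemma op_le_norm: "self_adjoint T \<Longrightarrow> T \<preceq> norm T *\<^sub>R id_blinfun" "self_adjoint T \<Longrightarrow> (- norm T) *\<^sub>R id_blinfun \<preceq> T"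
proof -
  assume s: "self_adjoint T"
  have "\<bar>inner (T x) x\<bar> \<le> norm T * inner x x" for x
  proof -
    have "\<bar>inner (T x) x\<bar> \<le> norm (T x) * norm x" by (rule Cauchy_Schwarz_ineq2)
    also have "\<dots> \<le> norm T * norm x * norm x" by (intro mult_right_mono norm_blinfun) auto
    finally show ?thesis by (simp add: power2_norm_eq_inner[symmetric] power2_eq_square ac_simps)
  qed
  then have "inner (T x) x \<le> norm T * inner x x" "- (norm T * inner x x) \<le> inner (T x) x" for x
    by (meson abs_le_D1 abs_le_iff minus_le_iff order_trans)+
  then show "T \<preceq> norm T *\<^sub>R id_blinfun" "(- norm T) *\<^sub>R id_blinfun \<preceq> T"
    using s by (subst op_le_iff; simp add: self_adjoint_intros op_simps)+
qed

lemma norm_op_leI: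
  assumes "self_adjoint T" "T \<preceq> c *\<^sub>R id_blinfun" "(- c) *\<^sub>R id_blinfun \<preceq> T" "0 \<le> c"
  shows "norm T \<le> c"
proof (rule norm_blinfun_bound[OF assms(4)], rule self_adjoint_norm_apply[OF assms(1)])
  fix x
  have "inner (T x) x \<le> c * (norm x)\<^sup>2" "- (c * (norm x)\<^sup>2) \<le> inner (T x) x"
    using assms(2,3) op_le_iff[of T "c *\<^sub>R id_blinfun"] op_le_iff[of "(- c) *\<^sub>R id_blinfun" T] assms(1)
    by (auto simp: self_adjoint_intros op_simps power2_norm_eq_inner)
  then show "\<bar>inner (T x) x\<bar> \<le> c * (norm x)\<^sup>2" by linarith
qed

section \<open>Strong operator limits of sequences\<close>

definition sconv :: "(nat \<Rightarrow> 'h::complex_hilbert_space op) \<Rightarrow> 'h op \<Rightarrow> bool" where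
  "sconv X T \<longleftrightarrow> (\<forall>x. (\<lambda>n. blinfun_apply (X n) x) \<longlonglongrightarrow> blinfun_apply T x)"

lemma sconvD: "sconv X T \<Longrightarrow> (\<lambda>n. blinfun_apply (X n) x) \<longlonglongrightarrow> blinfun_apply T x"
  by (simp add: sconv_def)

lemma sconv_unique: "sconv X S \<Longrightarrow> sconv X T \<Longrightarrow> S = T"
  unfolding sconv_def by (metis LIMSEQ_unique blinfun_eqI)

lemma sconv_const [simp]: "sconv (\<lambda>_. T) T"
  by (simp add: sconv_def)

lemma sconv_add: "sconv X S \<Longrightarrow> sconv Y T \<Longrightarrow> sconv (\<lambda>n. X n + Y n) (S + T)"
  and sconv_diff: "sconv X S \<Longrightarrow> sconv Y T \<Longrightarrow> sconv (\<lambda>n. X n - Y n) (S - T)"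
  and sconv_scaleR: "sconv X S \<Longrightarrow> sconv (\<lambda>n. r *\<^sub>R X n) (r *\<^sub>R S)"
  by (auto simp: sconv_def op_simps intro: tendsto_add tendsto_diff tendsto_scaleR)

text \<open>The bound \<open>K\<close> controls \<open>X n (Y n x - T x)\<close>, where the argument
  of \<open>X n\<close> moves with \<open>n\<close>.\<close>

lemma sconv_compose:
  assumes "sconv X S" "sconv Y T" "\<And>n. norm (X n) \<le> K"
  shows "sconv (\<lambda>n. X n o\<^sub>L Y n) (S o\<^sub>L T)"
  unfolding sconv_def
proof
  fix x
  have "(\<lambda>n. X n (Y n x - T x)) \<longlonglongrightarrow> 0"
  proof (rule Lim_null_comparison)
    show "\<forall>\<^sub>F n in sequentially. norm (X n (Y n x - T x)) \<le> K * norm (Y n x - T x)"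
      by (intro always_eventually allI order_trans[OF norm_blinfun] mult_right_mono assms) auto
    show "(\<lambda>n. K * norm (Y n x - T x)) \<longlonglongrightarrow> 0"
      using sconvD[OF assms(2), of x] by (intro tendsto_mult_right_zero tendsto_norm_zero) (simp add: LIM_zero_iff)
  qed
  then have "(\<lambda>n. X n (Y n x - T x) + X n (T x)) \<longlonglongrightarrow> 0 + S (T x)"
    using sconvD[OF assms(1)] by (rule tendsto_add)
  then show "(\<lambda>n. (X n o\<^sub>L Y n) x) \<longlonglongrightarrow> (S o\<^sub>L T) x" by (simp add: op_simps)
qed

lemma sconv_bounded_ops:
  assumes "sconv X T" "\<And>n. X n \<in> bounded_ops"
  shows "T \<in> bounded_ops"
  unfolding bounded_ops_def
proof (intro CollectI allI)
  fix c x
  have "(\<lambda>n. c *\<^sub>C X n x) \<longlonglongrightarrow> T (c *\<^sub>C x)"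
    using sconvD[OF assms(1), of "c *\<^sub>C x"] assms(2) by (simp add: bounded_opsD)
  then show "T (c *\<^sub>C x) = c *\<^sub>C T x"
    using LIMSEQ_unique tendsto_scaleC[OF sconvD[OF assms(1), of x], of c] by blast
qed

lemma sconv_self_adjoint:
  assumes "sconv X T" "\<And>n. self_adjoint (X n)"
  shows "self_adjoint T"
  unfolding self_adjoint_iff
proof (intro conjI allI)
  show "T \<in> bounded_ops" using sconv_bounded_ops assms self_adjointD(1) by blast
  fix x y
  have "(\<lambda>n. inner (X n x) y) \<longlonglongrightarrow> inner (T x) y"
    by (intro tendsto_intros sconvD assms)
  moreover have "(\<lambda>n. inner x (X n y)) \<longlonglongrightarrow> inner x (T y)"
    by (intro tendsto_intros sconvD assms)
  ultimately show "inner (T x) y = inner x (T y)"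
    using LIMSEQ_unique self_adjointD(3)[OF assms(2)] by auto
qed

lemma sconv_op_le:
  assumes "sconv X S" "sconv Y T" "\<And>n. X n \<preceq> Y n"
  shows "S \<preceq> T"
proof -
  have c: "sconv (\<lambda>n. Y n - X n) (T - S)" using assms sconv_diff by blast
  have p: "positive_op (Y n - X n)" for n using assms by (simp add: op_le_def)
  have "self_adjoint (T - S)" using sconv_self_adjoint[OF c] p positive_opD by blast
  moreover have "0 \<le> inner ((T - S) x) x" for x
  proof (rule LIMSEQ_le_const)
    show "(\<lambda>n. inner ((Y n - X n) x) x) \<longlonglongrightarrow> inner ((T - S) x) x"
      by (intro tendsto_intros sconvD c)
  qed (use p positive_opD in blast)
  ultimately show ?thesis by (simp add: op_le_def positive_op_iff)
qed

lemma sconv_exists: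
  fixes X :: "nat \<Rightarrow> 'h::complex_hilbert_space op"
  assumes "\<And>x. Cauchy (\<lambda>n. blinfun_apply (X n) x)" "\<And>n. norm (X n) \<le> K"
  shows "\<exists>T. sconv X T \<and> norm T \<le> K"
proof -
  have "\<exists>l. (\<lambda>n. X n x) \<longlonglongrightarrow> l" for x using assms(1) Cauchy_convergent convergent_def by blast
  then obtain t where t: "\<And>x. (\<lambda>n. X n x) \<longlonglongrightarrow> t x" by metis
  have K: "0 \<le> K" using assms(2)[of 0] norm_ge_zero order_trans by blast
  have tK: "norm (t x) \<le> norm x * K" for x
  proof (rule LIMSEQ_le_const2)
    show "(\<lambda>n. norm (X n x)) \<longlonglongrightarrow> norm (t x)" by (intro tendsto_intros t)
    show "\<exists>N. \<forall>n\<ge>N. norm (X n x) \<le> norm x * K"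
      by (metis assms(2) mult.commute mult_right_mono norm_blinfun norm_ge_zero order_trans)
  qed
  have "bounded_linear t"
  proof (rule bounded_linear_intro[OF _ _ tK])
    show "t (x + y) = t x + t y" for x y
      using LIMSEQ_unique[OF t[of "x + y"]] tendsto_add[OF t[of x] t[of y]] by (simp add: op_simps)
    show "t (r *\<^sub>R x) = r *\<^sub>R t x" for r x
      using LIMSEQ_unique[OF t[of "r *\<^sub>R x"]] tendsto_scaleR[OF tendsto_const t[of x], of r]
      by (simp add: op_simps)
  qed
  then have "sconv X (Blinfun t) \<and> norm (Blinfun t) \<le> K"
    using t tK K
    by (auto simp: sconv_def bounded_linear_Blinfun_apply mult.commute intro!: norm_blinfun_bound)
  then show ?thesis by blast
qed

text \<open>For each \<open>x\<close> the numbers \<open>inner (X n x) x\<close> increase and are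
  bounded, hence Cauchy; \<open>positive_op_norm_apply\<close> turns their increments into bounds
  for \<open>norm ((X n - X m) x)\<close>.\<close>

lemma monotone_sconv:
  fixes X :: "nat \<Rightarrow> 'h::complex_hilbert_space op"
  assumes sa: "\<And>n. self_adjoint (X n)" and inc: "\<And>n. X n \<preceq> X (Suc n)" and R: "\<And>n. X n \<preceq> K *\<^sub>R id_blinfun"
  obtains T where "sconv X T" "self_adjoint T" "\<And>n. X n \<preceq> T" 
    "\<And>S. (\<And>n. X n \<preceq> S) \<Longrightarrow> T \<preceq> S" "\<And>m n. m \<le> n \<Longrightarrow> X m \<preceq> X n"
proof -
  have mono: "X m \<preceq> X n" if "m \<le> n" for m n
    using that by (induction rule: dec_induct) (auto intro: op_le_refl op_le_trans inc)
  have q: "inner (X m x) x \<le> inner (X n x) x" if "m \<le> n" for m n x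
    using mono[OF that] sa by (simp add: op_le_iff)
  have qK: "inner (X n x) x \<le> K * (norm x)\<^sup>2" for n x
    using R[of n] sa op_le_iff[of "X n" "K *\<^sub>R id_blinfun"]
    by (simp add: self_adjoint_intros op_simps power2_norm_eq_inner)
  \<comment> \<open>The forms of all \<open>X n\<close> lie between \<open>- norm (X 0)\<close> and
    \<open>K\<close>, so \<open>C\<close> bounds the form of every difference.\<close>
  define C where "C = \<bar>K\<bar> + norm (X 0)"
  have low: "- (norm (X 0) * (norm x)\<^sup>2) \<le> inner (X n x) x" for n x
    using q[of 0 n x] op_le_norm(2)[OF sa[of 0]] op_le_iff[of "(- norm (X 0)) *\<^sub>R id_blinfun" "X 0"] sa[of 0]
    by (auto simp: self_adjoint_intros op_simps power2_norm_eq_inner intro: order_trans)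
  have diff: "(norm ((X n - X m) x))\<^sup>2 \<le> C * (inner (X n x) x - inner (X m x) x)" if "m \<le> n" for m n x
  proof -
    have "(norm ((X n - X m) x))\<^sup>2 \<le> C * inner ((X n - X m) x) x"
    proof (rule positive_op_norm_apply)
      show "positive_op (X n - X m)" using mono[OF that] by (simp add: op_le_def)
      fix y :: 'h
      have "K * (norm y)\<^sup>2 \<le> \<bar>K\<bar> * (norm y)\<^sup>2" by (intro mult_right_mono) auto
      then show "inner ((X n - X m) y) y \<le> C * (norm y)\<^sup>2"
        using qK[of n y] low[of y m] by (simp add: op_simps inner_simps C_def algebra_simps)
    qed
    then show ?thesis by (simp add: op_simps inner_simps)
  qed
  have C0: "C \<ge> 0" by (simp add: C_def)
  have "Cauchy (\<lambda>n. X n x)" for x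
  proof (rule CauchyI)
    fix e :: real assume e: "0 < e"
    have "incseq (\<lambda>n. inner (X n x) x)" using q by (simp add: incseq_def)
    then have "convergent (\<lambda>n. inner (X n x) x)"
      using incseq_convergent[of "\<lambda>n. inner (X n x) x"] qK convergent_def by metis
    then have "Cauchy (\<lambda>n. inner (X n x) x)" by (rule convergent_Cauchy)
    moreover have "e\<^sup>2 / (C + 1) > 0" using e C0 by simp
    ultimately obtain M where M: "\<And>m n. m \<ge> M \<Longrightarrow> n \<ge> M \<Longrightarrow> \<bar>inner (X m x) x - inner (X n x) x\<bar> < e\<^sup>2 / (C + 1)"
      unfolding Cauchy_iff real_norm_def by meson
    have *: "norm (X n x - X m x) < e" if "M \<le> m" "m \<le> n" for m n
    proof -
      have "(norm (X n x - X m x))\<^sup>2 \<le> C * (inner (X n x) x - inner (X m x) x)"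
        using diff[OF that(2)] by (simp add: op_simps)
      also have "\<dots> \<le> C * (e\<^sup>2 / (C + 1))"
        using M[of n m] that C0 by (intro mult_left_mono) auto
      also have "\<dots> < e\<^sup>2" using e C0 by (simp add: field_simps)
      finally show ?thesis using e by (meson less_imp_le power_less_imp_less_base)
    qed
    show "\<exists>M. \<forall>m\<ge>M. \<forall>n\<ge>M. norm (X m x - X n x) < e"
      by (metis * nat_le_linear norm_minus_commute)
  qed
  moreover have "norm (X n) \<le> C" for n
  proof (rule norm_blinfun_bound[OF C0], rule self_adjoint_norm_apply[OF sa])
    fix x :: "'h"
    have "K \<le> C" "norm (X 0) \<le> C" unfolding C_def using abs_ge_self[of K] by (simp_all add: add_increasing2)
    then have "K * (norm x)\<^sup>2 \<le> C * (norm x)\<^sup>2" "norm (X 0) * (norm x)\<^sup>2 \<le> C * (norm x)\<^sup>2"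
      by (auto intro!: mult_right_mono)
    then show "\<bar>inner (X n x) x\<bar> \<le> C * (norm x)\<^sup>2" using qK[of n x] low[of x n] by linarith
  qed
  ultimately obtain T where T: "sconv X T" using sconv_exists by blast
  have "X n \<preceq> T" for n
  proof (rule sconv_op_le)
    show "sconv (\<lambda>_. X n) (X n)" by simp
    show "sconv (\<lambda>k. X (k + n)) T" using T unfolding sconv_def by (auto intro: LIMSEQ_ignore_initial_segment)
    show "X n \<preceq> X (k + n)" for k by (rule mono) simp
  qed
  moreover have "T \<preceq> S" if "\<And>n. X n \<preceq> S" for S using sconv_op_le[OF T sconv_const] that by blast
  ultimately show thesis using that T sconv_self_adjoint[OF T sa] mono by blast
qed

section \<open>Square roots and spectral cuts\<close>

text \<open>This stands in for being a function of \<open>T\<close>. As \<open>R\<close> ranges over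
  all bounded real-linear maps, complex-linear or not, the condition puts a complex-linear
  \<open>S\<close> into every von Neumann algebra that contains \<open>T\<close> (lemma
  \<open>bicommutant\<close>).\<close>

definition in_bicommutant :: "'h::complex_hilbert_space op \<Rightarrow> 'h op \<Rightarrow> bool" where
  "in_bicommutant T S \<longleftrightarrow> (\<forall>R. R o\<^sub>L T = T o\<^sub>L R \<longrightarrow> R o\<^sub>L S = S o\<^sub>L R)"

lemma in_bicommutantD: "in_bicommutant T S \<Longrightarrow> R o\<^sub>L T = T o\<^sub>L R \<Longrightarrow> R o\<^sub>L S = S o\<^sub>L R"
  by (simp add: in_bicommutant_def)

lemma commute_apply: "S o\<^sub>L T = T o\<^sub>L S \<Longrightarrow> blinfun_apply S (blinfun_apply T x) = T (S x)"
  by (metis blinfun_apply_blinfun_compose)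

lemma commuteI: "(\<And>x. blinfun_apply S (blinfun_apply T x) = T (S x)) \<Longrightarrow> S o\<^sub>L T = T o\<^sub>L S"
  by (rule blinfun_eqI) simp

lemma tendsto_blinfun_apply: "(f \<longlongrightarrow> l) F \<Longrightarrow> ((\<lambda>n. blinfun_apply R (f n)) \<longlongrightarrow> R l) F"
  by (rule bounded_linear.tendsto[OF blinfun.bounded_linear_right])

lemma sconv_commute:
  assumes "sconv X T" "\<And>n. R o\<^sub>L X n = X n o\<^sub>L R"
  shows "R o\<^sub>L T = T o\<^sub>L R"
proof (rule commuteI)
  fix x
  have "(\<lambda>n. R (X n x)) \<longlonglongrightarrow> R (T x)" by (intro tendsto_blinfun_apply sconvD assms)
  moreover have "(\<lambda>n. R (X n x)) \<longlonglongrightarrow> T (R x)"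
    using sconvD[OF assms(1), of "R x"] by (simp add: commute_apply[OF assms(2)])
  ultimately show "R (T x) = T (R x)" by (rule LIMSEQ_unique)
qed

lemma id_minus_positive: "T \<preceq> id_blinfun \<Longrightarrow> positive_op (id_blinfun - T)"
  by (simp add: op_le_def)

lemma contraction_minus_square:
  assumes "positive_op t" "t \<preceq> id_blinfun"
  shows "positive_op (t - (t o\<^sub>L t))" "t - (t o\<^sub>L t) \<preceq> id_blinfun"
proof -
  have s: "self_adjoint t" "self_adjoint (id_blinfun - t)"
    using assms positive_opD(1) by (auto intro: self_adjoint_intros)
  have "t - (t o\<^sub>L t) = (t o\<^sub>L (id_blinfun - t) o\<^sub>L t) + ((id_blinfun - t) o\<^sub>L t o\<^sub>L (id_blinfun - t))"
    by (rule blinfun_eqI) (simp add: op_simps)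
  then show "positive_op (t - (t o\<^sub>L t))"
    using positive_op_intros(3) positive_op_sandwich(1) s assms id_minus_positive by metis
  have "id_blinfun - (t - (t o\<^sub>L t)) = (id_blinfun - t) + (t o\<^sub>L t)" by simp
  then show "t - (t o\<^sub>L t) \<preceq> id_blinfun"
    unfolding op_le_def using positive_op_intros(3) positive_op_sandwich(2) s(1) id_minus_positive[OF assms(2)]
    by metis
qed

text \<open>With \<open>a\<^sub>0 = a\<close> and \<open>a\<^sub>n\<^sub>+\<^sub>1 = a\<^sub>n - a\<^sub>n\<^sup>2\<close> one has \<open>a = \<Sum> a\<^sub>n\<^sup>2\<close>, whence \<open>a b = \<Sum> a\<^sub>n b a\<^sub>n\<close>.\<close>

lemma positive_op_compose_contraction:
  assumes a: "positive_op a" "a \<preceq> id_blinfun" and b: "positive_op b" and ab: "b o\<^sub>L a = a o\<^sub>L b"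
  shows "positive_op (a o\<^sub>L b)"
proof -
  define s where "s = rec_nat a (\<lambda>_ t. t - (t o\<^sub>L t))"
  have s0: "s 0 = a" and sS: "s (Suc n) = s n - (s n o\<^sub>L s n)" for n by (simp_all add: s_def)
  have s: "positive_op (s n) \<and> s n \<preceq> id_blinfun" for n
    by (induction n) (simp_all add: a s0 sS contraction_minus_square)
  have sb: "b o\<^sub>L s n = s n o\<^sub>L b" for n
  proof (induction n)
    case (Suc n)
    then have "b (s n x) = s n (b x)" for x by (rule commute_apply)
    then show ?case by (intro commuteI) (simp add: sS op_simps)
  qed (simp add: s0 ab)
  have sym: "inner (s n x) y = inner x (s n y)" for n x y
    using s positive_opD(1) self_adjointD(3) by metis
  have sum: "a x = (\<Sum>k<n. s k (s k x)) + s n x" for n x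
    by (induction n) (simp_all add: s0 sS op_simps)
  have lim: "(\<lambda>n. s n x) \<longlonglongrightarrow> 0" for x
  proof -
    have le: "(\<Sum>k<n. (norm (s k x))\<^sup>2) \<le> inner (a x) x" for n
    proof -
      have "inner (a x) x = (\<Sum>k<n. (norm (s k x))\<^sup>2) + inner (s n x) x"
        by (subst sum[of x n]) (simp add: inner_add_right inner_add_left inner_sum_left inner_sum_right sym power2_norm_eq_inner inner_commute)
      moreover have "0 \<le> inner (s n x) x" using s positive_opD by blast
      ultimately show ?thesis by linarith
    qed
    have "summable (\<lambda>k. (norm (s k x))\<^sup>2)"
      by (rule bounded_imp_summable[where B = "inner (a x) x"]) 
        (use le[of "Suc _"] in \<open>auto simp: lessThan_Suc_atMost\<close>)
    then have "(\<lambda>k. (norm (s k x))\<^sup>2) \<longlonglongrightarrow> 0" by (rule summable_LIMSEQ_zero)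
    then have "(\<lambda>k. sqrt ((norm (s k x))\<^sup>2)) \<longlonglongrightarrow> sqrt 0" by (rule tendsto_real_sqrt)
    then show ?thesis by (simp add: tendsto_norm_zero_iff)
  qed
  have "0 \<le> inner (a (b x)) x" for x
  proof (rule LIMSEQ_le_const2)
    show "(\<lambda>n. inner (b x) (s n x)) \<longlonglongrightarrow> 0"
      using tendsto_inner[OF tendsto_const lim, of "b x" x] by simp
    have "inner (b x) (s n x) \<le> inner (a (b x)) x" for n
    proof -
      have "s k (s k (b x)) = s k (b (s k x))" for k using commute_apply[OF sb] by metis
      then have "inner (a (b x)) x = (\<Sum>k<n. inner (b (s k x)) (s k x)) + inner (b x) (s n x)"
        by (subst sum[of "b x" n]) (simp add: inner_add_left inner_sum_left sym)
      moreover have "0 \<le> (\<Sum>k<n. inner (b (s k x)) (s k x))"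
        by (intro sum_nonneg positive_opD(2) b)
      ultimately show ?thesis by linarith
    qed
    then show "\<exists>N. \<forall>n\<ge>N. inner (b x) (s n x) \<le> inner (a (b x)) x" by blast
  qed
  moreover have "self_adjoint (a o\<^sub>L b)" using a b ab by (simp add: positive_opD self_adjoint_intros)
  ultimately show ?thesis by (simp add: positive_op_iff)
qed

lemma op_le_scaled_id:
  assumes "self_adjoint T" "norm T \<le> c" "c > 0"
  shows "(1 / c) *\<^sub>R T \<preceq> id_blinfun"
proof -
  have "inner (T x) x \<le> c * inner x x" for x
    using op_le_norm(1)[OF assms(1)] op_le_iff[OF assms(1), of "norm T *\<^sub>R id_blinfun"] 
      mult_right_mono[OF assms(2), of "inner x x"]
    by (auto simp: self_adjoint_intros op_simps intro: order_trans)
  then show ?thesis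
    using assms by (subst op_le_iff) (auto simp: self_adjoint_intros op_simps field_simps)
qed

lemma positive_op_compose:
  assumes a: "positive_op a" and b: "positive_op b" and ab: "b o\<^sub>L a = a o\<^sub>L b"
  shows "positive_op (a o\<^sub>L b)"
proof -
  define c where "c = norm a + 1"
  have c: "c > 0" "norm a \<le> c" by (simp_all add: c_def add_nonneg_pos)
  have "positive_op (((1 / c) *\<^sub>R a) o\<^sub>L b)"
  proof (rule positive_op_compose_contraction)
    show "positive_op ((1 / c) *\<^sub>R a)" using a c by (simp add: positive_op_intros)
    show "(1 / c) *\<^sub>R a \<preceq> id_blinfun" using a c by (simp add: op_le_scaled_id positive_opD)
    show "b o\<^sub>L (1 / c) *\<^sub>R a = (1 / c) *\<^sub>R a o\<^sub>L b"
      by (rule commuteI) (simp add: op_simps commute_apply[OF ab])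
  qed (rule b)
  then have "positive_op (c *\<^sub>R (((1 / c) *\<^sub>R a) o\<^sub>L b))" using c by (simp add: positive_op_intros)
  moreover have "c *\<^sub>R (((1 / c) *\<^sub>R a) o\<^sub>L b) = a o\<^sub>L b"
    using c by (intro blinfun_eqI) (simp add: op_simps)
  ultimately show ?thesis by simp
qed

lemma norm_le_one:
  assumes "positive_op T" "T \<preceq> id_blinfun"
  shows "norm T \<le> 1"
  using assms positive_opD[OF assms(1)]
  by (intro norm_op_leI) (auto simp: op_le_iff self_adjoint_intros op_simps intro: order_trans[of _ 0])

lemma square_le:
  assumes "positive_op T" "T \<preceq> id_blinfun"
  shows "T o\<^sub>L T \<preceq> T"
  using contraction_minus_square(1)[OF assms] by (simp add: op_le_def)

text \<open>Write \<open>a = 1 - x\<close> and the root as \<open>1 - Y\<close>; squaring gives the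
  fixed point equation \<open>Y = (x + Y\<^sup>2) / 2\<close>. Iterating it from 0 produces an
  increasing sequence of contractions, all in the bicommutant of \<open>a\<close>, whose strong
  limit solves it.\<close>

lemma sqrt_contraction_exists:
  assumes a: "positive_op a" "a \<preceq> id_blinfun"
  shows "\<exists>h. positive_op h \<and> h o\<^sub>L h = a \<and> in_bicommutant a h"
proof -
  define x where "x = id_blinfun - a"
  have x: "positive_op x" "x \<preceq> id_blinfun"
    using a by (auto simp: x_def op_le_def)
  define y where "y = rec_nat (0 :: 'a op) (\<lambda>_ t. (1/2) *\<^sub>R (x + (t o\<^sub>L t)))"
  have y0: "y 0 = 0" and yS: "y (Suc n) = (1/2) *\<^sub>R (x + (y n o\<^sub>L y n))" for n by (simp_all add: y_def)
  have comm: "R o\<^sub>L y n = y n o\<^sub>L R" if "R o\<^sub>L a = a o\<^sub>L R" for R n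
  proof (induction n)
    case (Suc n)
    then show ?case
      by (intro commuteI) (simp add: yS x_def op_simps commute_apply[OF that] commute_apply[OF Suc])
  qed (auto intro: commuteI simp: y0 op_simps)
  have y: "positive_op (y n) \<and> y n \<preceq> id_blinfun" for n
  proof (induction n)
    case (Suc n)
    have 1: "positive_op (y (Suc n))"
      unfolding yS using Suc x by (intro positive_op_intros positive_op_sandwich) (auto simp: positive_opD)
    have "y n o\<^sub>L y n \<preceq> id_blinfun" using square_le Suc op_le_trans by blast
    then have "positive_op ((1/2) *\<^sub>R (a + (id_blinfun - (y n o\<^sub>L y n))))"
      using a by (intro positive_op_intros) (auto simp: op_le_def)
    moreover have "id_blinfun - y (Suc n) = (1/2) *\<^sub>R (a + (id_blinfun - (y n o\<^sub>L y n)))"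
      by (rule blinfun_eqI) (simp add: yS x_def op_simps algebra_simps flip: scaleR_add_left)
    ultimately show ?case using 1 by (simp add: op_le_def)
  qed (use positive_op_intros in \<open>auto simp: y0 op_le_def\<close>)
  have inc: "y n \<preceq> y (Suc n)" for n
  proof (induction n)
    case 0
    have "positive_op (y 1)" using y by blast
    then show ?case by (simp add: op_le_def y0)
  next
    case (Suc n)
    have c: "y (Suc n) o\<^sub>L y n = y n o\<^sub>L y (Suc n)" by (intro comm comm[symmetric] refl)
    note c' = commute_apply[OF c]
    \<comment> \<open>The next increment is half the difference of two squares, and commutation
      factors it into positive operators.\<close>
    have "positive_op ((1/2) *\<^sub>R ((y (Suc n) - y n) o\<^sub>L (y (Suc n) + y n)))"
      using y Suc by (intro positive_op_intros positive_op_compose commuteI) (auto simp: op_le_def op_simps c')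
    moreover have "y (Suc (Suc n)) - y (Suc n) = (1/2) *\<^sub>R ((y (Suc n) - y n) o\<^sub>L (y (Suc n) + y n))"
      unfolding yS[of "Suc n"]
      by (subst (3) yS, rule blinfun_eqI) (simp add: op_simps c' algebra_simps)
    ultimately show ?case by (simp add: op_le_def)
  qed
  obtain Y where Y: "sconv y Y" "self_adjoint Y" "\<And>n. y n \<preceq> Y" "\<And>S. (\<And>n. y n \<preceq> S) \<Longrightarrow> Y \<preceq> S"
    using monotone_sconv[of y 1] y inc positive_opD(1) by (metis scaleR_one)
  have "sconv (\<lambda>n. y n o\<^sub>L y n) (Y o\<^sub>L Y)"
    by (rule sconv_compose[OF Y(1,1), of 1]) (use y norm_le_one in blast)
  then have "sconv (\<lambda>n. y (Suc n)) ((1/2) *\<^sub>R (x + (Y o\<^sub>L Y)))"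
    unfolding yS by (intro sconv_scaleR sconv_add sconv_const)
  moreover have "sconv (\<lambda>n. y (Suc n)) Y" using Y(1) unfolding sconv_def by (auto intro: LIMSEQ_Suc)
  ultimately have eq: "Y = (1/2) *\<^sub>R (x + (Y o\<^sub>L Y))" by (rule sconv_unique[rotated])
  have "x v + Y (Y v) = 2 *\<^sub>R Y v" for v
    using arg_cong[OF eq, of "\<lambda>T. 2 *\<^sub>R blinfun_apply T v"] by (simp add: op_simps)
  then have sq: "(id_blinfun - Y) o\<^sub>L (id_blinfun - Y) = a"
    by (intro blinfun_eqI) (simp add: op_simps x_def algebra_simps scaleR_2)
  have "Y \<preceq> id_blinfun" using Y(4) y by blast
  then have "positive_op (id_blinfun - Y)" by (simp add: op_le_def)
  moreover have "in_bicommutant a (id_blinfun - Y)"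
    unfolding in_bicommutant_def
  proof (intro allI impI)
    fix R assume "R o\<^sub>L a = a o\<^sub>L R"
    then have "R o\<^sub>L Y = Y o\<^sub>L R" using sconv_commute[OF Y(1)] comm by blast
    then show "R o\<^sub>L (id_blinfun - Y) = (id_blinfun - Y) o\<^sub>L R"
      by (intro commuteI) (simp add: op_simps commute_apply)
  qed
  ultimately show ?thesis using sq by blast
qed

lemma sqrt_exists:
  assumes a: "positive_op a"
  obtains h where "positive_op h" "h o\<^sub>L h = a" "in_bicommutant a h"
proof -
  define c where "c = norm a + 1"
  have c: "c > 0" "norm a \<le> c" by (simp_all add: c_def add_nonneg_pos)
  obtain h where h: "positive_op h" "h o\<^sub>L h = (1 / c) *\<^sub>R a" "in_bicommutant ((1 / c) *\<^sub>R a) h"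
    using sqrt_contraction_exists[of "(1 / c) *\<^sub>R a"] a c op_le_scaled_id positive_opD(1) positive_op_intros(4)[of "1 / c" a]
    by (metis divide_nonneg_pos zero_le_one)
  have "positive_op (sqrt c *\<^sub>R h)" using h c by (simp add: positive_op_intros)
  moreover have "(sqrt c *\<^sub>R h) o\<^sub>L (sqrt c *\<^sub>R h) = a"
  proof (rule blinfun_eqI)
    fix x
    have "h (h x) = (1 / c) *\<^sub>R a x" using h(2) by (metis blinfun_apply_blinfun_compose blinfun.scaleR_left)
    then show "((sqrt c *\<^sub>R h) o\<^sub>L (sqrt c *\<^sub>R h)) x = a x" using c by (simp add: op_simps)
  qed
  moreover have "in_bicommutant a (sqrt c *\<^sub>R h)"
    unfolding in_bicommutant_def
  proof (intro allI impI)
    fix R assume R: "R o\<^sub>L a = a o\<^sub>L R"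
    have "R o\<^sub>L h = h o\<^sub>L R"
      by (rule in_bicommutantD[OF h(3)], rule commuteI) (simp add: op_simps commute_apply[OF R])
    then show "R o\<^sub>L sqrt c *\<^sub>R h = sqrt c *\<^sub>R h o\<^sub>L R"
      by (intro commuteI) (simp add: op_simps commute_apply)
  qed
  ultimately show thesis using that by blast
qed

text \<open>The cut is the kernel projection of \<open>k = |T| - T\<close>, the strong limit of \<open>(1 - c k\<^sup>2)\<^sup>n\<close>.\<close>

lemma spectral_cut:
  assumes T: "self_adjoint T"
  obtains p where "projection p" "in_bicommutant T p"
    "\<And>x. 0 \<le> inner (T (p x)) (p x)" "\<And>x. inner (T (x - p x)) (x - p x) \<le> 0"
proof -
  obtain h where h: "positive_op h" "h o\<^sub>L h = T o\<^sub>L T" "in_bicommutant (T o\<^sub>L T) h"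
    using sqrt_exists[OF positive_op_sandwich(2)[OF T]] by blast
  have hcomm: "R o\<^sub>L h = h o\<^sub>L R" if "R o\<^sub>L T = T o\<^sub>L R" for R
    by (rule in_bicommutantD[OF h(3)], rule commuteI) (simp add: op_simps commute_apply[OF that])
  have hT: "T (h v) = h (T v)" for v using commute_apply[OF hcomm] by blast
  have hh: "h (h v) = T (T v)" for v using h(2) by (metis blinfun_apply_blinfun_compose)
  define k where "k = h - T"
  have k: "self_adjoint k" using h T by (simp add: k_def self_adjoint_intros positive_opD)
  have kcomm: "R o\<^sub>L k = k o\<^sub>L R" if "R o\<^sub>L T = T o\<^sub>L R" for R
    using hcomm[OF that] that by (intro commuteI) (simp add: k_def op_simps commute_apply)
  \<comment> \<open>\<open>h\<close> is the absolute value of \<open>T\<close>, so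
    \<open>(h + T) (h - T) = h\<^sup>2 - T\<^sup>2 = 0\<close>.\<close>
  have hTk: "(h + T) (k v) = 0" for v by (simp add: k_def op_simps hT hh)
  define c where "c = (norm k)\<^sup>2 + 1"
  have c: "c > 0" "norm (k o\<^sub>L k) \<le> c"
    using norm_blinfun_compose[of k k] by (auto simp: c_def power2_eq_square add_nonneg_pos)
  define x where "x = (1 / c) *\<^sub>R (k o\<^sub>L k)"
  have x: "positive_op x" "x \<preceq> id_blinfun" 
    unfolding x_def using c k by (auto intro!: positive_op_intros positive_op_sandwich op_le_scaled_id self_adjoint_intros)
  define y where "y = id_blinfun - x"
  have y: "positive_op y" using x by (simp add: y_def op_le_def)
  define z where "z = rec_nat (id_blinfun :: 'a op) (\<lambda>_ t. y o\<^sub>L t)"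
  have z0: "z 0 = id_blinfun" and zS: "z (Suc n) = y o\<^sub>L z n" for n by (simp_all add: z_def)
  have zcomm: "R o\<^sub>L z n = z n o\<^sub>L R" if "R o\<^sub>L k = k o\<^sub>L R" for R n
  proof (induction n)
    case (Suc n)
    then show ?case
      by (intro commuteI) (simp add: zS y_def x_def op_simps commute_apply[OF that] commute_apply[OF Suc])
  qed (auto intro: commuteI simp: z0 op_simps)
  have xk: "x o\<^sub>L k = k o\<^sub>L x" "y o\<^sub>L k = k o\<^sub>L y" by (rule commuteI; simp add: x_def y_def op_simps)+
  have z: "positive_op (z n)" for n
  proof (induction n)
    case (Suc n)
    then show ?case unfolding zS using y zcomm[OF xk(2), of n] by (intro positive_op_compose) auto
  qed (simp add: z0 positive_op_intros)
  have "z n - z (Suc n) = x o\<^sub>L z n" for n by (rule blinfun_eqI) (simp add: zS y_def op_simps)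
  then have dec: "z (Suc n) \<preceq> z n" for n
    using positive_op_compose[OF x(1) z, of n] zcomm[OF xk(1), of n] by (simp add: op_le_def)
  have "\<exists>q. sconv (\<lambda>n. id_blinfun - z n) q \<and> self_adjoint q"
  proof (rule monotone_sconv[of "\<lambda>n. id_blinfun - z n" 1])
    show "self_adjoint (id_blinfun - z n)" for n using z by (simp add: self_adjoint_intros positive_opD)
    show "id_blinfun - z n \<preceq> id_blinfun - z (Suc n)" for n using dec[of n] by (simp add: op_le_def)
    show "id_blinfun - z n \<preceq> 1 *\<^sub>R id_blinfun" for n using z[of n] by (simp add: op_le_def)
  qed blast
  then obtain q where q: "sconv (\<lambda>n. id_blinfun - z n) q" "self_adjoint q" by blast
  define p where "p = id_blinfun - q"
  have p: "sconv z p" "self_adjoint p"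
    using sconv_diff[OF sconv_const[of id_blinfun] q(1)] q(2) by (simp_all add: p_def self_adjoint_intros)
  note pl = sconvD[OF p(1)]
  have yp: "y (p v) = p v" for v
    using LIMSEQ_unique[OF tendsto_blinfun_apply[OF pl, of y v]] LIMSEQ_Suc[OF pl, of v] by (simp add: zS)
  have zp: "z n (p v) = p v" for n v by (induction n) (simp_all add: z0 zS yp)
  have pp: "p (p v) = p v" for v
    using LIMSEQ_unique[OF pl[of "p v"]] by (simp add: zp)
  have kp: "k (p v) = 0" for v
  proof -
    have "x (p v) = 0" using yp[of v] by (simp add: y_def op_simps)
    then have "k (k (p v)) = 0" using c by (simp add: x_def op_simps)
    then have "inner (k (p v)) (k (p v)) = 0" using self_adjointD(3)[OF k, of "p v" "k (p v)"] by simp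
    then show ?thesis by simp
  qed
  \<comment> \<open>Factors \<open>1 - x\<close> do not change \<open>h + T\<close>, because
    \<open>x\<close> is a multiple of \<open>k\<^sup>2\<close> and \<open>h + T\<close> annihilates
    the range of \<open>k\<close>. In the limit \<open>h + T\<close> vanishes on the range of
    \<open>1 - p\<close>, where therefore \<open>T = - h\<close>; on the range of \<open>p\<close>
    the equation \<open>k = 0\<close> says \<open>T = h\<close>.\<close>
  have hTz: "(h + T) (z n v) = (h + T) v" for n v
    by (induction n) (simp_all add: z0 zS y_def x_def blinfun.diff_left blinfun.diff_right 
        blinfun.scaleR_left blinfun.scaleR_right hTk)
  have hTp: "(h + T) (p v) = (h + T) v" for v
    using LIMSEQ_unique[OF tendsto_blinfun_apply[OF pl, of "h + T" v]] by (simp add: hTz)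
  have hpos: "0 \<le> inner (h v) v" for v using h positive_opD by blast
  show thesis
  proof
    show "projection p" using p pp by (simp add: projection_iff)
    show "in_bicommutant T p"
      unfolding in_bicommutant_def using sconv_commute[OF p(1)] zcomm kcomm by blast
    show "0 \<le> inner (T (p v)) (p v)" for v
      using kp[of v] hpos[of "p v"] by (simp add: k_def op_simps)
    show "inner (T (v - p v)) (v - p v) \<le> 0" for v
    proof -
      have "T (v - p v) = - h (v - p v)" using hTp[of v] by (simp add: op_simps algebra_simps)
      then show ?thesis using hpos[of "v - p v"] by simp
    qed
  qed
qed

text \<open>Solving \<open>s x = y\<close> means finding a fixed point of
  \<open>x - (s x - y) / K\<close>. For \<open>c \<le> s \<le> K\<close> the linear part
  \<open>1 - s / K\<close> has its form between 0 and \<open>q = 1 - c / K\<close>, so the map is a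
  contraction.\<close>

lemma positive_inverse_exists:
  assumes s: "self_adjoint s" and c: "c > 0" "c *\<^sub>R id_blinfun \<preceq> s"
  obtains r where "positive_op r" "s o\<^sub>L r = id_blinfun" "r o\<^sub>L s = id_blinfun" "in_bicommutant s r"
    "r \<preceq> (1 / c) *\<^sub>R id_blinfun"
proof -
  have low: "c * (norm x)\<^sup>2 \<le> inner (s x) x" for x
    using c(2) op_le_iff[of "c *\<^sub>R id_blinfun" s] s by (simp add: self_adjoint_intros op_simps power2_norm_eq_inner)
  have below: "c * norm x \<le> norm (s x)" for x
  proof (cases "x = 0")
    case False
    have "c * norm x * norm x \<le> norm (s x) * norm x"
      using low[of x] norm_cauchy_schwarz[of "s x" x] by (simp add: power2_eq_square)
    then show ?thesis using False by simp
  qed simp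
  have inj: "x = y" if "s x = s y" for x y
    using below[of "x - y"] that c by (simp add: op_simps zero_le_mult_iff mult_le_0_iff)
  define K where "K = c + norm s"
  have K: "K > 0" "c / K \<le> 1" "norm s \<le> K" using c by (auto simp: K_def add_pos_nonneg)
  define q where "q = 1 - c / K"
  have q: "0 \<le> q" "q < 1" using K c by (auto simp: q_def)
  have contr: "norm ((id_blinfun - (1 / K) *\<^sub>R s) x) \<le> q * norm x" for x
  proof (rule self_adjoint_norm_apply)
    show "self_adjoint (id_blinfun - (1 / K) *\<^sub>R s)" using s by (simp add: self_adjoint_intros)
    fix y :: 'a
    have "inner (s y) y \<le> K * (norm y)\<^sup>2"
    proof -
      have "inner (s y) y \<le> norm (s y) * norm y" by (rule norm_cauchy_schwarz)
      also have "\<dots> \<le> norm s * norm y * norm y" by (intro mult_right_mono norm_blinfun) auto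
      also have "\<dots> \<le> K * norm y * norm y" by (intro mult_right_mono K) auto
      finally show ?thesis by (simp add: power2_eq_square ac_simps)
    qed
    then have "inner ((id_blinfun - (1 / K) *\<^sub>R s) y) y \<ge> 0"
      using K by (simp add: op_simps inner_simps power2_norm_eq_inner field_simps)
    moreover have "inner ((id_blinfun - (1 / K) *\<^sub>R s) y) y \<le> q * (norm y)\<^sup>2"
      using low[of y] K by (simp add: q_def op_simps inner_simps power2_norm_eq_inner[symmetric] field_simps)
    ultimately show "\<bar>inner ((id_blinfun - (1 / K) *\<^sub>R s) y) y\<bar> \<le> q * (norm y)\<^sup>2" by simp
  qed
  have "\<exists>x. s x = y" for y
  proof -
    define f where "f x = (id_blinfun - (1 / K) *\<^sub>R s) x + (1 / K) *\<^sub>R y" for x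
    have "\<exists>!x. f x = x"
    proof (rule banach_fix_type[OF q], intro allI)
      fix x x'
      show "dist (f x) (f x') \<le> q * dist x x'"
        using contr[of "x - x'"] unfolding blinfun.diff_right by (simp add: f_def dist_norm)
    qed
    then obtain x where "f x = x" by blast
    then have "(1 / K) *\<^sub>R s x = (1 / K) *\<^sub>R y" by (auto simp: f_def op_simps algebra_simps)
    then have "s x = y" using K by simp
    then show ?thesis by blast
  qed
  then obtain r where r: "\<And>y. s (r y) = y" by metis
  have rs: "r (s x) = x" for x by (rule inj) (rule r)
  have "bounded_linear r"
  proof (rule bounded_linear_intro[where K = "1 / c"])
    show "r (x + y) = r x + r y" for x y by (rule inj) (simp add: r op_simps)
    show "r (t *\<^sub>R x) = t *\<^sub>R r x" for t x by (rule inj) (simp add: r op_simps)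
    show "norm (r x) \<le> norm x * (1 / c)" for x
      using below[of "r x"] c by (simp add: r field_simps)
  qed
  then have ap: "blinfun_apply (Blinfun r) = r" by (rule bounded_linear_Blinfun_apply)
  have "Blinfun r \<in> bounded_ops"
    unfolding bounded_ops_def by (intro CollectI allI, rule inj) (simp add: ap r bounded_opsD[OF self_adjointD(1)[OF s]])
  then have sa: "self_adjoint (Blinfun r)"
    unfolding self_adjoint_iff ap using self_adjointD(3)[OF s] r by metis
  moreover have "0 \<le> inner (r x) x" for x
    using low[of "r x"] c by (simp add: r inner_commute) (meson order_trans zero_le_mult_iff less_imp_le zero_le_power2)
  ultimately have "positive_op (Blinfun r)" by (simp add: positive_op_iff ap)
  moreover have "Blinfun r \<preceq> (1 / c) *\<^sub>R id_blinfun"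
  proof -
    have "inner (r x) x \<le> (1 / c) * inner x x" for x
    proof -
      have "inner (r x) x \<le> norm (r x) * norm x" by (rule norm_cauchy_schwarz)
      also have "\<dots> \<le> (1 / c) * norm x * norm x"
        using below[of "r x"] c by (intro mult_right_mono) (auto simp: r field_simps)
      finally show ?thesis by (simp add: power2_norm_eq_inner[symmetric] power2_eq_square)
    qed
    then show ?thesis using sa by (subst op_le_iff) (auto simp: self_adjoint_intros op_simps ap)
  qed
  moreover have "in_bicommutant s (Blinfun r)"
    unfolding in_bicommutant_def
  proof (intro allI impI commuteI)
    fix R x assume R: "R o\<^sub>L s = s o\<^sub>L R"
    show "R (Blinfun r x) = Blinfun r (R x)"
      by (rule inj) (simp add: ap r commute_apply[OF R, symmetric])
  qed
  moreover have "s o\<^sub>L Blinfun r = id_blinfun" "Blinfun r o\<^sub>L s = id_blinfun"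
    by (rule blinfun_eqI; simp add: ap r rs)+
  ultimately show thesis using that by blast
qed

text \<open>\<open>damp s\<close> is \<open>s (1 + s)\<inverse>\<close>, a monotone function of \<open>s \<ge> 0\<close> with values in \<open>[0, 1]\<close>.\<close>

definition damp :: "'h::complex_hilbert_space op \<Rightarrow> 'h op" where
  "damp s = (SOME g. \<exists>r. g = id_blinfun - r \<and> positive_op r \<and> r \<preceq> id_blinfun \<and>
    (id_blinfun + s) o\<^sub>L r = id_blinfun \<and> in_bicommutant s g)"

lemma damp_resolvent:
  assumes s: "positive_op s"
  obtains r where "damp s = id_blinfun - r" "positive_op r" "r \<preceq> id_blinfun"
    "\<And>x. r x + s (r x) = x" "in_bicommutant s (damp s)"
proof -
  have "1 *\<^sub>R id_blinfun \<preceq> id_blinfun + s" using s by (simp add: op_le_def)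
  then obtain r where r: "positive_op r" "(id_blinfun + s) o\<^sub>L r = id_blinfun"
      "in_bicommutant (id_blinfun + s) r" "r \<preceq> (1 / 1) *\<^sub>R id_blinfun"
    using positive_inverse_exists[of "id_blinfun + s" 1] s
    by (metis positive_opD(1) self_adjoint_intros(2,3) zero_less_one)
  have "in_bicommutant s (id_blinfun - r)"
    unfolding in_bicommutant_def
  proof (intro allI impI)
    fix R assume R: "R o\<^sub>L s = s o\<^sub>L R"
    have "R o\<^sub>L r = r o\<^sub>L R"
      by (rule in_bicommutantD[OF r(3)], rule commuteI) (simp add: op_simps commute_apply[OF R])
    then show "R o\<^sub>L (id_blinfun - r) = (id_blinfun - r) o\<^sub>L R"
      by (intro commuteI) (simp add: op_simps commute_apply)
  qed
  then have "\<exists>g r. g = id_blinfun - r \<and> positive_op r \<and> r \<preceq> id_blinfun \<and>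
    (id_blinfun + s) o\<^sub>L r = id_blinfun \<and> in_bicommutant s g" using r by auto
  from someI_ex[OF this] obtain r where *: "damp s = id_blinfun - r" "positive_op r" "r \<preceq> id_blinfun"
    "(id_blinfun + s) o\<^sub>L r = id_blinfun" "in_bicommutant s (damp s)" unfolding damp_def by blast
  moreover have "r x + s (r x) = x" for x
    using arg_cong[OF *(4), of "\<lambda>T. blinfun_apply T x"] by (simp add: op_simps)
  ultimately show thesis using that by blast
qed

text \<open>With \<open>u = r x\<close> one has \<open>x = u + s u\<close> and
  \<open>damp s x = s u\<close>. This substitution removes the inverse, here and in
  \<open>damp_lower\<close>.\<close>

lemma damp_props:
  assumes "positive_op s"
  shows "positive_op (damp s)" "damp s \<preceq> id_blinfun" "damp s \<preceq> s" "in_bicommutant s (damp s)"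
proof -
  obtain r where r: "damp s = id_blinfun - r" "positive_op r" "r \<preceq> id_blinfun"
    "\<And>x. r x + s (r x) = x" "in_bicommutant s (damp s)" using damp_resolvent[OF assms] by blast
  show "positive_op (damp s)" "damp s \<preceq> id_blinfun" "in_bicommutant s (damp s)"
    using r by (simp_all add: op_le_def)
  have "inner (damp s x) x \<le> inner (s x) x" for x
  proof -
    define u where "u = r x"
    have x: "x = u + s u" using r(4)[of x] by (simp add: u_def)
    have g: "damp s x = s u" using r(4)[of x] by (simp add: r(1) blinfun.diff_left u_def algebra_simps)
    have "inner (s (s u)) u = inner (s u) (s u)"
      using self_adjointD(3)[OF positive_opD(1)[OF assms], of "s u" u] by simp
    then show ?thesis unfolding g using positive_opD(2)[OF assms, of "s u"]
      by (subst (1 3) x) (simp add: x op_simps inner_simps)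
  qed
  then show "damp s \<preceq> s" using \<open>positive_op (damp s)\<close> assms by (simp add: op_le_iff positive_opD)
qed

text \<open>The operator form of \<open>t \<le> (1 + K) * t / (1 + t)\<close> on the interval from 0
  to \<open>K\<close>: on bounded operators damping loses only a constant factor.\<close>

lemma damp_lower:
  assumes s: "positive_op s" and K: "s \<preceq> K *\<^sub>R id_blinfun"
  shows "s \<preceq> (1 + K) *\<^sub>R damp s"
proof -
  obtain r where r: "damp s = id_blinfun - r" "\<And>x. r x + s (r x) = x" using damp_resolvent[OF s] by metis
  have sK: "inner (s x) x \<le> K * (norm x)\<^sup>2" for x
    using op_le_iff[of s "K *\<^sub>R id_blinfun"] s K by (simp add: self_adjoint_intros op_simps power2_norm_eq_inner positive_opD)
  have "inner (s x) x \<le> (1 + K) * inner (damp s x) x" for x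
  proof -
    define u where "u = r x"
    have x: "x = u + s u" using r(2)[of x] by (simp add: u_def)
    have g: "damp s x = s u" using r(2)[of x] by (simp add: r(1) blinfun.diff_left u_def algebra_simps)
    have *: "inner (s (s u)) u = (norm (s u))\<^sup>2"
      using self_adjointD(3)[OF positive_opD(1)[OF s], of "s u" u] by (simp add: power2_norm_eq_inner)
    have "inner (s x) x = inner (s u) u + 2 * (norm (s u))\<^sup>2 + inner (s (s u)) (s u)"
      unfolding x using * by (simp add: op_simps inner_simps power2_norm_eq_inner)
    moreover have "inner (damp s x) x = inner (s u) u + (norm (s u))\<^sup>2"
      unfolding g by (subst x) (simp add: inner_simps power2_norm_eq_inner)
    moreover have "(norm (s u))\<^sup>2 \<le> K * inner (s u) u" by (rule positive_op_norm_apply[OF s sK])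
    moreover have "inner (s (s u)) (s u) \<le> K * (norm (s u))\<^sup>2" by (rule sK)
    ultimately show ?thesis by (simp add: algebra_simps)
  qed
  then show ?thesis
    using s damp_props(1)[OF s] by (subst op_le_iff) (auto simp: self_adjoint_intros positive_opD op_simps)
qed

text \<open>Since \<open>damp s = 1 - r\<close>, the resolvents have to be compared. With
  \<open>w = r x\<close> and \<open>u = r' x\<close>, expanding
  \<open>inner ((1 + s) (w - u)) (w - u) \<ge> 0\<close> and replacing \<open>s\<close> by
  \<open>t\<close> in the term in \<open>u\<close> alone leaves
  \<open>inner x u \<le> inner x w\<close>.\<close>

lemma damp_mono:
  assumes s: "positive_op s" and t: "positive_op t" and st: "s \<preceq> t"
  shows "damp s \<preceq> damp t"
proof -
  obtain r where r: "damp s = id_blinfun - r" "\<And>x. r x + s (r x) = x" using damp_resolvent[OF s] by metis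
  obtain r' where r': "damp t = id_blinfun - r'" "\<And>x. r' x + t (r' x) = x" using damp_resolvent[OF t] by metis
  have "inner (damp s x) x \<le> inner (damp t x) x" for x
  proof -
    define w u where "w = r x" and "u = r' x"
    have x: "w + s w = x" "u + t u = x" using r r' by (auto simp: w_def u_def)
    have "0 \<le> inner (s (w - u)) (w - u) + inner (w - u) (w - u)" using positive_opD(2)[OF s] by simp
    also have "\<dots> = inner ((w + s w) - (u + s u)) (w - u)" by (simp add: op_simps inner_simps)
    also have "\<dots> = inner x w - inner x u - inner (u + s u) w + inner (u + s u) u"
      by (simp add: x inner_simps)
    also have "inner (u + s u) w = inner u (w + s w)"
      using self_adjointD(3)[OF positive_opD(1)[OF s]] by (simp add: inner_simps)
    also have "inner (u + s u) u \<le> inner (u + t u) u"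
      using st op_le_iff[of s t] s t by (simp add: positive_opD inner_simps)
    finally have "inner x u \<le> inner x w" by (simp add: x inner_commute)
    then show ?thesis by (simp add: r r' op_simps inner_simps w_def[symmetric] u_def[symmetric] inner_commute)
  qed
  then show ?thesis
    using damp_props(1)[OF s] damp_props(1)[OF t] by (simp add: op_le_iff positive_opD)
qed

section \<open>Von Neumann algebras\<close>

lemma commutant_antimono: "S \<subseteq> T \<Longrightarrow> commutant T \<subseteq> commutant S"
  by (auto simp: commutant_def)

lemma subset_double_commutant: "S \<subseteq> bounded_ops \<Longrightarrow> S \<subseteq> commutant (commutant S)"
  by (auto simp: commutant_def)

lemma commutant_subset: "commutant S \<subseteq> bounded_ops"
  by (auto simp: commutant_def)

lemma commutant_triple: "S \<subseteq> bounded_ops \<Longrightarrow> commutant (commutant (commutant S)) = commutant S"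
  by (intro equalityI commutant_antimono subset_double_commutant commutant_subset)

lemma commutant_von_neumann:
  assumes S: "S \<subseteq> bounded_ops" "\<And>T. T \<in> S \<Longrightarrow> adj T \<in> S"
  shows "von_neumann_algebra (commutant S)"
  unfolding von_neumann_algebra_def star_subalgebra_def
proof (intro conjI ballI allI)
  fix T T' c assume T: "T \<in> commutant S"
  then have b: "T \<in> bounded_ops" by (simp add: commutant_def)
  have c: "T o\<^sub>L R = R o\<^sub>L T" "T (R x) = R (T x)" if "R \<in> S" for R x
    using T that commute_apply by (auto simp: commutant_def)
  show "c *\<^sub>C T \<in> commutant S"
    unfolding commutant_def using b c S by (auto intro!: commuteI simp: op_simps subset_iff bounded_opsD)
  have "adj T o\<^sub>L R = R o\<^sub>L adj T" if R: "R \<in> S" for R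
  proof -
    have "adj (T o\<^sub>L adj R) = adj (adj R o\<^sub>L T)" using c(1)[OF S(2)[OF R]] by simp
    then show ?thesis using b S R by (simp add: subset_iff)
  qed
  then show "adj T \<in> commutant S" using b by (simp add: commutant_def)
  assume T': "T' \<in> commutant S"
  have c': "T' (R x) = R (T' x)" if "R \<in> S" for R x
    using T' that commute_apply by (auto simp: commutant_def)
  show "T + T' \<in> commutant S" "T o\<^sub>L T' \<in> commutant S"
    using b T' c c' by (auto intro!: commuteI simp: commutant_def op_simps)
qed (auto simp: S commutant_triple commutant_subset, auto simp: commutant_def intro: commuteI simp: op_simps)

text \<open>The estimate is on the vectors \<open>e x\<close>, so that it passes to smaller
  projections without any change.\<close>

definition nearly_scalar :: "real \<Rightarrow> 'h::complex_hilbert_space op \<Rightarrow> 'h op \<Rightarrow> bool" where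
  "nearly_scalar \<epsilon> S e \<longleftrightarrow> (\<exists>c::real. \<forall>x. norm (S (e x) - c *\<^sub>R e x) \<le> \<epsilon> * norm (e x))"

locale vn_algebra =
  fixes W :: "'h::complex_hilbert_space op set"
  assumes vn: "von_neumann_algebra W"
begin

lemma sub: "T \<in> W \<Longrightarrow> T \<in> bounded_ops"
  using vn by (auto simp: von_neumann_algebra_def star_subalgebra_def)

lemma double_commutant: "commutant (commutant W) = W"
  using vn by (simp add: von_neumann_algebra_def)

lemma zero [simp, intro]: "0 \<in> W"
  and add [intro]: "S \<in> W \<Longrightarrow> T \<in> W \<Longrightarrow> S + T \<in> W"
  and compose [intro]: "S \<in> W \<Longrightarrow> T \<in> W \<Longrightarrow> S o\<^sub>L T \<in> W"
  and scaleC [intro]: "T \<in> W \<Longrightarrow> c *\<^sub>C T \<in> W"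
  and adj [intro]: "T \<in> W \<Longrightarrow> adj T \<in> W"
  using vn by (auto simp: von_neumann_algebra_def star_subalgebra_def)

lemma id [simp, intro]: "id_blinfun \<in> W"
  using double_commutant by (auto simp: commutant_def intro!: commuteI)

lemma scaleR [intro]: 
  assumes "T \<in> W"
  shows "r *\<^sub>R T \<in> W"
proof -
  have "r *\<^sub>R T = complex_of_real r *\<^sub>C T" by (rule blinfun_eqI) (simp add: op_simps scaleC_of_real)
  then show ?thesis using scaleC assms by simp
qed

lemma uminus [intro]: "T \<in> W \<Longrightarrow> - T \<in> W"
  using scaleR[of T "-1"] by simp

lemma diff [intro]: "S \<in> W \<Longrightarrow> T \<in> W \<Longrightarrow> S - T \<in> W"
  using add[OF _ uminus] by force

lemma sum [intro]: "(\<And>i. i \<in> I \<Longrightarrow> f i \<in> W) \<Longrightarrow> (\<Sum>i\<in>I. f i) \<in> W"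
  by (induction I rule: infinite_finite_induct) auto

text \<open>Roots, cuts, inverses and \<open>damp\<close> are constructed on the Hilbert space, with
  no reference to an algebra; this lemma is what places them in \<open>W\<close>.\<close>

lemma bicommutant: "T \<in> W \<Longrightarrow> in_bicommutant T S \<Longrightarrow> S \<in> bounded_ops \<Longrightarrow> S \<in> W"
  by (subst double_commutant[symmetric]) (auto simp: commutant_def in_bicommutant_def)

lemma sconv_mem:
  assumes "\<And>n. X n \<in> W" "sconv X T"
  shows "T \<in> W"
proof -
  have "R o\<^sub>L T = T o\<^sub>L R" if "R \<in> commutant W" for R
    using sconv_commute[OF assms(2), of R] that assms(1) by (auto simp: commutant_def)
  moreover have "T \<in> bounded_ops" using sconv_bounded_ops[OF assms(2)] assms(1) sub by blast
  ultimately have "T \<in> commutant (commutant W)" by (simp add: commutant_def)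
  then show ?thesis by (simp add: double_commutant)
qed

lemma cut:
  assumes "T \<in> W" "self_adjoint T"
  obtains p where "p \<in> W" "projection p" "in_bicommutant T p"
    "\<And>x. 0 \<le> inner (T (p x)) (p x)" "\<And>x. inner (T (x - p x)) (x - p x) \<le> 0"
  using spectral_cut[OF assms(2)] bicommutant[OF assms(1)] projectionD(2) by metis

lemma sqrt_mem:
  assumes "T \<in> W" "positive_op T"
  obtains h where "h \<in> W" "positive_op h" "h o\<^sub>L h = T" "in_bicommutant T h"
  using sqrt_exists[OF assms(2)] bicommutant[OF assms(1)] positive_opD(1) self_adjointD(1) by metis

lemma damp_mem: "T \<in> W \<Longrightarrow> positive_op T \<Longrightarrow> damp T \<in> W"
  using damp_props[of T] bicommutant positive_opD(1) self_adjointD(1) by metis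

lemma real_imaginary_parts:
  assumes "T \<in> W"
  obtains X Y where "X \<in> W" "Y \<in> W" "self_adjoint X" "self_adjoint Y" "T = X + \<i> *\<^sub>C Y" "adj T = X - \<i> *\<^sub>C Y"
proof -
  define X Y where "X = (1/2) *\<^sub>R (T + adj T)" and "Y = (- \<i> / 2) *\<^sub>C (T - adj T)"
  have T: "T \<in> bounded_ops" using assms sub by blast
  have adjY: "adj Y = Y"
  proof -
    have "adj Y = (\<i> / 2) *\<^sub>C (adj T - T)" using T by (simp add: Y_def)
    also have "\<dots> = Y" by (rule blinfun_eqI) (simp add: Y_def op_simps scaleC_diff_right scaleC_minus_left)
    finally show ?thesis .
  qed
  have half: "v /\<^sub>R 2 + v /\<^sub>R 2 = v" for v :: 'h by (simp flip: scaleR_add_left)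
  have hi: "\<i> *\<^sub>C (\<i> / 2) *\<^sub>C v = - (v /\<^sub>R 2)" for v :: 'h
    using scaleC_of_real[of "-1/2" v] by (simp add: scaleC_scaleC)
  show thesis
  proof
    show "X \<in> W" "Y \<in> W" unfolding X_def Y_def using assms by auto
    show "self_adjoint X" using T by (simp add: self_adjoint_def X_def add.commute)
    show "self_adjoint Y" using T adjY by (simp add: self_adjoint_def Y_def)
    show "T = X + \<i> *\<^sub>C Y" "adj T = X - \<i> *\<^sub>C Y"
      using half by (intro blinfun_eqI; simp add: X_def Y_def op_simps scaleC_diff_right scaleC_minus_left
          scaleC_minus_right hi algebra_simps)+
  qed
qed

text \<open>A self-adjoint contraction \<open>T\<close> is the real part of the unitary \<open>T + i (1 - T\<^sup>2)\<^sup>1\<^sup>/\<^sup>2\<close>.\<close>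

lemma commute_unitaries_imp_commute:
  assumes S: "S \<in> bounded_ops" and u: "\<And>u. u \<in> W \<Longrightarrow> unitary u \<Longrightarrow> u o\<^sub>L S o\<^sub>L adj u = S" and T: "T \<in> W"
  shows "T o\<^sub>L S = S o\<^sub>L T"
proof -
  have contraction: "T o\<^sub>L S = S o\<^sub>L T" if T: "T \<in> W" "self_adjoint T" "norm T \<le> 1" for T
  proof -
    have "norm (T x) * norm (T x) \<le> norm x * norm x" for x
    proof -
      have "norm (T x) \<le> norm x"
        using norm_blinfun[of T x] mult_right_mono[OF that(3), of "norm x"] by simp
      then show ?thesis by (intro mult_mono) auto
    qed
    then have "positive_op (id_blinfun - (T o\<^sub>L T))"
      using T(2) by (auto simp: positive_op_iff self_adjoint_intros op_simps inner_simps self_adjointD(3)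
          power2_norm_eq_inner[symmetric] power2_eq_square)
    then obtain h where h: "h \<in> W" "positive_op h" "h o\<^sub>L h = id_blinfun - (T o\<^sub>L T)"
        "in_bicommutant (id_blinfun - (T o\<^sub>L T)) h"
      using sqrt_mem[of "id_blinfun - (T o\<^sub>L T)"] T(1) by blast
    have Th: "T (h v) = h (T v)" for v
    proof -
      have "T o\<^sub>L (id_blinfun - (T o\<^sub>L T)) = (id_blinfun - (T o\<^sub>L T)) o\<^sub>L T"
        by (rule blinfun_eqI) (simp add: op_simps)
      from commute_apply[OF in_bicommutantD[OF h(4) this]] show ?thesis .
    qed
    have hh: "h (h v) = v - T (T v)" for v
      using arg_cong[OF h(3), of "\<lambda>T. blinfun_apply T v"] by (simp add: op_simps)
    define u where "u = T + \<i> *\<^sub>C h"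
    have uW: "u \<in> W" using T h by (auto simp: u_def)
    have sa: "T \<in> bounded_ops" "h \<in> bounded_ops" "adj T = T" "adj h = h"
      using T h positive_opD(1) self_adjointD by blast+
    have au: "adj u = T + (- \<i>) *\<^sub>C h" unfolding u_def using sa by simp
    have ii: "\<i> *\<^sub>C \<i> *\<^sub>C v = - v" for v :: 'h by (simp add: scaleC_scaleC scaleC_minus_left)
    have "unitary u"
      unfolding unitary_def au
      using uW sub by (auto intro!: blinfun_eqI simp: u_def op_simps Th hh scaleC_minus_left scaleC_minus_right
          bounded_opsD[OF sa(1)] bounded_opsD[OF sa(2)] ii scaleC_diff_right)
    then have uS: "u o\<^sub>L S o\<^sub>L adj u = S" and uu: "adj u o\<^sub>L u = id_blinfun" "u o\<^sub>L adj u = id_blinfun" 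
      using u uW by (auto simp: unitary_def)
    have c: "u (S v) = S (u v)" for v
    proof -
      have "u (S (adj u (u v))) = S (u v)" using uS by (metis blinfun_apply_blinfun_compose)
      moreover have "adj u (u v) = v" using uu(1) by (metis blinfun_apply_blinfun_compose blinfun_apply_id_blinfun id_apply)
      ultimately show ?thesis by simp
    qed
    have c': "adj u (S v) = S (adj u v)" for v
    proof -
      have "u (adj u w) = w" for w using uu(2) by (metis blinfun_apply_blinfun_compose blinfun_apply_id_blinfun id_apply)
      then have "adj u (S v) = adj u (S (u (adj u v)))" by simp
      also have "\<dots> = adj u (u (S (adj u v)))" by (simp add: c)
      also have "\<dots> = S (adj u v)" using uu(1) by (metis blinfun_apply_blinfun_compose blinfun_apply_id_blinfun id_apply)
      finally show ?thesis .
    qed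
    have T2: "2 *\<^sub>R T v = u v + adj u v" for v
      unfolding au by (simp add: u_def op_simps scaleC_minus_left scaleR_2)
    have "2 *\<^sub>R T (S v) = S (2 *\<^sub>R T v)" for v
      by (simp only: T2 c c' blinfun.add_right)
    then have "2 *\<^sub>R T (S v) = 2 *\<^sub>R S (T v)" for v
      by (simp only: blinfun.scaleR_right)
    then show ?thesis by (intro commuteI) simp
  qed
  have sa: "T o\<^sub>L S = S o\<^sub>L T" if T: "T \<in> W" "self_adjoint T" for T
  proof -
    define c where "c = norm T + 1"
    have c: "c > 0" "norm T \<le> c" by (simp_all add: c_def add_nonneg_pos)
    have "((1 / c) *\<^sub>R T) o\<^sub>L S = S o\<^sub>L ((1 / c) *\<^sub>R T)"
      by (rule contraction) (use T c in \<open>auto simp: self_adjoint_intros\<close>)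
    from arg_cong[OF this, of "\<lambda>R. c *\<^sub>R blinfun_apply R v" for v]
    have "T (S v) = S (T v)" for v using c by (simp add: op_simps)
    then show ?thesis by (rule commuteI)
  qed
  obtain X Y where XY: "X \<in> W" "Y \<in> W" "self_adjoint X" "self_adjoint Y" "T = X + \<i> *\<^sub>C Y"
    using real_imaginary_parts[OF T] by metis
  show ?thesis
    unfolding XY(5) by (rule commuteI) (simp add: op_simps commute_apply[OF sa[OF XY(1,3)]]
        commute_apply[OF sa[OF XY(2,4)]] bounded_opsD[OF S])
qed

end

section \<open>Abelian algebras and induction over spectral cuts\<close>

locale abelian_vn_algebra = vn_algebra +
  assumes abelian: "abelian W"
begin

lemma commute: "S \<in> W \<Longrightarrow> T \<in> W \<Longrightarrow> S o\<^sub>L T = T o\<^sub>L S"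
  using abelian by (simp add: abelian_def)

lemma commute': "S \<in> W \<Longrightarrow> T \<in> W \<Longrightarrow> blinfun_apply S (T x) = T (S x)"
  using commute commute_apply by blast

text \<open>By repeated bisection of the range of the quadratic form of \<open>S\<close>.\<close>

lemma cut_induct:
  assumes S: "S \<in> W" "self_adjoint S" and eps: "\<epsilon> > 0" and e: "e \<in> W" "projection e"
    and base: "\<And>f. f \<in> W \<Longrightarrow> projection f \<Longrightarrow> e o\<^sub>L f = f \<Longrightarrow> nearly_scalar \<epsilon> S f \<Longrightarrow> \<Phi> f"
    and step: "\<And>f g. f \<in> W \<Longrightarrow> g \<in> W \<Longrightarrow> projection f \<Longrightarrow> projection g \<Longrightarrow> f o\<^sub>L g = 0 \<Longrightarrow> \<Phi> f \<Longrightarrow> \<Phi> g \<Longrightarrow> \<Phi> (f + g)"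
  shows "\<Phi> e"
proof -
  have bisect: "\<Phi> f" if "f \<in> W" "projection f" "e o\<^sub>L f = f"
    "\<And>x. a * (norm (f x))\<^sup>2 \<le> inner (S (f x)) (f x)"
    "\<And>x. inner (S (f x)) (f x) \<le> (a + 2 * \<epsilon> * 2 ^ k) * (norm (f x))\<^sup>2" for f a k
    using that
  proof (induction k arbitrary: f a)
    case 0
    \<comment> \<open>The form of \<open>S\<close> on the range of \<open>f\<close> lies in an
      interval of length \<open>2 * \<epsilon>\<close>, so its centre \<open>a + \<epsilon>\<close>
      is the scalar to compare with.\<close>
    define T where "T = f o\<^sub>L (S - (a + \<epsilon>) *\<^sub>R id_blinfun) o\<^sub>L f"
    have Sf: "S (f x) = f (S x)" for x using commute' S 0 by blast
    have T: "self_adjoint T" unfolding T_def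
      using self_adjoint_intros(8)[of f "S - (a + \<epsilon>) *\<^sub>R id_blinfun"] S 0 projectionD[of f]
      by (simp add: self_adjoint_intros)
    have "norm (S (f x) - (a + \<epsilon>) *\<^sub>R f x) \<le> \<epsilon> * norm (f x)" for x
    proof -
      have "norm (T (f x)) \<le> \<epsilon> * norm (f x)"
      proof (rule self_adjoint_norm_apply[OF T])
        fix y
        have "inner (T y) y = inner (S (f y)) (f y) - (a + \<epsilon>) * (norm (f y))\<^sup>2"
          using self_adjointD(3)[OF projectionD(1)[OF 0(2)]]
          by (simp add: T_def op_simps inner_simps power2_norm_eq_inner)
        then have "\<bar>inner (T y) y\<bar> \<le> \<epsilon> * (norm (f y))\<^sup>2"
          using 0(4)[of y] 0(5)[of y] by (simp add: algebra_simps abs_le_iff)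
        also have "\<dots> \<le> \<epsilon> * (norm y)\<^sup>2"
          using eps projection_norm_le[OF 0(2), of y] by (intro mult_left_mono power_mono) auto
        finally show "\<bar>inner (T y) y\<bar> \<le> \<epsilon> * (norm y)\<^sup>2" .
      qed
      moreover have "T (f x) = S (f x) - (a + \<epsilon>) *\<^sub>R f x"
        using 0(2) by (simp add: T_def op_simps projectionD Sf)
      ultimately show ?thesis by simp
    qed
    then have "nearly_scalar \<epsilon> S f" unfolding nearly_scalar_def by blast
    then show ?case using base 0 by blast
  next
    case (Suc k)
    \<comment> \<open>\<open>m\<close> is the midpoint of the interval of length
      \<open>2 * \<epsilon> * 2 ^ Suc k\<close>; the spectral cut of \<open>S - m\<close> separates
      the lower half from the upper one.\<close>
    define m where "m = a + 2 * \<epsilon> * 2 ^ k"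
    have "S - m *\<^sub>R id_blinfun \<in> W" "self_adjoint (S - m *\<^sub>R id_blinfun)"
      using S by (auto simp: self_adjoint_intros)
    then obtain p where p: "p \<in> W" "projection p"
        "\<And>x. 0 \<le> inner ((S - m *\<^sub>R id_blinfun) (p x)) (p x)" 
        "\<And>x. inner ((S - m *\<^sub>R id_blinfun) (x - p x)) (x - p x) \<le> 0"
      using cut by metis
    have pf: "p (f x) = f (p x)" for x using commute' p Suc by blast
    define q where "q = id_blinfun - p"
    have q: "q \<in> W" "projection q" using p by (auto simp: q_def projection_compl)
    have efx: "e (f x) = f x" for x using Suc.prems(3) by (metis blinfun_apply_blinfun_compose)
    have 1: "\<Phi> (f o\<^sub>L p)"
    proof (rule Suc.IH[of _ m])
      show "f o\<^sub>L p \<in> W" "projection (f o\<^sub>L p)"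
        using Suc.prems(1,2) p projection_mult[OF _ _ commute] by auto
      show "e o\<^sub>L (f o\<^sub>L p) = f o\<^sub>L p" by (rule blinfun_eqI) (simp add: efx)
      show "m * (norm ((f o\<^sub>L p) x))\<^sup>2 \<le> inner (S ((f o\<^sub>L p) x)) ((f o\<^sub>L p) x)" for x
        using p(3)[of "f x"] by (simp add: op_simps inner_simps power2_norm_eq_inner pf)
      show "inner (S ((f o\<^sub>L p) x)) ((f o\<^sub>L p) x) \<le> (m + 2 * \<epsilon> * 2 ^ k) * (norm ((f o\<^sub>L p) x))\<^sup>2" for x
        using Suc.prems(5)[of "p x"] by (simp add: m_def algebra_simps)
    qed
    have 2: "\<Phi> (f o\<^sub>L q)"
    proof (rule Suc.IH[of _ a])
      show "f o\<^sub>L q \<in> W" "projection (f o\<^sub>L q)"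
        using Suc.prems(1,2) q projection_mult[OF _ _ commute] by auto
      show "e o\<^sub>L (f o\<^sub>L q) = f o\<^sub>L q" by (rule blinfun_eqI) (simp add: efx)
      show "a * (norm ((f o\<^sub>L q) x))\<^sup>2 \<le> inner (S ((f o\<^sub>L q) x)) ((f o\<^sub>L q) x)" for x
        using Suc.prems(4)[of "q x"] by simp
      show "inner (S ((f o\<^sub>L q) x)) ((f o\<^sub>L q) x) \<le> (a + 2 * \<epsilon> * 2 ^ k) * (norm ((f o\<^sub>L q) x))\<^sup>2" for x
      proof -
        have w: "f x - p (f x) = (f o\<^sub>L q) x" by (simp add: q_def op_simps pf)
        show ?thesis
          using p(4)[of "f x", unfolded w]
          by (simp add: blinfun.diff_left blinfun.scaleR_left inner_diff_left power2_norm_eq_inner m_def)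
      qed
    qed
    have "(f o\<^sub>L p) o\<^sub>L (f o\<^sub>L q) = 0"
      using Suc p by (intro blinfun_eqI) (simp add: q_def op_simps projectionD pf)
    then have "\<Phi> ((f o\<^sub>L p) + (f o\<^sub>L q))"
      using 1 2 Suc.prems(1,2) p q projection_mult[OF _ _ commute] by (intro step) auto
    moreover have "(f o\<^sub>L p) + (f o\<^sub>L q) = f" by (rule blinfun_eqI) (simp add: q_def op_simps)
    ultimately show ?case by simp
  qed
  \<comment> \<open>The first interval starts at \<open>- norm S\<close>; this \<open>k\<close>
    makes it long enough to reach \<open>norm S\<close>.\<close>
  obtain k where k: "norm S / \<epsilon> < 2 ^ k" using real_arch_pow[of 2 "norm S / \<epsilon>"] by auto
  have k': "2 * norm S \<le> 2 * \<epsilon> * 2 ^ k" using k eps by (simp add: field_simps)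
  have Sb: "\<bar>inner (S y) y\<bar> \<le> norm S * (norm y)\<^sup>2" for y
  proof -
    have "\<bar>inner (S y) y\<bar> \<le> norm (S y) * norm y" by (rule Cauchy_Schwarz_ineq2)
    also have "\<dots> \<le> norm S * norm y * norm y" by (intro mult_right_mono norm_blinfun) auto
    finally show ?thesis by (simp add: power2_eq_square ac_simps)
  qed
  show ?thesis
  proof (rule bisect[of e "- norm S" k])
    fix x
    show "- norm S * (norm (e x))\<^sup>2 \<le> inner (S (e x)) (e x)" using Sb[of "e x"] by simp
    have "inner (S (e x)) (e x) \<le> norm S * (norm (e x))\<^sup>2" using Sb[of "e x"] by simp
    also have "\<dots> \<le> (- norm S + 2 * \<epsilon> * 2 ^ k) * (norm (e x))\<^sup>2"
      using k' by (intro mult_right_mono) auto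
    finally show "inner (S (e x)) (e x) \<le> (- norm S + 2 * \<epsilon> * 2 ^ k) * (norm (e x))\<^sup>2" .
  qed (use e in \<open>auto simp: projectionD\<close>)
qed

text \<open>Plays the role of a simultaneous diagonalisation: a property that adds up over
  orthogonal projections has to be checked only where all \<open>S i\<close> are almost scalar. The
  operators are handled one after the other, each inside projections on which the earlier ones
  already are almost scalar.\<close>

lemma cut_induct_family:
  assumes "finite I" and S: "\<And>i. i \<in> I \<Longrightarrow> S i \<in> W \<and> self_adjoint (S i)" 
    and eps: "\<epsilon> > 0" and e: "e \<in> W" "projection e"
    and base: "\<And>f. f \<in> W \<Longrightarrow> projection f \<Longrightarrow> e o\<^sub>L f = f \<Longrightarrow> (\<And>i. i \<in> I \<Longrightarrow> nearly_scalar \<epsilon> (S i) f) \<Longrightarrow> \<Phi> f"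
    and step: "\<And>f g. f \<in> W \<Longrightarrow> g \<in> W \<Longrightarrow> projection f \<Longrightarrow> projection g \<Longrightarrow> f o\<^sub>L g = 0 \<Longrightarrow> \<Phi> f \<Longrightarrow> \<Phi> g \<Longrightarrow> \<Phi> (f + g)"
  shows "\<Phi> e"
  using assms(1) S e base
proof (induction I arbitrary: e rule: finite_induct)
  case empty
  then show ?case by (simp add: projectionD)
next
  case (insert i I)
  show ?case
  proof (rule cut_induct[of "S i" \<epsilon> e \<Phi>])
    fix f assume f: "f \<in> W" "projection f" "e o\<^sub>L f = f" "nearly_scalar \<epsilon> (S i) f"
    show "\<Phi> f"
    proof (rule insert.IH)
      fix g assume g: "g \<in> W" "projection g" "f o\<^sub>L g = g" "\<And>j. j \<in> I \<Longrightarrow> nearly_scalar \<epsilon> (S j) g"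
      have fg: "f (g x) = g x" for x using g(3) by (metis blinfun_apply_blinfun_compose)
      have "nearly_scalar \<epsilon> (S i) g"
        using f(4) unfolding nearly_scalar_def by (metis fg)
      moreover have "e o\<^sub>L g = g" using f(3) g(3) by (metis blinfun_apply_blinfun_compose blinfun_eqI)
      ultimately show "\<Phi> g" using g insert.prems(4)[of g] by blast
    qed (use f insert.prems in auto)
  qed (use insert.prems eps step in auto)
qed

end

section \<open>Normal states and the trace norm\<close>

context vn_algebra
begin

lemmas mem = zero id add compose scaleC adj scaleR diff

text \<open>Connects the two forms of normality: directed sets with least upper bounds in the
  definitions, increasing sequences with strong limits in the proofs.\<close>

lemma lub_in_sequence:
  assumes "\<And>n. X n \<in> W" "\<And>n. self_adjoint (X n)" "\<And>n. X n \<preceq> X (Suc n)" "\<And>n. X n \<preceq> K *\<^sub>R id_blinfun" "sconv X T"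
  shows "directed_in W (range X)" "lub_in W (range X) T"
proof -
  obtain S where S: "sconv X S" "self_adjoint S" "\<And>n. X n \<preceq> S" "\<And>R. (\<And>n. X n \<preceq> R) \<Longrightarrow> S \<preceq> R"
    "\<And>m n. m \<le> n \<Longrightarrow> X m \<preceq> X n" using monotone_sconv[of X K, OF assms(2-4)] by blast
  have ST: "S = T" using S(1) assms(5) sconv_unique by blast
  have "\<exists>k. X m \<preceq> X k \<and> X n \<preceq> X k" for m n
    using S(5) by (meson max.cobounded1 max.cobounded2)
  then show "directed_in W (range X)" using assms by (auto simp: directed_in_def)
  show "lub_in W (range X) T" using S sconv_mem[OF assms(1,5)] by (auto simp: lub_in_def ST)
qed

text \<open>Normality is only required along sequences.\<close>

definition normal_state :: "('h op \<Rightarrow> real) \<Rightarrow> bool" where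
  "normal_state \<phi> \<longleftrightarrow>
    (\<forall>S\<in>W. \<forall>T\<in>W. \<phi> (S + T) = \<phi> S + \<phi> T) \<and> (\<forall>r. \<forall>T\<in>W. \<phi> (r *\<^sub>R T) = r * \<phi> T) \<and>
    (\<forall>T\<in>W. positive_op T \<longrightarrow> 0 \<le> \<phi> T) \<and> \<phi> id_blinfun = 1 \<and>
    (\<forall>X T K. (\<forall>n. X n \<in> W \<and> self_adjoint (X n) \<and> X n \<preceq> X (Suc n) \<and> X n \<preceq> K *\<^sub>R id_blinfun) \<longrightarrow>
      sconv X T \<longrightarrow> (\<lambda>n. \<phi> (X n)) \<longlonglongrightarrow> \<phi> T)"

lemma normal_stateI:
  assumes "\<And>S T. S \<in> W \<Longrightarrow> T \<in> W \<Longrightarrow> \<phi> (S + T) = \<phi> S + \<phi> T"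
    and "\<And>r T. T \<in> W \<Longrightarrow> \<phi> (r *\<^sub>R T) = r * \<phi> T"
    and pos: "\<And>T. T \<in> W \<Longrightarrow> positive_op T \<Longrightarrow> 0 \<le> \<phi> T" and "\<phi> id_blinfun = 1"
    and sup: "\<And>X T. directed_in W (range X) \<Longrightarrow> lub_in W (range X) T \<Longrightarrow> (\<And>n :: nat. X n \<preceq> X (Suc n)) \<Longrightarrow>
      (\<And>n. X n \<in> W) \<Longrightarrow> sconv X T \<Longrightarrow> \<phi> T = (SUP n. \<phi> (X n))"
  shows "normal_state \<phi>"
  unfolding normal_state_def
proof (intro conjI allI impI)
  fix X :: "nat \<Rightarrow> 'h op" and T K
  assume X: "\<forall>n. X n \<in> W \<and> self_adjoint (X n) \<and> X n \<preceq> X (Suc n) \<and> X n \<preceq> K *\<^sub>R id_blinfun" and T: "sconv X T"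
  have diff: "\<phi> (S - R) = \<phi> S - \<phi> R" if "S \<in> W" "R \<in> W" for S R
    using assms(1)[OF that(1) scaleR[OF that(2)], of "-1"] assms(2)[OF that(2), of "-1"] by simp
  have mono: "\<phi> R \<le> \<phi> S" if "S \<in> W" "R \<in> W" "R \<preceq> S" for S R
    using pos[of "S - R"] that diff by (auto simp: op_le_def)
  have l: "directed_in W (range X)" "lub_in W (range X) T"
    using lub_in_sequence[of X K T] X T by auto
  have le: "X n \<preceq> T" "T \<in> W" for n using l(2) by (auto simp: lub_in_def)
  have "incseq (\<lambda>n. \<phi> (X n))" using X mono by (intro incseq_SucI) auto
  moreover have "bdd_above (range (\<lambda>n. \<phi> (X n)))"
    using X mono le by (intro bdd_aboveI[of _ "\<phi> T"]) auto
  ultimately have "(\<lambda>n. \<phi> (X n)) \<longlonglongrightarrow> (SUP n. \<phi> (X n))" by (intro LIMSEQ_incseq_SUP)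
  then show "(\<lambda>n. \<phi> (X n)) \<longlonglongrightarrow> \<phi> T" using sup[OF l _ _ T] X by simp
qed (use assms in auto)

lemma normal_state_linear:
  assumes "normal_state \<phi>"
  shows "S \<in> W \<Longrightarrow> T \<in> W \<Longrightarrow> \<phi> (S + T) = \<phi> S + \<phi> T" "T \<in> W \<Longrightarrow> \<phi> (r *\<^sub>R T) = r * \<phi> T"
    "S \<in> W \<Longrightarrow> T \<in> W \<Longrightarrow> \<phi> (S - T) = \<phi> S - \<phi> T" "\<phi> 0 = 0" "\<phi> id_blinfun = 1"
    "(\<And>i. i \<in> I \<Longrightarrow> f i \<in> W) \<Longrightarrow> \<phi> (\<Sum>i\<in>I. f i) = (\<Sum>i\<in>I. \<phi> (f i))"
    "T \<in> W \<Longrightarrow> \<phi> (- T) = - \<phi> T"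
proof -
  show a: "\<phi> (S + T) = \<phi> S + \<phi> T" if "S \<in> W" "T \<in> W" for S T using assms that by (simp add: normal_state_def)
  show s: "\<phi> (r *\<^sub>R T) = r * \<phi> T" if "T \<in> W" for r T using assms that by (simp add: normal_state_def)
  show "\<phi> (S - T) = \<phi> S - \<phi> T" if "S \<in> W" "T \<in> W"
    using a[OF that(1) scaleR[OF that(2)], of "-1"] s[OF that(2), of "-1"] by simp
  show z: "\<phi> 0 = 0" using s[of 0 0] by simp
  show "\<phi> id_blinfun = 1" using assms by (simp add: normal_state_def)
  show "\<phi> (- T) = - \<phi> T" if "T \<in> W" using s[OF that, of "-1"] by simp
  show "\<phi> (\<Sum>i\<in>I. f i) = (\<Sum>i\<in>I. \<phi> (f i))" if "\<And>i. i \<in> I \<Longrightarrow> f i \<in> W"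
    using that by (induction I rule: infinite_finite_induct) (auto simp: z a sum)
qed

lemma normal_state_pos: "normal_state \<phi> \<Longrightarrow> T \<in> W \<Longrightarrow> positive_op T \<Longrightarrow> 0 \<le> \<phi> T"
  by (simp add: normal_state_def)

lemma normal_state_mono: "normal_state \<phi> \<Longrightarrow> S \<in> W \<Longrightarrow> T \<in> W \<Longrightarrow> S \<preceq> T \<Longrightarrow> \<phi> S \<le> \<phi> T"
  using normal_state_pos[of \<phi> "T - S"] normal_state_linear(3)[of \<phi> T S] diff by (auto simp: op_le_def)

lemma normal_state_sconv:
  assumes "normal_state \<phi>" "\<And>n. X n \<in> W" "\<And>n. self_adjoint (X n)" "\<And>n. X n \<preceq> X (Suc n)"
    "\<And>n. X n \<preceq> K *\<^sub>R id_blinfun" "sconv X T"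
  shows "(\<lambda>n. \<phi> (X n)) \<longlonglongrightarrow> \<phi> T"
proof -
  have *: "\<forall>X T K. (\<forall>n. X n \<in> W \<and> self_adjoint (X n) \<and> X n \<preceq> X (Suc n) \<and> X n \<preceq> K *\<^sub>R id_blinfun) \<longrightarrow>
      sconv X T \<longrightarrow> (\<lambda>n. \<phi> (X n)) \<longlonglongrightarrow> \<phi> T"
    using assms(1) unfolding normal_state_def by (elim conjE)
  show ?thesis
    by (rule spec[OF spec[OF spec[OF *, of X], of T], of K, THEN mp, THEN mp]) (simp_all add: assms)
qed

text \<open>The variance \<open>\<phi> ((S - c)\<^sup>2)\<close> with \<open>c = \<phi> S\<close> is
  nonnegative. Through this inequality, convergence of the squared errors gives convergence of the
  state.\<close>

lemma normal_state_square:
  assumes p: "normal_state \<phi>" and S: "S \<in> W" "self_adjoint S"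
  shows "(\<phi> S)\<^sup>2 \<le> \<phi> (S o\<^sub>L S)"
proof -
  define c where "c = \<phi> S"
  have "0 \<le> \<phi> ((S - c *\<^sub>R id_blinfun) o\<^sub>L (S - c *\<^sub>R id_blinfun))"
    using S by (intro normal_state_pos[OF p] positive_op_sandwich) (auto intro: mem self_adjoint_intros)
  also have "(S - c *\<^sub>R id_blinfun) o\<^sub>L (S - c *\<^sub>R id_blinfun) = (S o\<^sub>L S) - (2 * c) *\<^sub>R S + (c * c) *\<^sub>R id_blinfun"
    by (rule blinfun_eqI) (simp add: op_simps algebra_simps flip: scaleR_2)
  also have "\<phi> \<dots> = \<phi> (S o\<^sub>L S) - c\<^sup>2"
    using S by (simp add: normal_state_linear[OF p] mem c_def power2_eq_square)
  finally show ?thesis by (simp add: c_def)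
qed

lemma normal_state_decreasing:
  assumes p: "normal_state \<phi>" and g: "\<And>n. g n \<in> W" "\<And>n. positive_op (g n)" "\<And>n. g (Suc n) \<preceq> g n" "sconv g 0"
  shows "(\<lambda>n. \<phi> (g n)) \<longlonglongrightarrow> 0"
proof -
  have "(\<lambda>n. \<phi> (0 - g n)) \<longlonglongrightarrow> \<phi> (0 - 0)"
  proof (rule normal_state_sconv[OF p, where K = 0])
    show "sconv (\<lambda>n. 0 - g n) (0 - 0)" by (intro sconv_diff g sconv_const)
    show "0 - g n \<preceq> 0 - g (Suc n)" for n using g(3)[of n] by (simp add: op_le_def)
    show "0 - g n \<preceq> 0 *\<^sub>R id_blinfun" for n using g(2) by (simp add: op_le_def)
    show "self_adjoint (0 - g n)" for n using g(2)[of n] by (intro self_adjoint_intros) (auto simp: positive_opD)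
  qed (auto intro: g mem)
  then have "(\<lambda>n. - \<phi> (g n)) \<longlonglongrightarrow> - 0"
    using g(1) by (simp add: normal_state_linear[OF p])
  then show ?thesis using tendsto_minus_cancel by fastforce
qed

text \<open>Every normal state is continuous along sequences that converge in this sense.\<close>

definition order_conv :: "(nat \<Rightarrow> 'h op) \<Rightarrow> 'h op \<Rightarrow> bool" where
  "order_conv X T \<longleftrightarrow> (\<exists>g C. (\<forall>n. g n \<in> W \<and> positive_op (g n) \<and> g (Suc n) \<preceq> g n) \<and> sconv g 0 \<and> 0 \<le> C \<and>
    (\<forall>n. (adj (T - X n) o\<^sub>L (T - X n)) \<preceq> C *\<^sub>R g n))"

lemma order_conv_square:
  assumes p: "normal_state \<phi>" and "\<And>n. X n \<in> W" "T \<in> W" "order_conv X T"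
  shows "(\<lambda>n. \<phi> (adj (T - X n) o\<^sub>L (T - X n))) \<longlonglongrightarrow> 0"
proof -
  obtain g C where g: "\<And>n. g n \<in> W" "\<And>n. positive_op (g n)" "\<And>n. g (Suc n) \<preceq> g n" "sconv g 0" "0 \<le> C"
    "\<And>n. (adj (T - X n) o\<^sub>L (T - X n)) \<preceq> C *\<^sub>R g n"
    using assms(4) by (auto simp: order_conv_def)
  have m: "T - X n \<in> W" for n using assms by auto
  show ?thesis
  proof (rule tendsto_sandwich[OF _ _ tendsto_const])
    show "(\<lambda>n. C * \<phi> (g n)) \<longlonglongrightarrow> 0"
      using normal_state_decreasing[OF p g(1-4)] tendsto_mult_right_zero by blast
    show "\<forall>\<^sub>F n in sequentially. \<phi> (adj (T - X n) o\<^sub>L (T - X n)) \<le> C * \<phi> (g n)"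
      using normal_state_mono[OF p _ _ g(6)] g(1) m normal_state_linear(2)[OF p g(1)]
      by (intro always_eventually allI) (metis adj compose scaleR)
    show "\<forall>\<^sub>F n in sequentially. 0 \<le> \<phi> (adj (T - X n) o\<^sub>L (T - X n))"
      using m sub by (intro always_eventually allI normal_state_pos[OF p] positive_op_intros) auto
  qed
qed

lemma order_conv_state:
  assumes p: "normal_state \<phi>" and X: "\<And>n. X n \<in> W" "\<And>n. self_adjoint (X n)" "T \<in> W" "self_adjoint T" "order_conv X T"
  shows "(\<lambda>n. \<phi> (X n)) \<longlonglongrightarrow> \<phi> T"
proof -
  have "(\<lambda>n. (\<phi> (T - X n))\<^sup>2) \<longlonglongrightarrow> 0"
  proof (rule tendsto_sandwich[OF _ _ tendsto_const order_conv_square[OF p X(1,3,5)]])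
    have s: "self_adjoint (T - X n)" for n using X by (simp add: self_adjoint_intros)
    show "\<forall>\<^sub>F n in sequentially. (\<phi> (T - X n))\<^sup>2 \<le> \<phi> (adj (T - X n) o\<^sub>L (T - X n))"
      using normal_state_square[OF p _ s] X by (intro always_eventually allI) (simp only: self_adjointD(2)[OF s] diff)
  qed auto
  then have "(\<lambda>n. \<phi> T - \<phi> (X n)) \<longlonglongrightarrow> 0"
    using X by (simp add: normal_state_linear[OF p])
  from tendsto_diff[OF tendsto_const this, of "\<phi> T"] show ?thesis by simp
qed

end

section \<open>The trace and its norm\<close>

locale finite_vn_algebra = vn_algebra M for M :: "'h::complex_hilbert_space op set" +
  fixes \<tau> :: "'h op \<Rightarrow> complex"
  assumes trace: "faithful_normal_tracial_state M \<tau>"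
begin

definition tr :: "'h op \<Rightarrow> real" where
  "tr T = Re (\<tau> T)"

lemma tau_add: "S \<in> M \<Longrightarrow> T \<in> M \<Longrightarrow> \<tau> (S + T) = \<tau> S + \<tau> T"
  and tau_scaleC: "T \<in> M \<Longrightarrow> \<tau> (c *\<^sub>C T) = c * \<tau> T"
  and tau_id: "\<tau> id_blinfun = 1"
  using trace by (auto simp: faithful_normal_tracial_state_def complex_linear_on_def scaleC_complex_def)

lemma tau_commute: "S \<in> M \<Longrightarrow> T \<in> M \<Longrightarrow> \<tau> (S o\<^sub>L T) = \<tau> (T o\<^sub>L S)"
  using trace by (auto simp: faithful_normal_tracial_state_def)

lemma tr_commute: "S \<in> M \<Longrightarrow> T \<in> M \<Longrightarrow> tr (S o\<^sub>L T) = tr (T o\<^sub>L S)"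
  using tau_commute by (auto simp: tr_def)

lemma tau_positive: "T \<in> M \<Longrightarrow> positive_op T \<Longrightarrow> \<tau> T = complex_of_real (tr T)"
  and tr_nonneg: "T \<in> M \<Longrightarrow> positive_op T \<Longrightarrow> 0 \<le> tr T"
  using trace by (auto simp: faithful_normal_tracial_state_def complex_nonneg_Reals_iff tr_def complex_eq_iff)

lemma scaleR_scaleC: "r *\<^sub>R (T :: 'h op) = complex_of_real r *\<^sub>C T"
  by (rule blinfun_eqI) (simp add: op_simps scaleC_of_real)

lemma normal_state_tr: "normal_state tr"
proof (rule normal_stateI)
  show "tr (S + T) = tr S + tr T" if "S \<in> M" "T \<in> M" for S T using tau_add that by (simp add: tr_def)
  show "tr (r *\<^sub>R T) = r * tr T" if "T \<in> M" for r T
    using tau_scaleC[OF that] by (simp add: tr_def scaleR_scaleC)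
  show "tr id_blinfun = 1" by (simp add: tr_def tau_id)
  fix X T assume "directed_in M (range X)" "lub_in M (range X) T"
  then have "Re (\<tau> T) = (SUP S\<in>range X. Re (\<tau> S))"
    using trace unfolding faithful_normal_tracial_state_def by blast
  then show "tr T = (SUP n. tr (X n))" by (simp add: tr_def image_image)
qed (rule tr_nonneg)

lemmas tr_linear = normal_state_linear[OF normal_state_tr]
lemmas tr_mono = normal_state_mono[OF normal_state_tr]

text \<open>Faithfulness is assumed for elements \<open>adj T o\<^sub>L T\<close>; the square root
  brings a positive element into this form.\<close>

lemma tr_faithful:
  assumes "T \<in> M" "positive_op T" "tr T = 0"
  shows "T = 0"
proof -
  obtain h where h: "h \<in> M" "positive_op h" "h o\<^sub>L h = T" using sqrt_mem assms by metis
  have "\<tau> (adj h o\<^sub>L h) = 0"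
    using h tau_positive[OF assms(1,2)] assms(3) by (simp add: positive_opD self_adjointD(2))
  then have "h = 0" using trace h(1) unfolding faithful_normal_tracial_state_def by blast
  then show ?thesis using h(3) by auto
qed

text \<open>The square of the Hilbert space norm that the trace induces. With squares the
  parallelogram law is an identity between values of \<open>q2\<close>, and \<open>q2_add_le\<close>
  serves as triangle inequality.\<close>

definition q2 :: "'h op \<Rightarrow> real" where
  "q2 T = tr (adj T o\<^sub>L T)"

lemma q2_nonneg: "T \<in> M \<Longrightarrow> 0 \<le> q2 T"
  unfolding q2_def using sub by (intro tr_nonneg positive_op_intros) auto

lemma q2_zero_imp: "T \<in> M \<Longrightarrow> q2 T = 0 \<Longrightarrow> T = 0"
  using trace tau_positive[of "adj T o\<^sub>L T"] sub unfolding q2_def faithful_normal_tracial_state_def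
  by (auto simp: positive_op_intros compose adj)

lemma q2_expand:
  assumes "S \<in> M" "T \<in> M"
  shows "q2 (S + r *\<^sub>R T) = q2 S + r * tr (adj S o\<^sub>L T) + r * tr (adj T o\<^sub>L S) + r\<^sup>2 * q2 T"
proof -
  have "adj (S + r *\<^sub>R T) o\<^sub>L (S + r *\<^sub>R T)
      = (adj S o\<^sub>L S) + r *\<^sub>R (adj S o\<^sub>L T) + r *\<^sub>R (adj T o\<^sub>L S) + r\<^sup>2 *\<^sub>R (adj T o\<^sub>L T)"
    using assms sub by (intro blinfun_eqI) (simp add: op_simps power2_eq_square algebra_simps)
  then show ?thesis unfolding q2_def using assms by (simp add: tr_linear mem)
qed

lemma q2_scaleR: "T \<in> M \<Longrightarrow> q2 (r *\<^sub>R T) = r\<^sup>2 * q2 T"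
  using q2_expand[of 0 T r] by (simp add: q2_def tr_linear sub)

lemma q2_parallelogram:
  assumes "S \<in> M" "T \<in> M"
  shows "q2 (S - T) = 2 * q2 S + 2 * q2 T - 4 * q2 ((1/2) *\<^sub>R (S + T))"
  using q2_expand[OF assms, of "-1"] q2_expand[OF assms, of 1] q2_scaleR[of "S + T" "1/2"] assms
  by (simp add: mem power2_eq_square)

lemma q2_add_le: "S \<in> M \<Longrightarrow> T \<in> M \<Longrightarrow> q2 (S + T) \<le> 2 * q2 S + 2 * q2 T"
  using q2_expand[of S T "-1"] q2_expand[of S T 1] q2_nonneg[of "S - T"] mem by (simp add: power2_eq_square)

lemma q2_diff_commute: "S \<in> M \<Longrightarrow> T \<in> M \<Longrightarrow> q2 (S - T) = q2 (T - S)"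
  using q2_scaleR[of "S - T" "-1"] mem by simp

lemma q2_unitary:
  assumes "T \<in> M" "u \<in> M" "unitary u"
  shows "q2 (u o\<^sub>L T o\<^sub>L adj u) = q2 T"
proof -
  have u: "adj u (u x) = x" for x
    using assms(3) unfolding unitary_def by (metis blinfun_apply_blinfun_compose blinfun_apply_id_blinfun id_apply)
  have "adj (u o\<^sub>L T o\<^sub>L adj u) o\<^sub>L (u o\<^sub>L T o\<^sub>L adj u) = u o\<^sub>L ((adj T o\<^sub>L T) o\<^sub>L adj u)"
    using assms sub by (intro blinfun_eqI) (simp add: u)
  then have "q2 (u o\<^sub>L T o\<^sub>L adj u) = tr (((adj T o\<^sub>L T) o\<^sub>L adj u) o\<^sub>L u)"
    unfolding q2_def using assms by (simp add: tr_commute mem)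
  also have "((adj T o\<^sub>L T) o\<^sub>L adj u) o\<^sub>L u = adj T o\<^sub>L T" by (rule blinfun_eqI) (simp add: u)
  finally show ?thesis by (simp add: q2_def)
qed

text \<open>The weighted square sums \<open>\<Sum>\<^sub>k 2\<^sup>k\<^sup>+\<^sup>1 |Y\<^sub>k\<^sub>+\<^sub>1 - Y\<^sub>k|\<^sup>2\<close> may be unbounded operators; applying \<open>damp\<close>
  keeps them in the unit ball without losing monotonicity.\<close>

lemma fast_Cauchy_order_conv:
  assumes Y: "\<And>n. Y n \<in> M" "\<And>n. norm (Y n) \<le> K" and fast: "\<And>n. q2 (Y (Suc n) - Y n) \<le> (1/8) ^ n"
  obtains T where "T \<in> M" "norm T \<le> K" "sconv Y T" "order_conv Y T"
proof -
  define y where "y k = Y (Suc k) - Y k" for k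
  have yM: "y k \<in> M" for k using Y by (auto simp: y_def)
  define s where "s n m = (\<Sum>k=n..<m. 2 ^ Suc k *\<^sub>R (adj (y k) o\<^sub>L y k))" for n m
  have sM: "s n m \<in> M" for n m unfolding s_def using yM by (intro sum scaleR compose adj)
  have term_pos: "positive_op (2 ^ Suc k *\<^sub>R (adj (y k) o\<^sub>L y k))" for k
    using yM sub by (intro positive_op_intros) auto
  have spos: "positive_op (s n m)" for n m unfolding s_def by (intro positive_op_sum term_pos)
  have sinc: "s n m \<preceq> s n (Suc m)" for n m
  proof (cases "n \<le> m")
    case True
    then have "s n (Suc m) - s n m = 2 ^ Suc m *\<^sub>R (adj (y m) o\<^sub>L y m)" by (simp add: s_def)
    then show ?thesis using term_pos[of m] by (simp only: op_le_def)
  qed (simp add: s_def op_le_refl)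
  have sdec: "s (Suc n) m \<preceq> s n m" for n m
  proof (cases "n < m")
    case True
    then have "s n m - s (Suc n) m = 2 ^ Suc n *\<^sub>R (adj (y n) o\<^sub>L y n)"
      by (simp add: s_def sum.atLeast_Suc_lessThan)
    then show ?thesis using term_pos[of n] by (simp only: op_le_def)
  qed (simp add: s_def op_le_refl)
  \<comment> \<open>The rate \<open>(1/8) ^ k\<close> beats the weights \<open>2 ^ Suc k\<close> and
    leaves a geometric series of ratio 1/4, so the tails have small trace although they may be large
    in norm.\<close>
  have trs: "tr (s n m) \<le> 4 * (1/4) ^ n" for n m
  proof -
    have geo: "(\<Sum>k=n..<m. 2 * (1/4::real) ^ k) \<le> 4 * (1/4) ^ n"
    proof (cases "n \<le> m")
      case True
      then have "(\<Sum>k=n..<m. 2 * (1/4::real) ^ k) = (8/3) * ((1/4) ^ n - (1/4) ^ m)"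
      proof (induction rule: dec_induct)
        case (step k)
        have "8 / 3 * (a - b) + 2 * b = 8 / 3 * (a - b / 4)" for a b :: real by (simp add: diff_divide_distrib)
        moreover have "(1/4::real) ^ Suc k = (1/4) ^ k / 4" by simp
        ultimately show ?case using step by (simp only: sum.atLeastLessThan_Suc)
      qed simp
      also have "\<dots> \<le> 4 * (1/4) ^ n" by (simp add: algebra_simps)
      finally show ?thesis .
    qed simp
    have "tr (s n m) = (\<Sum>k=n..<m. 2 ^ Suc k * q2 (y k))"
      unfolding s_def q2_def using yM
      by (subst tr_linear(6)) (auto intro!: mem sum.cong simp: tr_linear mem)
    also have "\<dots> \<le> (\<Sum>k=n..<m. 2 ^ Suc k * (1/8) ^ k)"
      using fast by (intro sum_mono mult_left_mono) (auto simp: y_def)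
    also have "\<dots> = (\<Sum>k=n..<m. 2 * (1/4) ^ k)"
      by (intro sum.cong refl) (simp add: power_mult_distrib[symmetric])
    finally show ?thesis using geo by linarith
  qed
  define D where "D n m = damp (s n m)" for n m
  have D: "D n m \<in> M" "positive_op (D n m)" "D n m \<preceq> id_blinfun" "D n m \<preceq> D n (Suc m)" "D (Suc n) m \<preceq> D n m"
      "D n m \<preceq> s n m" for n m
    unfolding D_def
    by (rule damp_mem[OF sM spos] damp_props[OF spos] damp_mono[OF spos spos sinc] damp_mono[OF spos spos sdec])+
  have "\<exists>g. sconv (D n) g \<and> (\<forall>m. D n m \<preceq> g)" for n
  proof (rule monotone_sconv[of "D n" 1])
    show "self_adjoint (D n m)" for m using D(2) positive_opD(1) by blast
    show "D n m \<preceq> 1 *\<^sub>R id_blinfun" for m using D(3) by simp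
  qed (use D(4) in blast)+
  then obtain g where g: "\<And>n. sconv (D n) (g n)" "\<And>n m. D n m \<preceq> g n" by metis
  have gM: "g n \<in> M" for n using sconv_mem g(1) D(1) by blast
  have gpos: "positive_op (g n)" for n
    using D(2)[of n 0] g(2)[of n 0] op_le_trans[of 0 "D n 0" "g n"] by (simp add: op_le_def)
  have gle: "g n \<preceq> id_blinfun" for n using sconv_op_le[OF g(1) sconv_const] D(3) by blast
  have gdec: "g (Suc n) \<preceq> g n" for n using sconv_op_le[OF g(1) g(1)] D(5) by blast
  have trg: "tr (g n) \<le> 4 * (1/4) ^ n" for n
  proof (rule LIMSEQ_le_const2)
    show "(\<lambda>m. tr (D n m)) \<longlonglongrightarrow> tr (g n)"
      by (rule normal_state_sconv[OF normal_state_tr, where K = 1]) (use D positive_opD(1)[OF D(2)] g(1) in auto)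
    show "\<exists>N. \<forall>m\<ge>N. tr (D n m) \<le> 4 * (1/4) ^ n"
      using tr_mono[OF D(1) sM D(6)] trs order_trans by blast
  qed
  \<comment> \<open>A decreasing sequence of positive operators has a strong limit; here its trace
    is at most \<open>4 * (1/4) ^ n\<close> for every \<open>n\<close>, so faithfulness makes it
    0.\<close>
  have g0: "sconv g 0"
  proof -
    have "\<exists>G. sconv (\<lambda>n. id_blinfun - g n) G \<and> (\<forall>n. id_blinfun - g n \<preceq> G) \<and> (\<forall>S. (\<forall>n. id_blinfun - g n \<preceq> S) \<longrightarrow> G \<preceq> S)"
      by (rule monotone_sconv[of "\<lambda>n. id_blinfun - g n" 1])
        (use gpos gdec positive_opD(1)[OF gpos] in \<open>auto simp: op_le_def self_adjoint_intros\<close>)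
    then obtain G where G: "sconv (\<lambda>n. id_blinfun - g n) G" "\<And>n. id_blinfun - g n \<preceq> G"
      "\<And>S. (\<And>n. id_blinfun - g n \<preceq> S) \<Longrightarrow> G \<preceq> S" by blast
    define L where "L = id_blinfun - G"
    have L: "sconv g L" using sconv_diff[OF sconv_const[of id_blinfun] G(1)] by (simp add: L_def)
    have LM: "L \<in> M" using sconv_mem[OF gM L] .
    have "G \<preceq> id_blinfun" by (rule G(3)) (use gpos in \<open>simp add: op_le_def\<close>)
    then have Lpos: "positive_op L" by (simp add: L_def op_le_def)
    have "L \<preceq> g n" for n using G(2)[of n] by (simp add: L_def op_le_def algebra_simps)
    then have le: "tr L \<le> 4 * (1/4) ^ n" for n using tr_mono[OF LM gM] trg order_trans by blast
    have "(\<lambda>n. 4 * (1/4::real) ^ n) \<longlonglongrightarrow> 4 * 0" by (intro tendsto_intros LIMSEQ_power_zero) auto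
    then have "tr L \<le> 0" using le by (intro LIMSEQ_le_const[of "\<lambda>n. 4 * (1/4::real) ^ n"]) auto
    then have "L = 0" using tr_faithful[OF LM Lpos] tr_nonneg[OF LM Lpos] by simp
    then show ?thesis using L by simp
  qed
  \<comment> \<open>The constant of \<open>damp_lower\<close> for the bound
    \<open>(2 * K)\<^sup>2\<close> on the square \<open>a\<close> of
    \<open>Y m - Y n\<close>.\<close>
  define C where "C = 1 + (2 * K)\<^sup>2"
  have C: "0 \<le> C" by (simp add: C_def)
  \<comment> \<open>Splitting off one increment at a time doubles the remainder, which is the origin
    of the weights \<open>2 ^ Suc k\<close> and gives \<open>2 ^ n * a \<le> s n m\<close>. Then
    \<open>a \<le> C * damp a \<le> C * damp (s n m) \<le> C * g n\<close>.\<close>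
  have est: "(norm ((Y m - Y n) x))\<^sup>2 \<le> C * inner (g n x) x" if "n \<le> m" for n m x
  proof -
    define a where "a = adj (Y m - Y n) o\<^sub>L (Y m - Y n)"
    have M: "Y m - Y n \<in> bounded_ops" "a \<in> M" using Y sub by (auto simp: a_def mem)
    have apos: "positive_op a" unfolding a_def using M by (intro positive_op_intros)
    have qa: "inner (a x) x = (norm ((Y m - Y n) x))\<^sup>2" for x
      unfolding a_def using M(1) by (rule norm_op_square)
    have "2 ^ n * inner (a x) x \<le> inner (s n m x) x" for x
    proof -
      have "2 ^ n * (norm ((Y m - Y n) x))\<^sup>2 \<le> (\<Sum>k=n..<m. 2 ^ Suc k * (norm (y k x))\<^sup>2)"
        using that
      proof (induction rule: inc_induct)
        case base
        then show ?case by (simp add: op_simps)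
      next
        case (step n)
        have par: "(norm (u + v))\<^sup>2 \<le> 2 * (norm u)\<^sup>2 + 2 * (norm v)\<^sup>2" for u v :: 'h
        proof -
          have "0 \<le> (norm (u - v))\<^sup>2" by simp
          then show ?thesis by (simp add: power2_norm_eq_inner inner_simps inner_commute)
        qed
        have "(Y m - Y n) x = y n x + (Y m - Y (Suc n)) x" by (simp add: y_def op_simps)
        then have "2 ^ n * (norm ((Y m - Y n) x))\<^sup>2
            \<le> 2 ^ n * (2 * (norm (y n x))\<^sup>2 + 2 * (norm ((Y m - Y (Suc n)) x))\<^sup>2)"
          using par by (intro mult_left_mono) auto
        also have "\<dots> = 2 ^ Suc n * (norm (y n x))\<^sup>2 + 2 ^ Suc n * (norm ((Y m - Y (Suc n)) x))\<^sup>2"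
          by (simp add: algebra_simps)
        also have "\<dots> \<le> (\<Sum>k=n..<m. 2 ^ Suc k * (norm (y k x))\<^sup>2)"
          using step by (subst sum.atLeast_Suc_lessThan) auto
        finally show ?case .
      qed
      also have "\<dots> = inner (s n m x) x"
        unfolding s_def using norm_op_square[OF sub[OF yM]]
        by (simp add: op_simps inner_sum_left del: blinfun_apply_blinfun_compose)
      finally show ?thesis by (simp add: qa)
    qed
    moreover have "inner (a x) x \<le> 2 ^ n * inner (a x) x" for x
      using mult_right_mono[of 1 "2 ^ n" "inner (a x) x"] positive_opD(2)[OF apos] by simp
    ultimately have "a \<preceq> s n m" 
      using apos spos by (subst op_le_iff) (auto intro: order_trans positive_opD(1))
    then have 1: "damp a \<preceq> g n" using damp_mono[OF apos spos] g(2)[of n m] op_le_trans unfolding D_def by blast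
    have "a \<preceq> (2 * K)\<^sup>2 *\<^sub>R id_blinfun"
    proof -
      have "norm (Y m - Y n) \<le> 2 * K" using norm_triangle_ineq4[of "Y m" "Y n"] Y(2)[of m] Y(2)[of n] by linarith
      then have "norm ((Y m - Y n) x) \<le> 2 * K * norm x" for x
        using norm_blinfun[of "Y m - Y n" x] mult_right_mono[of "norm (Y m - Y n)" "2 * K" "norm x"] by simp
      then have "(norm ((Y m - Y n) x))\<^sup>2 \<le> (2 * K)\<^sup>2 * inner x x" for x
        using power_mono[of "norm ((Y m - Y n) x)" "2 * K * norm x" 2]
        by (simp add: power_mult_distrib power2_norm_eq_inner)
      then show ?thesis using apos by (subst op_le_iff) (auto simp: qa positive_opD self_adjoint_intros op_simps)
    qed
    then have 2: "a \<preceq> C *\<^sub>R damp a" unfolding C_def by (rule damp_lower[OF apos])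
    have "inner (a x) x \<le> C * inner (damp a x) x"
      using 2 op_le_iff[of a "C *\<^sub>R damp a"] apos damp_props(1)[OF apos]
      by (simp add: positive_opD self_adjoint_intros op_simps)
    also have "\<dots> \<le> C * inner (g n x) x"
      using 1 op_le_iff[of "damp a" "g n"] damp_props(1)[OF apos] gpos C
      by (intro mult_left_mono) (auto simp: positive_opD)
    finally show ?thesis by (simp add: qa)
  qed
  have glim: "(\<lambda>n. C * inner (g n x) x) \<longlonglongrightarrow> 0" for x
  proof -
    have "(\<lambda>n. C * inner (g n x) x) \<longlonglongrightarrow> C * inner (blinfun_apply 0 x) x" by (intro tendsto_intros sconvD g0)
    then show ?thesis by simp
  qed
  have "Cauchy (\<lambda>n. Y n x)" for x
  proof (rule CauchyI)
    fix e :: real assume e: "0 < e"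
    obtain N where "C * inner (g N x) x < (e/2)\<^sup>2"
      using order_tendstoD(2)[OF glim, of "(e/2)\<^sup>2" x] e by (auto simp: eventually_sequentially)
    then have "(norm ((Y m - Y N) x))\<^sup>2 < (e/2)\<^sup>2" if "m \<ge> N" for m using est[OF that, of x] by linarith
    then have *: "norm (Y m x - Y N x) < e/2" if "m \<ge> N" for m
      using that e power_less_imp_less_base[of "norm ((Y m - Y N) x)" 2 "e/2"] by (simp add: op_simps)
    have "norm (Y m x - Y n x) < e" if "m \<ge> N" "n \<ge> N" for m n
      using *[OF that(1)] *[OF that(2)] norm_triangle_ineq4[of "Y m x - Y N x" "Y n x - Y N x"] by simp
    then show "\<exists>M. \<forall>m\<ge>M. \<forall>n\<ge>M. norm (Y m x - Y n x) < e" by blast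
  qed
  then obtain T where T: "sconv Y T" "norm T \<le> K" using sconv_exists Y(2) by blast
  have TM: "T \<in> M" using sconv_mem Y(1) T(1) by blast
  have fin: "(norm ((T - Y n) x))\<^sup>2 \<le> C * inner (g n x) x" for n x
  proof (rule LIMSEQ_le_const2)
    show "(\<lambda>m. (norm ((Y m - Y n) x))\<^sup>2) \<longlonglongrightarrow> (norm ((T - Y n) x))\<^sup>2"
      by (intro tendsto_intros sconvD sconv_diff T(1) sconv_const)
  qed (use est in blast)
  have "(adj (T - Y n) o\<^sub>L (T - Y n)) \<preceq> C *\<^sub>R g n" for n
  proof -
    have b: "T - Y n \<in> bounded_ops" using TM Y sub by auto
    have "self_adjoint (adj (T - Y n) o\<^sub>L (T - Y n))" "self_adjoint (C *\<^sub>R g n)"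
      using b positive_opD(1)[OF gpos] by (intro self_adjoint_intros; simp)+
    then show ?thesis
      using fin by (subst op_le_iff) (auto simp only: norm_op_square[OF b] blinfun.scaleR_left inner_scaleR_left)
  qed
  then have "order_conv Y T" unfolding order_conv_def using gM gpos gdec g0 C by blast
  then show thesis using that TM T by blast
qed

lemma q2_order_conv:
  "(\<And>n. X n \<in> M) \<Longrightarrow> T \<in> M \<Longrightarrow> order_conv X T \<Longrightarrow> (\<lambda>n. q2 (T - X n)) \<longlonglongrightarrow> 0"
  unfolding q2_def by (rule order_conv_square[OF normal_state_tr])

end

lemma fast_subsequence:
  fixes d :: "nat \<Rightarrow> nat \<Rightarrow> real"
  assumes "\<And>e. e > 0 \<Longrightarrow> \<exists>N. \<forall>m\<ge>N. \<forall>n\<ge>N. d m n < e"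
  obtains r where "strict_mono r" "\<And>n. d (r (Suc n)) (r n) \<le> (1/8) ^ n"
proof -
  have "\<forall>k. \<exists>N. \<forall>m\<ge>N. \<forall>n\<ge>N. d m n < (1/8) ^ k" using assms by simp
  then obtain N where N: "\<And>k m n. m \<ge> N k \<Longrightarrow> n \<ge> N k \<Longrightarrow> d m n < (1/8) ^ k" by metis
  define r where "r = rec_nat (N 0) (\<lambda>k i. max (N (Suc k)) (Suc i))"
  have rS: "r (Suc k) = max (N (Suc k)) (Suc (r k))" for k by (simp add: r_def)
  have r: "r k \<ge> N k" for k by (cases k) (simp_all add: r_def)
  have "strict_mono r" by (rule strict_mono_Suc_iff[THEN iffD2]) (auto simp: rS less_max_iff_disj)
  moreover have "d (r (Suc n)) (r n) \<le> (1/8) ^ n" for n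
    using N[of n "r (Suc n)" "r n"] r[of n] rS[of n] by (simp add: less_imp_le)
  ultimately show thesis using that by blast
qed

context finite_vn_algebra
begin

text \<open>The element of least trace norm is unique, hence fixed by every unitary that preserves \<open>C\<close>.\<close>

lemma minimal_element:
  assumes ne: "C \<noteq> {}" and CM: "\<And>T. T \<in> C \<Longrightarrow> T \<in> M \<and> norm T \<le> K"
    and mid: "\<And>S T. S \<in> C \<Longrightarrow> T \<in> C \<Longrightarrow> (1/2) *\<^sub>R (S + T) \<in> C"
    and closed: "\<And>X T. (\<And>n. X n \<in> C) \<Longrightarrow> T \<in> M \<Longrightarrow> norm T \<le> K \<Longrightarrow> sconv X T \<Longrightarrow> order_conv X T \<Longrightarrow> T \<in> C"
  obtains F where "F \<in> C"
    "\<And>u. u \<in> M \<Longrightarrow> unitary u \<Longrightarrow> (\<And>T. T \<in> C \<Longrightarrow> u o\<^sub>L T o\<^sub>L adj u \<in> C) \<Longrightarrow> u o\<^sub>L F o\<^sub>L adj u = F"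
proof -
  obtain T0 where T0: "T0 \<in> C" using ne by blast
  obtain b where b: "\<And>m :: nat. b m \<in> C" "\<And>m a. a \<in> C \<Longrightarrow> q2 (b m) \<le> q2 a + 1 / Suc m"
    "\<And>e. e > 0 \<Longrightarrow> \<exists>N. \<forall>m\<ge>N. \<forall>n\<ge>N. q2 (b m - b n) < e"
  proof (rule near_minimal_sequence[where C = "\<lambda>_::nat. C" and mid = "\<lambda>S T. (1/2) *\<^sub>R (S + T)"
        and d = "\<lambda>S T. q2 (S - T)" and q = q2 and L = 0 and K = "q2 T0"])
    show "q2 (S - T) \<le> 2 * q2 S + 2 * q2 T - 4 * q2 ((1/2) *\<^sub>R (S + T))" if "S \<in> C" "T \<in> C" for S T
      using q2_parallelogram CM that by simp
  qed (use mid CM q2_nonneg T0 in auto)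
  obtain r where r: "strict_mono r" "\<And>n. q2 (b (r (Suc n)) - b (r n)) \<le> (1/8) ^ n"
    using fast_subsequence[of "\<lambda>m n. q2 (b m - b n)"] b(3) by blast
  define Y where "Y n = b (r n)" for n
  have YC: "Y n \<in> C" for n using b by (simp add: Y_def)
  then have YM: "Y n \<in> M" "norm (Y n) \<le> K" for n using CM by auto
  obtain F where F: "F \<in> M" "norm F \<le> K" "sconv Y F" "order_conv Y F"
  proof (rule fast_Cauchy_order_conv[OF YM])
    show "q2 (Y (Suc n) - Y n) \<le> (1/8) ^ n" for n using r(2) by (simp add: Y_def)
  qed
  have conv: "(\<lambda>n. q2 (F - Y n)) \<longlonglongrightarrow> 0" using q2_order_conv YM F by blast
  have Ymin: "q2 (Y n) \<le> q2 a + 1 / Suc n" if "a \<in> C" for n a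
  proof -
    have "1 / real (Suc (r n)) \<le> 1 / Suc n" using seq_suble[OF r(1), of n] by (simp add: frac_le)
    then show ?thesis using b(2)[OF that, of "r n"] by (simp add: Y_def)
  qed
  have "u o\<^sub>L F o\<^sub>L adj u = F" if u: "u \<in> M" "unitary u" "\<And>T. T \<in> C \<Longrightarrow> u o\<^sub>L T o\<^sub>L adj u \<in> C" for u
  proof -
    define U where "U T = u o\<^sub>L T o\<^sub>L adj u" for T
    have UM: "U T \<in> M" if "T \<in> M" for T using that u by (auto simp: U_def)
    have Ud: "U S - U T = U (S - T)" for S T by (rule blinfun_eqI) (simp add: U_def op_simps)
    have q: "q2 (U T) = q2 T" if "T \<in> M" for T using that u q2_unitary by (simp add: U_def)
    \<comment> \<open>\<open>Y n\<close> and its conjugate have the same trace norm, and their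
      midpoint lies in \<open>C\<close>; by near-minimality the parallelogram law leaves only
      \<open>4 / Suc n\<close>.\<close>
    have 1: "q2 (Y n - U (Y n)) \<le> 4 / Suc n" for n
    proof -
      have "(1/2) *\<^sub>R (Y n + U (Y n)) \<in> C" using mid YC u by (simp add: U_def)
      from Ymin[OF this, of n] q2_parallelogram[OF YM(1) UM[OF YM(1)], of n n] q[OF YM(1), of n]
      show ?thesis by simp
    qed
    have 2: "q2 (F - U F) \<le> 2 * q2 (F - Y n) + 2 * (2 * (4 / Suc n) + 2 * q2 (F - Y n))" for n
    proof -
      have "F - U F = (F - Y n) + ((Y n - U (Y n)) + (U (Y n) - U F))" by simp
      then have "q2 (F - U F) \<le> 2 * q2 (F - Y n) + 2 * q2 ((Y n - U (Y n)) + (U (Y n) - U F))"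
        using q2_add_le[of "F - Y n" "(Y n - U (Y n)) + (U (Y n) - U F)"] F YM UM mem by simp
      also have "q2 ((Y n - U (Y n)) + (U (Y n) - U F)) \<le> 2 * q2 (Y n - U (Y n)) + 2 * q2 (U (Y n) - U F)"
        using F YM UM mem by (intro q2_add_le) auto
      also have "q2 (U (Y n) - U F) = q2 (F - Y n)"
        using F YM mem by (simp add: Ud q q2_diff_commute)
      finally show ?thesis using 1[of n] by simp
    qed
    have "(\<lambda>n. 2 * q2 (F - Y n) + 2 * (2 * (4 * (1 / Suc n)) + 2 * q2 (F - Y n))) \<longlonglongrightarrow> 2 * 0 + 2 * (2 * (4 * 0) + 2 * 0)"
      using LIMSEQ_inverse_real_of_nat by (intro tendsto_intros conv) (simp add: inverse_eq_divide)
    then have "q2 (F - U F) \<le> 2 * 0 + 2 * (2 * (4 * 0) + 2 * 0)"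
      using 2 by (intro LIMSEQ_le_const) auto
    moreover have m: "F - U F \<in> M" using F UM by auto
    ultimately have "q2 (F - U F) = 0" using q2_nonneg[OF m] by simp
    then have "F - U F = 0" by (rule q2_zero_imp[OF m])
    then show ?thesis by (simp add: U_def)
  qed
  moreover have "F \<in> C" using closed[OF YC F(1-4)] .
  ultimately show thesis using that by blast
qed

end

section \<open>Comparison of projections\<close>

text \<open>The Brezis--Browder ordering principle.\<close>

lemma maximal_by_measure:
  fixes le :: "'a \<Rightarrow> 'a \<Rightarrow> bool" and m :: "'a \<Rightarrow> real"
  assumes ne: "s0 \<in> S" and refl: "\<And>s. s \<in> S \<Longrightarrow> le s s"
    and trans: "\<And>s t u. s \<in> S \<Longrightarrow> t \<in> S \<Longrightarrow> u \<in> S \<Longrightarrow> le s t \<Longrightarrow> le t u \<Longrightarrow> le s u"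
    and mono: "\<And>s t. s \<in> S \<Longrightarrow> t \<in> S \<Longrightarrow> le s t \<Longrightarrow> m s \<le> m t"
    and bound: "\<And>s. s \<in> S \<Longrightarrow> m s \<le> K"
    and chain: "\<And>x. (\<And>n. x n \<in> S) \<Longrightarrow> (\<And>n. le (x n) (x (Suc n))) \<Longrightarrow> \<exists>u\<in>S. \<forall>n :: nat. le (x n) u"
  obtains t where "t \<in> S" "\<And>u. u \<in> S \<Longrightarrow> le t u \<Longrightarrow> m u = m t"
proof -
  \<comment> \<open>Every \<open>s\<close> has a successor whose measure closes at least half of the
    gap to any element above \<open>s\<close>; iterating the choice leaves no gap above an upper
    bound of the resulting chain.\<close>
  have "\<exists>t\<in>S. le s t \<and> (\<forall>u\<in>S. le s u \<longrightarrow> (m s + m u) / 2 \<le> m t)" if s: "s \<in> S" for s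
  proof -
    define U where "U = {m u | u. u \<in> S \<and> le s u}"
    have sU: "m s \<in> U" using s refl by (auto simp: U_def)
    have bdd: "bdd_above U" using bound by (auto simp: U_def bdd_above_def)
    have le: "m u \<le> Sup U" if "u \<in> S" "le s u" for u using bdd that by (intro cSup_upper) (auto simp: U_def)
    show ?thesis
    proof (cases "m s = Sup U")
      case True
      then show ?thesis using s refl le by force
    next
      case False
      then have "(m s + Sup U) / 2 < Sup U" using le[OF s refl[OF s]] by simp
      then obtain y where "y \<in> U" "(m s + Sup U) / 2 < y"
        using less_cSup_iff[of U] sU bdd by blast
      then obtain t where "t \<in> S" "le s t" "(m s + Sup U) / 2 < m t" by (auto simp: U_def)
      then show ?thesis using le by (intro bexI[of _ t]) force+
    qed
  qed
  then obtain f where f: "\<And>s. s \<in> S \<Longrightarrow> f s \<in> S" "\<And>s. s \<in> S \<Longrightarrow> le s (f s)"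
    "\<And>s u. s \<in> S \<Longrightarrow> u \<in> S \<Longrightarrow> le s u \<Longrightarrow> (m s + m u) / 2 \<le> m (f s)" by metis
  define x where "x = rec_nat s0 (\<lambda>_. f)"
  have x0: "x 0 = s0" and xS: "x (Suc n) = f (x n)" for n by (simp_all add: x_def)
  have x: "x n \<in> S" for n by (induction n) (simp_all add: x0 xS ne f)
  obtain t where t: "t \<in> S" "\<And>n. le (x n) t" using chain[of x] x f xS by auto
  have "m u = m t" if u: "u \<in> S" "le t u" for u
  proof -
    have xu: "le (x n) u" for n using trans[OF x t(1) u(1) t(2) u(2)] .
    have "m u - m (x n) \<le> (m u - m s0) / 2 ^ n" for n
    proof (induction n)
      case (Suc n)
      have "m u - m (x (Suc n)) \<le> (m u - m (x n)) / 2" using f(3)[OF x u(1) xu, of n] by (simp add: xS)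
      also have "\<dots> \<le> ((m u - m s0) / 2 ^ n) / 2" using Suc by (intro divide_right_mono) auto
      also have "\<dots> = (m u - m s0) / 2 ^ Suc n" by simp
      finally show ?case .
    qed (simp add: x0)
    then have le: "m u - m t \<le> (m u - m s0) * (1/2) ^ n" for n
      using mono[OF x t(1) t(2), of n] by (simp add: power_divide) (smt (verit))
    have "(\<lambda>n. (m u - m s0) * (1/2::real) ^ n) \<longlonglongrightarrow> (m u - m s0) * 0"
      by (intro tendsto_intros LIMSEQ_power_zero) auto
    then have "m u - m t \<le> (m u - m s0) * 0" using le by (intro LIMSEQ_le_const) auto
    then show ?thesis using mono[OF t(1) u] by simp
  qed
  then show thesis using that t by blast
qed

lemma unitary_apply:
  assumes "unitary u"
  shows "adj u (u x) = x" "u (adj u x) = x"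
  using assms unfolding unitary_def by (metis blinfun_apply_blinfun_compose blinfun_apply_id_blinfun id_apply)+

lemma unitary_conj_positive:
  assumes "unitary u" "positive_op T"
  shows "positive_op (u o\<^sub>L T o\<^sub>L adj u)"
  using positive_op_intros(6)[of "adj u" T] assms by (auto simp: unitary_def)

lemma unitary_conj_contraction:
  assumes u: "unitary u" and T: "T \<preceq> id_blinfun"
  shows "u o\<^sub>L T o\<^sub>L adj u \<preceq> id_blinfun"
proof -
  have "id_blinfun - (u o\<^sub>L T o\<^sub>L adj u) = u o\<^sub>L (id_blinfun - T) o\<^sub>L adj u"
    by (rule blinfun_eqI) (simp add: op_simps unitary_apply[OF u])
  then show ?thesis using unitary_conj_positive[OF u] T by (simp add: op_le_def)
qed

text \<open>With \<open>e = adj v o\<^sub>L v\<close> one has \<open>(norm (v (x - e x)))\<^sup>2 =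
  inner (e (x - e x)) (x - e x) = 0\<close>, so \<open>v\<close> vanishes off its initial
  space.\<close>

lemma initial_projection_apply:
  assumes "v \<in> bounded_ops" "projection (adj v o\<^sub>L v)"
  shows "v (adj v (v x)) = v x"
proof -
  have "(norm (v (x - adj v (v x))))\<^sup>2 = inner ((adj v o\<^sub>L v) (x - (adj v o\<^sub>L v) x)) (x - (adj v o\<^sub>L v) x)"
    using assms(1) by (subst norm_op_square) auto
  also have "\<dots> = 0" using projectionD(4)[OF assms(2), of x] by (simp add: op_simps)
  finally show ?thesis by (simp add: op_simps)
qed

lemma final_projection:
  assumes "v \<in> bounded_ops" "projection (adj v o\<^sub>L v)"
  shows "projection (v o\<^sub>L adj v)"
  using assms self_adjoint_intros(7)[of "adj v"] 
  by (simp add: projection_iff initial_projection_apply[OF assms])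

lemma eq_by_norms:
  assumes "v \<in> bounded_ops" "projection p" "\<And>x. norm (blinfun_apply v x) = norm (p x)"
  shows "adj v o\<^sub>L v = p"
proof -
  have "(adj v o\<^sub>L v) - p = 0"
  proof (rule self_adjoint_eq_zeroI)
    show "self_adjoint ((adj v o\<^sub>L v) - p)" using assms by (intro self_adjoint_intros) (auto simp: projectionD)
    show "inner (((adj v o\<^sub>L v) - p) x) x = 0" for x
      using norm_op_square[OF assms(1), of x] projection_norm[OF assms(2), of x] assms(3)[of x]
      by (simp only: blinfun.diff_left inner_diff_left)
  qed
  then show ?thesis by simp
qed

lemma projection_absorb:
  assumes "projection f" "projection e" "\<And>x. norm (f (e x)) = norm (e x)"
  shows "f o\<^sub>L e = e"
proof (rule blinfun_eqI)
  fix x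
  have "(norm ((id_blinfun - f) (e x)))\<^sup>2 = inner (e x) (e x) - inner (f (e x)) (e x)"
    using projection_norm[OF projection_compl[OF assms(1)], of "e x"] by (simp add: op_simps inner_simps)
  also have "\<dots> = 0" using projection_norm[OF assms(1), of "e x"] assms(3)[of x] by (simp add: power2_norm_eq_inner)
  finally show "(f o\<^sub>L e) x = e x" by (simp add: op_simps)
qed

section \<open>Equivalence of projections in a finite factor\<close>

locale finite_factor = finite_vn_algebra +
  assumes factor: "M \<inter> commutant M = range (\<lambda>c. c *\<^sub>C id_blinfun)"
begin

lemma tr_projection_pos: "P \<in> M \<Longrightarrow> projection P \<Longrightarrow> P \<noteq> 0 \<Longrightarrow> 0 < tr P"
  using tr_faithful[of P] tr_nonneg[of P] projection_positive[of P] by fastforce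

text \<open>Otherwise \<open>Q\<close> belongs to a convex set of positive contractions of trace
  \<open>tr Q\<close>, invariant under all unitaries of \<open>M\<close>. Its element of least trace
  norm commutes with \<open>M\<close>, hence is a scalar \<open>c\<close> because \<open>M\<close>
  is a factor; \<open>P\<close> annihilates it, so \<open>c = 0\<close>, against the trace.\<close>

lemma corner_nonzero:
  assumes P: "P \<in> M" "projection P" "P \<noteq> 0" and Q: "Q \<in> M" "projection Q" "Q \<noteq> 0"
  obtains T where "T \<in> M" "P o\<^sub>L T o\<^sub>L Q \<noteq> 0"
proof (rule ccontr)
  assume "\<not> thesis"
  then have zero: "P o\<^sub>L T o\<^sub>L Q = 0" if "T \<in> M" for T using that \<open>\<And>T. T \<in> M \<Longrightarrow> P o\<^sub>L T o\<^sub>L Q \<noteq> 0 \<Longrightarrow> thesis\<close> by blast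
  \<comment> \<open>Requiring that \<open>P\<close> annihilates \<open>T x\<close> for all
    \<open>T\<close> in \<open>M\<close>, and not only \<open>x\<close>, makes the set invariant
    under conjugation by a unitary \<open>u\<close>: \<open>T u\<close> is again in
    \<open>M\<close>.\<close>
  define C where "C = {x \<in> M. positive_op x \<and> x \<preceq> id_blinfun \<and> tr x = tr Q \<and> (\<forall>T\<in>M. \<forall>v. P (T (x v)) = 0)}"
  have QC: "Q \<in> C"
    unfolding C_def using Q zero projection_positive projection_le_id 
    by (auto, metis blinfun.zero_left blinfun_apply_blinfun_compose)
  obtain F where F: "F \<in> C"
    "\<And>u. u \<in> M \<Longrightarrow> unitary u \<Longrightarrow> (\<And>T. T \<in> C \<Longrightarrow> u o\<^sub>L T o\<^sub>L adj u \<in> C) \<Longrightarrow> u o\<^sub>L F o\<^sub>L adj u = F"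
  proof (rule minimal_element[of C 1])
    show "C \<noteq> {}" using QC by blast
    show "T \<in> M \<and> norm T \<le> 1" if "T \<in> C" for T using that norm_le_one by (auto simp: C_def)
    show "(1/2) *\<^sub>R (S + T) \<in> C" if "S \<in> C" "T \<in> C" for S T
    proof -
      have "id_blinfun - (1/2) *\<^sub>R (S + T) = (1/2) *\<^sub>R ((id_blinfun - S) + (id_blinfun - T))"
        by (rule blinfun_eqI) (simp add: op_simps algebra_simps flip: scaleR_add_left)
      moreover have "positive_op \<dots>" using that by (intro positive_op_intros) (auto simp: C_def op_le_def)
      ultimately have "(1/2) *\<^sub>R (S + T) \<preceq> id_blinfun" by (simp add: op_le_def)
      then show ?thesis using that by (auto simp: C_def mem tr_linear op_simps intro!: positive_op_intros)
    qed
    fix X T assume X: "\<And>n. X n \<in> C" "T \<in> M" "sconv X T" "order_conv X T"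
    have pos: "positive_op T" using sconv_op_le[OF sconv_const[of 0] X(3)] X(1) by (auto simp: C_def op_le_def)
    moreover have "T \<preceq> id_blinfun" using sconv_op_le[OF X(3) sconv_const[of id_blinfun]] X(1) by (auto simp: C_def)
    moreover have "tr T = tr Q"
    proof -
      have "X n \<in> M" "self_adjoint (X n)" "tr (X n) = tr Q" for n
        using X(1)[of n] positive_opD(1)[of "X n"] by (auto simp: C_def)
      then show ?thesis
        using order_conv_state[OF normal_state_tr _ _ X(2) positive_opD(1)[OF pos] X(4)]
        by (simp add: LIMSEQ_const_iff)
    qed
    moreover have "P (S (T v)) = 0" if "S \<in> M" for S v
      using LIMSEQ_unique[OF tendsto_blinfun_apply[OF tendsto_blinfun_apply[OF sconvD[OF X(3)]], of P S v]] X(1) that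
      by (auto simp: C_def)
    ultimately show "T \<in> C" using X(2) by (simp add: C_def)
  qed blast
  have FM: "F \<in> M" "F \<in> bounded_ops" using F sub by (auto simp: C_def)
  have "u o\<^sub>L F o\<^sub>L adj u = F" if u: "u \<in> M" "unitary u" for u
  proof (rule F(2)[OF u])
    fix T assume T: "T \<in> C"
    have "u o\<^sub>L T o\<^sub>L adj u = u o\<^sub>L (T o\<^sub>L adj u)" "(T o\<^sub>L adj u) o\<^sub>L u = T"
      by (rule blinfun_eqI; simp add: unitary_apply[OF u(2)])+
    then have "tr (u o\<^sub>L T o\<^sub>L adj u) = tr T"
      using tr_commute[of u "T o\<^sub>L adj u"] T u by (auto simp: C_def)
    moreover have "P (S (u (T v))) = 0" if "S \<in> M" for S v
    proof -
      have "S o\<^sub>L u \<in> M" using that u by blast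
      then show ?thesis using T unfolding C_def by (metis (mono_tags, lifting) blinfun_apply_blinfun_compose mem_Collect_eq)
    qed
    ultimately show "u o\<^sub>L T o\<^sub>L adj u \<in> C"
      using T u unitary_conj_positive unitary_conj_contraction by (auto simp: C_def)
  qed
  then have "F \<in> commutant M"
    using commute_unitaries_imp_commute[OF FM(2)] FM by (auto simp: commutant_def)
  then obtain c where c: "F = c *\<^sub>C id_blinfun" using factor FM(1) by auto
  have "c = 0"
  proof (rule ccontr)
    assume "c \<noteq> 0"
    have "P (id_blinfun (F v)) = 0" for v using F(1) id unfolding C_def by blast
    then have "c *\<^sub>C P v = 0" for v using bounded_opsD[OF projectionD(2)[OF P(2)]] by (simp add: c op_simps)
    then have "P v = 0" for v using \<open>c \<noteq> 0\<close> by (metis norm_scaleC mult_eq_0_iff norm_eq_zero)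
    then show False using P(3) by (metis blinfun.zero_left blinfun_eqI)
  qed
  then have "F = 0" by (intro blinfun_eqI) (simp add: c op_simps)
  then have "tr Q = 0" using F(1) tr_linear(4) by (simp add: C_def)
  then show False using tr_projection_pos Q by fastforce
qed

text \<open>Polar decomposition of a nonzero \<open>x \<in> P M Q\<close>, restricted to a spectral subspace of \<open>|x|\<close> on which
  \<open>|x|\<close> is bounded below.\<close>

lemma partial_isometry_exists:
  assumes P: "P \<in> M" "projection P" "P \<noteq> 0" and Q: "Q \<in> M" "projection Q" "Q \<noteq> 0"
  obtains w where "w \<in> M" "projection (adj w o\<^sub>L w)" "w \<noteq> 0" "\<And>x. P (w x) = w x" "\<And>x. w (Q x) = w x"
proof -
  obtain T where T: "T \<in> M" "P o\<^sub>L T o\<^sub>L Q \<noteq> 0" using corner_nonzero[OF assms] by blast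
  define x where "x = P o\<^sub>L T o\<^sub>L Q"
  have x: "x \<in> M" "x \<in> bounded_ops" "x \<noteq> 0" using T P Q sub by (auto simp: x_def)
  have Px: "P (x v) = x v" and xQ: "x (Q v) = x v" for v by (simp_all add: x_def projectionD P Q)
  obtain h where h: "h \<in> M" "positive_op h" "h o\<^sub>L h = adj x o\<^sub>L x" "in_bicommutant (adj x o\<^sub>L x) h"
    using sqrt_mem[of "adj x o\<^sub>L x"] x positive_op_intros(5) by blast
  have sh: "self_adjoint h" using h positive_opD by blast
  have norms: "norm (h v) = norm (x v)" for v
  proof -
    have "(norm (h v))\<^sup>2 = inner ((h o\<^sub>L h) v) v" using self_adjointD(3)[OF sh] by (simp add: power2_norm_eq_inner)
    also have "\<dots> = (norm (x v))\<^sup>2" unfolding h(3) by (rule norm_op_square[OF x(2)])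
    finally show ?thesis by (simp add: power2_eq_iff_nonneg)
  qed
  have "h \<noteq> 0" using norms x(3) by (metis blinfun.zero_left blinfun_eqI norm_eq_zero)
  \<comment> \<open>Any level strictly between 0 and \<open>norm h\<close> serves: it is positive,
    and the part of \<open>h\<close> above it cannot vanish.\<close>
  define c where "c = norm h / 2"
  have c: "c > 0" "c < norm h" using \<open>h \<noteq> 0\<close> by (auto simp: c_def)
  have "h - c *\<^sub>R id_blinfun \<in> M" "self_adjoint (h - c *\<^sub>R id_blinfun)" using h sh by (auto simp: self_adjoint_intros)
  then obtain p where p: "p \<in> M" "projection p" "in_bicommutant (h - c *\<^sub>R id_blinfun) p"
    "\<And>v. 0 \<le> inner ((h - c *\<^sub>R id_blinfun) (p v)) (p v)"
    "\<And>v. inner ((h - c *\<^sub>R id_blinfun) (v - p v)) (v - p v) \<le> 0" using cut by metis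
  have pcomm: "R o\<^sub>L p = p o\<^sub>L R" if "R o\<^sub>L h = h o\<^sub>L R" for R
    by (rule in_bicommutantD[OF p(3)], rule commuteI) (simp add: op_simps commute_apply[OF that])
  have hp: "h (p v) = p (h v)" for v using commute_apply[OF pcomm] by blast
  have low: "c * (norm (p v))\<^sup>2 \<le> inner (h (p v)) (p v)" for v
    using p(4)[of v] by (simp add: op_simps inner_simps power2_norm_eq_inner)
  have "p \<noteq> 0"
  proof
    assume "p = 0"
    then have "inner (h v) v \<le> c * inner v v" for v using p(5)[of v] by (simp add: op_simps inner_simps)
    then have "norm h \<le> c"
      using c sh positive_opD(2)[OF h(2)]
      by (intro norm_op_leI) (auto simp: op_le_iff self_adjoint_intros op_simps intro: order_trans[of _ 0])
    then show False using c by simp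
  qed
  \<comment> \<open>\<open>y\<close> equals \<open>h\<close> on the range of \<open>p\<close> and
    \<open>c\<close> on its complement, so \<open>y \<ge> c\<close> has an inverse \<open>r\<close>.
    Since \<open>x\<close> and \<open>h\<close> have the same norms, \<open>x p r\<close> is
    isometric on the range of \<open>p\<close>.\<close>
  define y where "y = (h o\<^sub>L p) + c *\<^sub>R (id_blinfun - p)"
  have y: "y \<in> M" "self_adjoint y"
    unfolding y_def using h p sh pcomm[of h] projectionD(1)[OF p(2)] projectionD(1)[OF projection_compl[OF p(2)]]
    by (auto intro!: self_adjoint_intros mem)
  have "c *\<^sub>R id_blinfun \<preceq> y"
  proof -
    have "c * inner v v \<le> inner (y v) v" for v
    proof -
      have "inner (y v) v = inner (h (p v)) (p v) + c * (inner v v - inner (p v) v)"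
        using self_adjointD(3)[OF projectionD(1)[OF p(2)], of "h v" v] projectionD(4)[OF p(2), of v]
          self_adjointD(3)[OF projectionD(1)[OF p(2)], of "h v" "p v"]
        by (simp add: y_def op_simps inner_simps hp)
      then show ?thesis using low[of v] projection_norm[OF p(2), of v] by (simp add: algebra_simps)
    qed
    then show ?thesis using y by (subst op_le_iff) (auto simp: self_adjoint_intros op_simps)
  qed
  then obtain r where r: "positive_op r" "y o\<^sub>L r = id_blinfun" "r o\<^sub>L y = id_blinfun" "in_bicommutant y r"
    using positive_inverse_exists[OF y(2) c(1)] by metis
  have rM: "r \<in> M" using bicommutant[OF y(1) r(4)] r(1) positive_opD(1) self_adjointD(1) by blast
  have yp: "y (p v) = h (p v)" "p (y v) = h (p v)" for v
    by (simp_all add: y_def op_simps projectionD(4)[OF p(2)] hp)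
  have pr: "p (r v) = r (p v)" for v
    by (rule commute_apply[OF in_bicommutantD[OF r(4)]], rule commuteI) (simp add: yp)
  have yr: "y (r v) = v" for v using arg_cong[OF r(2), of "\<lambda>T. blinfun_apply T v"] by simp
  define w where "w = x o\<^sub>L p o\<^sub>L r"
  have wM: "w \<in> M" "w \<in> bounded_ops" using x p rM sub by (auto simp: w_def)
  have "norm (w v) = norm (p v)" for v
  proof -
    have "norm (w v) = norm (h (p (r v)))" by (simp add: w_def norms)
    also have "h (p (r v)) = p v" by (simp add: yp(2)[symmetric] yr)
    finally show ?thesis .
  qed
  then have ww: "adj w o\<^sub>L w = p" by (rule eq_by_norms[OF wM(2) p(2)])
  have hQ: "h (Q v) = h v" for v
  proof -
    have "norm (h (v - Q v)) = 0" by (subst norms) (simp add: blinfun.diff_right xQ)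
    then have "h (v - Q v) = 0" by (simp only: norm_eq_zero)
    then have "h v - h (Q v) = 0" by (simp only: blinfun.diff_right)
    then show ?thesis by (metis right_minus_eq)
  qed
  have Qh: "Q (h v) = h v" for v
    by (rule inner_eqI) (metis hQ self_adjointD(3)[OF sh] self_adjointD(3)[OF projectionD(1)[OF Q(2)]])
  have Qp: "Q (p v) = p (Q v)" for v
    by (rule commute_apply[OF pcomm], rule commuteI) (simp add: hQ Qh)
  have pQ: "p (Q v) = p v" for v
  proof -
    have "h (p (v - Q v)) = 0" by (simp add: op_simps hQ Qp[symmetric])
    then have "c * (norm (p (v - Q v)))\<^sup>2 \<le> 0" using low[of "v - Q v"] by simp
    then have "p (v - Q v) = 0" using c by (simp add: mult_le_0_iff)
    then show ?thesis by (simp add: op_simps)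
  qed
  have "w (Q v) = w v" for v by (simp add: w_def pr pQ)
  moreover have "P (w v) = w v" for v by (simp add: w_def Px)
  moreover have "w \<noteq> 0" using ww \<open>p \<noteq> 0\<close> by auto
  ultimately show thesis using that[of w] wM ww p(2) by simp
qed

text \<open>Take a partial isometry from a part of \<open>Q\<close> to a part of \<open>P\<close>
  none of whose extensions has an initial projection of larger trace. What is left of
  \<open>P\<close> and of \<open>Q\<close> has the same trace; were it nonzero,
  \<open>partial_isometry_exists\<close> would give such an extension.\<close>

lemma equal_trace_equivalent:
  assumes P: "P \<in> M" "projection P" and Q: "Q \<in> M" "projection Q" and eq: "tr P = tr Q"
  obtains v where "v \<in> M" "adj v o\<^sub>L v = Q" "v o\<^sub>L adj v = P"
proof -
  define S where "S = {v \<in> M. projection (adj v o\<^sub>L v) \<and> (\<forall>x. P (v x) = v x) \<and> (\<forall>x. v (Q x) = v x)}"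
  \<comment> \<open>\<open>w\<close> extends \<open>v\<close>: they agree on the initial space of
    \<open>v\<close>.\<close>
  define le where "le v w \<longleftrightarrow> (\<forall>x. w (adj v (v x)) = v x)" for v w :: "'a op"
  have SD: "v \<in> M" "v \<in> bounded_ops" "projection (adj v o\<^sub>L v)" "P (v x) = v x" "v (Q x) = v x"
    "v (adj v (v x)) = v x" if "v \<in> S" for v x
    using that sub initial_projection_apply by (auto simp: S_def)
  have nv: "norm (v x) = norm ((adj v o\<^sub>L v) x)" if "v \<in> S" for v x
    using norm_op_square[OF SD(2)[OF that], of x] projection_norm[OF SD(3)[OF that], of x]
    by (simp add: power2_eq_iff_nonneg)
  have absorb: "(adj w o\<^sub>L w) o\<^sub>L (adj v o\<^sub>L v) = adj v o\<^sub>L v" if "v \<in> S" "w \<in> S" "le v w" for v w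
  proof (rule projection_absorb[OF SD(3)[OF that(2)] SD(3)[OF that(1)]])
    fix x
    have "norm ((adj w o\<^sub>L w) ((adj v o\<^sub>L v) x)) = norm (w ((adj v o\<^sub>L v) x))" using nv[OF that(2)] by simp
    also have "\<dots> = norm (v x)" using that(3) by (simp add: le_def)
    finally show "norm ((adj w o\<^sub>L w) ((adj v o\<^sub>L v) x)) = norm ((adj v o\<^sub>L v) x)" using nv[OF that(1)] by simp
  qed
  have lemono: "adj v o\<^sub>L v \<preceq> adj w o\<^sub>L w" if "v \<in> S" "w \<in> S" "le v w" for v w
    using projection_le_iff[OF SD(3)[OF that(1)] SD(3)[OF that(2)]] absorb[OF that] by simp
  obtain v where v: "v \<in> S" and max: "\<And>u. u \<in> S \<Longrightarrow> le v u \<Longrightarrow> tr (adj u o\<^sub>L u) = tr (adj v o\<^sub>L v)"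
  proof (rule maximal_by_measure[of 0 S le "\<lambda>v. tr (adj v o\<^sub>L v)" 1])
    show "0 \<in> S" by (simp add: S_def op_simps)
    show "le s s" if "s \<in> S" for s using SD(6)[OF that] by (simp add: le_def)
    show "le s u" if "s \<in> S" "t \<in> S" "u \<in> S" "le s t" "le t u" for s t u
    proof -
      have "adj t (t (adj s (s x))) = adj s (s x)" for x
        using absorb[OF that(1,2,4)] by (metis blinfun_apply_blinfun_compose)
      then show ?thesis using that(4,5) unfolding le_def by metis
    qed
    show "tr (adj s o\<^sub>L s) \<le> tr (adj t o\<^sub>L t)" if "s \<in> S" "t \<in> S" "le s t" for s t
      using lemono[OF that] SD(1)[OF that(1)] SD(1)[OF that(2)] by (intro tr_mono) auto
    show "tr (adj s o\<^sub>L s) \<le> 1" if "s \<in> S" for s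
      using tr_mono[OF _ id projection_le_id[OF SD(3)[OF that]]] SD(1)[OF that] by (auto simp: tr_linear)
    fix x assume x: "\<And>n. x n \<in> S" and inc: "\<And>n. le (x n) (x (Suc n))"
    define e where "e n = adj (x n) o\<^sub>L x n" for n
    have e: "projection (e n)" "e n \<in> M" for n using SD[OF x] by (auto simp: e_def)
    obtain G where G: "sconv e G" "\<And>n. e n \<preceq> G" "\<And>m n. m \<le> n \<Longrightarrow> e m \<preceq> e n"
      using monotone_sconv[of e 1] e lemono[OF x x inc] projection_le_id
      by (metis projectionD(1) scaleR_one e_def)
    have chain: "x n ((e m) v) = x m v" if "m \<le> n" for m n v
      using that
    proof (induction rule: dec_induct)
      case base
      then show ?case using SD(6)[OF x] by (simp add: e_def)
    next
      case (step n)
      have "e n (e m v) = e m v"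
        using projection_le_iff[OF e(1) e(1), of m n] G(3)[OF step(1)] by (metis blinfun_apply_blinfun_compose)
      moreover have "x (Suc n) (e n (e m v)) = x n (e m v)" using inc[of n] by (simp add: le_def e_def)
      ultimately show ?case using step by simp
    qed
    \<comment> \<open>Along a chain the squared distance of \<open>x n v\<close> and
      \<open>x m v\<close> is an increment of the form of the initial projections, which converge;
      so the partial isometries converge strongly to an upper bound.\<close>
    have dist: "(norm (x n v - x m v))\<^sup>2 = inner (e n v) v - inner (e m v) v" if "m \<le> n" for m n v
    proof -
      have em: "e n (e m v) = e m v" for v
        using projection_le_iff[OF e(1) e(1), of m n] G(3)[OF that] by (metis blinfun_apply_blinfun_compose)
      have "inner (x n v) (x m v) = inner (e n v) (e m v)"
        unfolding chain[OF that, symmetric] using SD(2)[OF x] by (simp add: e_def inner_adj_left)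
      also have "\<dots> = inner (e m v) v"
        using self_adjointD(3)[OF projectionD(1)[OF e(1)], of n "e m v" v] by (simp add: em inner_commute)
      finally have "inner (x n v) (x m v) = inner (e m v) v" .
      then show ?thesis
        using norm_op_square[OF SD(2)[OF x], of n v] norm_op_square[OF SD(2)[OF x], of m v]
        unfolding e_def[symmetric] by (simp add: power2_norm_eq_inner inner_simps inner_commute)
    qed
    have Cauchy: "Cauchy (\<lambda>n. x n v)" for v
    proof (rule CauchyI)
      fix \<epsilon> :: real assume eps: "0 < \<epsilon>"
      have "(\<lambda>n. inner (e n v) v) \<longlonglongrightarrow> inner (G v) v" by (intro tendsto_intros sconvD G)
      then have "Cauchy (\<lambda>n. inner (e n v) v)" using LIMSEQ_imp_Cauchy by blast
      then obtain N where N: "\<And>m n. m \<ge> N \<Longrightarrow> n \<ge> N \<Longrightarrow> norm (inner (e m v) v - inner (e n v) v) < \<epsilon>\<^sup>2"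
        using eps unfolding Cauchy_iff by (meson zero_less_power)
      have *: "norm (x n v - x m v) < \<epsilon>" if "N \<le> m" "m \<le> n" for m n
      proof -
        have "(norm (x n v - x m v))\<^sup>2 < \<epsilon>\<^sup>2" using dist[OF that(2)] N[of n m] that by simp
        then show ?thesis using eps by (meson less_imp_le power_less_imp_less_base)
      qed
      show "\<exists>N. \<forall>m\<ge>N. \<forall>n\<ge>N. norm (x m v - x n v) < \<epsilon>"
        by (metis * nat_le_linear norm_minus_commute)
    qed
    have "norm (x n) \<le> 1" for n
    proof (rule norm_blinfun_bound)
      fix v show "norm (x n v) \<le> 1 * norm v" using nv[OF x] projection_norm_le[OF SD(3)[OF x]] by simp
    qed simp
    then obtain u where u: "sconv x u" using sconv_exists Cauchy by blast
    have uM: "u \<in> M" "u \<in> bounded_ops" using sconv_mem[OF SD(1)[OF x] u] sub by auto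
    have GP: "projection G"
      unfolding projection_iff
    proof (intro conjI allI)
      show sG: "self_adjoint G" using sconv_self_adjoint[OF G(1)] e projectionD(1) by blast
      have "sconv (\<lambda>n. e n o\<^sub>L e n) (G o\<^sub>L G)"
        by (rule sconv_compose[OF G(1,1), of 1]) (use e norm_le_one projection_positive projection_le_id in blast)
      then have "sconv e (G o\<^sub>L G)" using e by (simp add: projectionD)
      from sconv_unique[OF this G(1)] show "G (G v) = G v" for v by (metis blinfun_apply_blinfun_compose)
    qed
    have un: "norm (u v) = norm (G v)" for v
    proof -
      have "(\<lambda>n. norm (x n v)) \<longlonglongrightarrow> norm (u v)" by (intro tendsto_intros sconvD u)
      moreover have "(\<lambda>n. norm (x n v)) \<longlonglongrightarrow> norm (G v)"
        using tendsto_norm[OF sconvD[OF G(1), of v]] nv[OF x] by (simp add: e_def)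
      ultimately show ?thesis by (rule LIMSEQ_unique)
    qed
    have "adj u o\<^sub>L u = G" by (rule eq_by_norms[OF uM(2) GP un])
    moreover have "P (u v) = u v" for v
      using LIMSEQ_unique[OF tendsto_blinfun_apply[OF sconvD[OF u], of P v]] sconvD[OF u, of v] SD(4)[OF x] by simp
    moreover have "u (Q v) = u v" for v
      using LIMSEQ_unique[OF sconvD[OF u, of "Q v"]] sconvD[OF u, of v] SD(5)[OF x] by simp
    ultimately have "u \<in> S" using uM GP by (simp add: S_def)
    moreover have "le (x n) u" for n
      unfolding le_def
    proof
      fix v
      have "(\<lambda>k. x (k + n) (e n v)) \<longlonglongrightarrow> u (e n v)" using sconvD[OF u] by (rule LIMSEQ_ignore_initial_segment)
      then show "u (adj (x n) (x n v)) = x n v" using LIMSEQ_unique[of _ _ "x n v"] chain[of n] by (simp add: e_def)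
    qed
    ultimately show "\<exists>u\<in>S. \<forall>n. le (x n) u" by blast
  qed blast
  define e where "e = adj v o\<^sub>L v"
  define f where "f = v o\<^sub>L adj v"
  have e: "projection e" "e \<in> M" and f: "projection f" "f \<in> M"
    using SD(1-3)[OF v] final_projection by (auto simp: e_def f_def)
  have adjv: "adj v (P x) = adj v x" "Q (adj v x) = adj v x" for x
    by (rule inner_eqI; simp add: inner_adj_left SD[OF v] self_adjointD(3)[OF projectionD(1)[OF P(2)]]
        self_adjointD(3)[OF projectionD(1)[OF Q(2)]])+
  have Qe: "Q o\<^sub>L e = e" and Pf: "P o\<^sub>L f = f"
    by (rule blinfun_eqI; simp add: e_def f_def adjv SD[OF v])+
  note Qd = projection_diff[OF e(1) Q(2) Qe] and Pd = projection_diff[OF f(1) P(2) Pf]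
  have tref: "tr e = tr f" unfolding e_def f_def using SD(1)[OF v] by (intro tr_commute) auto
  have trd: "tr (Q - e) = tr (P - f)" using e f P Q tref eq by (simp add: tr_linear)
  have "Q - e = 0"
  proof (rule ccontr)
    assume nz: "Q - e \<noteq> 0"
    then have "tr (P - f) > 0" using trd tr_projection_pos[of "Q - e"] Qd(1) Q e by auto
    then have "P - f \<noteq> 0" using tr_linear(4) by auto
    then obtain w where w: "w \<in> M" "projection (adj w o\<^sub>L w)" "w \<noteq> 0" "\<And>x. (P - f) (w x) = w x" "\<And>x. w ((Q - e) x) = w x"
      using partial_isometry_exists[of "P - f" "Q - e"] Pd(1) Qd(1) nz P Q e f by blast
    have wb: "w \<in> bounded_ops" using w sub by blast
    have fw: "f (w x) = 0" for x
    proof -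
      have "f ((P - f) (w x)) = 0" using Pd(3) by (metis blinfun.zero_left blinfun_apply_blinfun_compose)
      then show ?thesis by (simp only: w(4))
    qed
    have we: "w (e x) = 0" for x
    proof -
      have "(Q - e) (e x) = 0"
        using projection_commute_zero[OF e(1) Qd(1) Qd(3)] by (metis blinfun.zero_left blinfun_apply_blinfun_compose)
      then show ?thesis using w(5)[of "e x"] by (simp add: blinfun.zero_right)
    qed
    have vw: "adj v (w x) = 0" for x
    proof -
      have "f (v y) = v y" for y by (simp add: f_def SD(6)[OF v])
      then have "adj v (f (w x)) = adj v (w x)"
        by (intro inner_eqI[of "adj v (f (w x))"])
          (simp add: inner_adj_left SD(2)[OF v] self_adjointD(3)[OF projectionD(1)[OF f(1)]])
      then show ?thesis by (simp add: fw blinfun.zero_right)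
    qed
    have wv: "adj w (v x) = 0" for x
      by (rule inner_eqI) (metis SD(2)[OF v] inner_adj_left inner_adj_right inner_commute inner_zero_left vw wb)
    define u where "u = v + w"
    have uu: "adj u o\<^sub>L u = e + (adj w o\<^sub>L w)"
      by (rule blinfun_eqI) (simp add: u_def SD[OF v] wb op_simps vw wv e_def)
    have "e o\<^sub>L (adj w o\<^sub>L w) = 0"
    proof -
      have "e (adj w x) = 0" for x
        by (rule inner_eqI) (simp add: self_adjointD(3)[OF projectionD(1)[OF e(1)]] inner_adj_left wb we)
      then show ?thesis by (intro blinfun_eqI) (simp add: blinfun.zero_left)
    qed
    then have "projection (adj u o\<^sub>L u)" unfolding uu by (rule projection_add[OF e(1) w(2)])
    moreover have "P (w x) = w x" for x
    proof -
      have "P ((P - f) (w x)) = (P - f) (w x)" using Pf P(2)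
        by (simp add: op_simps projectionD) (metis blinfun_apply_blinfun_compose)
      then show ?thesis by (simp only: w(4))
    qed
    moreover have "w (Q x) = w x" for x
    proof -
      have "(Q - e) (Q x) = (Q - e) x" using Qd(2) Q(2)
        by (simp add: op_simps projectionD) (metis blinfun_apply_blinfun_compose)
      then show ?thesis using w(5)[of x] w(5)[of "Q x"] by simp
    qed
    ultimately have "u \<in> S" using SD[OF v] w(1) by (auto simp: S_def u_def op_simps)
    moreover have "le v u" using SD(6)[OF v] we by (simp add: le_def u_def op_simps e_def)
    ultimately have "tr (adj u o\<^sub>L u) = tr e" using max by (simp add: e_def)
    moreover have "tr (adj w o\<^sub>L w) > 0"
    proof (rule tr_projection_pos[OF _ w(2)])
      show "adj w o\<^sub>L w \<noteq> 0" using q2_zero_imp[OF w(1)] w(3) tr_linear(4) unfolding q2_def by metis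
    qed (use w(1) in auto)
    ultimately show False using e w by (simp add: uu tr_linear mem)
  qed
  moreover then have "tr (P - f) = 0" using trd tr_linear(4) by simp
  then have "P - f = 0" using tr_projection_pos[of "P - f"] Pd(1) P f by force
  ultimately show thesis using that[of v] SD(1)[OF v] by (simp add: e_def f_def)
qed

end

section \<open>Maximal abelian subalgebras\<close>

locale masa_in_factor = finite_factor +
  fixes A :: "'a op set"
  assumes masa: "masa M A" and no_abelian: "\<And>P. abelian_projection M P \<Longrightarrow> P = 0"
begin

lemma A_sub_M: "T \<in> A \<Longrightarrow> T \<in> M"
  using masa by (auto simp: masa_def)

text \<open>A commuting adjoint-closed set between \<open>A\<close> and \<open>M\<close> has a
  double commutant that is an abelian von Neumann algebra inside \<open>M\<close>, so maximality
  identifies it with \<open>A\<close>. For \<open>S = A\<close> this shows that the MASA, defined as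
  a maximal abelian star-subalgebra, is a von Neumann algebra.\<close>

lemma masa_contains:
  assumes S: "A \<subseteq> S" "S \<subseteq> M" "\<And>T. T \<in> S \<Longrightarrow> adj T \<in> S" "\<And>T R. T \<in> S \<Longrightarrow> R \<in> S \<Longrightarrow> T o\<^sub>L R = R o\<^sub>L T"
  shows "von_neumann_algebra A" "S \<subseteq> A"
proof -
  define B where "B = commutant (commutant S)"
  have Sb: "S \<subseteq> bounded_ops" using S sub by blast
  have "von_neumann_algebra (commutant S)" using S Sb by (intro commutant_von_neumann) auto
  then have vnB: "von_neumann_algebra B"
    unfolding B_def by (intro commutant_von_neumann) (auto simp: commutant_subset von_neumann_algebra_def star_subalgebra_def)
  have SB: "S \<subseteq> B" unfolding B_def by (rule subset_double_commutant[OF Sb])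
  have "S \<subseteq> commutant S" using S(4) Sb by (auto simp: commutant_def)
  then have "B \<subseteq> commutant S" unfolding B_def using commutant_antimono by blast
  then have ab: "abelian B" by (auto simp: abelian_def B_def commutant_def)
  have "B \<subseteq> M" unfolding B_def using commutant_antimono[OF commutant_antimono[OF S(2)]] double_commutant by simp
  then have "B = A" using masa vnB ab SB S(1) unfolding masa_def von_neumann_algebra_def by blast
  then show "von_neumann_algebra A" "S \<subseteq> A" using vnB SB by auto
qed

sublocale A: abelian_vn_algebra A
proof
  have "star_subalgebra A" "abelian A" "A \<subseteq> M" using masa by (auto simp: masa_def)
  then show "von_neumann_algebra A" "abelian A"
    using masa_contains(1)[of A] by (auto simp: star_subalgebra_def abelian_def)
qed

text \<open>Adjoining an element to \<open>A\<close> must leave a commuting adjoint-closed set, so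
  the real and imaginary parts of \<open>T\<close> are adjoined separately; for this
  \<open>adj T\<close> must commute with \<open>A\<close>, which holds because \<open>A\<close> is
  closed under adjoints.\<close>

lemma relative_commutant:
  assumes T: "T \<in> M" and c: "\<And>R x. R \<in> A \<Longrightarrow> R (T x) = T (R x)"
  shows "T \<in> A"
proof -
  have sa: "X \<in> A" if "X \<in> M" "self_adjoint X" "\<And>R x. R \<in> A \<Longrightarrow> R (X x) = X (R x)" for X
  proof -
    have "insert X A \<subseteq> A"
      using that A_sub_M A.commute
      by (intro masa_contains(2)) (auto simp: self_adjointD(2) intro: commuteI commuteI[symmetric])
    then show ?thesis by blast
  qed
  have c': "R (adj T x) = adj T (R x)" if "R \<in> A" for R x
  proof (rule inner_eqI)
    fix y
    have "inner (R (adj T x)) y = inner x (T (adj R y))"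
      using inner_adj_right[OF A.sub[OF that], of "adj T x" y] inner_adj_left[OF sub[OF T], of x "adj R y"] by simp
    also have "\<dots> = inner (adj T (R x)) y"
      using c[OF A.adj[OF that], of y] inner_adj_right[OF A.sub[OF that], of x "T y"]
        inner_adj_left[OF sub[OF T], of "R x" y] by simp
    finally show "inner (R (adj T x)) y = inner (adj T (R x)) y" .
  qed
  obtain X Y where XY: "X \<in> M" "Y \<in> M" "self_adjoint X" "self_adjoint Y" "T = X + \<i> *\<^sub>C Y" "adj T = X - \<i> *\<^sub>C Y"
    using real_imaginary_parts[OF T] by metis
  have X: "X x = (1/2) *\<^sub>R (T x + adj T x)" for x
    unfolding XY(6) unfolding XY(5) by (simp add: op_simps flip: scaleR_2)
  have Y: "Y x = (- \<i>) *\<^sub>C (1/2) *\<^sub>R (T x - adj T x)" for x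
    unfolding XY(6) unfolding XY(5) by (simp add: op_simps scaleC_scaleC flip: scaleR_2)
  have "X \<in> A" by (rule sa[OF XY(1,3)]) (simp add: X c c' op_simps)
  moreover have "Y \<in> A"
  proof (rule sa[OF XY(2,4)])
    fix R x assume R: "R \<in> A"
    show "R (Y x) = Y (R x)" using R by (simp add: Y c c' op_simps bounded_opsD[OF A.sub[OF R]])
  qed
  ultimately show ?thesis unfolding XY(5) by auto
qed

text \<open>If \<open>e\<close> were minimal in \<open>A\<close>, every element of \<open>A\<close>
  would be scalar on \<open>e\<close>. Then \<open>e M e\<close> would commute with
  \<open>A\<close>, hence lie in \<open>A\<close> and be commutative, so \<open>e\<close> would be
  an abelian projection; there is none but 0.\<close>

lemma split_projection:
  assumes e: "e \<in> A" "projection e" "e \<noteq> 0"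
  obtains f where "f \<in> A" "projection f" "e o\<^sub>L f = f" "f \<noteq> 0" "f \<noteq> e"
proof (rule ccontr)
  assume "\<not> thesis"
  then have minimal: "f = 0 \<or> f = e" if "f \<in> A" "projection f" "e o\<^sub>L f = f" for f
    using that \<open>\<And>f. f \<in> A \<Longrightarrow> projection f \<Longrightarrow> e o\<^sub>L f = f \<Longrightarrow> f \<noteq> 0 \<Longrightarrow> f \<noteq> e \<Longrightarrow> thesis\<close> by blast
  have scalar: "nearly_scalar \<epsilon> a e" if "a \<in> A" "self_adjoint a" "\<epsilon> > 0" for a \<epsilon>
  proof (rule ccontr)
    assume ns: "\<not> nearly_scalar \<epsilon> a e"
    have "e = 0"
      \<comment> \<open>The property is \<open>f = 0\<close>: below \<open>e\<close> there are only
        0 and \<open>e\<close>, and \<open>e\<close> itself is not nearly scalar, so every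
        admissible \<open>f\<close> is 0; adding up gives \<open>e = 0\<close>.\<close>
      by (rule A.cut_induct[OF that e(1,2), where \<Phi> = "\<lambda>f. f = 0"]) (use minimal ns in auto)
    then show False using e by simp
  qed
  have corner: "y \<in> A" if y: "y \<in> M" "\<And>x. e (y x) = y x" "\<And>x. y (e x) = y x" for y
  proof (rule relative_commutant[OF y(1)])
    have sa: "a (y x) = y (a x)" if a: "a \<in> A" "self_adjoint a" for a x
    proof -
      have "norm (a (y x) - y (a x)) \<le> \<epsilon> * (norm (y x) + norm y * norm (e x))" if "\<epsilon> > 0" for \<epsilon>
      proof -
        obtain c where c: "\<And>x. norm (a (e x) - c *\<^sub>R e x) \<le> \<epsilon> * norm (e x)"
          using scalar[OF a \<open>\<epsilon> > 0\<close>] by (auto simp: nearly_scalar_def)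
        have ya: "y (a x) = y (a (e x))" using y(3)[of "a x"] A.commute'[OF e(1) a(1)] by metis
        have "a (y x) - y (a x) = (a (e (y x)) - c *\<^sub>R e (y x)) - y (a (e x) - c *\<^sub>R e x)"
          by (simp add: ya y op_simps)
        also have "norm \<dots> \<le> norm (a (e (y x)) - c *\<^sub>R e (y x)) + norm (y (a (e x) - c *\<^sub>R e x))"
          by (rule norm_triangle_ineq4)
        also have "\<dots> \<le> \<epsilon> * norm (y x) + norm y * (\<epsilon> * norm (e x))"
          using c[of "y x"] order_trans[OF norm_blinfun mult_left_mono[OF c norm_ge_zero], of y x] y(2)[of x]
          by (intro add_mono) simp_all
        finally show ?thesis by (simp add: algebra_simps)
      qed
      note b = this
      define k where "k = norm (y x) + norm y * norm (e x) + 1"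
      have k: "k > 0" by (simp add: k_def add_nonneg_pos)
      have "norm (a (y x) - y (a x)) \<le> 0"
      proof (rule field_le_epsilon)
        fix d :: real assume "d > 0"
        then have "norm (a (y x) - y (a x)) \<le> d / k * (norm (y x) + norm y * norm (e x))"
          using b[of "d / k"] k by simp
        also have "\<dots> \<le> d / k * k" using \<open>d > 0\<close> k by (intro mult_left_mono) (auto simp: k_def)
        finally show "norm (a (y x) - y (a x)) \<le> 0 + d" using k by simp
      qed
      then show ?thesis by simp
    qed
    fix R x assume "R \<in> A"
    then obtain X Y where XY: "X \<in> A" "Y \<in> A" "self_adjoint X" "self_adjoint Y" "R = X + \<i> *\<^sub>C Y"
      using A.real_imaginary_parts by metis
    show "R (y x) = y (R x)"
      unfolding XY(5) by (simp add: op_simps sa[OF XY(1,3)] sa[OF XY(2,4)] bounded_opsD[OF sub[OF y(1)]])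
  qed
  have "abelian_projection M e"
    unfolding abelian_projection_def
  proof (intro conjI ballI)
    fix S T assume "S \<in> M" "T \<in> M"
    then show "(e o\<^sub>L S o\<^sub>L e) o\<^sub>L (e o\<^sub>L T o\<^sub>L e) = (e o\<^sub>L T o\<^sub>L e) o\<^sub>L (e o\<^sub>L S o\<^sub>L e)"
      using e A_sub_M by (intro A.commute corner) (auto simp: projectionD)
  qed (use e A_sub_M in auto)
  then show False using no_abelian e by blast
qed

text \<open>Of the two parts of a splitting, one has at most half the trace.\<close>

lemma small_projection:
  assumes "f \<in> A" "projection f" "f \<noteq> 0"
  shows "\<exists>h\<in>A. projection h \<and> h \<noteq> 0 \<and> f o\<^sub>L h = h \<and> tr h \<le> tr f / 2 ^ k"
proof (induction k)
  case 0
  then show ?case using assms by (auto simp: projectionD)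
next
  case (Suc k)
  then obtain h where h: "h \<in> A" "projection h" "h \<noteq> 0" "f o\<^sub>L h = h" "tr h \<le> tr f / 2 ^ k" by blast
  obtain g where g: "g \<in> A" "projection g" "h o\<^sub>L g = g" "g \<noteq> 0" "g \<noteq> h" using split_projection h by metis
  note d = projection_diff[OF g(2) h(2) g(3)]
  have hd: "h o\<^sub>L (h - g) = h - g" using g(3) h(2) 
    by (intro blinfun_eqI) (simp add: op_simps projectionD, metis blinfun_apply_blinfun_compose)
  have sum: "tr g + tr (h - g) = tr h" using g h A_sub_M by (simp add: tr_linear)
  have fh: "f o\<^sub>L q = q" if "h o\<^sub>L q = q" for q using h(4) that by (metis blinfun_apply_blinfun_compose blinfun_eqI)
  show ?case
  proof (cases "tr g \<le> tr h / 2")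
    case True
    then show ?thesis using g h(5) fh[OF g(3)] by (intro bexI[of _ g]) auto
  next
    case False
    then have "tr (h - g) \<le> tr f / 2 ^ Suc k" using sum h(5) by simp
    then show ?thesis using g h d(1) fh[OF hd] by (intro bexI[of _ "h - g"]) auto
  qed
qed

text \<open>An intermediate value property. The ordering principle gives a projection
  \<open>g\<close> below \<open>e\<close> that cannot be enlarged to a greater trace within the
  bound \<open>c\<close>; chains are bounded by their strong limits. If \<open>g\<close> missed
  \<open>c\<close>, a sufficiently small projection below \<open>e - g\<close> could be
  added.\<close>

lemma exact_trace:
  assumes e: "e \<in> A" "projection e" and c: "0 \<le> c" "c \<le> tr e"
  obtains g where "g \<in> A" "projection g" "e o\<^sub>L g = g" "tr g = c"
proof -
  define S where "S = {g \<in> A. projection g \<and> e o\<^sub>L g = g \<and> tr g \<le> c}"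
  obtain g where g: "g \<in> S" and max: "\<And>u. u \<in> S \<Longrightarrow> g \<preceq> u \<Longrightarrow> tr u = tr g"
  proof (rule maximal_by_measure[of 0 S "(\<preceq>)" tr c])
    show "0 \<in> S" using c by (simp add: S_def tr_linear)
    show "tr s \<le> tr t" if "s \<in> S" "t \<in> S" "s \<preceq> t" for s t using that A_sub_M by (intro tr_mono) (auto simp: S_def)
    fix X assume X: "\<And>n. X n \<in> S" "\<And>n. X n \<preceq> X (Suc n)"
    have p: "projection (X n)" "X n \<in> A" "X n \<in> M" "e o\<^sub>L X n = X n" "tr (X n) \<le> c" for n
      using X A_sub_M by (auto simp: S_def)
    obtain G where G: "sconv X G" "\<And>n. X n \<preceq> G"
      using monotone_sconv[of X 1] p X(2) projection_le_id by (metis projectionD(1) scaleR_one)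
    have "sconv (\<lambda>n. X n o\<^sub>L X n) (G o\<^sub>L G)"
      by (rule sconv_compose[OF G(1,1), of 1])
        (rule norm_le_one[OF projection_positive[OF p(1)] projection_le_id[OF p(1)]])
    then have "sconv X (G o\<^sub>L G)" by (simp only: projectionD(5)[OF p(1)])
    then have "G o\<^sub>L G = G" by (rule sconv_unique[OF _ G(1)])
    moreover have "self_adjoint G" using sconv_self_adjoint[OF G(1)] p projectionD(1) by blast
    ultimately have "projection G" by (simp add: projection_def)
    moreover have "G \<in> A" using A.sconv_mem[OF p(2) G(1)] .
    moreover have "e o\<^sub>L G = G"
    proof (rule blinfun_eqI)
      fix v
      have "(\<lambda>n. e (X n v)) = (\<lambda>n. X n v)" using p(4) by (metis blinfun_apply_blinfun_compose)
      then show "(e o\<^sub>L G) v = G v"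
        using LIMSEQ_unique[OF tendsto_blinfun_apply[OF sconvD[OF G(1)], of e v]] sconvD[OF G(1), of v] by simp
    qed
    moreover have "tr G \<le> c"
    proof (rule LIMSEQ_le_const2)
      show "(\<lambda>n. tr (X n)) \<longlonglongrightarrow> tr G"
        by (rule normal_state_sconv[OF normal_state_tr, where K = 1])
          (use p X(2) G(1) projection_le_id[OF p(1)] projectionD(1)[OF p(1)] in auto)
    qed (use p in blast)
    ultimately show "\<exists>u\<in>S. \<forall>n. X n \<preceq> u" using G(2) by (intro bexI[of _ G]) (auto simp: S_def)
  next
    show "s \<preceq> u" if "s \<preceq> t" "t \<preceq> u" for s t u using op_le_trans[OF that] .
    show "tr s \<le> c" if "s \<in> S" for s using that by (simp add: S_def)
    show "s \<preceq> s" for s :: "'a op" by (rule op_le_refl)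
  qed blast
  have gS: "g \<in> A" "projection g" "e o\<^sub>L g = g" "tr g \<le> c" using g by (auto simp: S_def)
  note d = projection_diff[OF gS(2) e(2) gS(3)]
  have "tr g = c"
  proof (rule ccontr)
    assume "tr g \<noteq> c"
    then have less: "tr g < c" using gS by simp
    then have "tr (e - g) > 0" using e gS c A_sub_M by (simp add: tr_linear)
    then have "e - g \<noteq> 0" using tr_linear(4) by auto
    obtain k where k: "tr (e - g) / (c - tr g) < 2 ^ k" using real_arch_pow[of 2] by auto
    obtain h where h: "h \<in> A" "projection h" "h \<noteq> 0" "(e - g) o\<^sub>L h = h" "tr h \<le> tr (e - g) / 2 ^ k"
      using small_projection[of "e - g" k] \<open>e - g \<noteq> 0\<close> d(1) e gS by blast
    have "tr (e - g) / 2 ^ k \<le> c - tr g" using k less by (simp add: field_simps)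
    then have trh: "tr g + tr h \<le> c" using h by simp
    have "g o\<^sub>L h = 0"
      using d(3) h(4) by (metis blinfun_apply_blinfun_compose blinfun_eqI blinfun.zero_left)
    then have p: "projection (g + h)" by (rule projection_add[OF gS(2) h(2)])
    have ed: "e o\<^sub>L (e - g) = e - g" using gS(3) e(2)
      by (intro blinfun_eqI) (simp add: op_simps projectionD, metis blinfun_apply_blinfun_compose)
    have "e o\<^sub>L h = h" using h(4) ed by (metis blinfun_apply_blinfun_compose blinfun_eqI)
    then have "e o\<^sub>L (g + h) = g + h"
      using gS(3) by (intro blinfun_eqI) (simp add: op_simps, metis blinfun_apply_blinfun_compose)
    then have "g + h \<in> S" using p gS h trh A_sub_M by (auto simp: S_def tr_linear)
    moreover have "g \<preceq> g + h" using h projection_positive by (simp add: op_le_def)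
    ultimately have "tr (g + h) = tr g" using max by blast
    then show False using tr_projection_pos[of h] h gS A_sub_M by (simp add: tr_linear)
  qed
  then show thesis using that gS by blast
qed

lemma split_trace:
  fixes d :: nat
  assumes "e \<in> A" "projection e" "\<And>i. i < d \<Longrightarrow> 0 \<le> c i" "(\<Sum>i<d. c i) = tr e"
  shows "\<exists>f. (\<forall>i<d. f i \<in> A \<and> projection (f i) \<and> tr (f i) = c i \<and> e o\<^sub>L f i = f i) \<and>
    (\<forall>i<d. \<forall>j<d. i \<noteq> j \<longrightarrow> f i o\<^sub>L f j = 0) \<and> (\<Sum>i<d. f i) = e"
  using assms
proof (induction d arbitrary: e)
  case 0
  then have "e = 0" using tr_projection_pos[of e] A_sub_M by force
  then show ?case by simp
next
  case (Suc d)
  have "0 \<le> (\<Sum>i<d. c i)" using Suc.prems by (intro sum_nonneg) auto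
  then have "c d \<le> tr e" using Suc.prems(4) by simp
  then obtain g where g: "g \<in> A" "projection g" "e o\<^sub>L g = g" "tr g = c d"
    using exact_trace[OF Suc.prems(1,2), of "c d"] Suc.prems(3) by auto
  note dd = projection_diff[OF g(2) Suc.prems(2) g(3)]
  have m: "e - g \<in> A" using Suc.prems g by auto
  have ed: "e o\<^sub>L (e - g) = e - g" using g(3) Suc.prems(2)
    by (intro blinfun_eqI) (simp add: op_simps projectionD, metis blinfun_apply_blinfun_compose)
  have "\<exists>f. (\<forall>i<d. f i \<in> A \<and> projection (f i) \<and> tr (f i) = c i \<and> (e - g) o\<^sub>L f i = f i) \<and>
    (\<forall>i<d. \<forall>j<d. i \<noteq> j \<longrightarrow> f i o\<^sub>L f j = 0) \<and> (\<Sum>i<d. f i) = e - g"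
    using Suc.prems g A_sub_M dd(1) m by (intro Suc.IH) (auto simp: tr_linear)
  then obtain f where f: "\<And>i. i < d \<Longrightarrow> f i \<in> A \<and> projection (f i) \<and> tr (f i) = c i \<and> (e - g) o\<^sub>L f i = f i"
    "\<And>i j. i < d \<Longrightarrow> j < d \<Longrightarrow> i \<noteq> j \<Longrightarrow> f i o\<^sub>L f j = 0" "(\<Sum>i<d. f i) = e - g" by blast
  have z: "g o\<^sub>L f i = 0" "f i o\<^sub>L g = 0" "e o\<^sub>L f i = f i" if "i < d" for i
  proof -
    show z: "g o\<^sub>L f i = 0"
      using f(1)[OF that] dd(3) by (metis blinfun_apply_blinfun_compose blinfun_eqI blinfun.zero_left)
    then show "f i o\<^sub>L g = 0" using projection_commute_zero[OF g(2)] f(1)[OF that] by blast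
    show "e o\<^sub>L f i = f i" using f(1)[OF that] ed by (metis blinfun_apply_blinfun_compose blinfun_eqI)
  qed
  define f' where "f' i = (if i = d then g else f i)" for i
  have "(\<Sum>i<Suc d. f' i) = e" using f(3) by (simp add: f'_def)
  moreover have "\<forall>i<Suc d. f' i \<in> A \<and> projection (f' i) \<and> tr (f' i) = c i \<and> e o\<^sub>L f' i = f' i"
    using f(1) z g by (auto simp: f'_def less_Suc_eq)
  moreover have "\<forall>i<Suc d. \<forall>j<Suc d. i \<noteq> j \<longrightarrow> f' i o\<^sub>L f' j = 0"
    using f(2) z by (auto simp: f'_def less_Suc_eq)
  ultimately show ?case by blast
qed

text \<open>By \<open>exact_trace\<close> some projection of \<open>A\<close> has the trace of
  \<open>P\<close>. It is split in \<open>A\<close>, and a partial isometry carries the pieces to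
  \<open>P\<close>.\<close>

lemma split_trace_M:
  fixes d :: nat
  assumes P: "P \<in> M" "projection P" and c: "\<And>i. i < d \<Longrightarrow> 0 \<le> c i" "(\<Sum>i<d. c i) = tr P"
  obtains l where "\<And>i. i < d \<Longrightarrow> l i \<in> M \<and> projection (l i) \<and> tr (l i) = c i"
    "\<And>i j. i < d \<Longrightarrow> j < d \<Longrightarrow> i \<noteq> j \<Longrightarrow> l i o\<^sub>L l j = 0" "(\<Sum>i<d. l i) = P"
proof -
  have "0 \<le> tr P" "tr P \<le> tr id_blinfun"
    using tr_nonneg[OF P(1) projection_positive[OF P(2)]] tr_mono[OF P(1) id projection_le_id[OF P(2)]] by auto
  then obtain g where g: "g \<in> A" "projection g" "tr g = tr P"
    using exact_trace[of id_blinfun "tr P"] by auto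
  obtain f where f: "\<And>i. i < d \<Longrightarrow> f i \<in> A \<and> projection (f i) \<and> tr (f i) = c i \<and> g o\<^sub>L f i = f i"
    "\<And>i j. i < d \<Longrightarrow> j < d \<Longrightarrow> i \<noteq> j \<Longrightarrow> f i o\<^sub>L f j = 0" "(\<Sum>i<d. f i) = g"
  proof -
    have "(\<Sum>i<d. c i) = tr g" using c(2) g(3) by simp
    from split_trace[OF g(1,2) c(1) this] show ?thesis using that by blast
  qed
  obtain v where v: "v \<in> M" "adj v o\<^sub>L v = g" "v o\<^sub>L adj v = P"
    using equal_trace_equivalent[OF P A_sub_M[OF g(1)] g(2)] g(3) by metis
  have vb: "v \<in> bounded_ops" using v sub by blast
  have vv: "adj v (v x) = g x" for x using v(2) by (metis blinfun_apply_blinfun_compose)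
  have gf: "g (f i x) = f i x" if "i < d" for i x using f(1)[OF that] by (metis blinfun_apply_blinfun_compose)
  define l where "l i = v o\<^sub>L f i o\<^sub>L adj v" for i
  show thesis
  proof
    fix i assume i: "i < d"
    have fi: "f i \<in> M" "projection (f i)" "tr (f i) = c i" using f(1)[OF i] A_sub_M by auto
    have "self_adjoint (l i)"
      using self_adjoint_intros(8)[of "adj v" "f i"] vb projectionD(1)[OF fi(2)] by (simp add: l_def)
    moreover have "l i (l i x) = l i x" for x
      by (simp add: l_def vv gf[OF i] projectionD(4)[OF fi(2)])
    moreover have "tr (l i) = tr ((f i o\<^sub>L adj v) o\<^sub>L v)"
    proof -
      have "l i = v o\<^sub>L (f i o\<^sub>L adj v)" unfolding l_def by (rule blinfun_eqI) simp
      then show ?thesis using tr_commute v(1) fi by (simp add: mem)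
    qed
    moreover have "(f i o\<^sub>L adj v) o\<^sub>L v = f i"
    proof -
      have "f i o\<^sub>L g = f i" using projection_diff(2)[OF fi(2) g(2)] f(1)[OF i] by blast
      then show ?thesis by (intro blinfun_eqI) (simp add: vv, metis blinfun_apply_blinfun_compose)
    qed
    ultimately show "l i \<in> M \<and> projection (l i) \<and> tr (l i) = c i"
      using v(1) fi by (auto simp: projection_iff l_def)
    fix j assume j: "j < d" "i \<noteq> j"
    have "f i (f j x) = 0" for x using f(2)[OF i j] by (metis blinfun_apply_blinfun_compose blinfun.zero_left)
    then show "l i o\<^sub>L l j = 0" by (intro blinfun_eqI) (simp add: l_def vv gf[OF j(1)] op_simps)
  next
    have "(\<Sum>i<d. l i) x = v (g (adj v x))" for x
      by (simp add: l_def op_simps f(3)[symmetric])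
    also have "v (g (adj v x)) = P x" for x
      using arg_cong[OF v(3), of "\<lambda>T. T (P x)"] projectionD(4)[OF P(2), of x]
      by (simp add: vv[symmetric] v(3)[symmetric])
    finally show "(\<Sum>i<d. l i) = P" by (intro blinfun_eqI)
  qed
qed

end

section \<open>The conditional expectation preserves the trace\<close>

lemma unitary_norm_le:
  assumes "unitary u"
  shows "norm u \<le> 1" "norm (adj u) \<le> 1"
proof -
  have *: "norm v \<le> 1" if "unitary v" for v :: "'a op"
  proof (rule norm_blinfun_bound)
    fix x
    have "(norm (v x))\<^sup>2 = (norm x)\<^sup>2"
      using norm_op_square[of v x] that unitary_apply[OF that] by (simp add: unitary_def power2_norm_eq_inner)
    then show "norm (v x) \<le> 1 * norm x" by (simp add: power2_eq_iff_nonneg)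
  qed simp
  show "norm u \<le> 1" using * assms by blast
  have "unitary (adj u)" using assms by (simp add: unitary_def)
  then show "norm (adj u) \<le> 1" using * by blast
qed

lemma norm_unitary_conj_le:
  assumes "unitary u"
  shows "norm (u o\<^sub>L T o\<^sub>L adj u) \<le> norm T"
proof -
  have "norm (u o\<^sub>L T o\<^sub>L adj u) \<le> norm (u o\<^sub>L T) * norm (adj u)" by (rule norm_blinfun_compose)
  also have "\<dots> \<le> norm (u o\<^sub>L T) * 1" using unitary_norm_le[OF assms] by (intro mult_left_mono) auto
  also have "\<dots> \<le> norm u * norm T" using norm_blinfun_compose[of u T] by simp
  also have "\<dots> \<le> 1 * norm T" using unitary_norm_le[OF assms] by (intro mult_right_mono) auto
  finally show ?thesis by simp
qed

lemma self_adjoint_shift_positive: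
  assumes "self_adjoint T"
  shows "positive_op (T + norm T *\<^sub>R id_blinfun)"
  using op_le_norm(2)[OF assms] by (simp add: op_le_def)

locale masa_expectation = masa_in_factor +
  fixes E :: "'a op \<Rightarrow> 'a op"
  assumes expectation: "normal_conditional_expectation M A E"
begin

lemma E_mem: "T \<in> M \<Longrightarrow> E T \<in> A"
  and E_add: "S \<in> M \<Longrightarrow> T \<in> M \<Longrightarrow> E (S + T) = E S + E T"
  and E_scaleC: "T \<in> M \<Longrightarrow> E (c *\<^sub>C T) = c *\<^sub>C E T"
  and E_pos: "T \<in> M \<Longrightarrow> positive_op T \<Longrightarrow> positive_op (E T)"
  and E_fix: "T \<in> A \<Longrightarrow> E T = T"
  and E_bimodule: "R \<in> A \<Longrightarrow> S \<in> A \<Longrightarrow> T \<in> M \<Longrightarrow> E (R o\<^sub>L T o\<^sub>L S) = R o\<^sub>L E T o\<^sub>L S"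
  using expectation by (auto simp: normal_conditional_expectation_def complex_linear_on_def)

lemma E_scaleR: "T \<in> M \<Longrightarrow> E (r *\<^sub>R T) = r *\<^sub>R E T"
  using E_scaleC by (simp add: scaleR_scaleC)

lemma E_zero: "E 0 = 0"
  using E_fix by blast

lemma E_diff: "S \<in> M \<Longrightarrow> T \<in> M \<Longrightarrow> E (S - T) = E S - E T"
  using E_add[of S "(-1) *\<^sub>R T"] E_scaleR[of T "-1"] scaleR[of T "-1"] by simp

lemma E_sum: "(\<And>i. i \<in> I \<Longrightarrow> f i \<in> M) \<Longrightarrow> E (\<Sum>i\<in>I. f i) = (\<Sum>i\<in>I. E (f i))"
  by (induction I rule: infinite_finite_induct) (auto simp: E_zero E_add sum)

lemma E_sum_scaleC:
  assumes "\<And>i. i \<in> I \<Longrightarrow> f i \<in> M"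
  shows "E (\<Sum>i\<in>I. c i *\<^sub>C f i) = (\<Sum>i\<in>I. c i *\<^sub>C E (f i))"
proof -
  have "E (\<Sum>i\<in>I. c i *\<^sub>C f i) = (\<Sum>i\<in>I. E (c i *\<^sub>C f i))" using assms by (intro E_sum scaleC)
  also have "\<dots> = (\<Sum>i\<in>I. c i *\<^sub>C E (f i))" using assms by (intro sum.cong refl E_scaleC)
  finally show ?thesis .
qed

lemma E_mono: "S \<in> M \<Longrightarrow> T \<in> M \<Longrightarrow> S \<preceq> T \<Longrightarrow> E S \<preceq> E T"
  using E_pos[of "T - S"] E_diff[of T S] diff by (auto simp: op_le_def)

lemma E_self_adjoint:
  assumes "T \<in> M" "self_adjoint T"
  shows "self_adjoint (E T)"
proof -
  have "E (T + norm T *\<^sub>R id_blinfun) = E T + norm T *\<^sub>R id_blinfun"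
    using assms by (simp add: E_add mem E_scaleR E_fix)
  moreover have "self_adjoint (E (T + norm T *\<^sub>R id_blinfun))"
    using E_pos[OF _ self_adjoint_shift_positive[OF assms(2)]] assms positive_opD(1) mem by blast
  ultimately show ?thesis
    using self_adjoint_intros(4)[OF _ self_adjoint_intros(5)[OF self_adjoint_intros(2)], of "E T + norm T *\<^sub>R id_blinfun" "norm T"]
    by simp
qed

text \<open>This second state is compared with \<open>tr\<close> in \<open>tr_E_contraction\<close>.
  Normality of \<open>E\<close> yields a least upper bound in \<open>A\<close> and not a strong
  limit; but the strong limit of \<open>E (X n)\<close> is also the least upper bound in
  \<open>A\<close>, so the two are equal and normality of \<open>tr\<close> applies.\<close>

lemma normal_state_tr_E: "normal_state (\<lambda>T. tr (E T))"
proof (rule normal_stateI)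
  fix S T assume "S \<in> M" "T \<in> M"
  then show "tr (E (S + T)) = tr (E S) + tr (E T)" using E_mem A_sub_M by (simp add: E_add tr_linear)
next
  fix r T assume "T \<in> M"
  then show "tr (E (r *\<^sub>R T)) = r * tr (E T)" using E_mem A_sub_M by (simp add: E_scaleR tr_linear)
next
  fix T assume "T \<in> M" "positive_op T"
  then show "0 \<le> tr (E T)" using E_mem A_sub_M E_pos tr_nonneg by blast
next
  show "tr (E id_blinfun) = 1" by (simp add: E_fix tr_linear)
next
  fix X :: "nat \<Rightarrow> 'a op" and T
  assume d: "directed_in M (range X)" and l: "lub_in M (range X) T" and inc: "\<And>n. X n \<preceq> X (Suc n)"
    and X: "\<And>n. X n \<in> M"
  have sa: "self_adjoint (X n)" "X n \<preceq> T" for n using d l by (auto simp: directed_in_def lub_in_def)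
  have T: "T \<in> M" "self_adjoint T" using l by (auto simp: lub_in_def)
  define Y where "Y n = E (X n)" for n
  have Y: "Y n \<in> A" "Y n \<in> M" "self_adjoint (Y n)" "Y n \<preceq> Y (Suc n)" "Y n \<preceq> norm T *\<^sub>R id_blinfun" for n
  proof -
    show "Y n \<in> A" "Y n \<in> M" using X E_mem A_sub_M by (auto simp: Y_def)
    show "self_adjoint (Y n)" unfolding Y_def by (rule E_self_adjoint[OF X sa(1)])
    show "Y n \<preceq> Y (Suc n)" unfolding Y_def by (rule E_mono[OF X X inc])
    have "E (X n) \<preceq> E (norm T *\<^sub>R id_blinfun)"
      using op_le_trans[OF sa(2) op_le_norm(1)[OF T(2)]] X by (intro E_mono) auto
    then show "Y n \<preceq> norm T *\<^sub>R id_blinfun" by (simp add: Y_def E_fix A.scaleR)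
  qed
  have "\<exists>L. sconv Y L \<and> (\<forall>n. Y n \<preceq> L)"
    by (rule monotone_sconv[of Y "norm T", OF Y(3,4,5)]) blast
  then obtain L where L: "sconv Y L" "\<And>n. Y n \<preceq> L" by blast
  have lubL: "lub_in A (range Y) L" by (rule A.lub_in_sequence(2)[OF Y(1,3,4,5) L(1)])
  have "lub_in A (range Y) (E T)"
  proof -
    have "lub_in A (E ` range X) (E T)"
      using expectation d l unfolding normal_conditional_expectation_def by blast
    then show ?thesis by (simp add: Y_def[abs_def] image_image)
  qed
  then have eq: "E T = L" using lubL unfolding lub_in_def by (intro op_le_antisym) auto
  have LM: "L \<in> M" using eq E_mem[OF T(1)] A_sub_M by auto
  have lim: "(\<lambda>n. tr (Y n)) \<longlonglongrightarrow> tr L" by (rule normal_state_sconv[OF normal_state_tr Y(2-5) L(1)])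
  have "incseq (\<lambda>n. tr (Y n))" by (intro incseq_SucI tr_mono Y)
  moreover have "bdd_above (range (\<lambda>n. tr (Y n)))"
    using tr_mono[OF Y(2) LM L(2)] by (intro bdd_aboveI[of _ "tr L"]) auto
  ultimately have "(\<lambda>n. tr (Y n)) \<longlonglongrightarrow> (SUP n. tr (Y n))" by (intro LIMSEQ_incseq_SUP)
  then show "tr (E T) = (SUP n. tr (E (X n)))" using LIMSEQ_unique[OF lim] by (simp add: eq Y_def)
qed

text \<open>On the convex set of all \<open>x\<close> with the same values as \<open>T\<close> under both states, the minimal element is
  invariant under the unitaries of \<open>A\<close>, hence lies in \<open>A\<close>, where the two states agree.\<close>

lemma tr_E_contraction:
  assumes T: "T \<in> M" "self_adjoint T" "norm T \<le> 1"
  shows "tr (E T) = tr T"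
proof -
  define C where "C = {x \<in> M. self_adjoint x \<and> norm x \<le> 1 \<and> tr x = tr T \<and> tr (E x) = tr (E T)}"
  note ns = normal_state_tr normal_state_tr_E
  obtain F where F: "F \<in> C"
    "\<And>u. u \<in> M \<Longrightarrow> unitary u \<Longrightarrow> (\<And>T. T \<in> C \<Longrightarrow> u o\<^sub>L T o\<^sub>L adj u \<in> C) \<Longrightarrow> u o\<^sub>L F o\<^sub>L adj u = F"
  proof (rule minimal_element[of C 1])
    show "C \<noteq> {}" using T by (auto simp: C_def)
    show "S \<in> M \<and> norm S \<le> 1" if "S \<in> C" for S using that by (simp add: C_def)
    show "(1/2) *\<^sub>R (R + S) \<in> C" if "R \<in> C" "S \<in> C" for R S
    proof -
      have "norm (R + S) \<le> 2" using norm_triangle_ineq[of R S] that by (simp add: C_def)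
      then have "norm ((1/2) *\<^sub>R (R + S)) \<le> 1" by simp
      then show ?thesis
        using that by (auto simp del: norm_scaleR simp: C_def mem normal_state_linear[OF ns(1)] normal_state_linear[OF ns(2)]
            intro!: self_adjoint_intros)
    qed
    fix X S assume X: "\<And>n. X n \<in> C" "S \<in> M" "norm S \<le> 1" "sconv X S" "order_conv X S"
    have XC: "X n \<in> M" "self_adjoint (X n)" "tr (X n) = tr T" "tr (E (X n)) = tr (E T)" for n
      using X(1)[of n] by (auto simp: C_def)
    have "self_adjoint S" using sconv_self_adjoint[OF X(4) XC(2)] .
    moreover from order_conv_state[OF ns(1) XC(1,2) X(2) this X(5)] order_conv_state[OF ns(2) XC(1,2) X(2) this X(5)]
    have "tr S = tr T" "tr (E S) = tr (E T)" using XC by (auto simp: LIMSEQ_const_iff)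
    ultimately show "S \<in> C" using X by (simp add: C_def)
  qed blast
  have FM: "F \<in> M" "F \<in> bounded_ops" using F sub by (auto simp: C_def)
  \<comment> \<open>For unitaries of \<open>A\<close> the bimodule property makes \<open>E\<close>
    commute with the conjugation, so the values of both states are kept.\<close>
  have inv: "u o\<^sub>L F o\<^sub>L adj u = F" if u: "u \<in> A" "unitary u" for u
  proof (rule F(2)[OF A_sub_M[OF u(1)] u(2)])
    fix S assume S: "S \<in> C"
    have uM: "u \<in> M" "adj u \<in> A" "u \<in> bounded_ops" using u A_sub_M A.sub by auto
    have tr_u: "tr (u o\<^sub>L R o\<^sub>L adj u) = tr R" if "R \<in> M" for R
    proof -
      have "u o\<^sub>L R o\<^sub>L adj u = u o\<^sub>L (R o\<^sub>L adj u)" "(R o\<^sub>L adj u) o\<^sub>L u = R"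
        by (rule blinfun_eqI; simp add: unitary_apply[OF u(2)])+
      then show ?thesis using tr_commute[of u "R o\<^sub>L adj u"] that uM by auto
    qed
    have "E (u o\<^sub>L S o\<^sub>L adj u) = u o\<^sub>L E S o\<^sub>L adj u" using E_bimodule[OF u(1) uM(2)] S by (simp add: C_def)
    moreover have "E S \<in> M" using S E_mem A_sub_M by (simp add: C_def)
    moreover have "self_adjoint (u o\<^sub>L S o\<^sub>L adj u)"
      using self_adjoint_intros(8)[of "adj u" S] S uM by (simp add: C_def)
    moreover have "norm (u o\<^sub>L S o\<^sub>L adj u) \<le> 1"
      using norm_unitary_conj_le[OF u(2), of S] S by (simp add: C_def)
    ultimately show "u o\<^sub>L S o\<^sub>L adj u \<in> C" using S uM tr_u by (auto simp: C_def)
  qed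
  have "F \<in> A"
  proof (rule relative_commutant[OF FM(1)])
    fix R x assume "R \<in> A"
    then show "R (F x) = F (R x)"
      using A.commute_unitaries_imp_commute[OF FM(2) inv] commute_apply by blast
  qed
  then show ?thesis using F(1) by (simp add: C_def E_fix)
qed

lemma tau_self_adjoint:
  assumes "T \<in> M" "self_adjoint T"
  shows "\<tau> T = complex_of_real (tr T)"
proof -
  have "\<tau> (T + norm T *\<^sub>R id_blinfun) = complex_of_real (tr (T + norm T *\<^sub>R id_blinfun))"
    using assms by (intro tau_positive self_adjoint_shift_positive) auto
  moreover have "\<tau> (norm T *\<^sub>R id_blinfun) = complex_of_real (norm T)"
    unfolding scaleR_scaleC by (simp add: tau_scaleC tau_id)
  ultimately show ?thesis using assms by (simp add: tr_linear tau_add scaleR)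
qed

lemma tau_E:
  assumes "T \<in> M"
  shows "\<tau> (E T) = \<tau> T"
proof -
  have sa: "\<tau> (E T) = \<tau> T" if T: "T \<in> M" "self_adjoint T" for T
  proof -
    define c where "c = norm T + 1"
    have c: "c > 0" "norm T \<le> c" by (simp_all add: c_def add_nonneg_pos)
    have "tr (E ((1 / c) *\<^sub>R T)) = tr ((1 / c) *\<^sub>R T)"
      using T c by (intro tr_E_contraction) (auto simp: self_adjoint_intros)
    then have "tr (E T) = tr T" using T c E_mem A_sub_M by (simp add: E_scaleR tr_linear)
    then show ?thesis using T E_mem A_sub_M E_self_adjoint tau_self_adjoint by simp
  qed
  obtain X Y where XY: "X \<in> M" "Y \<in> M" "self_adjoint X" "self_adjoint Y" "T = X + \<i> *\<^sub>C Y"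
    using real_imaginary_parts[OF assms] by metis
  have "E X \<in> M" "E Y \<in> M" using XY E_mem A_sub_M by auto
  then show ?thesis
    unfolding XY(5) using XY(1-4) by (simp add: E_add E_scaleC tau_add tau_scaleC scaleC sa)
qed

lemma positive_summand_le_id:
  fixes B :: "nat \<Rightarrow> 'a op"
  assumes "k \<in> {1..n}" "\<And>k. k \<in> {1..n} \<Longrightarrow> positive_op (B k)" "(\<Sum>k=1..n. B k) = id_blinfun"
  shows "B k \<preceq> id_blinfun"
proof -
  have "id_blinfun - B k = (\<Sum>j\<in>{1..n} - {k}. B j)"
    using sum.remove[of "{1..n}" k B] assms(1,3) by (metis add_diff_cancel_left' finite_atLeastAtMost)
  then show ?thesis using assms(2) by (auto simp: op_le_def intro!: positive_op_sum)
qed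

section \<open>Limits of diagonals are given by partitions of unity\<close>

lemma closure_orbit_imp_partition:
  fixes P :: "nat \<Rightarrow> 'a op" and z :: "nat \<Rightarrow> complex"
  assumes P: "\<And>k. k \<in> {1..n} \<Longrightarrow> P k \<in> M \<and> positive_op (P k)" "(\<Sum>k=1..n. P k) = id_blinfun"
    and D: "D \<in> closure (expectation_orbit M E (\<Sum>k=1..n. z k *\<^sub>C P k))"
  shows "\<exists>B. partition_of_unity A n B \<and> (\<forall>k\<in>{1..n}. \<tau> (B k) = \<tau> (P k)) \<and> (\<Sum>k=1..n. z k *\<^sub>C B k) = D"
proof -
  \<comment> \<open>The equation with \<open>D\<close> is relaxed to an error
    \<open>1 / Suc m\<close>, since \<open>D\<close> is only approximated by diagonals; the sets
    shrink with \<open>m\<close>, and in the limit the equation is exact.\<close>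
  define C where "C m = {B :: nat \<Rightarrow> 'a op. (\<forall>k\<in>{1..n}. B k \<in> A \<and> positive_op (B k) \<and> \<tau> (B k) = \<tau> (P k)) \<and>
    (\<Sum>k=1..n. B k) = id_blinfun \<and> norm ((\<Sum>k=1..n. z k *\<^sub>C B k) - D) \<le> 1 / Suc m}" for m :: nat
  \<comment> \<open>Summing over \<open>k\<close> treats the family as one vector, so that a single
    minimisation and a single subsequence serve all components.\<close>
  define q where "q B = (\<Sum>k=1..n. q2 (B k))" for B
  define d where "d B B' = (\<Sum>k=1..n. q2 (B k - B' k))" for B B' :: "nat \<Rightarrow> 'a op"
  define mid where "mid B B' = (\<lambda>k. (1/2) *\<^sub>R (B k + B' k))" for B B' :: "nat \<Rightarrow> 'a op"
  have CD: "B k \<in> A" "B k \<in> M" "positive_op (B k)" "\<tau> (B k) = \<tau> (P k)" if "B \<in> C m" "k \<in> {1..n}" for B k m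
    using that A_sub_M by (auto simp: C_def)
  have Cnorm: "norm (B k) \<le> 1" "q2 (B k) \<le> 1" if "B \<in> C m" "k \<in> {1..n}" for B k m
  proof -
    have le: "B k \<preceq> id_blinfun"
      using CD(3)[OF that(1)] that by (intro positive_summand_le_id[of k n]) (auto simp: C_def)
    show "norm (B k) \<le> 1" using norm_le_one CD(3)[OF that] le by blast
    have "q2 (B k) = tr (B k o\<^sub>L B k)" using CD(3)[OF that] by (simp add: q2_def self_adjointD(2) positive_opD)
    also have "\<dots> \<le> tr id_blinfun"
      using op_le_trans[OF square_le[OF CD(3)[OF that] le] le] CD(2)[OF that] by (intro tr_mono) auto
    finally show "q2 (B k) \<le> 1" by (simp add: tr_linear)
  qed
  have half: "z *\<^sub>C ((1/2) *\<^sub>R (S + T)) = (1/2) *\<^sub>R (z *\<^sub>C S + z *\<^sub>C (T :: 'a op))" for z S T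
    by (rule blinfun_eqI) (simp add: op_simps scaleC_scaleR_commute scaleC_add_right)
  have "\<exists>B. B \<in> C m" for m
  proof -
    have "0 < 1 / real (Suc m)" by simp
    then obtain Y where Y: "Y \<in> expectation_orbit M E (\<Sum>k=1..n. z k *\<^sub>C P k)" "dist Y D < 1 / Suc m"
      using D unfolding closure_approachable by blast
    then obtain U where U: "U \<in> M" "unitary U" "Y = E (adj U o\<^sub>L (\<Sum>k=1..n. z k *\<^sub>C P k) o\<^sub>L U)"
      by (auto simp: expectation_orbit_def)
    have aU: "adj U \<in> M" "adj U \<in> bounded_ops" "U \<in> bounded_ops" using U sub by auto
    define R where "R k = adj U o\<^sub>L P k o\<^sub>L U" for k
    have R: "R k \<in> M" "positive_op (R k)" if "k \<in> {1..n}" for k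
      using P(1)[OF that] U aU by (auto simp: R_def positive_op_intros)
    have "(\<Sum>k=1..n. R k) x = x" for x
      using arg_cong[OF P(2), of "\<lambda>T. adj U (T (U x))"] by (simp add: R_def op_simps unitary_apply[OF U(2)])
    then have sumR: "(\<Sum>k=1..n. R k) = id_blinfun" by (intro blinfun_eqI) simp
    have tauR: "\<tau> (R k) = \<tau> (P k)" if "k \<in> {1..n}" for k
    proof -
      have "R k = adj U o\<^sub>L (P k o\<^sub>L U)" "(P k o\<^sub>L U) o\<^sub>L adj U = P k"
        by (rule blinfun_eqI; simp add: R_def unitary_apply[OF U(2)])+
      then show ?thesis using tau_commute[of "adj U" "P k o\<^sub>L U"] P(1)[OF that] U aU by auto
    qed
    have "adj U o\<^sub>L (\<Sum>k=1..n. z k *\<^sub>C P k) o\<^sub>L U = (\<Sum>k=1..n. z k *\<^sub>C R k)"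
      by (rule blinfun_eqI) (simp add: R_def op_simps bounded_opsD[OF aU(2)])
    then have "Y = (\<Sum>k=1..n. z k *\<^sub>C E (R k))" unfolding U(3) using R(1) by (simp only: E_sum_scaleC)
    moreover have "(\<Sum>k=1..n. E (R k)) = id_blinfun" using E_sum[of "{1..n}" R] R sumR by (simp add: E_fix)
    ultimately have "(\<lambda>k. E (R k)) \<in> C m"
      using R Y(2) tauR by (simp add: C_def E_mem E_pos tau_E dist_norm)
    then show ?thesis by blast
  qed
  then have ne: "\<exists>B\<in>C m. q B \<le> real n" for m
    using Cnorm(2) sum_bounded_above[of "{1..n}" "\<lambda>k. q2 (_ k)" 1] unfolding q_def
    by (metis (no_types, lifting) card_atLeastAtMost diff_Suc_1 mult.right_neutral)
  obtain b where b: "\<And>m. b m \<in> C m" "\<And>e. e > 0 \<Longrightarrow> \<exists>N. \<forall>m\<ge>N. \<forall>n\<ge>N. d (b m) (b n) < e"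
  proof (rule near_minimal_sequence[of C mid d q 0 "real n"])
    show "C m' \<subseteq> C m" if "m \<le> m'" for m m'
    proof -
      have "1 / real (Suc m') \<le> 1 / Suc m" using that by (simp add: frac_le)
      then show ?thesis by (auto simp: C_def)
    qed
    show "mid B B' \<in> C m" if "B \<in> C m" "B' \<in> C m" for m B B'
    proof -
      have "(\<Sum>k=1..n. mid B B' k) = (1/2) *\<^sub>R (id_blinfun + id_blinfun)"
        using that by (simp add: mid_def C_def scaleR_sum_right[symmetric] sum.distrib)
      then have 1: "(\<Sum>k=1..n. mid B B' k) = id_blinfun" by (simp flip: scaleR_2)
      have "(\<Sum>k=1..n. z k *\<^sub>C mid B B' k) - D
          = (1/2) *\<^sub>R (((\<Sum>k=1..n. z k *\<^sub>C B k) - D) + ((\<Sum>k=1..n. z k *\<^sub>C B' k) - D))"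
      proof -
        have "(1/2) *\<^sub>R ((s - D) + (s' - D)) = (1/2) *\<^sub>R (s + s') - (1/2) *\<^sub>R (2 *\<^sub>R D)" for s s'
          by (simp add: scaleR_2 algebra_simps)
        then show ?thesis by (simp only: mid_def half scaleR_sum_right[symmetric] sum.distrib) simp
      qed
      also have "norm \<dots> \<le> 1 / Suc m"
        using norm_triangle_ineq[of "(\<Sum>k=1..n. z k *\<^sub>C B k) - D" "(\<Sum>k=1..n. z k *\<^sub>C B' k) - D"] that
        by (simp add: C_def)
      finally have 2: "norm ((\<Sum>k=1..n. z k *\<^sub>C mid B B' k) - D) \<le> 1 / Suc m" .
      have "mid B B' k \<in> A" "positive_op (mid B B' k)" "\<tau> (mid B B' k) = \<tau> (P k)" if k: "k \<in> {1..n}" for k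
        using CD[OF \<open>B \<in> C m\<close> k] CD[OF \<open>B' \<in> C m\<close> k]
        by (auto simp: mid_def positive_op_intros intro!: A.scaleR A.add)
          (simp add: scaleR_scaleC tau_scaleC tau_add add)
      then show ?thesis using 1 2 by (simp add: C_def)
    qed
    show "d B B' \<le> 2 * q B + 2 * q B' - 4 * q (mid B B')" if "B \<in> C 0" "B' \<in> C 0" for B B'
    proof -
      have "d B B' = (\<Sum>k=1..n. 2 * q2 (B k) + 2 * q2 (B' k) - 4 * q2 (mid B B' k))"
        unfolding d_def mid_def using CD(2) that by (intro sum.cong refl q2_parallelogram) auto
      then show ?thesis by (simp add: q_def sum.distrib sum_subtractf sum_distrib_left)
    qed
    show "0 \<le> q B" if "B \<in> C 0" for B
      unfolding q_def using q2_nonneg CD(2)[OF that] by (intro sum_nonneg) auto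
    show "\<exists>B\<in>C m. q B \<le> real n" for m by (rule ne)
  qed blast
  obtain r where r: "strict_mono r" "\<And>m. d (b (r (Suc m))) (b (r m)) \<le> (1/8) ^ m"
    using fast_subsequence[of "\<lambda>m n. d (b m) (b n)"] b(2) by blast
  define Y where "Y k m = b (r m) k" for k m
  have Y: "Y k m \<in> A" "Y k m \<in> M" "positive_op (Y k m)" "\<tau> (Y k m) = \<tau> (P k)" "norm (Y k m) \<le> 1"
    if "k \<in> {1..n}" for k m
    using CD[OF b(1) that] Cnorm(1)[OF b(1) that] by (auto simp: Y_def)
  have "\<exists>B. B \<in> M \<and> sconv (Y k) B \<and> order_conv (Y k) B" if k: "k \<in> {1..n}" for k
  proof -
    have "q2 (Y k (Suc m) - Y k m) \<le> (1/8) ^ m" for m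
    proof -
      have "q2 (Y k (Suc m) - Y k m) \<le> d (b (r (Suc m))) (b (r m))"
        unfolding d_def Y_def using CD(2)[OF b(1)] q2_nonneg diff
        by (intro member_le_sum[OF k, of "\<lambda>k. q2 (b (r (Suc m)) k - b (r m) k)"]) auto
      then show ?thesis using r(2)[of m] by linarith
    qed
    then show ?thesis using fast_Cauchy_order_conv[of "Y k" 1] Y(2,5)[OF k] by metis
  qed
  then obtain B where B: "\<And>k. k \<in> {1..n} \<Longrightarrow> B k \<in> M \<and> sconv (Y k) (B k) \<and> order_conv (Y k) (B k)" by metis
  have BA: "B k \<in> A" "positive_op (B k)" "\<tau> (B k) = \<tau> (P k)" if k: "k \<in> {1..n}" for k
  proof -
    show "B k \<in> A" using A.sconv_mem[of "Y k" "B k"] Y(1)[OF k] B[OF k] by blast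
    have "0 \<preceq> B k" using sconv_op_le[OF sconv_const, of "Y k" "B k" 0] B[OF k] Y(3)[OF k] by (simp add: op_le_def)
    then show pos: "positive_op (B k)" by (simp add: op_le_def)
    have "(\<lambda>m. tr (Y k m)) \<longlonglongrightarrow> tr (B k)"
      by (rule order_conv_state[OF normal_state_tr])
        (use Y(2)[OF k] positive_opD(1)[OF Y(3)[OF k]] positive_opD(1)[OF pos] B[OF k] in auto)
    moreover have "tr (Y k m) = tr (P k)" for m using Y(4)[OF k] by (simp add: tr_def)
    ultimately have "tr (B k) = tr (P k)" by (simp add: LIMSEQ_const_iff)
    then show "\<tau> (B k) = \<tau> (P k)" using tau_positive B[OF k] pos P(1)[OF k] by simp
  qed
  have Yx: "(\<lambda>m. Y k m x) \<longlonglongrightarrow> B k x" if "k \<in> {1..n}" for k x using B[OF that] sconvD by blast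
  have sumB: "(\<Sum>k=1..n. B k) = id_blinfun"
  proof (rule blinfun_eqI)
    fix x
    have "(\<lambda>m. \<Sum>k=1..n. Y k m x) \<longlonglongrightarrow> (\<Sum>k=1..n. B k x)" using Yx by (intro tendsto_sum) auto
    moreover have "(\<Sum>k=1..n. Y k m x) = x" for m
    proof -
      have "(\<Sum>k=1..n. Y k m) = id_blinfun" using b(1)[of "r m"] by (simp add: C_def Y_def)
      from arg_cong[OF this, of "\<lambda>T. blinfun_apply T x"] show ?thesis by (simp add: blinfun.sum_left)
    qed
    ultimately show "(\<Sum>k=1..n. B k) x = id_blinfun x" by (simp add: LIMSEQ_const_iff op_simps)
  qed
  have "(\<Sum>k=1..n. z k *\<^sub>C B k) = D"
  proof (rule blinfun_eqI)
    fix x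
    \<comment> \<open>The combinations converge to \<open>D\<close> in norm, and to the combination
      of the limits strongly; evaluating at \<open>x\<close> compares the two.\<close>
    define V where "V m = (\<Sum>k=1..n. z k *\<^sub>C Y k m)" for m
    have "V \<longlonglongrightarrow> D"
    proof (rule Lim_transform2[OF tendsto_const], rule Lim_null_comparison)
      show "\<forall>\<^sub>F m in sequentially. norm (D - V m) \<le> 1 / Suc m"
      proof (intro always_eventually allI)
        fix m
        have "1 / real (Suc (r m)) \<le> 1 / Suc m" using seq_suble[OF r(1), of m] by (simp add: frac_le)
        then show "norm (D - V m) \<le> 1 / Suc m"
          using b(1)[of "r m"] by (simp add: C_def V_def Y_def norm_minus_commute)
      qed
      show "(\<lambda>m. 1 / real (Suc m)) \<longlonglongrightarrow> 0"
        using LIMSEQ_inverse_real_of_nat by (simp add: inverse_eq_divide)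
    qed
    then have "(\<lambda>m. V m x) \<longlonglongrightarrow> D x" by (intro bounded_linear.tendsto[OF blinfun.bounded_linear_left])
    moreover have "(\<lambda>m. V m x) \<longlonglongrightarrow> (\<Sum>k=1..n. z k *\<^sub>C B k x)"
      unfolding V_def blinfun.sum_left blinfun_apply_scaleC using Yx by (intro tendsto_sum tendsto_scaleC) auto
    ultimately show "(\<Sum>k=1..n. z k *\<^sub>C B k) x = D x"
      using LIMSEQ_unique by (simp add: blinfun.sum_left blinfun_apply_scaleC) blast
  qed
  moreover have "partition_of_unity A n B"
    unfolding partition_of_unity_def using BA sumB positive_summand_le_id[of _ n B] by (auto simp: op_le_def)
  ultimately show ?thesis using BA(3) by blast
qed

end

section \<open>Projections with prescribed expectation\<close>

lemma compose_eqD: "S o\<^sub>L T = R \<Longrightarrow> blinfun_apply S (blinfun_apply T x) = R x"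
  by auto

section \<open>The discrete Fourier matrix\<close>

definition unit_root :: "nat \<Rightarrow> nat \<Rightarrow> complex" where
  "unit_root d j = cis (2 * pi * real j / real d)"

text \<open>Symmetry of the Fourier matrix: it turns orthogonality of the rows into orthogonality of
  the columns.\<close>

lemma unit_root_power_swap: "unit_root d j ^ a = unit_root d a ^ j"
  by (simp add: unit_root_def Complex.DeMoivre mult.commute mult.left_commute)

lemma unit_root_norm: "unit_root d j * cnj (unit_root d j) = 1"
  by (simp add: unit_root_def cis_cnj cis_mult)

lemma unit_root_orthogonal:
  assumes "j < d" "k < d"
  shows "(\<Sum>a<d. unit_root d j ^ a * cnj (unit_root d k ^ a)) = (if j = k then of_nat d else 0)"
proof (cases "j = k")
  case True
  have "unit_root d j ^ a * cnj (unit_root d j ^ a) = 1" for a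
    using unit_root_norm[of d j] by (simp flip: power_mult_distrib)
  then show ?thesis using True by simp
next
  case False
  define w where "w = unit_root d j * cnj (unit_root d k)"
  have pow: "unit_root d i ^ d = 1" if "i < d" for i
    using that by (simp add: unit_root_def Complex.DeMoivre cis_multiple_2pi)
  have "w \<noteq> 1"
  proof
    assume "w = 1"
    then have "unit_root d j * (cnj (unit_root d k) * unit_root d k) = unit_root d k"
      by (simp add: w_def mult.assoc[symmetric])
    then have "unit_root d j = unit_root d k" using unit_root_norm[of d k] by (simp add: mult.commute)
    moreover have "inj_on (\<lambda>i. cis (2 * pi * real i / real d)) {..<d}"
      using Complex.bij_betw_roots_unity[of d] assms by (simp add: bij_betw_def)
    ultimately show False using assms False by (auto simp: unit_root_def inj_on_def)
  qed
  moreover have "w ^ d = 1" using pow assms by (simp add: w_def power_mult_distrib flip: complex_cnj_power)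
  ultimately have "(\<Sum>a<d. w ^ a) = 0" by (simp add: sum_gp_strict)
  then show ?thesis using False by (simp add: w_def power_mult_distrib)
qed

lemma norm_scaleC_op: "norm (c *\<^sub>C (T :: 'h::complex_hilbert_space op)) \<le> cmod c * norm T"
proof (rule norm_blinfun_bound)
  fix x
  have "norm ((c *\<^sub>C T) x) = cmod c * norm (T x)" by (simp add: blinfun_apply_scaleC norm_scaleC)
  also have "\<dots> \<le> cmod c * (norm T * norm x)" by (intro mult_left_mono norm_blinfun) auto
  finally show "norm ((c *\<^sub>C T) x) \<le> cmod c * norm T * norm x" by (simp add: mult.assoc)
qed simp

section \<open>Orthogonal families of projections\<close>

lemma orthogonal_sum_absorb:
  assumes "finite I" "\<And>i. i \<in> I \<Longrightarrow> projection (P i)" "\<And>i j. i \<in> I \<Longrightarrow> j \<in> I \<Longrightarrow> i \<noteq> j \<Longrightarrow> P i o\<^sub>L P j = 0" "k \<in> I"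
  shows "(\<Sum>i\<in>I. P i) o\<^sub>L P k = P k" "P k o\<^sub>L (\<Sum>i\<in>I. P i) = P k"
proof -
  have z: "P i (P j x) = (if i = j then P i x else 0)" if "i \<in> I" "j \<in> I" for i j x
    using assms(2,3)[of i] that by (auto simp: projectionD) (metis blinfun_apply_blinfun_compose blinfun.zero_left assms(3))
  show "(\<Sum>i\<in>I. P i) o\<^sub>L P k = P k" "P k o\<^sub>L (\<Sum>i\<in>I. P i) = P k"
    using assms(1,4) by (intro blinfun_eqI; simp add: op_simps z sum.delta sum.delta' cong: sum.cong)+
qed

lemma orthogonal_sum_projection:
  assumes "finite I" "\<And>i. i \<in> I \<Longrightarrow> projection (P i)" "\<And>i j. i \<in> I \<Longrightarrow> j \<in> I \<Longrightarrow> i \<noteq> j \<Longrightarrow> P i o\<^sub>L P j = 0"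
  shows "projection (\<Sum>i\<in>I. P i)"
  unfolding projection_iff
proof (intro conjI allI)
  show "self_adjoint (\<Sum>i\<in>I. P i)" using assms(2) projectionD(1) by (intro self_adjoint_sum) auto
  fix x
  have "(\<Sum>i\<in>I. P i) (P k x) = P k x" if "k \<in> I" for k
    by (rule compose_eqD[OF orthogonal_sum_absorb(1)[OF assms that]])
  then show "(\<Sum>i\<in>I. P i) ((\<Sum>i\<in>I. P i) x) = (\<Sum>i\<in>I. P i) x"
    unfolding blinfun.sum_left[of P I x] blinfun.sum_right by (intro sum.cong) auto
qed

definition orthogonal_partition :: "'i set \<Rightarrow> ('i \<Rightarrow> 'h::complex_hilbert_space op) \<Rightarrow> 'h op \<Rightarrow> bool" where
  "orthogonal_partition I P f \<longleftrightarrow> (\<forall>k\<in>I. projection (P k)) \<and>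
    (\<forall>j\<in>I. \<forall>k\<in>I. j \<noteq> k \<longrightarrow> P j o\<^sub>L P k = 0) \<and> (\<Sum>k\<in>I. P k) = f"

text \<open>Serves every gluing of two families below: \<open>Q j \<preceq> f\<close> and
  \<open>R k \<preceq> g\<close> with \<open>f\<close> and \<open>g\<close> orthogonal, so all mixed
  products vanish.\<close>

lemma orthogonal_add_step:
  assumes Q': "orthogonal_partition I Q f" and R': "orthogonal_partition I R g"
    and fg: "f o\<^sub>L g = 0" "projection f" "projection g" and I: "finite I"
  shows "j \<in> I \<Longrightarrow> k \<in> I \<Longrightarrow> Q j o\<^sub>L R k = 0" "j \<in> I \<Longrightarrow> k \<in> I \<Longrightarrow> R k o\<^sub>L Q j = 0"
    "j \<in> I \<Longrightarrow> k \<in> I \<Longrightarrow> j \<noteq> k \<Longrightarrow> (Q j + R j) o\<^sub>L (Q k + R k) = 0"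
    "k \<in> I \<Longrightarrow> projection (Q k + R k)" "(\<Sum>k\<in>I. Q k + R k) = f + g"
proof -
  have Q: "\<And>k. k \<in> I \<Longrightarrow> projection (Q k)" "\<And>j k. j \<in> I \<Longrightarrow> k \<in> I \<Longrightarrow> j \<noteq> k \<Longrightarrow> Q j o\<^sub>L Q k = 0" "(\<Sum>k\<in>I. Q k) = f"
    using Q' by (auto simp: orthogonal_partition_def)
  have R: "\<And>k. k \<in> I \<Longrightarrow> projection (R k)" "\<And>j k. j \<in> I \<Longrightarrow> k \<in> I \<Longrightarrow> j \<noteq> k \<Longrightarrow> R j o\<^sub>L R k = 0" "(\<Sum>k\<in>I. R k) = g"
    using R' by (auto simp: orthogonal_partition_def)
  show QR: "Q j o\<^sub>L R k = 0" if "j \<in> I" "k \<in> I" for j k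
  proof (rule blinfun_eqI)
    fix x
    have "Q j (R k x) = Q j (f (g (R k x)))"
      using compose_eqD[OF orthogonal_sum_absorb(2)[of I Q j, OF I Q(1,2) that(1)]]
        compose_eqD[OF orthogonal_sum_absorb(1)[of I R k, OF I R(1,2) that(2)]]
      unfolding Q(3) R(3) by simp
    also have "\<dots> = 0" by (simp add: compose_eqD[OF fg(1)] blinfun.zero_left blinfun.zero_right)
    finally show "(Q j o\<^sub>L R k) x = blinfun_apply 0 x" by (simp add: blinfun.zero_left)
  qed
  show RQ: "R k o\<^sub>L Q j = 0" if "j \<in> I" "k \<in> I" for j k
    using projection_commute_zero[OF Q(1) R(1) QR] that by blast
  show "(Q j + R j) o\<^sub>L (Q k + R k) = 0" if "j \<in> I" "k \<in> I" "j \<noteq> k" for j k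
  proof (rule blinfun_eqI)
    fix x
    have "Q j (Q k x) = 0" "R j (R k x) = 0" "Q j (R k x) = 0" "R j (Q k x) = 0"
      using Q(2)[OF that] R(2)[OF that] QR[OF that(1,2)] RQ[OF that(2,1)]
      by (metis blinfun_apply_blinfun_compose blinfun.zero_left)+
    then show "((Q j + R j) o\<^sub>L (Q k + R k)) x = blinfun_apply 0 x" by (simp add: op_simps)
  qed
  show "projection (Q k + R k)" if "k \<in> I" using projection_add[OF Q(1) R(1) QR] that by blast
  show "(\<Sum>k\<in>I. Q k + R k) = f + g" using Q(3) R(3) by (simp add: sum.distrib)
qed

context masa_expectation
begin

text \<open>The discrete Fourier transform of a system of matrix units over a partition of \<open>e\<close> in \<open>A\<close>.
  The expectation kills the off-diagonal matrix units because \<open>A\<close> is abelian.\<close>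

lemma uniform_projections:
  assumes e: "e \<in> A" "projection e" and d: "d > 0"
  obtains R where "\<And>j. j < d \<Longrightarrow> R j \<in> M \<and> projection (R j) \<and> tr (R j) = tr e / real d \<and> E (R j) = (1 / real d) *\<^sub>R e"
    "\<And>j k. j < d \<Longrightarrow> k < d \<Longrightarrow> j \<noteq> k \<Longrightarrow> R j o\<^sub>L R k = 0" "(\<Sum>j<d. R j) = e"
proof -
  have tre: "0 \<le> tr e" using e A_sub_M projection_positive tr_nonneg by blast
  have "(\<Sum>i<d. tr e / real d) = tr e" using d by simp
  then obtain f where f: "\<And>i. i < d \<Longrightarrow> f i \<in> A \<and> projection (f i) \<and> tr (f i) = tr e / real d \<and> e o\<^sub>L f i = f i"
    "\<And>i j. i < d \<Longrightarrow> j < d \<Longrightarrow> i \<noteq> j \<Longrightarrow> f i o\<^sub>L f j = 0" "(\<Sum>i<d. f i) = e"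
    using split_trace[OF e, of d "\<lambda>_. tr e / real d"] tre by auto
  \<comment> \<open>Each \<open>v a\<close> carries \<open>f 0\<close> to \<open>f a\<close>, so the
    \<open>v a o\<^sub>L adj (v b)\<close> are matrix units over the splitting of
    \<open>e\<close>.\<close>
  have "\<exists>v. v \<in> M \<and> adj v o\<^sub>L v = f 0 \<and> v o\<^sub>L adj v = f a" if "a < d" for a
    using equal_trace_equivalent[of "f a" "f 0"] f(1)[OF that] f(1)[OF d] A_sub_M by metis
  then obtain v where v: "\<And>a. a < d \<Longrightarrow> v a \<in> M \<and> adj (v a) o\<^sub>L v a = f 0 \<and> v a o\<^sub>L adj (v a) = f a" by metis
  have vb: "v a \<in> bounded_ops" if "a < d" for a using v[OF that] sub by blast
  have vi: "v a (adj (v a) (v a x)) = v a x" if "a < d" for a x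
    using initial_projection_apply[OF vb[OF that]] v[OF that] f(1)[OF d] by auto
  have fv: "f a (v a x) = v a x" if "a < d" for a x
    using vi[OF that] v[OF that] by (metis blinfun_apply_blinfun_compose)
  have vf: "adj (v a) (f a x) = adj (v a) x" if "a < d" for a x
  proof (rule inner_eqI)
    fix y
    show "inner (adj (v a) (f a x)) y = inner (adj (v a) x) y"
      using f(1)[OF that] by (simp add: inner_adj_left vb that self_adjointD(3)[OF projectionD(1)] fv)
  qed
  have f0v: "f 0 (adj (v a) x) = adj (v a) x" if "a < d" for a x
    using vf[OF that] v[OF that] by (metis blinfun_apply_blinfun_compose)
  have vv: "adj (v a) (v b x) = (if a = b then f 0 x else 0)" if "a < d" "b < d" for a b x
  proof (cases "a = b")
    case True
    then show ?thesis using v[OF that(1)] by (metis blinfun_apply_blinfun_compose)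
  next
    case False
    have "adj (v a) (v b x) = adj (v a) (f a (f b (v b x)))" using vf fv that by simp
    also have "f a (f b (v b x)) = 0" using f(2)[OF that False] by (metis blinfun_apply_blinfun_compose blinfun.zero_left)
    finally show ?thesis using False by (simp add: blinfun.zero_right)
  qed
  \<comment> \<open>The Fourier matrix, normalised to be unitary. All
    \<open>s j a * cnj (s j a)\<close> equal \<open>1 / real d\<close>, which makes the expectations
    of the rotated projections equal.\<close>
  define s where "s j a = unit_root d j ^ a / complex_of_real (sqrt (real d))" for j a
  have ss: "s j a * cnj (s k b) = (unit_root d j ^ a * cnj (unit_root d k ^ b)) / of_nat d" for j a k b
    using d by (simp add: s_def flip: of_real_mult)
  have orth1: "(\<Sum>a<d. s k a * cnj (s j a)) = (if j = k then 1 else 0)" if "j < d" "k < d" for j k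
    unfolding ss sum_divide_distrib[symmetric] unit_root_orthogonal[OF that(2,1)] using d by auto
  have orth2: "(\<Sum>j<d. s j a * cnj (s j b)) = (if a = b then 1 else 0)" if "a < d" "b < d" for a b
    unfolding ss sum_divide_distrib[symmetric] unit_root_power_swap[of d _ a] unit_root_power_swap[of d _ b]
      unit_root_orthogonal[OF that] using d by auto
  have sdiag: "s j a * cnj (s j a) = complex_of_real (1 / real d)" for j a
    unfolding ss using unit_root_norm[of d j] by (simp flip: power_mult_distrib)
  define u where "u j = (\<Sum>a<d. s j a *\<^sub>C v a)" for j
  have uM: "u j \<in> M" for j unfolding u_def using v by (intro sum scaleC) auto
  have ub: "u j \<in> bounded_ops" for j using uM sub by blast
  have adju: "adj (u j) = (\<Sum>a<d. cnj (s j a) *\<^sub>C adj (v a))" for j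
    unfolding u_def using adj_sum[of "{..<d}" "\<lambda>a. s j a *\<^sub>C v a"] vb by simp
  have uu: "adj (u j) (u k x) = (if j = k then f 0 x else 0)" if "j < d" "k < d" for j k x
  proof -
    have "adj (u j) (u k x) = (\<Sum>b<d. \<Sum>a<d. (cnj (s j a) * s k b) *\<^sub>C adj (v a) (v b x))"
      unfolding adju unfolding u_def
      by (simp add: blinfun.sum_left blinfun.sum_right blinfun_apply_scaleC bounded_opsD adj_bounded_ops vb
          scaleC_sum_right scaleC_scaleC)
    also have "\<dots> = (\<Sum>a<d. \<Sum>b<d. (cnj (s j a) * s k b) *\<^sub>C adj (v a) (v b x))" by (rule sum.swap)
    also have "\<dots> = (\<Sum>a<d. (s k a * cnj (s j a)) *\<^sub>C f 0 x)"
    proof (intro sum.cong refl)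
      fix a assume a: "a \<in> {..<d}"
      have "(\<Sum>b<d. (cnj (s j a) * s k b) *\<^sub>C adj (v a) (v b x))
          = (\<Sum>b<d. if a = b then (s k a * cnj (s j a)) *\<^sub>C f 0 x else 0)"
        using a by (intro sum.cong refl) (simp add: vv mult.commute)
      then show "(\<Sum>b<d. (cnj (s j a) * s k b) *\<^sub>C adj (v a) (v b x)) = (s k a * cnj (s j a)) *\<^sub>C f 0 x"
        using a by simp
    qed
    also have "\<dots> = (if j = k then f 0 x else 0)"
      unfolding scaleC_sum_left[symmetric] orth1[OF that] by simp
    finally show ?thesis .
  qed
  have f0u: "f 0 (adj (u j) x) = adj (u j) x" for j x
    unfolding adju using f(1)[OF d] A.sub
    by (simp add: blinfun.sum_left blinfun.sum_right blinfun_apply_scaleC bounded_opsD f0v)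
  define R where "R j = u j o\<^sub>L adj (u j)" for j
  have RM: "R j \<in> M" for j using uM by (auto simp: R_def)
  have Rexp: "R j = (\<Sum>a<d. \<Sum>b<d. (s j a * cnj (s j b)) *\<^sub>C (v a o\<^sub>L adj (v b)))" for j
  proof (rule blinfun_eqI)
    fix x
    have "R j x = (\<Sum>b<d. \<Sum>a<d. (s j a * cnj (s j b)) *\<^sub>C v a (adj (v b) x))"
      unfolding R_def blinfun_apply_blinfun_compose adju unfolding u_def
      by (simp add: blinfun.sum_left blinfun.sum_right blinfun_apply_scaleC bounded_opsD vb scaleC_sum_right scaleC_scaleC)
    also have "\<dots> = (\<Sum>a<d. \<Sum>b<d. (s j a * cnj (s j b)) *\<^sub>C v a (adj (v b) x))" by (rule sum.swap)
    finally show "R j x = (\<Sum>a<d. \<Sum>b<d. (s j a * cnj (s j b)) *\<^sub>C (v a o\<^sub>L adj (v b))) x"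
      by (simp add: blinfun.sum_left blinfun_apply_scaleC)
  qed
  have Eoff: "E (v a o\<^sub>L adj (v b)) = (if a = b then f a else 0)" if "a < d" "b < d" for a b
  proof (cases "a = b")
    case True
    then show ?thesis using v[OF that(1)] f(1)[OF that(1)] by (simp add: E_fix)
  next
    case False
    define T where "T = v a o\<^sub>L adj (v b)"
    have TM: "T \<in> M" using v that by (auto simp: T_def)
    have "T = f a o\<^sub>L T o\<^sub>L f b" using that by (intro blinfun_eqI) (simp add: T_def fv vf)
    \<comment> \<open>\<open>f a\<close> and \<open>f b\<close> come out of the expectation by the
      bimodule property, and in the abelian \<open>A\<close> they meet as
      \<open>f a o\<^sub>L f b = 0\<close>.\<close>
    then have "E T = f a o\<^sub>L E T o\<^sub>L f b" using E_bimodule[of "f a" "f b" T] f(1) that TM by metis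
    also have "\<dots> = E T o\<^sub>L (f a o\<^sub>L f b)"
      using A.commute'[of "f a" "E T"] f(1) that E_mem[OF TM] by (intro blinfun_eqI) simp
    also have "\<dots> = 0" using f(2)[OF that False] by simp
    finally show ?thesis using False by (simp add: T_def)
  qed
  show thesis
  proof
    fix j assume j: "j < d"
    have "self_adjoint (R j)" using self_adjoint_intros(7)[of "adj (u j)"] ub by (simp add: R_def)
    then have "projection (R j)" using uu[OF j j] f0u by (simp add: projection_iff R_def)
    moreover have "tr (R j) = tr e / real d"
    proof -
      have "tr (R j) = tr (adj (u j) o\<^sub>L u j)" unfolding R_def using uM by (intro tr_commute) auto
      also have "adj (u j) o\<^sub>L u j = f 0" using uu[OF j j] by (intro blinfun_eqI) simp
      finally show ?thesis using f(1)[OF d] by simp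
    qed
    moreover have "E (R j) = (1 / real d) *\<^sub>R e"
    proof -
      have m: "v a o\<^sub>L adj (v b) \<in> M" if "a < d" "b < d" for a b using v that by auto
      have "E (R j) = (\<Sum>a<d. \<Sum>b<d. (s j a * cnj (s j b)) *\<^sub>C E (v a o\<^sub>L adj (v b)))"
        unfolding Rexp using m by (subst E_sum) (auto intro!: sum scaleC sum.cong E_sum_scaleC)
      also have "\<dots> = (\<Sum>a<d. \<Sum>b<d. if a = b then (s j a * cnj (s j a)) *\<^sub>C f a else 0)"
        by (intro sum.cong refl) (auto simp: Eoff intro!: blinfun_eqI simp: op_simps)
      also have "\<dots> = (\<Sum>a<d. (1 / real d) *\<^sub>R f a)"
        by (intro sum.cong refl) (simp add: sdiag scaleR_scaleC)
      also have "\<dots> = (1 / real d) *\<^sub>R e" by (simp add: scaleR_sum_right[symmetric] f(3))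
      finally show ?thesis .
    qed
    ultimately show "R j \<in> M \<and> projection (R j) \<and> tr (R j) = tr e / real d \<and> E (R j) = (1 / real d) *\<^sub>R e"
      using RM by blast
    fix k assume k: "k < d" "j \<noteq> k"
    then show "R j o\<^sub>L R k = 0"
      using uu[OF j k(1)] by (intro blinfun_eqI) (simp add: R_def op_simps)
  next
    show "(\<Sum>j<d. R j) = e"
    proof (rule blinfun_eqI)
      fix x
      have "(\<Sum>j<d. R j) x = (\<Sum>j<d. \<Sum>a<d. \<Sum>b<d. (s j a * cnj (s j b)) *\<^sub>C v a (adj (v b) x))"
        unfolding Rexp by (simp add: blinfun.sum_left blinfun_apply_scaleC)
      also have "\<dots> = (\<Sum>a<d. \<Sum>j<d. \<Sum>b<d. (s j a * cnj (s j b)) *\<^sub>C v a (adj (v b) x))" by (rule sum.swap)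
      also have "\<dots> = (\<Sum>a<d. \<Sum>b<d. \<Sum>j<d. (s j a * cnj (s j b)) *\<^sub>C v a (adj (v b) x))"
        by (intro sum.cong refl sum.swap)
      also have "\<dots> = (\<Sum>a<d. \<Sum>b<d. if a = b then v a (adj (v a) x) else 0)"
        unfolding scaleC_sum_left[symmetric] by (intro sum.cong refl) (auto simp: orth2)
      also have "\<dots> = (\<Sum>a<d. f a x)"
        using v by (intro sum.cong refl) (auto, metis blinfun_apply_blinfun_compose)
      finally show "(\<Sum>j<d. R j) x = e x" by (simp add: f(3)[symmetric] blinfun.sum_left)
    qed
  qed
qed

text \<open>Blocks of the uniform projections approximate the traces \<open>t\<^sub>k\<close> from below; the at most \<open>n\<close> unused
  projections are split so as to make the traces exact, and disturb the expectation by at most \<open>n / d\<close>.\<close>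

lemma block_projections:
  fixes t :: "nat \<Rightarrow> real"
  assumes e: "e \<in> A" "projection e" and pos: "tr e > 0" and t: "\<And>k. k \<in> {1..n} \<Longrightarrow> 0 \<le> t k" "(\<Sum>k=1..n. t k) = tr e"
    and eps: "\<epsilon> > 0"
  obtains Q where "\<And>k. k \<in> {1..n} \<Longrightarrow> Q k \<in> M \<and> projection (Q k) \<and> tr (Q k) = t k"
    "\<And>j k. j \<in> {1..n} \<Longrightarrow> k \<in> {1..n} \<Longrightarrow> j \<noteq> k \<Longrightarrow> Q j o\<^sub>L Q k = 0" "(\<Sum>k=1..n. Q k) = e"
    "\<And>k x. k \<in> {1..n} \<Longrightarrow> \<bar>inner (E (Q k) x) x - t k / tr e * (norm (e x))\<^sup>2\<bar> \<le> \<epsilon> * (norm (e x))\<^sup>2"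
proof -
  \<comment> \<open>\<open>d\<close> is so large that \<open>1 / d\<close>, the error of rounding
    the traces, and \<open>n / d\<close>, the size of the leftover, are both at most
    \<open>\<epsilon>\<close>.\<close>
  obtain d :: nat where d': "real (n + 1) / \<epsilon> < real d" using reals_Archimedean2 by blast
  have "0 < real (n + 1) / \<epsilon>" using eps by simp
  then have d: "d > 0" using d' by (cases d) auto
  have nd: "real n / real d \<le> \<epsilon>" "1 / real d \<le> \<epsilon>"
    using d' eps d by (simp_all add: field_simps)
  define \<delta> where "\<delta> = tr e / real d"
  have \<delta>: "\<delta> > 0" "real d * \<delta> = tr e" using pos d by (simp_all add: \<delta>_def)
  \<comment> \<open>The number of whole uniform projections, each of trace \<open>\<delta>\<close>,
    that fit into \<open>t k\<close>.\<close>
  define p where "p k = nat \<lfloor>t k / \<delta>\<rfloor>" for k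
  have p: "real (p k) * \<delta> \<le> t k" "t k < (real (p k) + 1) * \<delta>" if "k \<in> {1..n}" for k
  proof -
    have "0 \<le> t k / \<delta>" using t(1)[OF that] \<delta> by simp
    then have "real (p k) \<le> t k / \<delta>" "t k / \<delta> < real (p k) + 1" by (simp_all add: p_def)
    then show "real (p k) * \<delta> \<le> t k" "t k < (real (p k) + 1) * \<delta>" using \<delta>(1) by (simp_all add: field_simps)
  qed
  define off where "off k = (\<Sum>l\<in>{1..<k}. p l)" for k
  have offS: "off (Suc k) = off k + p k" if "k \<in> {1..n}" for k using that by (simp add: off_def)
  have offmono: "off j \<le> off k" if "j \<le> k" for j k unfolding off_def using that by (intro sum_mono2) auto
  define m where "m = off (Suc n)"
  have msum: "m = (\<Sum>k=1..n. p k)" by (simp add: m_def off_def atLeastLessThanSuc_atLeastAtMost)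
  have "real m * \<delta> = (\<Sum>k=1..n. real (p k) * \<delta>)" by (simp add: msum sum_distrib_right)
  also have "\<dots> \<le> (\<Sum>k=1..n. t k)" by (intro sum_mono p) auto
  finally have "real m * \<delta> \<le> real d * \<delta>" using t(2) \<delta>(2) by simp
  then have md: "m \<le> d" using \<delta>(1) by simp
  have "real d * \<delta> = (\<Sum>k=1..n. t k)" using t(2) \<delta>(2) by simp
  also have "\<dots> \<le> (\<Sum>k=1..n. (real (p k) + 1) * \<delta>)" by (intro sum_mono less_imp_le p) auto
  also have "\<dots> = (real m + real n) * \<delta>" by (simp add: msum sum_distrib_right[symmetric] sum.distrib)
  finally have dmn: "real d \<le> real m + real n" using \<delta>(1) by simp
  obtain R where R: "\<And>j. j < d \<Longrightarrow> R j \<in> M \<and> projection (R j) \<and> tr (R j) = tr e / real d \<and> E (R j) = (1 / real d) *\<^sub>R e"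
    "\<And>j k. j < d \<Longrightarrow> k < d \<Longrightarrow> j \<noteq> k \<Longrightarrow> R j o\<^sub>L R k = 0" "(\<Sum>j<d. R j) = e"
    using uniform_projections[OF e d] by metis
  define RS where "RS S = (\<Sum>j\<in>S. R j)" for S
  have RS: "RS S \<in> M" "projection (RS S)" "tr (RS S) = real (card S) * \<delta>" "E (RS S) = (real (card S) / real d) *\<^sub>R e"
    if "S \<subseteq> {..<d}" for S
  proof -
    have f: "finite S" using that finite_subset by blast
    have M: "R j \<in> M" if "j \<in> S" for j using R(1) that \<open>S \<subseteq> {..<d}\<close> by auto
    show "RS S \<in> M" unfolding RS_def using M by (intro sum) auto
    show "projection (RS S)" unfolding RS_def using R that f by (intro orthogonal_sum_projection) auto
    have "tr (RS S) = (\<Sum>j\<in>S. tr (R j))" unfolding RS_def using M by (intro tr_linear(6))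
    also have "\<dots> = (\<Sum>j\<in>S. \<delta>)" using R(1) that by (intro sum.cong refl) (auto simp: \<delta>_def)
    finally show "tr (RS S) = real (card S) * \<delta>" by simp
    have "E (RS S) = (\<Sum>j\<in>S. E (R j))" unfolding RS_def using M by (intro E_sum)
    also have "\<dots> = (\<Sum>j\<in>S. (1 / real d) *\<^sub>R e)" using R(1) that by (intro sum.cong refl) auto
    also have "\<dots> = (real (card S) / real d) *\<^sub>R e"
      by (simp only: sum_constant_scaleR) (simp add: divide_inverse)
    finally show "E (RS S) = (real (card S) / real d) *\<^sub>R e" .
  qed
  have RS_orth: "RS S (RS S' x) = 0" if "S \<subseteq> {..<d}" "S' \<subseteq> {..<d}" "S \<inter> S' = {}" for S S' x
  proof -
    have "R i (R j x) = 0" if "i \<in> S" "j \<in> S'" for i j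
    proof -
      have "i < d" "j < d" "i \<noteq> j" using that \<open>S \<subseteq> {..<d}\<close> \<open>S' \<subseteq> {..<d}\<close> \<open>S \<inter> S' = {}\<close> by auto
      then show ?thesis using R(2) by (metis blinfun_apply_blinfun_compose blinfun.zero_left)
    qed
    then show ?thesis by (simp add: RS_def blinfun.sum_left blinfun.sum_right)
  qed
  define S where "S k = {off k..<off (Suc k)}" for k
  have Sd: "S k \<subseteq> {..<d}" "S k \<subseteq> {..<m}" "card (S k) = p k" if "k \<in> {1..n}" for k
    using offmono[of "Suc k" "Suc n"] that md offS[OF that] by (auto simp: S_def m_def)
  have Sdisj: "S j \<inter> S k = {}" if "j \<in> {1..n}" "k \<in> {1..n}" "j \<noteq> k" for j k
    using that offmono[of "Suc j" k] offmono[of "Suc k" j] by (cases "j < k") (auto simp: S_def)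
  define L where "L = RS {m..<d}"
  have Ld: "{m..<d} \<subseteq> {..<d}" by auto
  note LP = RS[OF Ld, folded L_def]
  have Ssum: "(\<Sum>k=1..K. RS (S k)) = RS {0..<off (Suc K)}" if "K \<le> n" for K
    using that
  proof (induction K)
    case 0
    then show ?case by (simp add: RS_def off_def)
  next
    case (Suc K)
    have "off (Suc K) \<le> off (Suc (Suc K))" by (rule offmono) simp
    then have "RS {0..<off (Suc K)} + RS (S (Suc K)) = RS {0..<off (Suc (Suc K))}"
      unfolding RS_def S_def by (intro sum.atLeastLessThan_concat) auto
    then show ?case using Suc by simp
  qed
  have total: "(\<Sum>k=1..n. RS (S k)) + L = e"
  proof -
    have "RS {0..<m} + RS {m..<d} = RS {0..<d}" unfolding RS_def using md by (intro sum.atLeastLessThan_concat) auto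
    then show ?thesis using Ssum[of n] R(3) by (simp add: m_def[symmetric] L_def RS_def lessThan_atLeast0)
  qed
  \<comment> \<open>The blocks count from 1, \<open>split_trace_M\<close> from 0.\<close>
  have shift: "(\<Sum>k=1..n. h k) = (\<Sum>i<n. h (Suc i))" for h :: "nat \<Rightarrow> 'b::comm_monoid_add"
    by (metis (no_types, lifting) One_nat_def sum.cong sum.shift_bounds_cl_Suc_ivl sum.atLeast1_atMost_eq)
  \<comment> \<open>The traces missing in the blocks add up to the trace of the leftover
    \<open>L\<close>, which can therefore be split exactly. \<open>L\<close> lies in
    \<open>M\<close> and need not lie in \<open>A\<close>, hence
    \<open>split_trace_M\<close>.\<close>
  have "(\<Sum>i<n. t (Suc i) - real (p (Suc i)) * \<delta>) = tr L"
  proof -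
    have "(\<Sum>i<n. t (Suc i) - real (p (Suc i)) * \<delta>) = (\<Sum>k=1..n. t k - real (p k) * \<delta>)"
      using shift[of "\<lambda>k. t k - real (p k) * \<delta>"] by simp
    also have "\<dots> = tr e - real m * \<delta>" by (simp add: sum_subtractf t(2)[simplified] msum sum_distrib_right)
    also have "\<dots> = tr L" using LP(3) md \<delta>(2) by (simp add: of_nat_diff algebra_simps)
    finally show ?thesis .
  qed
  then obtain l where l: "\<And>i. i < n \<Longrightarrow> l i \<in> M \<and> projection (l i) \<and> tr (l i) = t (Suc i) - real (p (Suc i)) * \<delta>"
    "\<And>i j. i < n \<Longrightarrow> j < n \<Longrightarrow> i \<noteq> j \<Longrightarrow> l i o\<^sub>L l j = 0" "(\<Sum>i<n. l i) = L"
    using split_trace_M[OF LP(1,2), of n "\<lambda>i. t (Suc i) - real (p (Suc i)) * \<delta>"] p(1) by auto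
  define l' where "l' k = l (k - 1)" for k
  have l': "l' k \<in> M" "projection (l' k)" "tr (l' k) = t k - real (p k) * \<delta>" if "k \<in> {1..n}" for k
    using l(1)[of "k - 1"] that by (auto simp: l'_def)
  have l'orth: "l' j o\<^sub>L l' k = 0" if "j \<in> {1..n}" "k \<in> {1..n}" "j \<noteq> k" for j k
    using l(2)[of "j - 1" "k - 1"] that by (auto simp: l'_def)
  have l'sum: "(\<Sum>k=1..n. l' k) = L" using shift[of l'] l(3) by (simp add: l'_def)
  have So: "RS (S j) o\<^sub>L RS (S k) = 0" if "j \<in> {1..n}" "k \<in> {1..n}" "j \<noteq> k" for j k
    using RS_orth[OF Sd(1)[OF that(1)] Sd(1)[OF that(2)] Sdisj[OF that]] by (intro blinfun_eqI) (simp add: blinfun.zero_left)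
  have m0: "RS {0..<m} o\<^sub>L L = 0"
  proof (rule blinfun_eqI)
    fix x
    have "{0..<m} \<subseteq> {..<d}" "{0..<m} \<inter> {m..<d} = {}" using md by auto
    then show "(RS {0..<m} o\<^sub>L L) x = blinfun_apply 0 x"
      using RS_orth[OF _ Ld] by (simp add: L_def blinfun.zero_left)
  qed
  have sm: "(\<Sum>k=1..n. RS (S k)) = RS {0..<m}" using Ssum[of n] by (simp add: m_def)
  have "{0..<m} \<subseteq> {..<d}" using md by auto
  then have "projection (RS {0..<m})" by (rule RS(2))
  moreover have "orthogonal_partition {1..n} (\<lambda>k. RS (S k)) (RS {0..<m})"
    using RS(2)[OF Sd(1)] So sm unfolding orthogonal_partition_def by blast
  moreover have "orthogonal_partition {1..n} l' L"
    using l'(2) l'orth l'sum unfolding orthogonal_partition_def by blast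
  ultimately have "projection (RS (S k) + l' k)" "j \<noteq> k \<Longrightarrow> (RS (S j) + l' j) o\<^sub>L (RS (S k) + l' k) = 0"
    if "j \<in> {1..n}" "k \<in> {1..n}" for j k
    using orthogonal_add_step(4)[of "{1..n}" "\<lambda>k. RS (S k)" "RS {0..<m}" l' L k]
      orthogonal_add_step(3)[of "{1..n}" "\<lambda>k. RS (S k)" "RS {0..<m}" l' L j k] that m0 LP(2) by blast+
  note step = this
  define Q where "Q k = RS (S k) + l' k" for k
  show thesis
  proof
    fix k assume k: "k \<in> {1..n}"
    show "Q k \<in> M \<and> projection (Q k) \<and> tr (Q k) = t k"
      using step(1)[OF k k] RS(1,3)[OF Sd(1)[OF k]] Sd(3)[OF k] l'[OF k] by (auto simp: Q_def tr_linear)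
    have EQ: "E (Q k) = (real (p k) / real d) *\<^sub>R e + E (l' k)"
      using RS(1,4)[OF Sd(1)[OF k]] Sd(3)[OF k] l'[OF k] by (simp add: Q_def E_add)
    \<comment> \<open>Whatever the splitting of \<open>L\<close>, \<open>l' k \<preceq> L\<close>
      and positivity of \<open>E\<close> bound the expectation of the correction by
      \<open>E L\<close>, a multiple of \<open>e\<close> with factor at most
      \<open>n / d\<close>.\<close>
    have "L o\<^sub>L l' k = l' k" using orthogonal_sum_absorb(1)[of "{1..n}" l' k] l'(2) l'orth k l'sum by auto
    then have "l' k \<preceq> L" using projection_le_iff[OF l'(2)[OF k] LP(2)] by simp
    then have le: "E (l' k) \<preceq> E L" using E_mono l'(1)[OF k] LP(1) by blast
    have Elpos: "positive_op (E (l' k))" using E_pos l'[OF k] projection_positive by blast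
    fix x
    have "inner (E L x) x = (real (d - m) / real d) * (norm (e x))\<^sup>2"
      using LP(4) projection_norm[OF e(2)] by (simp add: blinfun.scaleR_left)
    also have "\<dots> \<le> (real n / real d) * (norm (e x))\<^sup>2"
      using dmn md by (intro mult_right_mono divide_right_mono) (auto simp: of_nat_diff)
    also have "\<dots> \<le> \<epsilon> * (norm (e x))\<^sup>2" using nd by (intro mult_right_mono) auto
    finally have "inner (E L x) x \<le> \<epsilon> * (norm (e x))\<^sup>2" .
    moreover have "inner (E (l' k) x) x \<le> inner (E L x) x"
      using le op_le_iff[of "E (l' k)" "E L"] positive_opD(1)[OF Elpos] E_self_adjoint LP(1,2) projectionD(1) by blast
    ultimately have 1: "inner (E (l' k) x) x \<le> \<epsilon> * (norm (e x))\<^sup>2" by linarith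
    have 2: "0 \<le> inner (E (l' k) x) x" using positive_opD(2)[OF Elpos] .
    have td: "t k / tr e = t k / \<delta> / real d" using \<delta>(2) by (metis divide_divide_eq_left mult.commute)
    have "real (p k) \<le> t k / \<delta>" "t k / \<delta> \<le> real (p k) + 1" using p[OF k] \<delta>(1) by (simp_all add: field_simps)
    then have "real (p k) / real d \<le> t k / tr e" "t k / tr e \<le> (real (p k) + 1) / real d"
      unfolding td by (intro divide_right_mono; simp)+
    then have 3: "0 \<le> (t k / tr e - real (p k) / real d)" "t k / tr e - real (p k) / real d \<le> \<epsilon>"
      using nd(2) by (simp_all add: add_divide_distrib)
    have 4: "0 \<le> (t k / tr e - real (p k) / real d) * (norm (e x))\<^sup>2"
      "(t k / tr e - real (p k) / real d) * (norm (e x))\<^sup>2 \<le> \<epsilon> * (norm (e x))\<^sup>2"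
      using 3 by (auto intro: mult_right_mono)
    have "inner (E (Q k) x) x = real (p k) / real d * (norm (e x))\<^sup>2 + inner (E (l' k) x) x"
      unfolding EQ using projection_norm[OF e(2)] by (simp add: op_simps inner_simps)
    then show "\<bar>inner (E (Q k) x) x - t k / tr e * (norm (e x))\<^sup>2\<bar> \<le> \<epsilon> * (norm (e x))\<^sup>2"
      using 1 2 4 by (simp add: algebra_simps abs_le_iff)
  next
    show "Q j o\<^sub>L Q k = 0" if "j \<in> {1..n}" "k \<in> {1..n}" "j \<noteq> k" for j k
      using step(2)[OF that] by (simp add: Q_def)
    show "(\<Sum>k=1..n. Q k) = e" unfolding Q_def using sm l'sum total by (simp add: sum.distrib)
  qed
qed

text \<open>A norm estimate survives the induction over cuts because the error on \<open>f\<close>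
  is measured by \<open>3 * \<epsilon> * (norm (f x))\<^sup>2\<close>: for orthogonal
  \<open>f\<close> and \<open>g\<close> these bounds add by Pythagoras to the bound for
  \<open>f + g\<close> with the same constant. The traces add exactly.\<close>

lemma approximate_partition:
  fixes B :: "nat \<Rightarrow> 'a op"
  assumes B: "\<And>k. k \<in> {1..n} \<Longrightarrow> B k \<in> A \<and> positive_op (B k)" "(\<Sum>k=1..n. B k) = id_blinfun" and eps: "\<epsilon> > 0"
  obtains Q where "\<And>k. k \<in> {1..n} \<Longrightarrow> Q k \<in> M \<and> projection (Q k) \<and> tr (Q k) = tr (B k) \<and> norm (E (Q k) - B k) \<le> 3 * \<epsilon>"
    "\<And>j k. j \<in> {1..n} \<Longrightarrow> k \<in> {1..n} \<Longrightarrow> j \<noteq> k \<Longrightarrow> Q j o\<^sub>L Q k = 0" "(\<Sum>k=1..n. Q k) = id_blinfun"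
proof -
  define \<Phi> where "\<Phi> f = (\<exists>Q. (\<forall>k\<in>{1..n}. Q k \<in> M \<and> projection (Q k) \<and> tr (Q k) = tr (B k o\<^sub>L f) \<and>
      (\<forall>x. \<bar>inner (E (Q k) x) x - inner (B k (f x)) x\<bar> \<le> 3 * \<epsilon> * (norm (f x))\<^sup>2)) \<and>
      (\<forall>j\<in>{1..n}. \<forall>k\<in>{1..n}. j \<noteq> k \<longrightarrow> Q j o\<^sub>L Q k = 0) \<and> (\<Sum>k=1..n. Q k) = f)" for f
  have "\<Phi> id_blinfun"
  proof (rule A.cut_induct_family[of "{1..n}" B \<epsilon> id_blinfun \<Phi>])
    show "B k \<in> A \<and> self_adjoint (B k)" if "k \<in> {1..n}" for k using B(1)[OF that] positive_opD(1) by blast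
    fix f assume f: "f \<in> A" "projection f" "\<And>k. k \<in> {1..n} \<Longrightarrow> nearly_scalar \<epsilon> (B k) f"
    show "\<Phi> f"
    proof (cases "f = 0")
      case True
      then show ?thesis unfolding \<Phi>_def by (intro exI[of _ "\<lambda>_. 0"]) (simp add: E_zero op_simps)
    next
      case False
      have fM: "f \<in> M" using f A_sub_M by blast
      have trf: "tr f > 0" using tr_projection_pos[OF fM f(2) False] .
      have Bf: "B k (f x) = f (B k x)" if "k \<in> {1..n}" for k x using A.commute' B(1)[OF that] f(1) by blast
      have Bff: "inner (B k (f x)) x = inner (B k (f x)) (f x)" if "k \<in> {1..n}" for k x
        using self_adjointD(3)[OF projectionD(1)[OF f(2)], of "B k (f x)" x] Bf[OF that, of "f x"] projectionD(4)[OF f(2), of x]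
        by simp
      have BfM: "B k o\<^sub>L f \<in> M" "positive_op (B k o\<^sub>L f)" if "k \<in> {1..n}" for k
        using B(1)[OF that] fM A_sub_M
          positive_op_compose[OF _ projection_positive[OF f(2)] A.commute[OF f(1)], of "B k"] by auto
      define t where "t k = tr (B k o\<^sub>L f)" for k
      have t: "0 \<le> t k" if "k \<in> {1..n}" for k using tr_nonneg BfM[OF that] by (simp add: t_def)
      have tsum: "(\<Sum>k=1..n. t k) = tr f"
      proof -
        have "(\<Sum>k=1..n. t k) = tr (\<Sum>k=1..n. B k o\<^sub>L f)" unfolding t_def using BfM by (subst tr_linear(6)) auto
        also have "(\<Sum>k=1..n. B k o\<^sub>L f) = (\<Sum>k=1..n. B k) o\<^sub>L f" by (rule blinfun_eqI) (simp add: op_simps)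
        also have "(\<Sum>k=1..n. B k) o\<^sub>L f = f" unfolding B(2) by (rule blinfun_eqI) simp
        finally show ?thesis .
      qed
      obtain Q where Q: "\<And>k. k \<in> {1..n} \<Longrightarrow> Q k \<in> M \<and> projection (Q k) \<and> tr (Q k) = t k"
        "\<And>j k. j \<in> {1..n} \<Longrightarrow> k \<in> {1..n} \<Longrightarrow> j \<noteq> k \<Longrightarrow> Q j o\<^sub>L Q k = 0" "(\<Sum>k=1..n. Q k) = f"
        "\<And>k x. k \<in> {1..n} \<Longrightarrow> \<bar>inner (E (Q k) x) x - t k / tr f * (norm (f x))\<^sup>2\<bar> \<le> \<epsilon> * (norm (f x))\<^sup>2"
        using block_projections[OF f(1,2) trf t tsum eps] by metis
      \<comment> \<open>Three errors of size \<open>\<epsilon>\<close>: from \<open>E (Q k)\<close>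
        to the constant \<open>t k / tr f\<close>, from this to the scalar \<open>c\<close> of
        \<open>B k\<close> on \<open>f\<close>, and from \<open>c\<close> to \<open>B k\<close>. The
        second follows from the third by taking traces.\<close>
      have "\<bar>inner (E (Q k) x) x - inner (B k (f x)) x\<bar> \<le> 3 * \<epsilon> * (norm (f x))\<^sup>2" if k: "k \<in> {1..n}" for k x
      proof -
        obtain c where c: "\<And>x. norm (B k (f x) - c *\<^sub>R f x) \<le> \<epsilon> * norm (f x)"
          using f(3)[OF k] by (auto simp: nearly_scalar_def)
        have cb: "\<bar>inner (B k (f x)) x - c * (norm (f x))\<^sup>2\<bar> \<le> \<epsilon> * (norm (f x))\<^sup>2" for x
        proof -
          have "inner (B k (f x)) x - c * (norm (f x))\<^sup>2 = inner (B k (f x) - c *\<^sub>R f x) (f x)"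
            using Bff[OF k, of x] by (simp add: inner_simps power2_norm_eq_inner)
          also have "\<bar>\<dots>\<bar> \<le> norm (B k (f x) - c *\<^sub>R f x) * norm (f x)" by (rule Cauchy_Schwarz_ineq2)
          also have "\<dots> \<le> \<epsilon> * norm (f x) * norm (f x)" using c by (intro mult_right_mono) auto
          finally show ?thesis by (simp add: power2_eq_square mult.assoc)
        qed
        have sa: "self_adjoint (B k o\<^sub>L f)" "self_adjoint f" using BfM[OF k] positive_opD(1) f projectionD(1) by auto
        have "B k o\<^sub>L f \<preceq> (c + \<epsilon>) *\<^sub>R f" "(c - \<epsilon>) *\<^sub>R f \<preceq> B k o\<^sub>L f"
          using cb sa by (auto simp: op_le_iff self_adjoint_intros op_simps projection_norm[OF f(2)] abs_le_iff algebra_simps)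
        then have "t k \<le> (c + \<epsilon>) * tr f" "(c - \<epsilon>) * tr f \<le> t k"
          using tr_mono[OF BfM(1)[OF k], of "(c + \<epsilon>) *\<^sub>R f"] tr_mono[OF _ BfM(1)[OF k], of "(c - \<epsilon>) *\<^sub>R f"] fM
          by (auto simp: t_def tr_linear mem)
        then have "t k / tr f - c \<le> \<epsilon>" "- \<epsilon> \<le> t k / tr f - c" using trf by (simp_all add: field_simps)
        then have "(t k / tr f - c) * (norm (f x))\<^sup>2 \<le> \<epsilon> * (norm (f x))\<^sup>2" "(- \<epsilon>) * (norm (f x))\<^sup>2 \<le> (t k / tr f - c) * (norm (f x))\<^sup>2"
          by (intro mult_right_mono; simp)+
        then show ?thesis using cb[of x] Q(4)[OF k, of x] by (simp add: algebra_simps abs_le_iff)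
      qed
      then show ?thesis unfolding \<Phi>_def using Q by (intro exI[of _ Q]) (auto simp: t_def)
    qed
  next
    fix f g assume fg: "f \<in> A" "g \<in> A" "projection f" "projection g" "f o\<^sub>L g = 0" and "\<Phi> f" "\<Phi> g"
    obtain Q where Q: "\<And>k. k \<in> {1..n} \<Longrightarrow> Q k \<in> M" "\<And>k. k \<in> {1..n} \<Longrightarrow> projection (Q k)"
      "\<And>k. k \<in> {1..n} \<Longrightarrow> tr (Q k) = tr (B k o\<^sub>L f)"
      "\<And>k x. k \<in> {1..n} \<Longrightarrow> \<bar>inner (E (Q k) x) x - inner (B k (f x)) x\<bar> \<le> 3 * \<epsilon> * (norm (f x))\<^sup>2"
      "\<And>j k. j \<in> {1..n} \<Longrightarrow> k \<in> {1..n} \<Longrightarrow> j \<noteq> k \<Longrightarrow> Q j o\<^sub>L Q k = 0" "(\<Sum>k=1..n. Q k) = f"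
      using \<open>\<Phi> f\<close> unfolding \<Phi>_def by blast
    obtain R where R: "\<And>k. k \<in> {1..n} \<Longrightarrow> R k \<in> M" "\<And>k. k \<in> {1..n} \<Longrightarrow> projection (R k)"
      "\<And>k. k \<in> {1..n} \<Longrightarrow> tr (R k) = tr (B k o\<^sub>L g)"
      "\<And>k x. k \<in> {1..n} \<Longrightarrow> \<bar>inner (E (R k) x) x - inner (B k (g x)) x\<bar> \<le> 3 * \<epsilon> * (norm (g x))\<^sup>2"
      "\<And>j k. j \<in> {1..n} \<Longrightarrow> k \<in> {1..n} \<Longrightarrow> j \<noteq> k \<Longrightarrow> R j o\<^sub>L R k = 0" "(\<Sum>k=1..n. R k) = g"
      using \<open>\<Phi> g\<close> unfolding \<Phi>_def by blast
    have "orthogonal_partition {1..n} Q f" "orthogonal_partition {1..n} R g"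
      using Q(2,5,6) R(2,5,6) unfolding orthogonal_partition_def by blast+
    note step = orthogonal_add_step[OF this fg(5,3,4) finite_atLeastAtMost]
    have pyth: "(norm ((f + g) x))\<^sup>2 = (norm (f x))\<^sup>2 + (norm (g x))\<^sup>2" for x
      using projection_norm[OF projection_add[OF fg(3,4,5)], of x] projection_norm[OF fg(3), of x]
        projection_norm[OF fg(4), of x] by (simp add: op_simps inner_simps)
    have "\<bar>inner (E (Q k + R k) x) x - inner (B k ((f + g) x)) x\<bar> \<le> 3 * \<epsilon> * (norm ((f + g) x))\<^sup>2" if k: "k \<in> {1..n}" for k x
      using Q(4)[OF k, of x] R(4)[OF k, of x] unfolding pyth E_add[OF Q(1)[OF k] R(1)[OF k]]
      by (simp add: op_simps inner_simps algebra_simps abs_le_iff)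
    moreover have "tr (Q k + R k) = tr (B k o\<^sub>L (f + g))" if k: "k \<in> {1..n}" for k
    proof -
      have "B k o\<^sub>L (f + g) = (B k o\<^sub>L f) + (B k o\<^sub>L g)" by (rule blinfun_eqI) (simp add: op_simps)
      moreover have "B k o\<^sub>L f \<in> M" "B k o\<^sub>L g \<in> M" using B(1)[OF k] fg A_sub_M by auto
      ultimately show ?thesis using Q(1,3)[OF k] R(1,3)[OF k] by (simp add: tr_linear)
    qed
    ultimately show "\<Phi> (f + g)"
      unfolding \<Phi>_def using step(3,4,5) Q(1) R(1) by (intro exI[of _ "\<lambda>k. Q k + R k"]) auto
  qed (use eps in auto)
  then obtain Q where Q: "\<And>k. k \<in> {1..n} \<Longrightarrow> Q k \<in> M" "\<And>k. k \<in> {1..n} \<Longrightarrow> projection (Q k)"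
    "\<And>k. k \<in> {1..n} \<Longrightarrow> tr (Q k) = tr (B k o\<^sub>L id_blinfun)"
    "\<And>k x. k \<in> {1..n} \<Longrightarrow> \<bar>inner (E (Q k) x) x - inner (B k (id_blinfun x)) x\<bar> \<le> 3 * \<epsilon> * (norm (id_blinfun x))\<^sup>2"
    "\<And>j k. j \<in> {1..n} \<Longrightarrow> k \<in> {1..n} \<Longrightarrow> j \<noteq> k \<Longrightarrow> Q j o\<^sub>L Q k = 0" "(\<Sum>k=1..n. Q k) = id_blinfun"
    unfolding \<Phi>_def by blast
  have "norm (E (Q k) - B k) \<le> 3 * \<epsilon>" if k: "k \<in> {1..n}" for k
  proof (rule norm_blinfun_bound, use eps in simp, rule self_adjoint_norm_apply)
    show "self_adjoint (E (Q k) - B k)"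
      using E_self_adjoint[OF Q(1)[OF k] projectionD(1)[OF Q(2)[OF k]]] B(1)[OF k] positive_opD(1) by (intro self_adjoint_intros) auto
    show "\<bar>inner ((E (Q k) - B k) x) x\<bar> \<le> 3 * \<epsilon> * (norm x)\<^sup>2" for x
      using Q(4)[OF k, of x] by (simp add: op_simps inner_simps)
  qed
  moreover have "B k o\<^sub>L id_blinfun = B k" for k by (rule blinfun_eqI) simp
  ultimately show thesis using that[of Q] Q by simp
qed

text \<open>Equal traces give partial isometries \<open>v k\<close> from \<open>Q k\<close> to
  \<open>P k\<close>. As both families are orthogonal and sum to the identity, the sum
  \<open>U\<close> of the \<open>v k\<close> is unitary, and it conjugates the given operator into
  the combination of the \<open>Q k\<close>, whose expectation is close to the required sum.\<close>

lemma partition_imp_closure_orbit: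
  fixes P B :: "nat \<Rightarrow> 'a op" and z :: "nat \<Rightarrow> complex"
  assumes P: "\<And>k. k \<in> {1..n} \<Longrightarrow> P k \<in> M \<and> projection (P k)"
      "\<And>j k. j \<in> {1..n} \<Longrightarrow> k \<in> {1..n} \<Longrightarrow> j \<noteq> k \<Longrightarrow> P j o\<^sub>L P k = 0" "(\<Sum>k=1..n. P k) = id_blinfun"
    and B: "partition_of_unity A n B" "\<And>k. k \<in> {1..n} \<Longrightarrow> \<tau> (B k) = \<tau> (P k)"
  shows "(\<Sum>k=1..n. z k *\<^sub>C B k) \<in> closure (expectation_orbit M E (\<Sum>k=1..n. z k *\<^sub>C P k))"
  unfolding closure_approachable
proof (intro allI impI)
  fix \<eta> :: real assume \<eta>: "\<eta> > 0"
  define C where "C = (\<Sum>k=1..n. cmod (z k))"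
  have C: "C \<ge> 0" by (auto simp: C_def intro: sum_nonneg)
  \<comment> \<open>The final error is \<open>C * (3 * \<epsilon>)\<close>, at most half of
    \<open>\<eta>\<close>; the summand 1 covers \<open>C = 0\<close>.\<close>
  define \<epsilon> where "\<epsilon> = \<eta> / (6 * (C + 1))"
  have eps: "\<epsilon> > 0" "C * (3 * \<epsilon>) < \<eta>" using \<eta> C by (auto simp: \<epsilon>_def field_simps intro: add_pos_nonneg)
  have B': "B k \<in> A \<and> positive_op (B k)" if "k \<in> {1..n}" for k
    using B(1) that by (auto simp: partition_of_unity_def op_le_def)
  have Bsum: "(\<Sum>k=1..n. B k) = id_blinfun" using B(1) by (simp add: partition_of_unity_def)
  obtain Q where Q: "\<And>k. k \<in> {1..n} \<Longrightarrow> Q k \<in> M \<and> projection (Q k) \<and> tr (Q k) = tr (B k) \<and> norm (E (Q k) - B k) \<le> 3 * \<epsilon>"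
    "\<And>j k. j \<in> {1..n} \<Longrightarrow> k \<in> {1..n} \<Longrightarrow> j \<noteq> k \<Longrightarrow> Q j o\<^sub>L Q k = 0" "(\<Sum>k=1..n. Q k) = id_blinfun"
    using approximate_partition[OF B' Bsum eps(1)] by metis
  have "\<exists>v. v \<in> M \<and> adj v o\<^sub>L v = Q k \<and> v o\<^sub>L adj v = P k" if k: "k \<in> {1..n}" for k
    using equal_trace_equivalent[of "P k" "Q k"] P(1)[OF k] Q(1)[OF k] B(2)[OF k] by (metis tr_def)
  then obtain v where v: "\<And>k. k \<in> {1..n} \<Longrightarrow> v k \<in> M \<and> adj (v k) o\<^sub>L v k = Q k \<and> v k o\<^sub>L adj (v k) = P k" by metis
  have vb: "v k \<in> bounded_ops" if "k \<in> {1..n}" for k using v[OF that] sub by blast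
  have Qv: "Q k x = adj (v k) (v k x)" and Pv: "P k x = v k (adj (v k) x)" if "k \<in> {1..n}" for k x
    using v[OF that] by (metis blinfun_apply_blinfun_compose)+
  have vQ: "v k (Q k x) = v k x" if "k \<in> {1..n}" for k x
    using initial_projection_apply[OF vb[OF that]] v[OF that] Q(1)[OF that] by (metis Qv[OF that])
  have vP: "adj (v k) (P k x) = adj (v k) x" if "k \<in> {1..n}" for k x
    using initial_projection_apply[of "adj (v k)"] vb[OF that] v[OF that] P(1)[OF that] Pv[OF that] by simp
  have Pvk: "P k (v k x) = v k x" if "k \<in> {1..n}" for k x
    using vQ[OF that] that by (simp add: Pv Qv)
  have Qvk: "Q k (adj (v k) x) = adj (v k) x" if "k \<in> {1..n}" for k x
    using vP[OF that] that by (simp add: Pv Qv)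
  have o1: "adj (v j) (v k x) = (if j = k then Q k x else 0)" if "j \<in> {1..n}" "k \<in> {1..n}" for j k x
  proof (cases "j = k")
    case False
    have "adj (v j) (v k x) = adj (v j) (P j (P k (v k x)))" using that by (simp add: vP Pvk)
    also have "P j (P k (v k x)) = 0" using P(2)[OF that False] by (metis blinfun_apply_blinfun_compose blinfun.zero_left)
    finally show ?thesis using False by (simp add: blinfun.zero_right)
  qed (use Qv that in auto)
  have o2: "v j (adj (v k) x) = (if j = k then P k x else 0)" if "j \<in> {1..n}" "k \<in> {1..n}" for j k x
  proof (cases "j = k")
    case False
    have "v j (adj (v k) x) = v j (Q j (Q k (adj (v k) x)))" using that by (simp add: vQ Qvk)
    also have "Q j (Q k (adj (v k) x)) = 0" using Q(2)[OF that False] by (metis blinfun_apply_blinfun_compose blinfun.zero_left)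
    finally show ?thesis using False by (simp add: blinfun.zero_right)
  qed (use Pv that in auto)
  define U where "U = (\<Sum>k=1..n. v k)"
  have UM: "U \<in> M" unfolding U_def using v by (intro sum) auto
  have adjU: "adj U = (\<Sum>k=1..n. adj (v k))" unfolding U_def using adj_sum[of "{1..n}" v] vb by simp
  have Qs: "(\<Sum>k=1..n. Q k x) = x" and Ps: "(\<Sum>k=1..n. P k x) = x" for x
    using arg_cong[OF Q(3), of "\<lambda>T. blinfun_apply T x"] arg_cong[OF P(3), of "\<lambda>T. blinfun_apply T x"]
    by (simp_all add: blinfun.sum_left)
  have "unitary U"
    unfolding unitary_def
  proof (intro conjI)
    show "U \<in> bounded_ops" using UM sub by blast
    show "adj U o\<^sub>L U = id_blinfun"
    proof (rule blinfun_eqI)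
      fix x
      have "adj U (U x) = (\<Sum>k=1..n. \<Sum>j=1..n. adj (v j) (v k x))"
        unfolding adjU unfolding U_def by (simp add: blinfun.sum_left blinfun.sum_right)
      also have "\<dots> = (\<Sum>k=1..n. \<Sum>j=1..n. if j = k then Q k x else 0)" by (intro sum.cong refl o1)
      finally show "(adj U o\<^sub>L U) x = id_blinfun x" by (simp add: Qs[simplified])
    qed
    show "U o\<^sub>L adj U = id_blinfun"
    proof (rule blinfun_eqI)
      fix x
      have "U (adj U x) = (\<Sum>k=1..n. \<Sum>j=1..n. v j (adj (v k) x))"
        unfolding adjU unfolding U_def by (simp add: blinfun.sum_left blinfun.sum_right)
      also have "\<dots> = (\<Sum>k=1..n. \<Sum>j=1..n. if j = k then P k x else 0)" by (intro sum.cong refl o2)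
      finally show "(U o\<^sub>L adj U) x = id_blinfun x" by (simp add: Ps[simplified])
    qed
  qed
  have conj: "adj U o\<^sub>L (\<Sum>k=1..n. z k *\<^sub>C P k) o\<^sub>L U = (\<Sum>k=1..n. z k *\<^sub>C Q k)"
  proof (rule blinfun_eqI)
    fix x
    have PU: "P k (U x) = v k x" if "k \<in> {1..n}" for k
    proof -
      have "P k (v j x) = (if k = j then v j x else 0)" if "j \<in> {1..n}" for j
        using P(2)[OF \<open>k \<in> {1..n}\<close> that] Pvk that
        by (auto, metis blinfun_apply_blinfun_compose blinfun.zero_left)
      then have "(\<Sum>j=1..n. P k (v j x)) = (\<Sum>j=1..n. if k = j then v j x else 0)" by (intro sum.cong refl)
      then show ?thesis using that by (simp add: U_def blinfun.sum_left blinfun.sum_right)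
    qed
    have Uv: "adj U (v k x) = Q k x" if "k \<in> {1..n}" for k
    proof -
      have "(\<Sum>j=1..n. adj (v j) (v k x)) = (\<Sum>j=1..n. if j = k then Q k x else 0)"
        using that by (intro sum.cong refl o1)
      then show ?thesis using that by (simp add: adjU blinfun.sum_left)
    qed
    have aU: "adj U \<in> bounded_ops" using UM sub by blast
    show "(adj U o\<^sub>L (\<Sum>k=1..n. z k *\<^sub>C P k) o\<^sub>L U) x = (\<Sum>k=1..n. z k *\<^sub>C Q k) x"
      unfolding blinfun_apply_blinfun_compose blinfun.sum_left blinfun.sum_right blinfun_apply_scaleC bounded_opsD[OF aU]
      by (intro sum.cong refl) (simp only: PU Uv)
  qed
  define Y where "Y = E (adj U o\<^sub>L (\<Sum>k=1..n. z k *\<^sub>C P k) o\<^sub>L U)"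
  have "Y = (\<Sum>k=1..n. z k *\<^sub>C E (Q k))"
    unfolding Y_def conj using Q(1) by (intro E_sum_scaleC) auto
  then have "Y - (\<Sum>k=1..n. z k *\<^sub>C B k) = (\<Sum>k=1..n. z k *\<^sub>C (E (Q k) - B k))"
    by (intro blinfun_eqI) (simp add: op_simps sum_subtractf scaleC_diff_right)
  also have "norm \<dots> \<le> (\<Sum>k=1..n. cmod (z k) * (3 * \<epsilon>))"
    using Q(1) by (intro sum_norm_le order_trans[OF norm_scaleC_op] mult_left_mono) auto
  also have "\<dots> = C * (3 * \<epsilon>)" by (simp add: C_def sum_distrib_right)
  finally have "dist Y (\<Sum>k=1..n. z k *\<^sub>C B k) < \<eta>" using eps by (simp add: dist_norm)
  moreover have "Y \<in> expectation_orbit M E (\<Sum>k=1..n. z k *\<^sub>C P k)"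
    unfolding expectation_orbit_def Y_def using UM \<open>unitary U\<close> by blast
  ultimately show "\<exists>y\<in>expectation_orbit M E (\<Sum>k=1..n. z k *\<^sub>C P k). dist y (\<Sum>k=1..n. z k *\<^sub>C B k) < \<eta>" by blast
qed

end

section \<open>Normal operators with finite spectrum\<close>

lemma resolvent_bound:
  assumes "c \<notin> op_spectrum N"
  obtains \<delta> where "\<delta> > 0" "\<And>x. \<delta> * norm x \<le> norm (N x - c *\<^sub>C x)"
proof -
  obtain S where S: "S o\<^sub>L (N - c *\<^sub>C id_blinfun) = id_blinfun"
    using assms by (auto simp: op_spectrum_def)
  have "norm x \<le> (norm S + 1) * norm (N x - c *\<^sub>C x)" for x
  proof -
    have "x = S (N x - c *\<^sub>C x)"
      using arg_cong[OF S, of "\<lambda>T. blinfun_apply T x"] by (simp add: op_simps)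
    then have "norm x \<le> norm S * norm (N x - c *\<^sub>C x)" by (metis norm_blinfun)
    also have "\<dots> \<le> (norm S + 1) * norm (N x - c *\<^sub>C x)" by (intro mult_right_mono) auto
    finally show ?thesis .
  qed
  moreover have "norm S + 1 > 0" by (simp add: add_nonneg_pos)
  ultimately have "1 / (norm S + 1) * norm x \<le> norm (N x - c *\<^sub>C x)" for x
    by (simp add: divide_le_eq mult.commute)
  then show thesis using that[of "1 / (norm S + 1)"] \<open>norm S + 1 > 0\<close> by simp
qed

text \<open>Pointwise lower bounds become uniform by compactness: points \<open>c j\<close> at which
  the bounds get worse and worse would accumulate at a point outside the spectrum. Beyond
  \<open>norm N + 1\<close> the bound 1 is explicit, which confines the argument to a ball.\<close>

lemma uniform_resolvent_bound:
  fixes N :: "'h::complex_hilbert_space op"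
  assumes spec: "op_spectrum N \<subseteq> F" and r: "r > 0"
  obtains \<delta> where "\<delta> > 0" "\<And>c x. (\<And>w. w \<in> F \<Longrightarrow> r \<le> cmod (c - w)) \<Longrightarrow> \<delta> * norm x \<le> norm (N x - c *\<^sub>C x)"
proof -
  define K where "K = cball 0 (norm N + 1) \<inter> (\<Inter>w\<in>F. {c. r \<le> cmod (c - w)})"
  have "closed {c. r \<le> cmod (c - w)}" for w by (intro closed_Collect_le continuous_intros)
  then have K: "compact K" unfolding K_def by (intro compact_Int_closed closed_INT) auto
  have "\<exists>\<delta>>0. \<forall>c\<in>K. \<forall>x. \<delta> * norm x \<le> norm (N x - c *\<^sub>C x)"
  proof (rule ccontr)
    assume "\<not> ?thesis"
    then have "\<forall>j :: nat. \<exists>c\<in>K. \<exists>x. norm (N x - c *\<^sub>C x) < 1 / real (Suc j) * norm x"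
      by (metis not_le of_nat_0_less_iff zero_less_Suc zero_less_divide_1_iff)
    then obtain c x where c: "\<And>j :: nat. c j \<in> K" and x: "\<And>j. norm (N (x j) - c j *\<^sub>C x j) < 1 / real (Suc j) * norm (x j)"
      by metis
    obtain l s where l: "l \<in> K" "strict_mono s" "(c \<circ> s) \<longlonglongrightarrow> l"
      using K c unfolding compact_def by metis
    have "l \<notin> op_spectrum N" using l(1) spec r by (force simp: K_def)
    then obtain \<delta> where \<delta>: "\<delta> > 0" "\<And>x. \<delta> * norm x \<le> norm (N x - l *\<^sub>C x)" using resolvent_bound by blast
    have less: "\<delta> < 1 / real (Suc j) + cmod (c (s j) - l)" for j
    proof -
      define v where "v = x (s j)"
      have v0: "norm v > 0" using x[of "s j"] norm_ge_zero[of "N v - c (s j) *\<^sub>C v"]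
        unfolding v_def by (cases "norm (x (s j)) = 0") auto
      have "N v - l *\<^sub>C v = (N v - c (s j) *\<^sub>C v) + (c (s j) - l) *\<^sub>C v" by (simp add: scaleC_diff_left)
      then have "\<delta> * norm v \<le> norm (N v - c (s j) *\<^sub>C v) + norm ((c (s j) - l) *\<^sub>C v)"
        using \<delta>(2)[of v] norm_triangle_ineq by (metis order_trans)
      also have "\<dots> < 1 / real (Suc (s j)) * norm v + cmod (c (s j) - l) * norm v"
        using x[of "s j"] by (simp add: v_def norm_scaleC)
      finally have "\<delta> * norm v < (1 / real (Suc (s j)) + cmod (c (s j) - l)) * norm v" by (simp add: algebra_simps)
      then have "\<delta> < 1 / real (Suc (s j)) + cmod (c (s j) - l)" using v0 by simp
      moreover have "1 / real (Suc (s j)) \<le> 1 / real (Suc j)" using seq_suble[OF l(2), of j] by (simp add: frac_le)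
      ultimately show ?thesis by linarith
    qed
    have "(\<lambda>j. 1 / real (Suc j) + cmod (c (s j) - l)) \<longlonglongrightarrow> 0 + cmod (l - l)"
      using l(3) LIMSEQ_inverse_real_of_nat by (intro tendsto_intros) (simp_all add: inverse_eq_divide o_def)
    then have "\<delta> \<le> 0 + cmod (l - l)" using less by (intro LIMSEQ_le_const) (auto intro: less_imp_le)
    then show False using \<delta>(1) by simp
  qed
  then obtain \<delta> where \<delta>: "\<delta> > 0" "\<And>c x. c \<in> K \<Longrightarrow> \<delta> * norm x \<le> norm (N x - c *\<^sub>C x)" by blast
  show thesis
  proof
    show "min \<delta> 1 > 0" using \<delta> by simp
    fix c x assume c: "\<And>w. w \<in> F \<Longrightarrow> r \<le> cmod (c - w)"
    show "min \<delta> 1 * norm x \<le> norm (N x - c *\<^sub>C x)"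
    proof (cases "cmod c \<le> norm N + 1")
      case True
      then have "c \<in> K" using c by (auto simp: K_def)
      then have "\<delta> * norm x \<le> norm (N x - c *\<^sub>C x)" by (rule \<delta>(2))
      moreover have "min \<delta> 1 * norm x \<le> \<delta> * norm x" by (intro mult_right_mono) auto
      ultimately show ?thesis by linarith
    next
      case False
      have "min \<delta> 1 * norm x \<le> 1 * norm x" by (intro mult_right_mono) auto
      also have "\<dots> \<le> (cmod c - norm N) * norm x" using False by (intro mult_right_mono) auto
      also have "\<dots> \<le> norm (c *\<^sub>C x) - norm (N x)"
        using norm_blinfun[of N x] by (simp add: norm_scaleC algebra_simps)
      also have "\<dots> \<le> norm (N x - c *\<^sub>C x)" by (metis norm_minus_commute norm_triangle_ineq2)
      finally show ?thesis .
    qed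
  qed
qed

text \<open>Including \<open>adj N\<close> makes the generating set closed under adjoints, so the
  double commutant is a von Neumann algebra; normality makes the set commute, hence the algebra is
  abelian.\<close>

lemma normal_double_commutant:
  assumes "normal_operator N"
  shows "abelian_vn_algebra (commutant (commutant {N, adj N}))" "N \<in> commutant (commutant {N, adj N})"
proof -
  define S where "S = {N, adj N}"
  have N: "N \<in> bounded_ops" "adj N o\<^sub>L N = N o\<^sub>L adj N" using assms by (auto simp: normal_operator_def)
  have Sb: "S \<subseteq> bounded_ops" using N by (simp add: S_def)
  have "von_neumann_algebra (commutant S)"
    using N Sb by (intro commutant_von_neumann) (auto simp: S_def)
  then have vn: "von_neumann_algebra (commutant (commutant S))"
    by (intro commutant_von_neumann) (auto simp: commutant_subset von_neumann_algebra_def star_subalgebra_def)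
  have "S \<subseteq> commutant S" using N by (auto simp: S_def commutant_def)
  then have "commutant (commutant S) \<subseteq> commutant S" by (rule commutant_antimono)
  then have "abelian (commutant (commutant S))" by (auto simp: abelian_def commutant_def)
  then show "abelian_vn_algebra (commutant (commutant {N, adj N}))"
    using vn unfolding S_def by unfold_locales
  show "N \<in> commutant (commutant {N, adj N})" using subset_double_commutant[OF Sb] by (auto simp: S_def)
qed

text \<open>Where the real and imaginary parts of \<open>N\<close> are almost scalar on
  \<open>f \<noteq> 0\<close>, \<open>N\<close> is almost a scalar \<open>c\<close> there. A nonzero
  vector in the range of \<open>f\<close> then violates the lower bound for \<open>N - c\<close>
  unless \<open>c\<close> is within \<open>r\<close> of some \<open>z k\<close>, and
  \<open>f\<close> is assigned to that index.\<close>

lemma (in abelian_vn_algebra) approximate_spectral_projections: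
  fixes z :: "nat \<Rightarrow> complex"
  assumes N: "N \<in> W" and spec: "op_spectrum N = z ` {1..n}" and r: "r > 0"
  obtains P where "\<And>k. k \<in> {1..n} \<Longrightarrow> P k \<in> W \<and> projection (P k)"
    "\<And>k x. k \<in> {1..n} \<Longrightarrow> norm (N (P k x) - z k *\<^sub>C P k x) \<le> 2 * r * norm (P k x)"
    "\<And>j k. j \<in> {1..n} \<Longrightarrow> k \<in> {1..n} \<Longrightarrow> j \<noteq> k \<Longrightarrow> P j o\<^sub>L P k = 0" "(\<Sum>k=1..n. P k) = id_blinfun"
proof -
  obtain X Y where XY: "X \<in> W" "Y \<in> W" "self_adjoint X" "self_adjoint Y" "N = X + \<i> *\<^sub>C Y"
    using real_imaginary_parts[OF N] by metis
  obtain \<delta> where \<delta>: "\<delta> > 0" "\<And>c x. (\<And>w. w \<in> z ` {1..n} \<Longrightarrow> r \<le> cmod (c - w)) \<Longrightarrow> \<delta> * norm x \<le> norm (N x - c *\<^sub>C x)"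
    using uniform_resolvent_bound[of N "z ` {1..n}" r] spec r by auto
  \<comment> \<open>\<open>2 * \<epsilon> < \<delta>\<close> yields the contradiction with the
    resolvent bound, and \<open>2 * \<epsilon> \<le> r\<close> keeps the total error
    \<open>2 * \<epsilon> + r\<close> within \<open>2 * r\<close>.\<close>
  define \<epsilon> where "\<epsilon> = min (\<delta> / 3) (r / 2)"
  have eps: "\<epsilon> > 0" "2 * \<epsilon> < \<delta>" "2 * \<epsilon> \<le> r" using \<delta> r by (auto simp: \<epsilon>_def min_def)
  define \<Phi> where "\<Phi> f = (\<exists>P. (\<forall>k\<in>{1..n}. P k \<in> W \<and> projection (P k) \<and>
      (\<forall>x. norm (N (P k x) - z k *\<^sub>C P k x) \<le> 2 * r * norm (P k x))) \<and>
      (\<forall>j\<in>{1..n}. \<forall>k\<in>{1..n}. j \<noteq> k \<longrightarrow> P j o\<^sub>L P k = 0) \<and> (\<Sum>k=1..n. P k) = f)" for f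
  have "\<Phi> id_blinfun"
  proof (rule cut_induct_family[of "{X, Y}" "\<lambda>S. S" \<epsilon> id_blinfun \<Phi>])
    show "S \<in> W \<and> self_adjoint S" if "S \<in> {X, Y}" for S using XY that by auto
    fix f assume f: "f \<in> W" "projection f" "\<And>S. S \<in> {X, Y} \<Longrightarrow> nearly_scalar \<epsilon> S f"
    show "\<Phi> f"
    proof (cases "f = 0")
      case True
      then show ?thesis unfolding \<Phi>_def by (intro exI[of _ "\<lambda>_. 0"]) (simp add: op_simps)
    next
      case False
      obtain a b where ab: "\<And>x. norm (X (f x) - a *\<^sub>R f x) \<le> \<epsilon> * norm (f x)" "\<And>x. norm (Y (f x) - b *\<^sub>R f x) \<le> \<epsilon> * norm (f x)"
        using f(3)[of X] f(3)[of Y] by (auto simp: nearly_scalar_def)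
      define c where "c = complex_of_real a + \<i> * complex_of_real b"
      have Nc: "norm (N (f x) - c *\<^sub>C f x) \<le> 2 * \<epsilon> * norm (f x)" for x
      proof -
        have "N (f x) - c *\<^sub>C f x = (X (f x) - a *\<^sub>R f x) + \<i> *\<^sub>C (Y (f x) - b *\<^sub>R f x)"
          by (simp add: XY(5) c_def op_simps scaleC_add_left scaleC_diff_right scaleC_of_real[symmetric] scaleC_scaleC)
        also have "norm \<dots> \<le> norm (X (f x) - a *\<^sub>R f x) + norm (Y (f x) - b *\<^sub>R f x)"
          using norm_triangle_ineq[of "X (f x) - a *\<^sub>R f x" "\<i> *\<^sub>C (Y (f x) - b *\<^sub>R f x)"] by (simp add: norm_scaleC)
        finally show ?thesis using ab[of x] by linarith
      qed
      obtain x where "f x \<noteq> 0" using False by (metis blinfun.zero_left blinfun_eqI)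
      then have "norm (N (f x) - c *\<^sub>C f x) < \<delta> * norm (f x)"
        using le_less_trans[OF Nc[of x] mult_strict_right_mono[OF eps(2), of "norm (f x)"]] by simp
      then have "\<not> (\<forall>w\<in>z ` {1..n}. r \<le> cmod (c - w))" using \<delta>(2)[of c "f x"] by (auto simp: not_le[symmetric])
      then obtain k where k: "k \<in> {1..n}" "cmod (c - z k) < r" by (auto simp: not_le)
      define P where "P j = (if j = k then f else 0)" for j
      have "norm (N (f x) - z k *\<^sub>C f x) \<le> 2 * r * norm (f x)" for x
      proof -
        have "N (f x) - z k *\<^sub>C f x = (N (f x) - c *\<^sub>C f x) + (c - z k) *\<^sub>C f x" by (simp add: scaleC_diff_left)
        then have "norm (N (f x) - z k *\<^sub>C f x) \<le> norm (N (f x) - c *\<^sub>C f x) + norm ((c - z k) *\<^sub>C f x)"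
          by (metis norm_triangle_ineq)
        also have "\<dots> \<le> 2 * \<epsilon> * norm (f x) + r * norm (f x)"
          using Nc[of x] k(2) by (intro add_mono) (auto simp: norm_scaleC intro: mult_right_mono)
        also have "\<dots> \<le> 2 * r * norm (f x)"
          using mult_right_mono[OF eps(3), of "norm (f x)"] by (simp add: algebra_simps)
        finally show ?thesis .
      qed
      then show ?thesis
        unfolding \<Phi>_def using f k by (intro exI[of _ P]) (auto simp: P_def op_simps)
    qed
  next
    fix f g assume fg: "f \<in> W" "g \<in> W" "projection f" "projection g" "f o\<^sub>L g = 0" and "\<Phi> f" "\<Phi> g"
    obtain P where P: "\<And>k. k \<in> {1..n} \<Longrightarrow> P k \<in> W" "\<And>k. k \<in> {1..n} \<Longrightarrow> projection (P k)"
      "\<And>k x. k \<in> {1..n} \<Longrightarrow> norm (N (P k x) - z k *\<^sub>C P k x) \<le> 2 * r * norm (P k x)"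
      "\<And>j k. j \<in> {1..n} \<Longrightarrow> k \<in> {1..n} \<Longrightarrow> j \<noteq> k \<Longrightarrow> P j o\<^sub>L P k = 0" "(\<Sum>k=1..n. P k) = f"
      using \<open>\<Phi> f\<close> unfolding \<Phi>_def by blast
    obtain R where R: "\<And>k. k \<in> {1..n} \<Longrightarrow> R k \<in> W" "\<And>k. k \<in> {1..n} \<Longrightarrow> projection (R k)"
      "\<And>k x. k \<in> {1..n} \<Longrightarrow> norm (N (R k x) - z k *\<^sub>C R k x) \<le> 2 * r * norm (R k x)"
      "\<And>j k. j \<in> {1..n} \<Longrightarrow> k \<in> {1..n} \<Longrightarrow> j \<noteq> k \<Longrightarrow> R j o\<^sub>L R k = 0" "(\<Sum>k=1..n. R k) = g"
      using \<open>\<Phi> g\<close> unfolding \<Phi>_def by blast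
    have "orthogonal_partition {1..n} P f" "orthogonal_partition {1..n} R g"
      using P(2,4,5) R(2,4,5) unfolding orthogonal_partition_def by blast+
    note step = orthogonal_add_step[OF this fg(5,3,4) finite_atLeastAtMost]
    have "norm (N ((P k + R k) x) - z k *\<^sub>C (P k + R k) x) \<le> 2 * r * norm ((P k + R k) x)" if k: "k \<in> {1..n}" for k x
    proof -
      have PR: "P k (R k x) = 0" for x
        using compose_eqD[OF step(1)[OF k k]] by (simp add: blinfun.zero_left)
      have pyth: "(norm (u + v))\<^sup>2 = (norm u)\<^sup>2 + (norm v)\<^sup>2" if "P k u = u" "R k v = v" for u v
      proof -
        have "inner u v = inner u (P k (R k v))"
          using that self_adjointD(3)[OF projectionD(1)[OF P(2)[OF k]], of u "R k v"] by simp
        then have "inner u v = 0" by (simp add: PR)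
        then show ?thesis by (simp add: power2_norm_eq_inner inner_simps inner_commute)
      qed
      \<comment> \<open>\<open>N\<close> commutes with the projections, so the error vectors for
        \<open>P k\<close> and \<open>R k\<close> stay in orthogonal ranges; the relative error
        \<open>2 * r\<close> does not grow when the pieces are added.\<close>
      have NP: "P k (N (P k x) - z k *\<^sub>C P k x) = N (P k x) - z k *\<^sub>C P k x"
        "R k (N (R k x) - z k *\<^sub>C R k x) = N (R k x) - z k *\<^sub>C R k x"
        using commute'[OF P(1)[OF k] N] commute'[OF R(1)[OF k] N] P(2)[OF k] R(2)[OF k]
        by (simp_all add: blinfun.diff_right projectionD bounded_opsD)
      have "N ((P k + R k) x) - z k *\<^sub>C (P k + R k) x = (N (P k x) - z k *\<^sub>C P k x) + (N (R k x) - z k *\<^sub>C R k x)"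
        by (simp add: op_simps scaleC_add_right)
      then have "(norm (N ((P k + R k) x) - z k *\<^sub>C (P k + R k) x))\<^sup>2
          = (norm (N (P k x) - z k *\<^sub>C P k x))\<^sup>2 + (norm (N (R k x) - z k *\<^sub>C R k x))\<^sup>2"
        using pyth[OF NP] by simp
      also have "\<dots> \<le> (2 * r * norm (P k x))\<^sup>2 + (2 * r * norm (R k x))\<^sup>2"
        using P(3)[OF k] R(3)[OF k] by (intro add_mono power_mono) auto
      also have "\<dots> = (2 * r)\<^sup>2 * ((norm (P k x))\<^sup>2 + (norm (R k x))\<^sup>2)" by (simp add: power_mult_distrib algebra_simps)
      also have "(norm (P k x))\<^sup>2 + (norm (R k x))\<^sup>2 = (norm ((P k + R k) x))\<^sup>2"
        using pyth[of "P k x" "R k x"] P(2)[OF k] R(2)[OF k] by (simp add: projectionD blinfun.add_left)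
      finally have "(norm (N ((P k + R k) x) - z k *\<^sub>C (P k + R k) x))\<^sup>2 \<le> (2 * r * norm ((P k + R k) x))\<^sup>2"
        by (simp add: power_mult_distrib)
      then show ?thesis by (rule power2_le_imp_le) (use r in simp)
    qed
    then show "\<Phi> (f + g)"
      unfolding \<Phi>_def using step(3,4,5) P(1) R(1) by (intro exI[of _ "\<lambda>k. P k + R k"]) auto
  qed (use eps in auto)
  then show thesis unfolding \<Phi>_def using that by blast
qed

text \<open>For small \<open>r\<close> the approximate spectral projections do not depend on \<open>r\<close>.\<close>

lemma normal_finite_spectrum:
  fixes N :: "'h::complex_hilbert_space op" and z :: "nat \<Rightarrow> complex"
  assumes N: "normal_operator N" and spec: "op_spectrum N = z ` {1..n}" and inj: "inj_on z {1..n}"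
  obtains P where "\<And>k. k \<in> {1..n} \<Longrightarrow> P k \<in> commutant (commutant {N, adj N}) \<and> projection (P k)"
    "\<And>k x. k \<in> {1..n} \<Longrightarrow> N (P k x) = z k *\<^sub>C P k x"
    "\<And>j k. j \<in> {1..n} \<Longrightarrow> k \<in> {1..n} \<Longrightarrow> j \<noteq> k \<Longrightarrow> P j o\<^sub>L P k = 0" "(\<Sum>k=1..n. P k) = id_blinfun"
proof -
  define W where "W = commutant (commutant {N, adj N})"
  interpret abelian_vn_algebra W unfolding W_def by (rule normal_double_commutant[OF N])
  have NW: "N \<in> W" unfolding W_def by (rule normal_double_commutant[OF N])
  define G where "G r P \<longleftrightarrow> (\<forall>k\<in>{1..n}. P k \<in> W \<and> projection (P k)) \<and>
      (\<forall>k\<in>{1..n}. \<forall>x. norm (N (P k x) - z k *\<^sub>C P k x) \<le> 2 * r * norm (P k x)) \<and>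
      (\<forall>j\<in>{1..n}. \<forall>k\<in>{1..n}. j \<noteq> k \<longrightarrow> P j o\<^sub>L P k = 0) \<and> (\<Sum>k=1..n. P k) = id_blinfun" for r P
  have "\<exists>P. G r P" if "r > 0" for r
    by (rule approximate_spectral_projections[OF NW spec that]) (unfold G_def, blast)
  then obtain P where G: "\<And>r. r > 0 \<Longrightarrow> G r (P r)" by metis
  have P: "\<And>r k. r > 0 \<Longrightarrow> k \<in> {1..n} \<Longrightarrow> P r k \<in> W \<and> projection (P r k)"
    "\<And>r k x. r > 0 \<Longrightarrow> k \<in> {1..n} \<Longrightarrow> norm (N (P r k x) - z k *\<^sub>C P r k x) \<le> 2 * r * norm (P r k x)"
    "\<And>r j k. r > 0 \<Longrightarrow> j \<in> {1..n} \<Longrightarrow> k \<in> {1..n} \<Longrightarrow> j \<noteq> k \<Longrightarrow> P r j o\<^sub>L P r k = 0"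
    "\<And>r. r > 0 \<Longrightarrow> (\<Sum>k=1..n. P r k) = id_blinfun"
    using G unfolding G_def by blast+
  obtain \<eta> where \<eta>: "\<eta> > 0" "\<And>j k. j \<in> {1..n} \<Longrightarrow> k \<in> {1..n} \<Longrightarrow> j \<noteq> k \<Longrightarrow> \<eta> \<le> cmod (z j - z k)"
  proof -
    \<comment> \<open>The extra 1 keeps the set nonempty when there are fewer than two
      points.\<close>
    define D where "D = insert 1 ((\<lambda>(j, k). cmod (z j - z k)) ` ({1..n} \<times> {1..n} - Id))"
    have D: "finite D" "D \<noteq> {}" unfolding D_def by simp_all
    have "0 < y" if "y \<in> D" for y using that inj unfolding D_def inj_on_def by fastforce
    then have "Min D > 0" using D by simp
    moreover have "Min D \<le> cmod (z j - z k)" if "j \<in> {1..n}" "k \<in> {1..n}" "j \<noteq> k" for j k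
      using D(1) that unfolding D_def by (intro Min_le) auto
    ultimately show thesis using that by blast
  qed
  define r0 where "r0 = \<eta> / 5"
  have r0: "r0 > 0" "4 * r0 < \<eta>" using \<eta> by (auto simp: r0_def)
  \<comment> \<open>A vector in both ranges is an approximate eigenvector for \<open>z j\<close> and
    for \<open>z k\<close>, with relative errors at most \<open>2 * r0\<close> each;
    \<open>4 * r0 < \<eta>\<close> leaves only 0. So families with different parameters are
    orthogonal to each other like parts of one family.\<close>
  have zero: "P r0 j (P s k x) = 0" if s: "0 < s" "s \<le> r0" and jk: "j \<in> {1..n}" "k \<in> {1..n}" "j \<noteq> k" for s j k x
  proof -
    define y where "y = P r0 j (P s k x)"
    have c: "P r0 j (P s k x) = P s k (P r0 j x)" using commute' P(1)[OF r0(1) jk(1)] P(1)[OF s(1) jk(2)] by blast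
    have "norm (N y - z j *\<^sub>C y) \<le> 2 * r0 * norm y" "norm (N y - z k *\<^sub>C y) \<le> 2 * s * norm y"
      using P(2)[OF r0(1) jk(1), of "P s k x"] P(2)[OF s(1) jk(2), of "P r0 j x"] by (simp_all add: y_def c[symmetric])
    moreover have "(z j - z k) *\<^sub>C y = (N y - z k *\<^sub>C y) - (N y - z j *\<^sub>C y)" by (simp add: scaleC_diff_left)
    then have "norm ((z j - z k) *\<^sub>C y) \<le> norm (N y - z k *\<^sub>C y) + norm (N y - z j *\<^sub>C y)"
      by (metis norm_triangle_ineq4)
    ultimately have "cmod (z j - z k) * norm y \<le> (2 * s + 2 * r0) * norm y"
      by (simp add: norm_scaleC algebra_simps)
    also have "\<dots> \<le> 4 * r0 * norm y" using s by (intro mult_right_mono) auto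
    finally have "cmod (z j - z k) * norm y \<le> 4 * r0 * norm y" .
    moreover have "\<eta> * norm y \<le> cmod (z j - z k) * norm y" using \<eta>(2)[OF jk] by (intro mult_right_mono) auto
    ultimately have "(\<eta> - 4 * r0) * norm y \<le> 0" by (simp add: algebra_simps)
    then have "norm y = 0" using r0 by (simp add: mult_le_0_iff)
    then show ?thesis by (simp add: y_def)
  qed
  have indep: "P r0 k x = P s k x" if s: "0 < s" "s \<le> r0" and k: "k \<in> {1..n}" for s k x
  proof -
    have sum: "(\<Sum>j=1..n. P r j v) = v" if "r > 0" for r v
      using arg_cong[OF P(4)[OF that], of "\<lambda>T. blinfun_apply T v"] by (simp add: blinfun.sum_left)
    have "P r0 k x = P r0 k (\<Sum>j=1..n. P s j x)" by (simp only: sum[OF s(1)])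
    also have "\<dots> = (\<Sum>j=1..n. if k = j then P r0 k (P s k x) else 0)"
      unfolding blinfun.sum_right using zero[OF s k] by (intro sum.cong) auto
    also have "\<dots> = (\<Sum>j=1..n. P r0 j (P s k x))"
      using zero[OF s _ k] by (intro sum.cong) auto
    also have "\<dots> = P s k x" by (rule sum[OF r0(1)])
    finally show ?thesis .
  qed
  have eigen: "N (P r0 k x) = z k *\<^sub>C P r0 k x" if k: "k \<in> {1..n}" for k x
  proof -
    define a where "a = norm (N (P r0 k x) - z k *\<^sub>C P r0 k x)"
    \<comment> \<open>The projection for \<open>r0\<close> is also the one for any smaller
      \<open>s\<close>, so its eigenvalue error is bounded by arbitrarily small numbers.\<close>
    have b: "a \<le> 2 * s * norm (P r0 k x)" if "0 < s" "s \<le> r0" for s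
      using P(2)[OF that(1) k, of x] indep[OF that k, of x] by (simp add: a_def)
    have "a \<le> 0"
    proof (rule field_le_epsilon)
      fix d :: real assume d: "d > 0"
      define s where "s = min r0 (d / (2 * (norm (P r0 k x) + 1)))"
      have p: "2 * (norm (P r0 k x) + 1) > 0" by (simp add: add_nonneg_pos)
      have "0 < s" "s \<le> r0" using r0 d p by (auto simp: s_def)
      then have "a \<le> 2 * s * norm (P r0 k x)" by (rule b)
      also have "\<dots> \<le> s * (2 * (norm (P r0 k x) + 1))" using \<open>0 < s\<close> by (simp add: algebra_simps)
      also have "\<dots> \<le> d / (2 * (norm (P r0 k x) + 1)) * (2 * (norm (P r0 k x) + 1))"
        using p by (intro mult_right_mono) (auto simp: s_def)
      also have "\<dots> = d" using p by simp
      finally show "a \<le> 0 + d" by simp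
    qed
    then show ?thesis by (simp add: a_def)
  qed
  show thesis
    by (rule that[of "P r0"])
      (rule P(1)[OF r0(1), unfolded W_def] eigen P(3)[OF r0(1)] P(4)[OF r0(1)]; assumption)+
qed

section \<open>Spectral measures\<close>

lemma cinner_zero_left [simp]: "cinner 0 (x :: 'h::complex_hilbert_space) = 0"
  using cinner_scaleC_left[of 0 "0 :: 'h" x] by simp

lemma cinner_diff_left: "cinner (x - y) (w :: 'h::complex_hilbert_space) = cinner x w - cinner y w"
  using cinner_add_left[of "x - y" y w] by simp

lemma cinner_add_right: "cinner (w :: 'h::complex_hilbert_space) (x + y) = cinner w x + cinner w y"
  by (metis cinner_add_left cinner_commute complex_cnj_add)

lemma cinner_sum_left: "cinner (\<Sum>i\<in>I. f i) (w :: 'h::complex_hilbert_space) = (\<Sum>i\<in>I. cinner (f i) w)"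
  by (induction I rule: infinite_finite_induct) (auto simp: cinner_add_left)

lemma complex_polarization:
  fixes s t :: complex
  assumes "s + t = 0" "- \<i> * s + \<i> * t = 0"
  shows "s = 0"
proof -
  have "s = t" using assms(2) by (simp add: algebra_simps)
  then show ?thesis using assms(1) by simp
qed

text \<open>\<open>spectral_projection\<close> is a definite description over all spectral measures
  of \<open>N\<close>, so an arbitrary one has to be studied; its value at a single point turns out
  to be the projection onto the eigenspace.\<close>

locale operator_spectral_measure =
  fixes Q :: "complex set \<Rightarrow> 'h::complex_hilbert_space op" and N :: "'h op"
  assumes sm: "spectral_measure Q N" and N: "N \<in> bounded_ops"
begin

lemma proj: "X \<in> sets borel \<Longrightarrow> projection (Q X)"
  and UNIV: "Q UNIV = id_blinfun"
  and Int: "X \<in> sets borel \<Longrightarrow> Y \<in> sets borel \<Longrightarrow> Q (X \<inter> Y) = Q X o\<^sub>L Q Y"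
  and sums: "range F \<subseteq> sets borel \<Longrightarrow> disjoint_family F \<Longrightarrow> (\<lambda>i. Q (F i) x) sums Q (\<Union>i. F i) x"
  and integrable: "integrable (scalar_measure Q x) (\<lambda>w. w)"
  and integral: "cinner (N x) x = (LINT w|scalar_measure Q x. w)"
  using sm by (auto simp: spectral_measure_def)

lemma Int_apply: "X \<in> sets borel \<Longrightarrow> Y \<in> sets borel \<Longrightarrow> Q X (Q Y x) = Q (X \<inter> Y) x"
  using Int by simp

lemma empty: "Q {} x = 0"
proof -
  have "(\<lambda>i :: nat. Q {} x) sums Q (\<Union>i :: nat. {}) x"
    by (rule sums) (auto simp: disjoint_family_on_def)
  then show ?thesis using sums_summable summable_const_iff by blast
qed

lemma quadratic: "X \<in> sets borel \<Longrightarrow> Re (cinner (Q X x) x) = (norm (Q X x))\<^sup>2"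
  by (simp add: Re_cinner projection_norm proj)

lemma emeasure_scalar:
  assumes X: "X \<in> sets borel"
  shows "emeasure (scalar_measure Q x) X = ennreal ((norm (Q X x))\<^sup>2)"
proof -
  have "emeasure (scalar_measure Q x) X = ennreal (Re (cinner (Q X x) x))"
  proof (rule emeasure_measure_of[OF scalar_measure_def])
    show "sets borel \<subseteq> Pow (UNIV :: complex set)" by simp
    have s: "sets (scalar_measure Q x) = sets borel"
      using sets.sigma_sets_eq[of "borel :: complex measure"] by (simp add: scalar_measure_def)
    show "X \<in> sets (scalar_measure Q x)" using X s by simp
    show "positive (sets (scalar_measure Q x)) (\<lambda>X. ennreal (Re (cinner (Q X x) x)))"
      by (simp add: positive_def empty Re_cinner)
    show "countably_additive (sets (scalar_measure Q x)) (\<lambda>X. ennreal (Re (cinner (Q X x) x)))"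
      unfolding s
    proof (rule countably_additiveI)
      fix F :: "nat \<Rightarrow> complex set" assume F: "range F \<subseteq> sets borel" "disjoint_family F" "(\<Union>i. F i) \<in> sets borel"
      have "(\<lambda>i. inner (Q (F i) x) x) sums inner (Q (\<Union>i. F i) x) x"
        using sums[OF F(1,2), of x] bounded_linear.sums[OF bounded_linear_inner_left] by blast
      moreover have "0 \<le> inner (Q (F i) x) x" for i using F projection_norm[OF proj, of "F i" x] by auto
      ultimately show "(\<Sum>i. ennreal (Re (cinner (Q (F i) x) x))) = ennreal (Re (cinner (Q (\<Union>i. F i) x) x))"
        unfolding Re_cinner by (simp add: sums_iff suminf_ennreal_eq)
    qed
  qed
  then show ?thesis using quadratic[OF X] by simp
qed

lemma sets_scalar [measurable_cong]: "sets (scalar_measure Q x) = sets borel"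
  using sets.sigma_sets_eq[of "borel :: complex measure"] by (simp add: scalar_measure_def)

lemma space_scalar [simp]: "space (scalar_measure Q x) = UNIV"
  by (simp add: scalar_measure_def space_measure_of_conv)

lemma finite_scalar: "finite_measure (scalar_measure Q x)"
  by (rule finite_measureI) (simp add: emeasure_scalar)

lemma measure_scalar: "X \<in> sets borel \<Longrightarrow> measure (scalar_measure Q x) X = (norm (Q X x))\<^sup>2"
  by (simp add: measure_def emeasure_scalar)

lemma integral_indicator_scaleR:
  assumes X: "X \<in> sets borel"
  shows "(LINT w|scalar_measure Q x. indicator X w *\<^sub>R (c :: 'b::{banach, second_countable_topology}))
      = measure (scalar_measure Q x) X *\<^sub>R c"
    "Bochner_Integration.integrable (scalar_measure Q x) (\<lambda>w. indicator X w *\<^sub>R c)"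
proof -
  interpret finite_measure "scalar_measure Q x" by (rule finite_scalar)
  have i: "Bochner_Integration.integrable (scalar_measure Q x) (indicator X :: complex \<Rightarrow> real)"
    using X by (intro integrable_real_indicator) (auto simp: sets_scalar emeasure_finite less_top[symmetric])
  show "(LINT w|scalar_measure Q x. indicator X w *\<^sub>R c) = measure (scalar_measure Q x) X *\<^sub>R c"
    by (subst integral_scaleR_left[OF i]) simp
  show "Bochner_Integration.integrable (scalar_measure Q x) (\<lambda>w. indicator X w *\<^sub>R c)"
    using i by (rule integrable_scaleR_left)
qed

lemma scalar_restrict:
  assumes X: "X \<in> sets borel"
  shows "scalar_measure Q (Q X x) = density (scalar_measure Q x) (indicator X)"
proof (rule measure_eqI)
  show "sets (scalar_measure Q (Q X x)) = sets (density (scalar_measure Q x) (indicator X))" by (simp add: sets_scalar)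
  fix Y assume "Y \<in> sets (scalar_measure Q (Q X x))"
  then have Y: "Y \<in> sets borel" by (simp add: sets_scalar)
  have "emeasure (density (scalar_measure Q x) (indicator X)) Y = emeasure (scalar_measure Q x) (X \<inter> Y)"
    using X Y by (intro emeasure_restricted) (simp_all add: sets_scalar)
  then show "emeasure (scalar_measure Q (Q X x)) Y = emeasure (density (scalar_measure Q x) (indicator X)) Y"
    using X Y by (simp add: emeasure_scalar Int_apply Int_commute)
qed

lemma compl:
  assumes X: "X \<in> sets borel"
  shows "Q (- X) x = x - Q X x"
proof -
  have b: "range (binaryset X (- X)) \<subseteq> sets borel" using X by (auto simp: range_binaryset_eq)
  have d: "disjoint_family (binaryset X (- X))"
    by (auto simp: disjoint_family_on_def binaryset_def)
  have "(\<lambda>i. Q (binaryset X (- X) i) x) sums Q UNIV x"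
    using sums[OF b d, of x] by (simp add: UN_binaryset_eq)
  moreover have "(\<lambda>i. Q (binaryset X (- X) i) x) sums (\<Sum>i<2. Q (binaryset X (- X) i) x)"
    by (rule sums_finite) (auto simp: binaryset_def empty)
  ultimately have "Q UNIV x = (\<Sum>i<2. Q (binaryset X (- X) i) x)" using sums_unique2 by blast
  then show ?thesis by (simp add: UNIV binaryset_def numeral_2_eq_2 algebra_simps)
qed

lemma integral_restrict:
  assumes X: "X \<in> sets borel"
  shows "cinner (N (Q X x)) (Q X x) = (LINT w|scalar_measure Q x. indicator X w *\<^sub>R w)"
    "integrable (scalar_measure Q x) (\<lambda>w. indicator X w *\<^sub>R w)"
proof -
  note [measurable] = X
  have e: "density (scalar_measure Q x) (indicator X) = density (scalar_measure Q x) (\<lambda>w. ennreal (indicator X w))"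
    by (simp add: ennreal_indicator)
  show "cinner (N (Q X x)) (Q X x) = (LINT w|scalar_measure Q x. indicator X w *\<^sub>R w)"
    unfolding integral scalar_restrict[OF X] e by (subst integral_density) auto
  show "integrable (scalar_measure Q x) (\<lambda>w. indicator X w *\<^sub>R w)"
    using integrable by (intro integrable_mult_indicator) (auto simp: sets_scalar)
qed

text \<open>The definition ties \<open>N\<close> to \<open>Q\<close> through the quadratic form
  only. For \<open>a\<close> in the range of \<open>Q X\<close> and \<open>v\<close> in its kernel,
  the form at \<open>a + v\<close> is the sum of the forms at \<open>a\<close> and \<open>v\<close>,
  because the integral splits over \<open>X\<close> and its complement. So the two mixed terms
  cancel; taking both \<open>b\<close> and \<open>\<i> *\<^sub>C b\<close> for \<open>v\<close>
  separates them.\<close>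

lemma off_diagonal:
  assumes X: "X \<in> sets borel"
  shows "cinner (N (Q X x)) (y - Q X y) = 0"
proof -
  define a where "a = Q X x"
  define b where "b = y - Q X y"
  have Xa: "Q X a = a" and Xb: "Q X b = 0" using projectionD(4)[OF proj[OF X]] by (simp_all add: a_def b_def op_simps)
  have sum: "cinner (N a) v + cinner (N v) a = 0" if v: "Q X v = 0" for v
  proof -
    have "Q X (a + v) = a" "Q (- X) (a + v) = v" using X v by (simp_all add: compl blinfun.add_right Xa)
    then have "cinner (N a) a + cinner (N v) v = cinner (N (Q X (a + v))) (Q X (a + v)) + cinner (N (Q (- X) (a + v))) (Q (- X) (a + v))"
      by simp
    also have "\<dots> = (LINT w|scalar_measure Q (a + v). indicator X w *\<^sub>R w + indicator (- X) w *\<^sub>R w)"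
      using X integral_restrict[of X "a + v"] integral_restrict[of "- X" "a + v"] by (simp add: Bochner_Integration.integral_add)
    also have "(\<lambda>w. indicator X w *\<^sub>R w + indicator (- X) w *\<^sub>R w) = (\<lambda>w :: complex. w)"
      by (auto simp: indicator_def)
    also have "(LINT w|scalar_measure Q (a + v). w) = cinner (N (a + v)) (a + v)" by (simp add: integral)
    also have "\<dots> = cinner (N a) a + cinner (N v) v + (cinner (N a) v + cinner (N v) a)"
      by (simp add: blinfun.add_right cinner_add_left cinner_add_right algebra_simps)
    finally show ?thesis by simp
  qed
  have "Q X (\<i> *\<^sub>C b) = 0" using Xb bounded_opsD[OF projectionD(2)[OF proj[OF X]]] by simp
  from sum[OF this] have "- \<i> * cinner (N a) b + \<i> * cinner (N b) a = 0"
    by (simp add: cinner_scaleC_right cinner_scaleC_left bounded_opsD[OF N])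
  moreover have "cinner (N a) b + cinner (N b) a = 0" using sum[OF Xb] .
  ultimately have "cinner (N a) b = 0" by (rule complex_polarization[rotated])
  then show ?thesis by (simp add: a_def b_def)
qed

lemma commute:
  assumes X: "X \<in> sets borel"
  shows "N (Q X x) = Q X (N x)"
proof -
  note p = proj[OF X]
  have ran: "Q X (N (Q X y)) = N (Q X y)" for y
  proof -
    define w where "w = N (Q X y) - Q X (N (Q X y))"
    have "cinner (N (Q X y)) w = 0" unfolding w_def by (rule off_diagonal[OF X])
    then have "inner (N (Q X y)) w = 0" by (metis Re_cinner zero_complex.simps(1))
    moreover have "inner (Q X (N (Q X y))) w = 0"
      using self_adjointD(3)[OF projectionD(1)[OF p], of "N (Q X y)" w] projectionD(4)[OF p]
      by (simp add: w_def op_simps)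
    ultimately have "inner w w = 0" by (simp add: w_def inner_diff_left)
    then show ?thesis by (simp add: w_def)
  qed
  have ran': "Q X (N (y - Q X y)) = 0" for y
  proof -
    have X': "- X \<in> sets borel" using X by auto
    have "cinner (N (y - Q X y)) (Q X v) = 0" for v
      using off_diagonal[OF X', of y v] X by (simp add: compl)
    then have "inner (Q X (N (y - Q X y))) v = inner 0 v" for v
      using self_adjointD(3)[OF projectionD(1)[OF p]] by (metis Re_cinner inner_zero_left zero_complex.simps(1))
    then show ?thesis by (rule inner_eqI)
  qed
  have "Q X (N x) = Q X (N (Q X x)) + Q X (N (x - Q X x))" by (simp add: op_simps)
  then show ?thesis by (simp only: ran ran') simp
qed

text \<open>On the range of \<open>Q {z}\<close> the integrand is the constant \<open>z\<close>, so
  the form of \<open>N - z\<close> vanishes there. Polarisation extends this to pairs of vectors of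
  the range, which is invariant under \<open>N\<close> by \<open>commute\<close>.\<close>

lemma eigenspace: "N (Q {z} x) = z *\<^sub>C Q {z} x"
proof -
  define T where "T y = N y - z *\<^sub>C y" for y
  have form: "cinner (T (Q {z} y)) (Q {z} y) = 0" for y
  proof -
    have "cinner (N (Q {z} y)) (Q {z} y) = (LINT w|scalar_measure Q y. indicator {z} w *\<^sub>R w)"
      by (rule integral_restrict) simp
    also have "\<dots> = (LINT w|scalar_measure Q y. indicator {z} w *\<^sub>R z)"
      by (intro Bochner_Integration.integral_cong) (auto simp: indicator_def)
    also have "\<dots> = measure (scalar_measure Q y) {z} *\<^sub>R z"
      by (rule integral_indicator_scaleR) simp
    also have "\<dots> = z * cinner (Q {z} y) (Q {z} y)"
      by (simp add: measure_scalar cinner_self scaleR_conv_of_real mult.commute)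
    finally show ?thesis by (simp add: T_def cinner_diff_left cinner_scaleC_left)
  qed
  have Tadd: "T (u + v) = T u + T v" and TC: "T (c *\<^sub>C u) = c *\<^sub>C T u" for u v c
    by (simp_all add: T_def blinfun.add_right scaleC_add_right bounded_opsD[OF N] scaleC_diff_right scaleC_scaleC mult.commute)
  have z: "{z} \<in> sets borel" by simp
  have qC: "Q {z} (c *\<^sub>C y) = c *\<^sub>C Q {z} y" for c y using bounded_opsD[OF projectionD(2)[OF proj[OF z]]] .
  have sum: "cinner (T a) b + cinner (T b) a = 0" if "Q {z} a = a" "Q {z} b = b" for a b
    using form[of "a + b"] form[of a] form[of b] that
    by (simp add: blinfun.add_right Tadd cinner_add_left cinner_add_right add.commute)
  have "cinner (T a) b = 0" if ab: "Q {z} a = a" "Q {z} b = b" for a b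
  proof -
    have "Q {z} (\<i> *\<^sub>C b) = \<i> *\<^sub>C b" using ab qC by simp
    from sum[OF ab(1) this] have "- \<i> * cinner (T a) b + \<i> * cinner (T b) a = 0"
      by (simp add: TC cinner_scaleC_left cinner_scaleC_right)
    with sum[OF ab] show ?thesis by (rule complex_polarization)
  qed
  moreover have "Q {z} (Q {z} x) = Q {z} x" using projectionD(4)[OF proj[OF z]] .
  moreover from this have "Q {z} (T (Q {z} x)) = T (Q {z} x)"
    by (simp add: T_def blinfun.diff_right commute[OF z, symmetric] qC)
  ultimately have "cinner (T (Q {z} x)) (T (Q {z} x)) = 0" by blast
  then have "T (Q {z} x) = 0" by (simp add: cinner_self)
  then show ?thesis by (simp add: T_def)
qed

text \<open>For an eigenvector \<open>x\<close>, integrating \<open>w - z\<close> over a half plane that does not contain \<open>z\<close> shows that the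
  half plane is a null set; countably many half planes cover the complement of \<open>z\<close>.\<close>

lemma eigenvector_fixed:
  assumes Nx: "N x = z *\<^sub>C x"
  shows "Q {z} x = x"
proof -
  \<comment> \<open>For \<open>u\<close> of modulus 1, the half plane in the direction
    \<open>cnj u\<close> at distance \<open>1 / Suc m\<close> from \<open>z\<close>. With four
    directions and all \<open>m\<close> these cover everything but \<open>z\<close>.\<close>
  define H where "H u m = {w. 1 / real (Suc m) \<le> Re (u * (w - z))}" for u m
  have Hb: "H u m \<in> sets borel" for u m
    unfolding H_def by (intro borel_closed closed_Collect_le continuous_intros)
  have null: "emeasure (scalar_measure Q x) (H u m) = 0" for u m
  proof -
    let ?X = "H u m" and ?\<mu> = "scalar_measure Q x"
    note [measurable] = Hb[of u m]
    interpret finite_measure ?\<mu> by (rule finite_scalar)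
    have "N (Q ?X x) = z *\<^sub>C Q ?X x"
      by (simp add: commute[OF Hb] Nx bounded_opsD[OF projectionD(2)[OF proj[OF Hb]]])
    then have "(LINT w|?\<mu>. indicator ?X w *\<^sub>R w) = z * cinner (Q ?X x) (Q ?X x)"
      by (simp add: integral_restrict(1)[OF Hb, symmetric] cinner_scaleC_left)
    also have "\<dots> = measure ?\<mu> ?X *\<^sub>R z"
      by (simp add: measure_scalar[OF Hb] cinner_self scaleR_conv_of_real mult.commute)
    also have "\<dots> = (LINT w|?\<mu>. indicator ?X w *\<^sub>R z)"
      by (rule integral_indicator_scaleR(1)[OF Hb, symmetric])
    finally have eq: "(LINT w|?\<mu>. indicator ?X w *\<^sub>R w) = (LINT w|?\<mu>. indicator ?X w *\<^sub>R z)" .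
    have int: "integrable ?\<mu> (\<lambda>w. indicator ?X w *\<^sub>R w)" "integrable ?\<mu> (\<lambda>w. indicator ?X w *\<^sub>R z)"
      by (rule integral_restrict(2)[OF Hb] integral_indicator_scaleR(2)[OF Hb])+
    have "(LINT w|?\<mu>. indicator ?X w *\<^sub>R w - indicator ?X w *\<^sub>R z) = 0"
      using eq by (simp add: Bochner_Integration.integral_diff[OF int])
    then have zero: "(LINT w|?\<mu>. u * (indicator ?X w *\<^sub>R w - indicator ?X w *\<^sub>R z)) = 0" by simp
    have int3: "integrable ?\<mu> (\<lambda>w. u * (indicator ?X w *\<^sub>R w - indicator ?X w *\<^sub>R z))"
      using int by auto
    have "(LINT w|?\<mu>. Re (u * (indicator ?X w *\<^sub>R w - indicator ?X w *\<^sub>R z))) = 0"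
      unfolding integral_Re[OF int3] zero by simp
    moreover have "(LINT w|?\<mu>. indicator ?X w *\<^sub>R (1 / real (Suc m))) \<le> (LINT w|?\<mu>. Re (u * (indicator ?X w *\<^sub>R w - indicator ?X w *\<^sub>R z)))"
    proof (rule integral_mono)
      show "integrable ?\<mu> (\<lambda>w. indicator ?X w *\<^sub>R (1 / real (Suc m)))"
        by (rule integral_indicator_scaleR(2)[OF Hb])
      show "integrable ?\<mu> (\<lambda>w. Re (u * (indicator ?X w *\<^sub>R w - indicator ?X w *\<^sub>R z)))" using int3 by (rule integrable_Re)
      show "indicator ?X w *\<^sub>R (1 / real (Suc m)) \<le> Re (u * (indicator ?X w *\<^sub>R w - indicator ?X w *\<^sub>R z))" for w
        by (cases "w \<in> ?X") (auto simp: H_def)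
    qed
    moreover have "(LINT w|?\<mu>. indicator ?X w *\<^sub>R (1 / real (Suc m))) = measure ?\<mu> ?X *\<^sub>R (1 / real (Suc m))"
      by (rule integral_indicator_scaleR(1)[OF Hb])
    ultimately have "measure ?\<mu> ?X * (1 / real (Suc m)) \<le> 0" by simp
    then have "measure ?\<mu> ?X = 0" using measure_nonneg[of ?\<mu> ?X] by (simp add: mult_le_0_iff divide_le_0_iff)
    then show ?thesis by (simp add: emeasure_eq_measure)
  qed
  have cover: "- {z} \<subseteq> (\<Union>u\<in>{1, -1, \<i>, - \<i>}. \<Union>m. H u m)"
  proof
    fix w assume "w \<in> - {z}"
    then have "Re (w - z) \<noteq> 0 \<or> Im (w - z) \<noteq> 0" by (auto simp: complex_eq_iff)
    then have "\<exists>u\<in>{1, -1, \<i>, - \<i>}. 0 < Re (u * (w - z))" by (auto simp: not_le[symmetric])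
    then obtain u where u: "u \<in> {1, -1, \<i>, - \<i>}" "0 < Re (u * (w - z))" by blast
    then obtain m where "inverse (real (Suc m)) < Re (u * (w - z))" using reals_Archimedean by blast
    then have "w \<in> H u m" by (simp add: H_def inverse_eq_divide less_imp_le)
    then show "w \<in> (\<Union>u\<in>{1, -1, \<i>, - \<i>}. \<Union>m. H u m)" using u by blast
  qed
  have "(\<Union>u\<in>{1, -1, \<i>, - \<i>}. \<Union>m. H u m) \<in> null_sets (scalar_measure Q x)"
    using null Hb by (intro null_sets.finite_UN null_sets_UN) (auto simp: null_sets_def sets_scalar)
  then have "- {z} \<in> null_sets (scalar_measure Q x)"
    by (rule null_sets_subset[OF _ _ cover]) (simp add: sets_scalar)
  then have "(norm (Q (- {z}) x))\<^sup>2 = 0" by (simp add: null_sets_def emeasure_scalar)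
  then show ?thesis by (simp add: compl)
qed

end

text \<open>Existence, the other half of what the definite description in
  \<open>spectral_projection\<close> asks for.\<close>

lemma finite_spectral_measure:
  fixes N :: "'h::complex_hilbert_space op" and z :: "nat \<Rightarrow> complex"
  assumes P: "\<And>k. k \<in> {1..n} \<Longrightarrow> projection (P k)" "\<And>k x. k \<in> {1..n} \<Longrightarrow> N (P k x) = z k *\<^sub>C P k x"
    "\<And>j k. j \<in> {1..n} \<Longrightarrow> k \<in> {1..n} \<Longrightarrow> j \<noteq> k \<Longrightarrow> P j o\<^sub>L P k = 0" "(\<Sum>k=1..n. P k) = id_blinfun"
  shows "spectral_measure (\<lambda>X. \<Sum>k\<in>{k \<in> {1..n}. z k \<in> X}. P k) N"
proof -
  define Q where "Q X = (\<Sum>k\<in>{k \<in> {1..n}. z k \<in> X}. P k)" for X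
  have Qx: "Q X x = (\<Sum>k=1..n. if z k \<in> X then P k x else 0)" for X x
    unfolding Q_def blinfun.sum_left by (rule sum.inter_filter) simp
  have Pz: "P j (P k x) = (if j = k then P k x else 0)" if "j \<in> {1..n}" "k \<in> {1..n}" for j k x
    using P(1)[OF that(1)] compose_eqD[OF P(3)[OF that], of x] by (auto simp: projectionD blinfun.zero_left)
  have sumP: "(\<Sum>k=1..n. P k x) = x" for x
    using arg_cong[OF P(4), of "\<lambda>T. blinfun_apply T x"] by (simp add: blinfun.sum_left)
  have proj: "projection (Q X)" for X unfolding Q_def using P(1,3) by (intro orthogonal_sum_projection) auto
  have inner_Q: "inner (Q X x) x = (\<Sum>k=1..n. if z k \<in> X then (norm (P k x))\<^sup>2 else 0)" for X x
    unfolding Qx inner_sum_left using P(1) by (intro sum.cong) (auto simp: projection_norm)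
  have cinner_P: "cinner (P k x) x = complex_of_real ((norm (P k x))\<^sup>2)" if "k \<in> {1..n}" for k x
  proof -
    have "cinner (P k x) x \<in> \<real>\<^sub>\<ge>\<^sub>0" using projection_positive[OF P(1)[OF that]] by (simp add: positive_op_def)
    then show ?thesis
      using projection_norm[OF P(1)[OF that], of x] by (auto simp: complex_nonneg_Reals_iff complex_eq_iff Re_cinner)
  qed
  \<comment> \<open>The scalar measure of \<open>x\<close> is the image under \<open>z\<close> of
    the point masses \<open>(norm (P k x))\<^sup>2\<close> on the indices, which turns the integrals
    into finite sums.\<close>
  define \<mu> where "\<mu> x = distr (point_measure {1..n} (\<lambda>k. ennreal ((norm (P k x))\<^sup>2))) borel z" for x
  have scalar: "scalar_measure Q x = \<mu> x" for x
  proof -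
    have em: "emeasure (\<mu> x) X = ennreal (Re (cinner (Q X x) x))" if X: "X \<in> sets borel" for X
    proof -
      have zm: "z \<in> measurable (point_measure {1..n} (\<lambda>k. ennreal ((norm (P k x))\<^sup>2))) borel"
        by (simp add: measurable_point_measure_eq1)
      have "emeasure (\<mu> x) X = (\<Sum>k\<in>z -` X \<inter> {1..n}. ennreal ((norm (P k x))\<^sup>2))"
        unfolding \<mu>_def by (subst emeasure_distr[OF zm X]) (simp add: space_point_measure emeasure_point_measure_finite)
      also have "\<dots> = ennreal (\<Sum>k\<in>z -` X \<inter> {1..n}. (norm (P k x))\<^sup>2)" by (intro sum_ennreal) auto
      also have "(\<Sum>k\<in>z -` X \<inter> {1..n}. (norm (P k x))\<^sup>2) = inner (Q X x) x"
        unfolding inner_Q by (subst sum.inter_filter[symmetric]) (auto intro!: sum.cong)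
      finally show ?thesis by (simp add: Re_cinner)
    qed
    have "scalar_measure Q x = measure_of UNIV (sets borel) (emeasure (\<mu> x))"
      unfolding scalar_measure_def using em sets.sigma_sets_eq[of "borel :: complex measure"]
      by (intro measure_of_eq) auto
    also have "\<dots> = \<mu> x" using measure_of_of_measure[of "\<mu> x"] by (simp add: \<mu>_def)
    finally show ?thesis .
  qed
  have "spectral_measure Q N"
    unfolding spectral_measure_def
  proof (intro conjI ballI allI impI)
    show "projection (Q X)" for X by (rule proj)
    have "{k \<in> {1..n}. z k \<in> UNIV} = {1..n}" by auto
    then show "Q UNIV = id_blinfun" unfolding Q_def using P(4) by simp
    show "Q (X \<inter> Y) = Q X o\<^sub>L Q Y" for X Y
    proof (rule blinfun_eqI)
      fix x
      have PQ: "P j (Q Y x) = (if z j \<in> Y then P j x else 0)" if j: "j \<in> {1..n}" for j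
      proof -
        have "P j (Q Y x) = (\<Sum>k=1..n. P j (if z k \<in> Y then P k x else 0))"
          unfolding Qx by (rule blinfun.sum_right)
        also have "\<dots> = (\<Sum>k=1..n. if j = k then (if z j \<in> Y then P j x else 0) else 0)"
          by (intro sum.cong refl) (auto simp: Pz[OF j] blinfun.zero_right)
        finally show ?thesis using j by simp
      qed
      have "Q X (Q Y x) = (\<Sum>j=1..n. if z j \<in> X then P j (Q Y x) else 0)" by (rule Qx)
      also have "\<dots> = (\<Sum>j=1..n. if z j \<in> X \<inter> Y then P j x else 0)"
        by (intro sum.cong refl) (auto simp: PQ)
      also have "\<dots> = Q (X \<inter> Y) x" by (rule Qx[symmetric])
      finally show "Q (X \<inter> Y) x = (Q X o\<^sub>L Q Y) x" by simp
    qed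
    show "(\<lambda>i. Q (F i) x) sums Q (\<Union>i. F i) x" if F: "disjoint_family F" for F :: "nat \<Rightarrow> complex set" and x
      unfolding Qx
    proof (rule sums_sum)
      fix k
      show "(\<lambda>i. if z k \<in> F i then P k x else 0) sums (if z k \<in> (\<Union>i. F i) then P k x else 0)"
      proof (cases "z k \<in> (\<Union>i. F i)")
        case True
        then obtain i0 where i0: "z k \<in> F i0" by blast
        have "z k \<in> F i \<longleftrightarrow> i = i0" for i using F i0 by (auto simp: disjoint_family_on_def)
        then show ?thesis using True sums_single[of i0 "\<lambda>_. P k x"] by simp
      qed auto
    qed
    fix x
    let ?p = "point_measure {1..n} (\<lambda>k. ennreal ((norm (P k x))\<^sup>2))"
    have zm: "z \<in> measurable ?p borel" by (simp add: measurable_point_measure_eq1)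
    show "integrable (scalar_measure Q x) (\<lambda>w. w)"
      unfolding scalar \<mu>_def by (subst integrable_distr_eq[OF zm]) (auto intro!: integrable_point_measure_finite)
    have "(LINT w|scalar_measure Q x. w) = (\<Sum>k=1..n. (norm (P k x))\<^sup>2 *\<^sub>R z k)"
      unfolding scalar \<mu>_def by (subst integral_distr[OF zm]) (auto simp: lebesgue_integral_point_measure_finite)
    also have "\<dots> = (\<Sum>k=1..n. cinner (z k *\<^sub>C P k x) x)"
      by (intro sum.cong refl) (simp add: cinner_scaleC_left cinner_P scaleR_conv_of_real mult.commute)
    also have "\<dots> = cinner (\<Sum>k=1..n. z k *\<^sub>C P k x) x" by (simp add: cinner_sum_left)
    also have "(\<Sum>k=1..n. z k *\<^sub>C P k x) = N (\<Sum>k=1..n. P k x)" by (simp add: blinfun.sum_right P(2))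
    finally show "cinner (N x) x = (LINT w|scalar_measure Q x. w)" by (simp only: sumP)
  qed
  then show ?thesis by (simp add: Q_def[abs_def])
qed

text \<open>For two spectral measures of \<open>N\<close>, the value of each at \<open>{z k}\<close>
  has its range in the eigenspace and fixes all eigenvectors; so each projection absorbs the other,
  and they agree.\<close>

lemma spectral_projection_eq:
  fixes N :: "'h::complex_hilbert_space op" and z :: "nat \<Rightarrow> complex"
  assumes N: "N \<in> bounded_ops" and inj: "inj_on z {1..n}"
    and P: "\<And>k. k \<in> {1..n} \<Longrightarrow> projection (P k)" "\<And>k x. k \<in> {1..n} \<Longrightarrow> N (P k x) = z k *\<^sub>C P k x"
      "\<And>j k. j \<in> {1..n} \<Longrightarrow> k \<in> {1..n} \<Longrightarrow> j \<noteq> k \<Longrightarrow> P j o\<^sub>L P k = 0" "(\<Sum>k=1..n. P k) = id_blinfun"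
    and k: "k \<in> {1..n}"
  shows "spectral_projection N {z k} = P k"
  unfolding spectral_projection_def
proof (rule the_equality)
  define Q where "Q X = (\<Sum>k\<in>{k \<in> {1..n}. z k \<in> X}. P k)" for X
  have Q: "spectral_measure Q N" unfolding Q_def by (rule finite_spectral_measure[OF P])
  have "{j \<in> {1..n}. z j \<in> {z k}} = {k}" using k by (auto dest: inj_onD[OF inj])
  then have Qk: "Q {z k} = P k" by (simp add: Q_def)
  then show "\<exists>Q. spectral_measure Q N \<and> P k = Q {z k}" using Q by metis
  fix R assume "\<exists>Q. spectral_measure Q N \<and> R = Q {z k}"
  then obtain Q' where Q': "spectral_measure Q' N" "R = Q' {z k}" by blast
  interpret a: operator_spectral_measure Q N by unfold_locales (rule Q, rule N)
  interpret b: operator_spectral_measure Q' N by unfold_locales (rule Q'(1), rule N)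
  have 1: "R (P k x) = P k x" for x using b.eigenvector_fixed[OF a.eigenspace[of "z k" x]] by (simp add: Qk Q'(2))
  have 2: "P k (R x) = R x" for x using a.eigenvector_fixed[OF b.eigenspace[of "z k" x]] by (simp add: Qk Q'(2))
  have R: "projection R" unfolding Q'(2) by (rule b.proj) simp
  show "R = P k"
  proof (rule op_le_antisym)
    show "R \<preceq> P k" using projection_le_iff[OF R P(1)[OF k]] 2 by (auto intro: blinfun_eqI)
    show "P k \<preceq> R" using projection_le_iff[OF P(1)[OF k] R] 1 by (auto intro: blinfun_eqI)
  qed
qed

theorem theorem4p10:
  fixes M \<A> :: "'h::complex_hilbert_space op set"
    and \<tau> :: "'h op \<Rightarrow> complex"
    and E :: "'h op \<Rightarrow> 'h op"
    and N A :: "'h op"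
    and n :: nat
    and z :: "nat \<Rightarrow> complex"
  assumes "type_II1_factor M"
    and "faithful_normal_tracial_state M \<tau>"
    and "masa M \<A>"
    and "normal_conditional_expectation M \<A> E"
    and "N \<in> M"
    and "normal_operator N"
    and "inj_on z {1..n}"
    and "op_spectrum N = z ` {1..n}"
  shows "A \<in> closure (expectation_orbit M E N) \<longleftrightarrow>
    (\<exists>B. partition_of_unity \<A> n B \<and>
      (\<forall>k\<in>{1..n}. \<tau> (B k) = \<tau> (spectral_projection N {z k})) \<and>
      (\<Sum>k=1..n. z k *\<^sub>C B k) = A)"
proof -
  interpret masa_expectation M \<tau> \<A> E
    using assms(1-4) by unfold_locales (auto simp: type_II1_factor_def factor_def)
  obtain P where P: "\<And>k. k \<in> {1..n} \<Longrightarrow> P k \<in> commutant (commutant {N, adj N}) \<and> projection (P k)"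
    "\<And>k x. k \<in> {1..n} \<Longrightarrow> N (P k x) = z k *\<^sub>C P k x"
    "\<And>j k. j \<in> {1..n} \<Longrightarrow> k \<in> {1..n} \<Longrightarrow> j \<noteq> k \<Longrightarrow> P j o\<^sub>L P k = 0" "(\<Sum>k=1..n. P k) = id_blinfun"
    using normal_finite_spectrum[OF assms(6,8,7)] by metis
  \<comment> \<open>A von Neumann algebra contains the double commutant of each of its subsets, so
    the eigenprojections of \<open>N\<close> lie in \<open>M\<close> and have a trace there.\<close>
  have "commutant (commutant {N, adj N}) \<subseteq> M"
    using commutant_antimono[OF commutant_antimono[of "{N, adj N}" M]] assms(5) double_commutant by auto
  then have PM: "P k \<in> M \<and> projection (P k)" if "k \<in> {1..n}" for k using P(1)[OF that] by blast
  have sp: "spectral_projection N {z k} = P k" if "k \<in> {1..n}" for k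
    by (rule spectral_projection_eq[OF sub[OF assms(5)] assms(7) _ P(2-4) that]) (use P(1) in auto)
  have N: "N = (\<Sum>k=1..n. z k *\<^sub>C P k)"
  proof (rule blinfun_eqI)
    fix x
    have "(\<Sum>k=1..n. P k x) = x"
      using arg_cong[OF P(4), of "\<lambda>T. blinfun_apply T x"] by (simp add: blinfun.sum_left)
    then have "N x = N (\<Sum>k=1..n. P k x)" by simp
    then show "N x = (\<Sum>k=1..n. z k *\<^sub>C P k) x"
      by (simp add: blinfun.sum_right blinfun.sum_left blinfun_apply_scaleC P(2))
  qed
  show ?thesis
  proof
    assume "A \<in> closure (expectation_orbit M E N)"
    then have "A \<in> closure (expectation_orbit M E (\<Sum>k=1..n. z k *\<^sub>C P k))" by (simp only: N[symmetric])
    from closure_orbit_imp_partition[OF _ P(4) this] PM projection_positive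
    obtain B where "partition_of_unity \<A> n B" "\<And>k. k \<in> {1..n} \<Longrightarrow> \<tau> (B k) = \<tau> (P k)" "(\<Sum>k=1..n. z k *\<^sub>C B k) = A"
      by blast
    then show "\<exists>B. partition_of_unity \<A> n B \<and> (\<forall>k\<in>{1..n}. \<tau> (B k) = \<tau> (spectral_projection N {z k})) \<and>
        (\<Sum>k=1..n. z k *\<^sub>C B k) = A"
      using sp by (intro exI[of _ B]) auto
  next
    assume "\<exists>B. partition_of_unity \<A> n B \<and> (\<forall>k\<in>{1..n}. \<tau> (B k) = \<tau> (spectral_projection N {z k})) \<and>
        (\<Sum>k=1..n. z k *\<^sub>C B k) = A"
    then obtain B where B: "partition_of_unity \<A> n B" "\<And>k. k \<in> {1..n} \<Longrightarrow> \<tau> (B k) = \<tau> (P k)"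
      "(\<Sum>k=1..n. z k *\<^sub>C B k) = A" using sp by auto
    show "A \<in> closure (expectation_orbit M E N)"
      using partition_imp_closure_orbit[OF PM P(3,4) B(1,2), of z] unfolding B(3) N[symmetric] .
  qed
qed

end
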